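(* The endofunctor $\mathbf{Fa\grave{a}}$ on the category of Cartesian restriction categories (with functors preserving the chosen restriction products and restrictions on the nose) has the structure of a comonad, with counit $\epsilon:\mathbf{Fa\grave{a}}(\mathbb{X})\to\mathbb{X}$ given by $$\epsilon((A,+,0),X)=X,\qquad\epsilon(f_*,f_1,f_2,\ldots)=f_*,$$ and comultiplication $\delta:\mathbf{Fa\grave{a}}(\mathbb{X})\to\mathbf{Fa\grave{a}}^2(\mathbb{X})$ given on objects by $$\delta((A,+,0),X)=\Big(\big(((A,+,0),A),\,(+,\pi_0+,0,\ldots),\,(0,\pi_00,0,\ldots)\big),\ ((A,+,0),X)\Big)$$ and on arrows by the formula for $\delta(f)$ recalled in the context.
   Context: Composition is diagrammatic: $fg$ means first $f$, then $g$. A restriction category is a category with an operation assigning to each $f:X\to Y$ a map $\overline{f}:X\to X$ with: [R.1] $\overline{f}f=f$; [R.2] $\overline{f}\,\overline{g}=\overline{g}\,\overline{f}$ for $f,g$ with the same domain; [R.3] $\overline{\overline{f}g}=\overline{f}\,\overline{g}$ for $f,g$ with the same domain; [R.4] $f\overline{g}=\overline{fg}f$. A map $f$ is total if $\overline{f}=1$. A Cartesian restriction category is a restriction category with chosen restriction products: a chosen object $1$ with, for each $X$, a unique total map $!:X\to1$, such that every $f:X\to1$ equals $\overline{f}\,!$; and for all $X,Y$ a chosen object $X\times Y$ with total projections $\pi_0,\pi_1$ such that for all $f:Z\to X$, $g:Z\to Y$ there is a unique $\langle f,g\rangle:Z\to X\times Y$ with $\langle f,g\rangle\pi_0=\overline{g}f$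 and $\langle f,g\rangle\pi_1=\overline{f}g$. A total commutative monoid $(A,+,0)$ is a commutative monoid whose structure maps are total; for $f,g:X\to A$, $f+g:=\langle f,g\rangle+$ and $0:X\to A$ denotes $!\,0$. In $A^n\times X$, $\pi_0,\ldots,\pi_{n-1}$ are the projections to the copies of $A$ and $\pi_n$ the projection to $X$. We write $h(z_1,\ldots,z_k)$ for $\langle z_1,\ldots,z_k\rangle h$. The Cartesian restriction category $\mathbf{Fa\grave{a}}(\mathbb{X})$. Objects: pairs $((A,+,0),X)$, abbreviated $(A,X)$, with $(A,+,0)$ a total commutative monoid and $X$ an object of $\mathbb{X}$. Maps $(A,X)\to(B,Y)$: sequences $f=(f_*,f_1,f_2,\ldots)$ with $f_*:X\to Y$ and, for $n\ge1$, $f_n:A^n\times X\to B$ such that $\overline{f_n}=1\times\overline{f_*}=\overline{\pi_nf_*}$, and $f_n$ is symmetric and additive in its first $n$ variables (additive: substituting a sum $a+b$ in a variable gives the sum of the maps obtained by substituting $a$ and $b$, and substituting $0$ gives the corresponding restriction of the zero map). Identities $(1_X,\pi_0,0,0,\ldots)$. Composition: $(fg)_*=f_*g_*$ and $$(fg)_n=\sum_{\{B_1,\ldots,B_k\}}g_k\big(f_{|B_1|}(a_{B_1},x),\ldots,f_{|B_k|}(a_{B_k},x),f_*(x)\big),$$ the sum being over partitions of $\{1,\ldots,n\}$ into nonempty blocks, $a_1,\ldots,a_n,x$ being the projections from $A^n\times X$ and $f_m(a_B,x)=f_m(a_{i_1},\ldots,a_{i_m},x)$ for $B=\{i_1<\cdots<i_m\}$.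 Restriction: $\overline{f}=(\overline{f_*},\overline{\pi_1f_*}\pi_0,\overline{\pi_2f_*}0,\overline{\pi_3f_*}0,\ldots)$. Chosen products: $(A,X)\times(B,Y)=(A\times B,X\times Y)$ with the product monoid on $A\times B$, projections $(\pi_i,\pi_0\pi_i,0,0,\ldots)$, pairing $\langle f,g\rangle_*=\langle f_*,g_*\rangle$, $\langle f,g\rangle_n=\langle f_n,g_n\rangle$; terminal object $(1,1)$. On functors $F$: $\mathbf{Fa\grave{a}}(F)((A,+,0),X)=((FA,F+,F0),FX)$ and $\mathbf{Fa\grave{a}}(F)(f_*,f_1,\ldots)=(F(f_* ),F(f_1),\ldots)$. The functor $\delta$ on arrows. For $f:(A,X)\to(B,Y)$: $\delta(f)_*=f$ and, for $n\ge1$, $\delta(f)_n:(A,A)^n\times(A,X)=(A^n\times A,A^n\times X)\to(B,B)$ is the arrow of $\mathbf{Fa\grave{a}}(\mathbb{X})$ with $(\delta(f)_n)_*=f_n$ and, for $r\ge1$, writing the variables (projections) of $(A^n\times A)^r\times(A^n\times X)$ as $v^j=(v^j_1,\ldots,v^j_n,w^j)$ for $1\le j\le r$ and $(a_1,\ldots,a_n,x)$, $$(\delta(f)_n)_r=\sum_{(S,\varphi)}f_{n+r-|S|}\big(a^\varphi_1,\ldots,a^\varphi_n,(w^j)_{j\notin S},x\big),$$ the sum being over all subsets $S\subseteq\{1,\ldots,r\}$ and injections $\varphi:S\to\{1,\ldots,n\}$, where $a^\varphi_i=v^j_i$ if $i=\varphi(j)$ for some $j\in S$ and $a^\varphi_i=a_i$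 otherwise. *)

theory Defs
  imports
    "HOL-Algebra.FiniteProduct"
    "HOL-Library.FuncSet"
    "HOL-Library.Disjoint_Sets"
    "HOL-Combinatorics.Permutations"
begin

section \<open>Cartesian restriction categories\<close>

text \<open>
  Composition is diagrammatic: \<open>f \<cdot>\<^bsub>C\<^esub> g\<close> is first \<open>f\<close>, then \<open>g\<close>. The operations are total
  HOL functions; their values are only meaningful on \<open>Obj C\<close>, on \<open>Arr C\<close>, on composable
  pairs (\<open>Comp\<close>) and on pairs of arrows with a common domain (\<open>Pairing\<close>).
\<close>

record ('o, 'm) crcat =
  Obj  :: "'o set"
  Arr  :: "'m set"
  Dom  :: "'m \<Rightarrow> 'o"
  Cod  :: "'m \<Rightarrow> 'o"
  Ide  :: "'o \<Rightarrow> 'm"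
  Comp :: "'m \<Rightarrow> 'm \<Rightarrow> 'm"  (infixl "\<cdot>\<index>" 70)
  Rst  :: "'m \<Rightarrow> 'm"
  Unit :: "'o"
  Bang :: "'o \<Rightarrow> 'm"
  Prod :: "'o \<Rightarrow> 'o \<Rightarrow> 'o"
  Pi0  :: "'o \<Rightarrow> 'o \<Rightarrow> 'm"
  Pi1  :: "'o \<Rightarrow> 'o \<Rightarrow> 'm"
  Pairing :: "'m \<Rightarrow> 'm \<Rightarrow> 'm"

definition Hom :: "('o, 'm) crcat \<Rightarrow> 'o \<Rightarrow> 'o \<Rightarrow> 'm set" where
  "Hom C X Y = {f \<in> Arr C. Dom C f = X \<and> Cod C f = Y}"

definition total_map :: "('o, 'm) crcat \<Rightarrow> 'm \<Rightarrow> bool" where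
  "total_map C f \<longleftrightarrow> f \<in> Arr C \<and> Rst C f = Ide C (Dom C f)"

locale category =
  fixes C :: "('o, 'm) crcat" (structure)
  assumes Dom_Obj: "f \<in> Arr C \<Longrightarrow> Dom C f \<in> Obj C"
    and Cod_Obj: "f \<in> Arr C \<Longrightarrow> Cod C f \<in> Obj C"
    and Ide_Hom: "X \<in> Obj C \<Longrightarrow> Ide C X \<in> Hom C X X"
    and Comp_Hom: "\<lbrakk>f \<in> Hom C X Y; g \<in> Hom C Y Z\<rbrakk> \<Longrightarrow> f \<cdot> g \<in> Hom C X Z"
    and Ide_Comp: "f \<in> Hom C X Y \<Longrightarrow> Ide C X \<cdot> f = f"
    and Comp_Ide: "f \<in> Hom C X Y \<Longrightarrow> f \<cdot> Ide C Y = f"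
    and Comp_assoc:
      "\<lbrakk>f \<in> Hom C W X; g \<in> Hom C X Y; h \<in> Hom C Y Z\<rbrakk> \<Longrightarrow> (f \<cdot> g) \<cdot> h = f \<cdot> (g \<cdot> h)"

locale restriction_category = category C
  for C :: "('o, 'm) crcat" (structure) +
  assumes Rst_Hom: "f \<in> Hom C X Y \<Longrightarrow> Rst C f \<in> Hom C X X"
    and R1: "f \<in> Hom C X Y \<Longrightarrow> Rst C f \<cdot> f = f"
    and R2: "\<lbrakk>f \<in> Hom C X Y; g \<in> Hom C X Z\<rbrakk> \<Longrightarrow> Rst C f \<cdot> Rst C g = Rst C g \<cdot> Rst C f"
    and R3: "\<lbrakk>f \<in> Hom C X Y; g \<in> Hom C X Z\<rbrakk> \<Longrightarrow> Rst C (Rst C f \<cdot> g) = Rst C f \<cdot> Rst C g"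
    and R4: "\<lbrakk>f \<in> Hom C X Y; g \<in> Hom C Y Z\<rbrakk> \<Longrightarrow> f \<cdot> Rst C g = Rst C (f \<cdot> g) \<cdot> f"

locale cartesian_restriction_category = restriction_category C
  for C :: "('o, 'm) crcat" (structure) +
  assumes Unit_Obj: "Unit C \<in> Obj C"
    and Bang_Hom: "X \<in> Obj C \<Longrightarrow> Bang C X \<in> Hom C X (Unit C)"
    and Bang_total: "X \<in> Obj C \<Longrightarrow> total_map C (Bang C X)"
    and Bang_unique: "\<lbrakk>f \<in> Hom C X (Unit C); total_map C f\<rbrakk> \<Longrightarrow> f = Bang C X"
    and Unit_restriction: "f \<in> Hom C X (Unit C) \<Longrightarrow> f = Rst C f \<cdot> Bang C X"
    and Prod_Obj: "\<lbrakk>X \<in> Obj C; Y \<in> Obj C\<rbrakk> \<Longrightarrow> Prod C X Y \<in> Obj C"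
    and Pi0_Hom: "\<lbrakk>X \<in> Obj C; Y \<in> Obj C\<rbrakk> \<Longrightarrow> Pi0 C X Y \<in> Hom C (Prod C X Y) X"
    and Pi1_Hom: "\<lbrakk>X \<in> Obj C; Y \<in> Obj C\<rbrakk> \<Longrightarrow> Pi1 C X Y \<in> Hom C (Prod C X Y) Y"
    and Pi0_total: "\<lbrakk>X \<in> Obj C; Y \<in> Obj C\<rbrakk> \<Longrightarrow> total_map C (Pi0 C X Y)"
    and Pi1_total: "\<lbrakk>X \<in> Obj C; Y \<in> Obj C\<rbrakk> \<Longrightarrow> total_map C (Pi1 C X Y)"
    and Pairing_Hom: "\<lbrakk>f \<in> Hom C Z X; g \<in> Hom C Z Y\<rbrakk> \<Longrightarrow> Pairing C f g \<in> Hom C Z (Prod C X Y)"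
    and Pairing_Pi0: "\<lbrakk>f \<in> Hom C Z X; g \<in> Hom C Z Y\<rbrakk> \<Longrightarrow> Pairing C f g \<cdot> Pi0 C X Y = Rst C g \<cdot> f"
    and Pairing_Pi1: "\<lbrakk>f \<in> Hom C Z X; g \<in> Hom C Z Y\<rbrakk> \<Longrightarrow> Pairing C f g \<cdot> Pi1 C X Y = Rst C f \<cdot> g"
    and Pairing_unique:
      "\<lbrakk>f \<in> Hom C Z X; g \<in> Hom C Z Y; h \<in> Hom C Z (Prod C X Y);
        h \<cdot> Pi0 C X Y = Rst C g \<cdot> f; h \<cdot> Pi1 C X Y = Rst C f \<cdot> g\<rbrakk> \<Longrightarrow> h = Pairing C f g"


section \<open>Functors preserving the structure on the nose\<close>

text \<open>
  The object and arrow parts are required to be \<open>extensional\<close> (\<open>undefined\<close> off the source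
  category), so that equality of functors is equality in HOL. Preservation of \<open>Bang\<close> and
  \<open>Pairing\<close> follows from their uniqueness.
\<close>

datatype ('o, 'm, 'p, 'n) crfun = CRFun (onObj: "'o \<Rightarrow> 'p") (onArr: "'m \<Rightarrow> 'n")

definition cr_functor ::
  "('o, 'm) crcat \<Rightarrow> ('p, 'n) crcat \<Rightarrow> ('o, 'm, 'p, 'n) crfun \<Rightarrow> bool" where
  "cr_functor C D F \<longleftrightarrow>
     onObj F \<in> Obj C \<rightarrow>\<^sub>E Obj D \<and>
     onArr F \<in> Arr C \<rightarrow>\<^sub>E Arr D \<and>
     (\<forall>f\<in>Arr C. Dom D (onArr F f) = onObj F (Dom C f) \<and> Cod D (onArr F f) = onObj F (Cod C f)) \<and>
     (\<forall>X\<in>Obj C. onArr F (Ide C X) = Ide D (onObj F X)) \<and>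
     (\<forall>f\<in>Arr C. \<forall>g\<in>Arr C. Cod C f = Dom C g \<longrightarrow>
        onArr F (f \<cdot>\<^bsub>C\<^esub> g) = onArr F f \<cdot>\<^bsub>D\<^esub> onArr F g) \<and>
     (\<forall>f\<in>Arr C. onArr F (Rst C f) = Rst D (onArr F f)) \<and>
     onObj F (Unit C) = Unit D \<and>
     (\<forall>X\<in>Obj C. \<forall>Y\<in>Obj C.
        onObj F (Prod C X Y) = Prod D (onObj F X) (onObj F Y) \<and>
        onArr F (Pi0 C X Y) = Pi0 D (onObj F X) (onObj F Y) \<and>
        onArr F (Pi1 C X Y) = Pi1 D (onObj F X) (onObj F Y))"

definition fun_ide :: "('o, 'm) crcat \<Rightarrow> ('o, 'm, 'o, 'm) crfun" where
  "fun_ide C = CRFun (\<lambda>X\<in>Obj C. X) (\<lambda>f\<in>Arr C. f)"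

text \<open>\<open>fun_comp C F G\<close> is first \<open>F\<close>, with source \<open>C\<close>, then \<open>G\<close>.\<close>

definition fun_comp ::
  "('o, 'm) crcat \<Rightarrow> ('o, 'm, 'p, 'n) crfun \<Rightarrow> ('p, 'n, 'q, 'l) crfun \<Rightarrow> ('o, 'm, 'q, 'l) crfun"
  where
  "fun_comp C F G =
     CRFun (compose (Obj C) (onObj G) (onObj F)) (compose (Arr C) (onArr G) (onArr F))"


section \<open>The products \<open>A\<^sup>n \<times> X\<close>\<close>

text \<open>
  \<open>A\<^sup>n \<times> X\<close> is the iterated chosen product \<open>A \<times> (A \<times> \<dots> (A \<times> X))\<close>, with \<open>A\<^sup>0 \<times> X = X\<close>; its
  projections \<open>\<pi>\<^sub>0, \<dots>, \<pi>\<^sub>n\<close> are \<open>proj C A n X i\<close> with \<open>i \<le> n\<close>, the last one to \<open>X\<close>.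
\<close>

fun powprod :: "('o, 'm) crcat \<Rightarrow> 'o \<Rightarrow> nat \<Rightarrow> 'o \<Rightarrow> 'o" where
  "powprod C A 0 X = X"
| "powprod C A (Suc n) X = Prod C A (powprod C A n X)"

fun proj :: "('o, 'm) crcat \<Rightarrow> 'o \<Rightarrow> nat \<Rightarrow> 'o \<Rightarrow> nat \<Rightarrow> 'm" where
  "proj C A 0 X i = Ide C X"
| "proj C A (Suc n) X 0 = Pi0 C A (powprod C A n X)"
| "proj C A (Suc n) X (Suc i) = Pi1 C A (powprod C A n X) \<cdot>\<^bsub>C\<^esub> proj C A n X i"

text \<open>\<open>apply_map C h [z\<^sub>1, \<dots>, z\<^sub>n] x\<close> is \<open>h(z\<^sub>1, \<dots>, z\<^sub>n, x)\<close>.\<close>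

definition apply_map :: "('o, 'm) crcat \<Rightarrow> 'm \<Rightarrow> 'm list \<Rightarrow> 'm \<Rightarrow> 'm" where
  "apply_map C h zs x = foldr (Pairing C) zs x \<cdot>\<^bsub>C\<^esub> h"


section \<open>Total commutative monoids\<close>

datatype ('o, 'm) cmon = CMon (mcar: 'o) (mplus: 'm) (mzero: 'm)

definition madd :: "('o, 'm) crcat \<Rightarrow> ('o, 'm) cmon \<Rightarrow> 'm \<Rightarrow> 'm \<Rightarrow> 'm" where
  "madd C A f g = Pairing C f g \<cdot>\<^bsub>C\<^esub> mplus A"

definition zero_map :: "('o, 'm) crcat \<Rightarrow> ('o, 'm) cmon \<Rightarrow> 'o \<Rightarrow> 'm" where
  "zero_map C A Z = Bang C Z \<cdot>\<^bsub>C\<^esub> mzero A"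

definition total_comm_monoid :: "('o, 'm) crcat \<Rightarrow> ('o, 'm) cmon \<Rightarrow> bool" where
  "total_comm_monoid C A \<longleftrightarrow>
     (let A0 = mcar A; a = proj C A0 2 A0 0; b = proj C A0 2 A0 1; c = proj C A0 2 A0 2 in
        A0 \<in> Obj C \<and>
        mplus A \<in> Hom C (Prod C A0 A0) A0 \<and> total_map C (mplus A) \<and>
        mzero A \<in> Hom C (Unit C) A0 \<and> total_map C (mzero A) \<and>
        madd C A (madd C A a b) c = madd C A a (madd C A b c) \<and>
        madd C A (Pi0 C A0 A0) (Pi1 C A0 A0) = madd C A (Pi1 C A0 A0) (Pi0 C A0 A0) \<and>
        madd C A (Ide C A0) (zero_map C A A0) = Ide C A0)"

text \<open>Finite sums of maps \<open>Z \<rightarrow> A\<close>.\<close>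

definition hom_monoid :: "('o, 'm) crcat \<Rightarrow> ('o, 'm) cmon \<Rightarrow> 'o \<Rightarrow> 'm monoid" where
  "hom_monoid C A Z =
     \<lparr>carrier = Hom C Z (mcar A), monoid.mult = madd C A, one = zero_map C A Z\<rparr>"

definition msum :: "('o, 'm) crcat \<Rightarrow> ('o, 'm) cmon \<Rightarrow> 'o \<Rightarrow> ('i \<Rightarrow> 'm) \<Rightarrow> 'i set \<Rightarrow> 'm" where
  "msum C A Z t I = finprod (hom_monoid C A Z) t I"

definition prod_cmon :: "('o, 'm) crcat \<Rightarrow> ('o, 'm) cmon \<Rightarrow> ('o, 'm) cmon \<Rightarrow> ('o, 'm) cmon" where
  "prod_cmon C A B =
     (let P = Prod C (mcar A) (mcar B);
          p = Pi0 C P P; q = Pi1 C P P;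
          l = Pi0 C (mcar A) (mcar B); r = Pi1 C (mcar A) (mcar B)
      in CMon P
           (Pairing C (madd C A (p \<cdot>\<^bsub>C\<^esub> l) (q \<cdot>\<^bsub>C\<^esub> l)) (madd C B (p \<cdot>\<^bsub>C\<^esub> r) (q \<cdot>\<^bsub>C\<^esub> r)))
           (Pairing C (mzero A) (mzero B)))"

definition unit_cmon :: "('o, 'm) crcat \<Rightarrow> ('o, 'm) cmon" where
  "unit_cmon C = CMon (Unit C) (Bang C (Prod C (Unit C) (Unit C))) (Bang C (Unit C))"


section \<open>The category \<open>Faa(C)\<close>\<close>

text \<open>Symmetry and additivity of \<open>h : A\<^sup>n \<times> X \<rightarrow> B\<close> in its first \<open>n\<close> variables.\<close>

definition symmetric_map ::
  "('o, 'm) crcat \<Rightarrow> ('o, 'm) cmon \<Rightarrow> nat \<Rightarrow> 'o \<Rightarrow> 'm \<Rightarrow> bool" where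
  "symmetric_map C A n X h \<longleftrightarrow>
     (\<forall>Z\<in>Obj C. \<forall>zs x \<sigma>.
        length zs = n \<and> set zs \<subseteq> Hom C Z (mcar A) \<and> x \<in> Hom C Z X \<and> \<sigma> permutes {..<n} \<longrightarrow>
        apply_map C h (permute_list \<sigma> zs) x = apply_map C h zs x)"

definition additive_map ::
  "('o, 'm) crcat \<Rightarrow> ('o, 'm) cmon \<Rightarrow> nat \<Rightarrow> 'o \<Rightarrow> ('o, 'm) cmon \<Rightarrow> 'm \<Rightarrow> bool" where
  "additive_map C A n X B h \<longleftrightarrow>
     (\<forall>Z\<in>Obj C. \<forall>zs x.
        length zs = n \<and> set zs \<subseteq> Hom C Z (mcar A) \<and> x \<in> Hom C Z X \<longrightarrow>
        (\<forall>i<n.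
           (\<forall>a\<in>Hom C Z (mcar A). \<forall>b\<in>Hom C Z (mcar A).
              apply_map C h (zs[i := madd C A a b]) x =
              madd C B (apply_map C h (zs[i := a]) x) (apply_map C h (zs[i := b]) x)) \<and>
           apply_map C h (zs[i := zero_map C A Z]) x =
             Rst C (apply_map C h (zs[i := zero_map C A Z]) x) \<cdot>\<^bsub>C\<^esub> zero_map C B Z))"

type_synonym ('o, 'm) faa_obj = "('o, 'm) cmon \<times> 'o"

text \<open>
  A map carries its source and target objects, since these (in particular their monoid
  structures) are not determined by the sequence. The sequence \<open>(f\<^sub>*, f\<^sub>1, f\<^sub>2, \<dots>)\<close> is stored as
  a function on \<open>nat\<close> with \<open>f\<^sub>*\<close> at index \<open>0\<close>.
\<close>

datatype ('o, 'm) faa_arr =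
  FaaArr (faa_src: "('o, 'm) faa_obj") (faa_tgt: "('o, 'm) faa_obj") (faa_seq: "nat \<Rightarrow> 'm")

definition faa_Obj :: "('o, 'm) crcat \<Rightarrow> ('o, 'm) faa_obj set" where
  "faa_Obj C = {(A, X). total_comm_monoid C A \<and> X \<in> Obj C}"

definition faa_Arr :: "('o, 'm) crcat \<Rightarrow> ('o, 'm) faa_arr set" where
  "faa_Arr C = {FaaArr (A, X) (B, Y) f | A X B Y f.
     (A, X) \<in> faa_Obj C \<and> (B, Y) \<in> faa_Obj C \<and>
     f 0 \<in> Hom C X Y \<and>
     (\<forall>n\<ge>1.
        f n \<in> Hom C (powprod C (mcar A) n X) (mcar B) \<and>
        Rst C (f n) = Rst C (proj C (mcar A) n X n \<cdot>\<^bsub>C\<^esub> f 0) \<and>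
        symmetric_map C A n X (f n) \<and>
        additive_map C A n X B (f n))}"

text \<open>The map \<open>(f, g, 0, 0, \<dots>)\<close>.\<close>

definition faa_linear ::
  "('o, 'm) crcat \<Rightarrow> ('o, 'm) faa_obj \<Rightarrow> ('o, 'm) faa_obj \<Rightarrow> 'm \<Rightarrow> 'm \<Rightarrow> ('o, 'm) faa_arr" where
  "faa_linear C S T f g =
     FaaArr S T (\<lambda>n. if n = 0 then f else if n = 1 then g
                     else zero_map C (fst T) (powprod C (mcar (fst S)) n (snd S)))"

definition faa_Ide :: "('o, 'm) crcat \<Rightarrow> ('o, 'm) faa_obj \<Rightarrow> ('o, 'm) faa_arr" where
  "faa_Ide C = (\<lambda>(A, X). faa_linear C (A, X) (A, X) (Ide C X) (Pi0 C (mcar A) X))"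

text \<open>
  The blocks of a partition are listed by increasing minimum; by symmetry of \<open>g\<^sub>k\<close> the order is
  immaterial. Variables are numbered from \<open>0\<close>.
\<close>

definition faa_Comp ::
  "('o, 'm) crcat \<Rightarrow> ('o, 'm) faa_arr \<Rightarrow> ('o, 'm) faa_arr \<Rightarrow> ('o, 'm) faa_arr" where
  "faa_Comp C F G =
     (let A = mcar (fst (faa_src F)); X = snd (faa_src F); E = fst (faa_tgt G);
          f = faa_seq F; g = faa_seq G
      in FaaArr (faa_src F) (faa_tgt G)
        (\<lambda>n. if n = 0 then f 0 \<cdot>\<^bsub>C\<^esub> g 0
             else msum C E (powprod C A n X)
               (\<lambda>P. apply_map C (g (card P))
                      (map (\<lambda>B. apply_map C (f (card B))
                                  (map (proj C A n X) (sorted_list_of_set B)) (proj C A n X n))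
                           (sorted_key_list_of_set Min P))
                      (proj C A n X n \<cdot>\<^bsub>C\<^esub> f 0))
               {P. partition_on {..<n} P}))"

definition faa_Rst :: "('o, 'm) crcat \<Rightarrow> ('o, 'm) faa_arr \<Rightarrow> ('o, 'm) faa_arr" where
  "faa_Rst C F =
     (let A = fst (faa_src F); X = snd (faa_src F); f0 = faa_seq F 0
      in FaaArr (faa_src F) (faa_src F)
        (\<lambda>n. if n = 0 then Rst C f0
             else Rst C (proj C (mcar A) n X n \<cdot>\<^bsub>C\<^esub> f0) \<cdot>\<^bsub>C\<^esub>
                  (if n = 1 then Pi0 C (mcar A) X
                   else zero_map C A (powprod C (mcar A) n X))))"

definition faa_Unit :: "('o, 'm) crcat \<Rightarrow> ('o, 'm) faa_obj" where
  "faa_Unit C = (unit_cmon C, Unit C)"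

definition faa_Bang :: "('o, 'm) crcat \<Rightarrow> ('o, 'm) faa_obj \<Rightarrow> ('o, 'm) faa_arr" where
  "faa_Bang C = (\<lambda>(A, X). FaaArr (A, X) (faa_Unit C) (\<lambda>n. Bang C (powprod C (mcar A) n X)))"

definition faa_Prod ::
  "('o, 'm) crcat \<Rightarrow> ('o, 'm) faa_obj \<Rightarrow> ('o, 'm) faa_obj \<Rightarrow> ('o, 'm) faa_obj" where
  "faa_Prod C = (\<lambda>(A, X) (B, Y). (prod_cmon C A B, Prod C X Y))"

definition faa_Pi0 ::
  "('o, 'm) crcat \<Rightarrow> ('o, 'm) faa_obj \<Rightarrow> ('o, 'm) faa_obj \<Rightarrow> ('o, 'm) faa_arr" where
  "faa_Pi0 C = (\<lambda>(A, X) (B, Y).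
     faa_linear C (faa_Prod C (A, X) (B, Y)) (A, X) (Pi0 C X Y)
       (Pi0 C (Prod C (mcar A) (mcar B)) (Prod C X Y) \<cdot>\<^bsub>C\<^esub> Pi0 C (mcar A) (mcar B)))"

definition faa_Pi1 ::
  "('o, 'm) crcat \<Rightarrow> ('o, 'm) faa_obj \<Rightarrow> ('o, 'm) faa_obj \<Rightarrow> ('o, 'm) faa_arr" where
  "faa_Pi1 C = (\<lambda>(A, X) (B, Y).
     faa_linear C (faa_Prod C (A, X) (B, Y)) (B, Y) (Pi1 C X Y)
       (Pi0 C (Prod C (mcar A) (mcar B)) (Prod C X Y) \<cdot>\<^bsub>C\<^esub> Pi1 C (mcar A) (mcar B)))"

definition faa_Pairing ::
  "('o, 'm) crcat \<Rightarrow> ('o, 'm) faa_arr \<Rightarrow> ('o, 'm) faa_arr \<Rightarrow> ('o, 'm) faa_arr" where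
  "faa_Pairing C F G =
     FaaArr (faa_src F) (faa_Prod C (faa_tgt F) (faa_tgt G))
       (\<lambda>n. Pairing C (faa_seq F n) (faa_seq G n))"

definition Faa :: "('o, 'm) crcat \<Rightarrow> (('o, 'm) faa_obj, ('o, 'm) faa_arr) crcat" where
  "Faa C =
     \<lparr>Obj = faa_Obj C, Arr = faa_Arr C, Dom = faa_src, Cod = faa_tgt,
      Ide = faa_Ide C, Comp = faa_Comp C, Rst = faa_Rst C,
      Unit = faa_Unit C, Bang = faa_Bang C,
      Prod = faa_Prod C, Pi0 = faa_Pi0 C, Pi1 = faa_Pi1 C, Pairing = faa_Pairing C\<rparr>"


section \<open>\<open>Faa\<close> on functors\<close>

definition map_faa_obj ::
  "('o, 'm, 'p, 'n) crfun \<Rightarrow> ('o, 'm) faa_obj \<Rightarrow> ('p, 'n) faa_obj" where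
  "map_faa_obj F = (\<lambda>(A, X).
     (CMon (onObj F (mcar A)) (onArr F (mplus A)) (onArr F (mzero A)), onObj F X))"

definition map_faa_arr ::
  "('o, 'm, 'p, 'n) crfun \<Rightarrow> ('o, 'm) faa_arr \<Rightarrow> ('p, 'n) faa_arr" where
  "map_faa_arr F f =
     FaaArr (map_faa_obj F (faa_src f)) (map_faa_obj F (faa_tgt f))
       (\<lambda>n. onArr F (faa_seq f n))"

text \<open>\<open>C\<close> is the source of \<open>F\<close>.\<close>

definition Faa_fun ::
  "('o, 'm) crcat \<Rightarrow> ('o, 'm, 'p, 'n) crfun \<Rightarrow>
   (('o, 'm) faa_obj, ('o, 'm) faa_arr, ('p, 'n) faa_obj, ('p, 'n) faa_arr) crfun" where
  "Faa_fun C F =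
     CRFun (restrict (map_faa_obj F) (Obj (Faa C))) (restrict (map_faa_arr F) (Arr (Faa C)))"


section \<open>Counit and comultiplication\<close>

definition counit ::
  "('o, 'm) crcat \<Rightarrow> (('o, 'm) faa_obj, ('o, 'm) faa_arr, 'o, 'm) crfun" where
  "counit C = CRFun (\<lambda>(A, X)\<in>Obj (Faa C). X) (\<lambda>f\<in>Arr (Faa C). faa_seq f 0)"

definition delta_cmon ::
  "('o, 'm) crcat \<Rightarrow> ('o, 'm) cmon \<Rightarrow> (('o, 'm) faa_obj, ('o, 'm) faa_arr) cmon" where
  "delta_cmon C A =
     (let AA = (A, mcar A); P = Prod C (mcar A) (mcar A)
      in CMon AA
        (faa_linear C (Prod (Faa C) AA AA) AA (mplus A) (Pi0 C P P \<cdot>\<^bsub>C\<^esub> mplus A))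
        (faa_linear C (Unit (Faa C)) AA (mzero A) (Pi0 C (Unit C) (Unit C) \<cdot>\<^bsub>C\<^esub> mzero A)))"

definition delta_obj ::
  "('o, 'm) crcat \<Rightarrow> ('o, 'm) faa_obj \<Rightarrow> (('o, 'm) faa_obj, ('o, 'm) faa_arr) faa_obj" where
  "delta_obj C = (\<lambda>(A, X). (delta_cmon C A, (A, X)))"

text \<open>
  The index set of the sum defining \<open>(\<delta>(f)\<^sub>n)\<^sub>r\<close>: a set \<open>S\<close> of directions together with an
  injection of \<open>S\<close> into the \<open>n\<close> linear variables. Directions and variables are numbered from \<open>0\<close>.
\<close>

definition delta_index :: "nat \<Rightarrow> nat \<Rightarrow> (nat set \<times> (nat \<Rightarrow> nat)) set" where
  "delta_index n r = {(S, \<phi>). S \<subseteq> {..<r} \<and> \<phi> \<in> S \<rightarrow>\<^sub>E {..<n} \<and> inj_on \<phi> S}"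

definition delta_entry ::
  "('o, 'm) crcat \<Rightarrow> ('o, 'm) faa_arr \<Rightarrow> nat \<Rightarrow> nat \<Rightarrow> 'm" where
  "delta_entry C F n r =
     (let A = mcar (fst (faa_src F)); X = snd (faa_src F); B = fst (faa_tgt F);
          V = powprod C A n A; W = powprod C A n X;
          v = (\<lambda>j i. proj C V r W j \<cdot>\<^bsub>C\<^esub> proj C A n A i);
          w = (\<lambda>j. proj C V r W j \<cdot>\<^bsub>C\<^esub> proj C A n A n);
          a = (\<lambda>i. proj C V r W r \<cdot>\<^bsub>C\<^esub> proj C A n X i);
          x = proj C V r W r \<cdot>\<^bsub>C\<^esub> proj C A n X n
      in msum C B (powprod C V r W)
           (\<lambda>(S, \<phi>).
              apply_map C (faa_seq F (n + r - card S))
                (map (\<lambda>i. if i \<in> \<phi> ` S then v (inv_into S \<phi> i) i else a i) [0..<n] @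
                 map w (sorted_list_of_set ({..<r} - S)))
                x)
           (delta_index n r))"

definition delta_arr ::
  "('o, 'm) crcat \<Rightarrow> ('o, 'm) faa_arr \<Rightarrow> (('o, 'm) faa_obj, ('o, 'm) faa_arr) faa_arr" where
  "delta_arr C F =
     (let A = fst (faa_src F); X = snd (faa_src F); B = fst (faa_tgt F)
      in FaaArr (delta_obj C (faa_src F)) (delta_obj C (faa_tgt F))
        (\<lambda>n. if n = 0 then F
             else FaaArr (powprod (Faa C) (A, mcar A) n (A, X)) (B, mcar B)
                    (\<lambda>r. if r = 0 then faa_seq F n else delta_entry C F n r)))"

definition comult ::
  "('o, 'm) crcat \<Rightarrow>
   (('o, 'm) faa_obj, ('o, 'm) faa_arr,
    (('o, 'm) faa_obj, ('o, 'm) faa_arr) faa_obj,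
    (('o, 'm) faa_obj, ('o, 'm) faa_arr) faa_arr) crfun" where
  "comult C = CRFun (restrict (delta_obj C) (Obj (Faa C))) (restrict (delta_arr C) (Arr (Faa C)))"

end

theory Submission
 imports Defs
begin

text \<open>
  Fix an idempotent \<open>e\<close> on \<open>Z\<close>; the maps \<open>Z \<rightarrow> A\<close> with restriction \<open>e\<close> form an honest commutative monoid.
  A cube, a point of \<open>X\<close> with coefficients in \<open>A\<close> for the nonempty subsets of a finite set of directions,
  is a formal jet, on which an arrow acts by its Taylor expansion, a sum over partitions. Arrows are
  determined by these actions, composition becomes composition of actions, and restrictions and projections
  act entrywise, so the axioms for \<open>Faa(C)\<close> reduce to those of \<open>C\<close>. Evaluating \<open>\<delta>(f)\<close> at a cube of cubes, with
  directions \<open>I\<close> and \<open>J\<close>, is evaluating \<open>f\<close> at the joint cube with directions \<open>I + J\<close>; functoriality and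
  naturality of \<open>\<delta>\<close> follow, and coassociativity becomes \<open>(N + I) + J = N + (I + J)\<close>.
\<close>

text \<open>The obstacle is partiality. A sum of maps is defined only where both summands are, and
  additivity at \<open>0\<close> yields a zero restricted to some domain, so on all maps
  \<open>Z \<rightarrow> A\<close> a component is not multiadditive in the usual sense. The domain
  of a component, however, depends on its last argument alone. Once all entries share a domain, so
  do all values, the restricted zero is the unit there, and what remains is combinatorics in
  ordinary commutative monoids. Two regroupings of sums over partitions carry it: refining a
  partition blockwise (\<open>pev_core\<close>) gives the chain rule, separating one group of
  directions from the rest (\<open>pev_fuse\<close>) gives the comultiplication. Directions have
  arbitrary types, so that joint directions can be disjoint sums. Arrows are recovered from their
  actions at the universal cube over \<open>A^n \<times> X\<close>, whose linear coefficients are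
  the projections and whose other coefficients vanish. The sum over \<open>(S, \<phi>)\<close> in
  \<delta> is never manipulated as such: it is recognised once as an evaluation of \<open>f\<close>
  at a cube linear in \<open>n\<close> of its directions, the pairs being the partitions whose terms
  survive.\<close>

abbreviation (input) left_right (infixr "|+|" 65) where "I |+| J \<equiv> Inl ` I \<union> Inr ` J"

abbreviation (input) faa_star (infixl "\<star>\<index>" 70) where "F \<star>\<^bsub>C\<^esub> G \<equiv> F \<cdot>\<^bsub>Faa C\<^esub> G"

section \<open>Symmetric multiadditive families and sums over partitions\<close>

lemma (in comm_monoid) finprod_Sigma:
 assumes "finite A" "!!a. a \<in> A ==> finite (B a)"
  and "!!a b. a \<in> A ==> b \<in> B a ==> f a b \<in> carrier G"
 shows "finprod G (%a. finprod G (f a) (B a)) A = finprod G (%(a, b). f a b) (Sigma A B)"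
 using assms
proof (induction A rule: finite_induct)
 case empty
 then show ?case by simp
next
 case (insert a A)
 have split: "Sigma (insert a A) B = Pair a ` B a \<union> Sigma A B" by auto
 have closed: "(%(a, b). f a b) \<in> Sigma A B \<rightarrow> carrier G"
  using insert.prems by auto
 have row: "finprod G (%(a, b). f a b) (Pair a ` B a) = finprod G (f a) (B a)"
  by (subst finprod_reindex) (use insert.prems in "auto simp: inj_on_def")
 have "finprod G (%(a, b). f a b) (Sigma (insert a A) B) =
   finprod G (f a) (B a) \<otimes> finprod G (%(a, b). f a b) (Sigma A B)"
  unfolding split row[symmetric]
  by (rule finprod_Un_disjoint) (use insert closed in auto)
 moreover have "finprod G (%a. finprod G (f a) (B a)) (insert a A) =
   finprod G (f a) (B a) \<otimes> finprod G (%a. finprod G (f a) (B a)) A"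
  by (rule finprod_insert) (use insert in "auto intro!: finprod_closed")
 ultimately show ?case
  using insert by simp
qed

lemma (in comm_monoid) finprod_bij:
 assumes "bij_betw h A B" "!!a. a \<in> A ==> g (h a) = f a" "f \<in> A \<rightarrow> carrier G"
 shows "finprod G g B = finprod G f A"
proof -
 have "finprod G g (h ` A) = finprod G (%x. g (h x)) A"
  by (rule finprod_reindex) (use assms in "auto simp: bij_betw_def")
 moreover have "finprod G (%x. g (h x)) A = finprod G f A"
  by (rule finprod_cong') (use assms in auto)
 ultimately show ?thesis
  using assms(1) by (simp add: bij_betw_def)
qed

lemma finprod_hom:
 assumes "comm_monoid G" "comm_monoid H" and f: "f \<in> A \<rightarrow> carrier G"
  and h: "!!a. a \<in> carrier G ==> h a \<in> carrier H" "h \<one>\<^bsub>G\<^esub> = \<one>\<^bsub>H\<^esub>"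
   "!!a b. a \<in> carrier G ==> b \<in> carrier G ==> h (a \<otimes>\<^bsub>G\<^esub> b) = h a \<otimes>\<^bsub>H\<^esub> h b"
 shows "h (finprod G f A) = finprod H (%a. h (f a)) A"
proof -
 interpret G: comm_monoid G by fact
 interpret H: comm_monoid H by fact
 show ?thesis
  using f
 proof (induction A rule: infinite_finite_induct)
  case (insert a A)
  moreover have "(%a. h (f a)) \<in> A \<rightarrow> carrier H"
   using insert.prems h(1) by auto
  ultimately show ?case
   using h by auto
 qed (use h in auto)
qed

section \<open>Partitions of finite sets\<close>

text \<open>Empty for infinite \<open>J\<close>, so that \<open>parts J\<close> is a finite set in
  every case. The empty set has exactly one partition, the empty one.\<close>

definition parts :: "'i set => 'i set set set" where
 "parts J = {P. finite J \<and> partition_on J P}"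

lemma finite_parts: "finite (parts J)"
proof (cases "finite J")
 case True
 then show ?thesis
  using finitely_many_partition_on[of J] by (simp add: parts_def)
qed (simp add: parts_def)

lemma parts_empty [simp]: "parts {} = {{}}"
 by (auto simp: parts_def partition_on_empty)

lemma parts_iff:
 "P \<in> parts J \<longleftrightarrow> finite J \<and> \<Union>P = J \<and> {} \<notin> P \<and> (\<forall>B\<in>P. \<forall>B'\<in>P. B \<noteq> B' \<longrightarrow> B \<inter> B' = {})"
 by (auto simp: parts_def partition_on_def disjoint_def)

lemma partsD:
 assumes "P \<in> parts J"
 shows "finite J" "finite P" "\<Union>P = J" "{} \<notin> P" "!!B. B \<in> P ==> finite B" "!!B. B \<in> P ==> B \<subseteq> J"
  "!!B B' i. B \<in> P ==> B' \<in> P ==> i \<in> B ==> i \<in> B' ==> B = B'"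
proof -
 show *: "finite J" "\<Union>P = J" "{} \<notin> P"
  using assms by (auto simp: parts_iff)
 then show "finite P"
  using finite_UnionD by blast
 show "!!B. B \<in> P ==> B \<subseteq> J" "!!B B' i. B \<in> P ==> B' \<in> P ==> i \<in> B ==> i \<in> B' ==> B = B'"
  using assms by (auto simp: parts_iff)
 with * show "!!B. B \<in> P ==> finite B"
  by (meson finite_subset)
qed

lemma partsI:
 assumes "finite J" "\<Union>P = J" "{} \<notin> P"
  "!!B B' i. B \<in> P ==> B' \<in> P ==> i \<in> B ==> i \<in> B' ==> B = B'"
 shows "P \<in> parts J"
 using assms unfolding parts_iff by blast

lemma parts_nonempty: "P \<in> parts J ==> J \<noteq> {} ==> P \<noteq> {}"
 by (auto dest: partsD(3))

lemma parts_singletons: "finite J ==> (%j. {j}) ` J \<in> parts J"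
 by (rule partsI) auto

lemma parts_top: "finite J ==> J \<noteq> {} ==> {J} \<in> parts J"
 by (rule partsI) auto

lemma parts_image:
 assumes "inj_on h J"
 shows "bij_betw (image (image h)) (parts J) (parts (h ` J))"
proof (rule bij_betwI')
 fix P Q assume "P \<in> parts J" "Q \<in> parts J"
 then have "P \<subseteq> Pow J" "Q \<subseteq> Pow J"
  by (auto dest: partsD(6))
 moreover have "inj_on (image h) (Pow J)"
  using assms by (rule inj_on_image_Pow)
 ultimately show "((`) h ` P = (`) h ` Q) = (P = Q)"
  by (meson inj_on_image_eq_iff)
next
 fix P assume P: "P \<in> parts J"
 show "(`) h ` P \<in> parts (h ` J)"
 proof (rule partsI)
  show "finite (h ` J)" "\<Union> ((`) h ` P) = h ` J" "{} \<notin> (`) h ` P"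
   using partsD[OF P] by auto
  fix B B' i assume "B \<in> (`) h ` P" "B' \<in> (`) h ` P" "i \<in> B" "i \<in> B'"
  then obtain C C' j j' where "B = h ` C" "B' = h ` C'" "C \<in> P" "C' \<in> P"
   "j \<in> C" "j' \<in> C'" "h j = h j'" by auto
  moreover then have "j = j'"
   using assms partsD(6)[OF P] by (meson inj_onD subsetD)
  ultimately show "B = B'"
   using partsD(7)[OF P] by metis
 qed
next
 fix Q assume Q: "Q \<in> parts (h ` J)"
 let ?P = "(%B. h -` B \<inter> J) ` Q"
 have im: "h ` (h -` B \<inter> J) = B" if "B \<in> Q" for B
  using partsD(6)[OF Q that] by auto
 have "?P \<in> parts J"
 proof (rule partsI)
  show "finite J"
   using partsD(1)[OF Q] assms by (rule finite_imageD)
  show "\<Union> ?P = J"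
   using partsD(3)[OF Q] by auto
  show "{} \<notin> ?P"
  proof
   assume "{} \<in> ?P"
   then obtain B where "B \<in> Q" "h -` B \<inter> J = {}" by auto
   then show False using im[of B] partsD(4)[OF Q] by auto
  qed
  fix B B' i assume "B \<in> ?P" "B' \<in> ?P" "i \<in> B" "i \<in> B'"
  then show "B = B'"
   using partsD(7)[OF Q] by auto
 qed
 moreover have "(`) h ` ?P = Q"
  using im by (auto simp: image_image)
 ultimately show "\<exists>P\<in>parts J. Q = (`) h ` P"
  by metis
qed

text \<open>A partition \<open>\<sigma>\<close> with a partition of each of its blocks amounts to a partition \<open>\<rho>\<close> with a partition of
 the set of its blocks: this is why the composition of arrows is associative.\<close>

definition glue :: "'i set set \<times> ('i set => 'i set set) => 'i set set \<times> 'i set set set" where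
 "glue = (%(\<sigma>, \<pi>). (\<Union>(\<pi> ` \<sigma>), \<pi> ` \<sigma>))"

text \<open>To undo the glueing of \<open>(\<rho>, \<tau>)\<close>, take as blocks of \<sigma> the
  unions of the members of \<tau>; the partition of such a block is the member of \<tau> it came
  from. The blocks of \<rho> are nonempty and disjoint, so a member of \<tau> is determined by its
  union.\<close>

lemma glue_bij:
 "bij_betw glue (SIGMA \<sigma>:parts J. PiE \<sigma> parts) (SIGMA \<rho>:parts J. parts \<rho>)"
proof (rule bij_betwI')
 fix p q assume p: "p \<in> (SIGMA \<sigma>:parts J. PiE \<sigma> parts)" and q: "q \<in> (SIGMA \<sigma>:parts J. PiE \<sigma> parts)"
 obtain \<sigma> \<pi> where p': "p = (\<sigma>, \<pi>)" "\<sigma> \<in> parts J" "\<pi> \<in> PiE \<sigma> parts" using p by auto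
 obtain \<sigma>' \<pi>' where q': "q = (\<sigma>', \<pi>')" "\<sigma>' \<in> parts J" "\<pi>' \<in> PiE \<sigma>' parts" using q by auto
 have U: "\<Union>(\<pi> B) = B" if "B \<in> \<sigma>" for B using p' that by (auto dest!: PiE_mem partsD(3))
 have U': "\<Union>(\<pi>' B) = B" if "B \<in> \<sigma>'" for B using q' that by (auto dest!: PiE_mem partsD(3))
 show "(glue p = glue q) = (p = q)"
 proof
  assume "glue p = glue q"
  then have *: "\<pi> ` \<sigma> = \<pi>' ` \<sigma>'" by (simp add: glue_def p' q')
  \<comment> \<open>A block of \<sigma> is the union of the partition chosen for it, so \<sigma> can
    be read off the image of \<pi> alone.\<close>
  have "\<sigma> = Union ` \<pi> ` \<sigma>" using U by (force simp: image_image)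
  also have "... = \<sigma>'" unfolding * using U' by (force simp: image_image)
  finally have \<sigma>: "\<sigma> = \<sigma>'" .
  have "\<pi> B = \<pi>' B" if "B \<in> \<sigma>" for B
  proof -
   have "\<pi> B \<in> \<pi>' ` \<sigma>'" using that by (simp flip: *)
   then obtain B' where "B' \<in> \<sigma>'" "\<pi> B = \<pi>' B'" by auto
   then show ?thesis using U[OF that] U' by metis
  qed
  then have "\<pi> = \<pi>'" using p'(3) q'(3) \<sigma> by (metis PiE_ext)
  then show "p = q" using \<sigma> p' q' by simp
 qed simp
next
 fix p assume "p \<in> (SIGMA \<sigma>:parts J. PiE \<sigma> parts)"
 then obtain \<sigma> \<pi> where p: "p = (\<sigma>, \<pi>)" "\<sigma> \<in> parts J" "\<pi> \<in> PiE \<sigma> parts" by auto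
 have \<pi>: "\<pi> B \<in> parts B" if "B \<in> \<sigma>" for B using p that by auto
 note \<sigma> = partsD[OF p(2)]
 have same: "B = B'" if "B \<in> \<sigma>" "B' \<in> \<sigma>" "b \<in> \<pi> B" "b \<in> \<pi> B'" for B B' b
 proof -
  have "b \<noteq> {}" "b \<subseteq> B" "b \<subseteq> B'" using that partsD(4,6)[OF \<pi>] by metis+
  then show ?thesis using \<sigma>(7) that(1,2) by (metis ex_in_conv subsetD)
 qed
 have "\<Union>(\<pi> ` \<sigma>) \<in> parts J"
 proof (rule partsI)
  have "\<Union>(\<Union>(\<pi> ` \<sigma>)) = (\<Union>B\<in>\<sigma>. \<Union>(\<pi> B))" by auto
  also have "... = \<Union>\<sigma>" using partsD(3)[OF \<pi>] by simp
  finally show "\<Union>(\<Union>(\<pi> ` \<sigma>)) = J" using \<sigma>(3) by simp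
  show "finite J" by fact
  show "{} \<notin> \<Union>(\<pi> ` \<sigma>)" using partsD(4)[OF \<pi>] by auto
  fix b b' i assume b: "b \<in> \<Union>(\<pi> ` \<sigma>)" "b' \<in> \<Union>(\<pi> ` \<sigma>)" "i \<in> b" "i \<in> b'"
  then obtain B B' where BB: "B \<in> \<sigma>" "b \<in> \<pi> B" "B' \<in> \<sigma>" "b' \<in> \<pi> B'" by auto
  moreover then have "B = B'" using \<sigma>(7) b(3,4) partsD(6)[OF \<pi>] by (meson subsetD)
  ultimately show "b = b'" using partsD(7)[OF \<pi>] b(3,4) by blast
 qed
 moreover have "\<pi> ` \<sigma> \<in> parts (\<Union>(\<pi> ` \<sigma>))"
 proof (rule partsI)
  show "finite (\<Union>(\<pi> ` \<sigma>))" using \<sigma>(2) partsD(2)[OF \<pi>] by auto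
  show "{} \<notin> \<pi> ` \<sigma>" using \<sigma>(4) partsD(3)[OF \<pi>] by fastforce
  fix D D' b assume "D \<in> \<pi> ` \<sigma>" "D' \<in> \<pi> ` \<sigma>" "b \<in> D" "b \<in> D'"
  then show "D = D'" using same by blast
 qed simp
 ultimately show "glue p \<in> (SIGMA \<rho>:parts J. parts \<rho>)" by (simp add: glue_def p(1))
next
 fix q assume "q \<in> (SIGMA \<rho>:parts J. parts \<rho>)"
 then obtain \<rho> \<tau> where q: "q = (\<rho>, \<tau>)" "\<rho> \<in> parts J" "\<tau> \<in> parts \<rho>" by auto
 note \<rho> = partsD[OF q(2)] and \<tau> = partsD[OF q(3)]
 have sub: "b \<in> \<rho>" if "b \<in> D" "D \<in> \<tau>" for b D using that \<tau>(3) by auto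
 have same: "D = D'" if D: "D \<in> \<tau>" "D' \<in> \<tau>" and i: "i \<in> \<Union>D" "i \<in> \<Union>D'" for D D' i
 proof -
  obtain b b' where "b \<in> D" "b' \<in> D'" "i \<in> b" "i \<in> b'" using i by auto
  moreover then have "b = b'" using sub D \<rho>(7) by meson
  ultimately show ?thesis using \<tau>(7) D by blast
 qed
 have ne: "\<Union>D \<noteq> {}" if "D \<in> \<tau>" for D
 proof -
  have "D \<noteq> {}" using \<tau>(4) that by auto
  then obtain b where "b \<in> D" by auto
  moreover then have "b \<noteq> {}" using sub that \<rho>(4) by metis
  ultimately show ?thesis by auto
 qed
 have inj: "inj_on Union \<tau>"
  by (rule inj_onI) (metis ne ex_in_conv same)
 let ?\<sigma> = "Union ` \<tau>"
 let ?\<pi> = "restrict (the_inv_into \<tau> Union) ?\<sigma>"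
 have \<pi>: "?\<pi> (\<Union>D) = D" if "D \<in> \<tau>" for D using the_inv_into_f_f[OF inj that] that by simp
 have "?\<sigma> \<in> parts J"
 proof (rule partsI)
  show "finite J" by fact
  show "\<Union>?\<sigma> = J" using \<tau>(3) \<rho>(3) by auto
  show "{} \<notin> ?\<sigma>" using ne by (metis imageE)
  fix B B' i assume "B \<in> ?\<sigma>" "B' \<in> ?\<sigma>" "i \<in> B" "i \<in> B'"
  then show "B = B'" using same by (metis imageE)
 qed
 moreover have "D \<in> parts (\<Union>D)" if "D \<in> \<tau>" for D
 proof (rule partsI)
  have "D \<subseteq> \<rho>" using sub that by blast
  then show "finite (\<Union>D)" using \<rho>(1,3) by (metis Union_mono finite_subset)
  show "{} \<notin> D" using \<open>D \<subseteq> \<rho>\<close> \<rho>(4) by auto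
  show "B = B'" if "B \<in> D" "B' \<in> D" "i \<in> B" "i \<in> B'" for B B' i
   using \<open>D \<subseteq> \<rho>\<close> \<rho>(7) that by blast
 qed simp
 then have "?\<pi> \<in> PiE ?\<sigma> parts" using \<pi> by (intro PiE_I) auto
 moreover have "?\<pi> ` ?\<sigma> = \<tau>" using \<pi> by (force simp: image_image)
 then have "glue (?\<sigma>, ?\<pi>) = q" unfolding glue_def case_prod_conv using \<tau>(3) q(1) by metis
 ultimately show "\<exists>p\<in>(SIGMA \<sigma>:parts J. PiE \<sigma> parts). q = glue p" by blast
qed

section \<open>Evaluation of a multiadditive family over partitions\<close>

text \<open>The value at \<open>{}\<close> is left free: in a cube it is the base point, which lives
  in \<open>X\<close> and not in the monoid.\<close>

definition fam :: "'a monoid => ('i set => 'a) set" where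
 "fam G = {c. \<forall>B. B \<noteq> {} \<longrightarrow> c B \<in> carrier G}"

lemma famD: "c \<in> fam G ==> B \<noteq> {} ==> c B \<in> carrier G"
 by (simp add: fam_def)

text \<open>The Faa di Bruno sum at the direction set \<open>J\<close>. The coefficients at the
  blocks enter as a multiset, since the order of the arguments of a symmetric map is immaterial. For
  \<open>J = {}\<close> the only term is \<open>\<phi> {#}\<close>, which need not lie in
  \<open>H\<close>; that case is kept apart throughout.\<close>

definition pev :: "'b monoid => ('a multiset => 'b) => ('i set => 'a) => 'i set => 'b" where
 "pev H \<phi> c J = finprod H (%P. \<phi> (image_mset c (mset_set P))) (parts J)"

text \<open>Symmetry is built into the multiset argument. \<open>closed\<close> excludes the empty
  multiset because there \<phi> will be the value of \<open>f 0\<close> at the base point, which is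
  a point of \<open>Y\<close> rather than of \<open>B\<close>. The zero law is exact: a unit in any
  slot gives the unit.\<close>

locale symadd = G: comm_monoid G + H: comm_monoid H
 for G :: "'a monoid" and H :: "'b monoid" +
 fixes \<phi> :: "'a multiset => 'b"
 assumes closed: "M \<noteq> {#} ==> set_mset M \<subseteq> carrier G ==> \<phi> M \<in> carrier H"
  and add: "set_mset M \<subseteq> carrier G ==> a \<in> carrier G ==> b \<in> carrier G ==>
   \<phi> (add_mset (a \<otimes>\<^bsub>G\<^esub> b) M) = \<phi> (add_mset a M) \<otimes>\<^bsub>H\<^esub> \<phi> (add_mset b M)"
  and zero: "set_mset M \<subseteq> carrier G ==> \<phi> (add_mset \<one>\<^bsub>G\<^esub> M) = \<one>\<^bsub>H\<^esub>"
begin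

lemma finprod_slot:
 assumes "set_mset M \<subseteq> carrier G" "t \<in> K \<rightarrow> carrier G"
 shows "\<phi> (add_mset (finprod G t K) M) = finprod H (%k. \<phi> (add_mset (t k) M)) K"
 by (rule finprod_hom) (use assms closed add zero G.comm_monoid_axioms H.comm_monoid_axioms in auto)

text \<open>Multiplying out: a multiadditive expression in sums is the sum over all choice
  functions. The induction peels off one slot at a time and moves the chosen summand into
  \<open>M\<close>, which is why \<open>M\<close> is general.\<close>

lemma finprod_slots:
 assumes "finite S" "!!s. s \<in> S ==> finite (K s)"
  and "!!s k. s \<in> S ==> k \<in> K s ==> t s k \<in> carrier G"
  and "set_mset M \<subseteq> carrier G" "S \<noteq> {} \<or> M \<noteq> {#}"
 shows "\<phi> (M + {#finprod G (t s) (K s). s \<in># mset_set S#}) =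
  finprod H (%\<psi>. \<phi> (M + {#t s (\<psi> s). s \<in># mset_set S#})) (PiE S K)"
 using assms
proof (induction S arbitrary: M rule: finite_induct)
 case empty
 then show ?case using closed[of M] by (simp add: H.finprod_insert[of "{}"])
next
 case (insert s S)
 let ?f = "%k \<psi>. \<phi> (add_mset (t s k) M + {#t s (\<psi> s). s \<in># mset_set S#})"
 have sub: "set_mset {#finprod G (t s) (K s). s \<in># mset_set S#} \<subseteq> carrier G"
  using insert by (auto intro!: G.finprod_closed)
 have f: "?f k \<psi> \<in> carrier H" if "k \<in> K s" "\<psi> \<in> PiE S K" for k \<psi>
  by (rule closed) (use that insert in "auto dest: PiE_mem")
 have "\<phi> (M + {#finprod G (t s) (K s). s \<in># mset_set (insert s S)#}) =
   \<phi> (add_mset (finprod G (t s) (K s)) (M + {#finprod G (t s) (K s). s \<in># mset_set S#}))"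
  using insert by simp
 also have "... = finprod H (%k. \<phi> (add_mset (t s k) (M + {#finprod G (t s) (K s). s \<in># mset_set S#}))) (K s)"
  by (rule finprod_slot) (use sub insert in auto)
 also have "... = finprod H (%k. finprod H (?f k) (PiE S K)) (K s)"
 proof (rule H.finprod_cong')
  show "(%k. finprod H (?f k) (PiE S K)) \<in> K s \<rightarrow> carrier H"
   using f by (auto intro!: H.finprod_closed)
  fix k assume k: "k \<in> K s"
  show "\<phi> (add_mset (t s k) (M + {#finprod G (t s) (K s). s \<in># mset_set S#})) = finprod H (?f k) (PiE S K)"
   using insert.IH[of "add_mset (t s k) M"] k insert by simp
 qed simp
 also have "... = finprod H (%(k, \<psi>). ?f k \<psi>) (K s \<times> PiE S K)"
  by (rule H.finprod_Sigma) (use f insert in "auto intro: finite_PiE")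
 also have "... = finprod H (%\<psi>. \<phi> (M + {#t s (\<psi> s). s \<in># mset_set (insert s S)#})) (PiE (insert s S) K)"
 proof (rule H.finprod_bij[symmetric])
  show "bij_betw (%(y, g). g(s := y)) (K s \<times> PiE S K) (PiE (insert s S) K)"
   using inj_combinator[OF insert.hyps(2)] by (simp add: bij_betw_def PiE_insert_eq)
  fix p assume "p \<in> K s \<times> PiE S K"
  moreover obtain k \<psi> where "p = (k, \<psi>)" by (cases p)
  moreover have "{#t i ((\<psi>(s := k)) i). i \<in># mset_set S#} = {#t i (\<psi> i). i \<in># mset_set S#}"
   by (rule image_mset_cong) (use insert.hyps in auto)
  ultimately show "\<phi> (M + {#t i ((case p of (y, g) => g(s := y)) i). i \<in># mset_set (insert s S)#}) =
    (case p of (k, \<psi>) => ?f k \<psi>)"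
   using insert.hyps by simp
 qed (use f in auto)
 finally show ?case .
qed

lemma closed_fam:
 assumes "c \<in> fam G" "{} \<notin> P" "P \<noteq> {}" "finite P"
 shows "\<phi> (image_mset c (mset_set P)) \<in> carrier H"
proof (rule closed)
 show "set_mset (image_mset c (mset_set P)) \<subseteq> carrier G"
  using famD[OF assms(1)] assms(2,4) by (metis (no_types, lifting) finite_set_mset_mset_set image_subsetI set_image_mset)
qed (use assms in "auto simp: mset_set_empty_iff")

lemma pev_term_closed:
 assumes "c \<in> fam G" "J \<noteq> {}" "P \<in> parts J"
 shows "\<phi> (image_mset c (mset_set P)) \<in> carrier H"
 using closed_fam[OF assms(1) partsD(4) parts_nonempty partsD(2)] assms by blast

lemma pev_closed: "c \<in> fam G ==> J \<noteq> {} ==> pev H \<phi> c J \<in> carrier H"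
 unfolding pev_def using pev_term_closed by (auto intro!: H.finprod_closed)

lemma pev_cong:
 assumes "c \<in> fam G" "J \<noteq> {}" "!!B. B \<subseteq> J ==> B \<noteq> {} ==> finite B ==> c B = c' B"
 shows "pev H \<phi> c' J = pev H \<phi> c J"
 unfolding pev_def
proof (rule H.finprod_cong')
 show "(%P. \<phi> (image_mset c (mset_set P))) \<in> parts J \<rightarrow> carrier H"
  using pev_term_closed assms by auto
 fix P assume P: "P \<in> parts J"
 have "image_mset c (mset_set P) = image_mset c' (mset_set P)"
 proof (rule image_mset_cong)
  fix B assume "B \<in># mset_set P"
  then have "B \<in> P" using partsD(2)[OF P] by simp
  then show "c B = c' B" using partsD(4,5,6)[OF P] assms(3) by metis
 qed
 then show "\<phi> (image_mset c' (mset_set P)) = \<phi> (image_mset c (mset_set P))" by simp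
qed simp

text \<open>Renaming directions along an injection induces a bijection between the partitions, block
  by block.\<close>

lemma pev_reindex:
 assumes "c \<in> fam G" "J \<noteq> {}" "inj_on h J"
 shows "pev H \<phi> c (h ` J) = pev H \<phi> (%B. c (h ` B)) J"
 unfolding pev_def
proof (rule H.finprod_bij[OF parts_image[OF assms(3)]])
 have "(%B. c (h ` B)) \<in> fam G"
  using assms(1) by (auto simp: fam_def)
 then show "(%P. \<phi> {#c (h ` B). B \<in># mset_set P#}) \<in> parts J \<rightarrow> carrier H"
  using pev_term_closed assms(2) by auto
 fix P assume P: "P \<in> parts J"
 have "inj_on (image h) P"
  using inj_on_image_Pow[OF assms(3)] partsD(6)[OF P] by (meson PowI inj_on_subset subsetI)
 then show "\<phi> (image_mset c (mset_set ((`) h ` P))) = \<phi> {#c (h ` B). B \<in># mset_set P#}"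
  by (simp add: image_mset_mset_set[symmetric] multiset.map_comp o_def)
qed

text \<open>The family at a block \<open>B\<close> is a sum over the partitions of \<open>B\<close>.
  Multiplying out in every block gives a sum over a partition of \<open>J\<close> together with a
  partition of each block, and \<open>glue_bij\<close> regroups it by the union \<rho> of these
  partitions. Since \<open>h\<close> is indexed by sets of blocks, \<rho> now serves as a set of
  directions.\<close>

lemma pev_core:
 assumes h: "h \<in> fam G" and "J \<noteq> {}"
 shows "pev H \<phi> (%B. finprod G h (parts B)) J = finprod H (%\<rho>. pev H \<phi> h \<rho>) (parts J)"
proof -
 have hc: "h \<in> parts B \<rightarrow> carrier G" if "B \<noteq> {}" for B
  using parts_nonempty[OF _ that] famD[OF h] by auto
 have tc: "\<phi> (image_mset h (mset_set \<tau>)) \<in> carrier H" if "\<rho> \<in> parts J" "\<tau> \<in> parts \<rho>" for \<rho> \<tau>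
  using pev_term_closed[OF h _ that(2)] parts_nonempty[OF that(1) assms(2)] by blast
 have \<phi>': "\<phi> {#finprod G h (parts B). B \<in># mset_set \<sigma>#} =
   finprod H (%\<pi>. \<phi> {#h (\<pi> B). B \<in># mset_set \<sigma>#}) (PiE \<sigma> parts)" if \<sigma>: "\<sigma> \<in> parts J" for \<sigma>
 proof -
  have "t \<in> carrier G" if "s \<in> \<sigma>" "k \<in> parts s" "t = h k" for s k t
   using that hc[of s] partsD(4)[OF \<sigma>] by (metis Pi_mem)
  then show ?thesis
   using finprod_slots[of \<sigma> parts "%_. h" "{#}", OF partsD(2)[OF \<sigma>] finite_parts]
    parts_nonempty[OF \<sigma> assms(2)] by simp
 qed
 \<comment> \<open>The partitions chosen for different blocks have different unions, so \<pi> is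
   injective on \<sigma> and no multiplicities are lost.\<close>
 have term2: "\<phi> {#h (\<pi> B). B \<in># mset_set \<sigma>#} = \<phi> (image_mset h (mset_set (\<pi> ` \<sigma>)))"
  if "\<sigma> \<in> parts J" "\<pi> \<in> PiE \<sigma> parts" for \<sigma> \<pi>
 proof -
  have "inj_on \<pi> \<sigma>"
   by (rule inj_onI) (metis that(2) PiE_mem partsD(3))
  then show ?thesis
   by (simp add: image_mset_mset_set[symmetric] multiset.map_comp o_def)
 qed
 have glue: "\<Union>(\<pi> ` \<sigma>) \<in> parts J" "\<pi> ` \<sigma> \<in> parts (\<Union>(\<pi> ` \<sigma>))"
  if "\<sigma> \<in> parts J" "\<pi> \<in> PiE \<sigma> parts" for \<sigma> \<pi>
  using bij_betw_apply[OF glue_bij, of "(\<sigma>, \<pi>)" J] that by (auto simp: glue_def)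
 have tc2: "\<phi> {#h (\<pi> B). B \<in># mset_set \<sigma>#} \<in> carrier H" if "\<sigma> \<in> parts J" "\<pi> \<in> PiE \<sigma> parts" for \<sigma> \<pi>
  using tc[OF glue[OF that]] term2[OF that] by simp
 have "pev H \<phi> (%B. finprod G h (parts B)) J =
   finprod H (%\<sigma>. finprod H (%\<pi>. \<phi> {#h (\<pi> B). B \<in># mset_set \<sigma>#}) (PiE \<sigma> parts)) (parts J)"
  unfolding pev_def
  by (rule H.finprod_cong') (use \<phi>' tc2 in "auto intro!: H.finprod_closed")
 also have "... = finprod H (%(\<sigma>, \<pi>). \<phi> {#h (\<pi> B). B \<in># mset_set \<sigma>#}) (SIGMA \<sigma>:parts J. PiE \<sigma> parts)"
  by (rule H.finprod_Sigma)
   (use tc2 in "auto simp: finite_parts intro!: finite_PiE dest: partsD(2)")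
 also have "... = finprod H (%(\<rho>, \<tau>). \<phi> (image_mset h (mset_set \<tau>))) (SIGMA \<rho>:parts J. parts \<rho>)"
  by (rule H.finprod_bij[OF glue_bij, symmetric]) (use term2 tc2 in "auto simp: glue_def")
 also have "... = finprod H (%\<rho>. pev H \<phi> h \<rho>) (parts J)"
  unfolding pev_def by (rule H.finprod_Sigma[symmetric]) (use tc in "auto simp: finite_parts")
 finally show ?thesis .
qed

text \<open>Isolates the one block through \<open>j\<close>; the remaining blocks are untouched by
  changes in direction \<open>j\<close>.\<close>

lemma parts_slot:
 assumes "P \<in> parts J" "j \<in> J"
 obtains B where "B \<in> P" "j \<in> B" "B \<subseteq> J" "mset_set P = add_mset B (mset_set (P - {B}))"
  "!!B'. B' \<in> P - {B} ==> j \<notin> B' \<and> B' \<subseteq> J \<and> B' \<noteq> {}" "finite P"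
proof -
 obtain B where B: "B \<in> P" "j \<in> B" using assms partsD(3)[OF assms(1)] by auto
 show ?thesis
 proof (rule that[OF B])
  show "B \<subseteq> J" "finite P" using B partsD(2,6)[OF assms(1)] by auto
  show "mset_set P = add_mset B (mset_set (P - {B}))"
   using B partsD(2)[OF assms(1)] by (simp add: mset_set.remove)
  show "j \<notin> B' \<and> B' \<subseteq> J \<and> B' \<noteq> {}" if "B' \<in> P - {B}" for B'
   using that B partsD(4,6,7)[OF assms(1)] by blast
 qed
qed

text \<open>In each partition of \<open>J\<close> exactly one block contains \<open>j\<close>, and
  only its coefficient differs between the three families. Additivity of \<phi> in that single slot
  gives the claim term by term.\<close>

lemma pev_slot_add:
 assumes c: "c \<in> fam G" "c1 \<in> fam G" "c2 \<in> fam G" and j: "j \<in> J"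
  and other: "!!B. B \<subseteq> J ==> B \<noteq> {} ==> j \<notin> B ==> c1 B = c B \<and> c2 B = c B"
  and slot: "!!B. B \<subseteq> J ==> j \<in> B ==> c B = c1 B \<otimes>\<^bsub>G\<^esub> c2 B"
 shows "pev H \<phi> c J = pev H \<phi> c1 J \<otimes>\<^bsub>H\<^esub> pev H \<phi> c2 J"
proof -
 have ne: "J \<noteq> {}" using j by auto
 have closed': "(%P. \<phi> (image_mset c' (mset_set P))) \<in> parts J \<rightarrow> carrier H" if "c' \<in> fam G" for c' :: "'c set => 'a"
  using pev_term_closed[OF that ne] by auto
 have "\<phi> (image_mset c (mset_set P)) = \<phi> (image_mset c1 (mset_set P)) \<otimes>\<^bsub>H\<^esub> \<phi> (image_mset c2 (mset_set P))"
  if P: "P \<in> parts J" for P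
 proof -
  obtain B where B: "B \<in> P" "j \<in> B" "B \<subseteq> J" "mset_set P = add_mset B (mset_set (P - {B}))"
   "!!B'. B' \<in> P - {B} ==> j \<notin> B' \<and> B' \<subseteq> J \<and> B' \<noteq> {}" "finite P"
   using parts_slot[OF P j] by blast
  have eq: "image_mset c1 (mset_set (P - {B})) = image_mset c (mset_set (P - {B}))"
   "image_mset c2 (mset_set (P - {B})) = image_mset c (mset_set (P - {B}))"
   using B(5,6) other by (auto intro!: image_mset_cong)
  have "set_mset (image_mset c (mset_set (P - {B}))) \<subseteq> carrier G"
   using B(5,6) famD[OF c(1)] by auto
  moreover have "c1 B \<in> carrier G" "c2 B \<in> carrier G"
   using B(2) famD[OF c(2), of B] famD[OF c(3), of B] by auto
  ultimately show ?thesis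
   using B(2,3) eq add slot unfolding B(4) by simp
 qed
 then have "pev H \<phi> c J = finprod H (%P. \<phi> (image_mset c1 (mset_set P)) \<otimes>\<^bsub>H\<^esub> \<phi> (image_mset c2 (mset_set P))) (parts J)"
  unfolding pev_def by (intro H.finprod_cong') (use closed' c in auto)
 also have "... = pev H \<phi> c1 J \<otimes>\<^bsub>H\<^esub> pev H \<phi> c2 J"
  unfolding pev_def by (rule H.finprod_multf) (use closed' c in auto)
 finally show ?thesis .
qed

lemma term_zero:
 assumes "c \<in> fam G" "finite P" "{} \<notin> P" "B \<in> P" "c B = \<one>\<^bsub>G\<^esub>"
 shows "\<phi> (image_mset c (mset_set P)) = \<one>\<^bsub>H\<^esub>"
proof -
 have "mset_set P = add_mset B (mset_set (P - {B}))"
  using assms by (simp add: mset_set.remove)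
 moreover have "c B' \<in> carrier G" if "B' \<in> P" for B'
  using assms(3) that by (intro famD[OF assms(1)]) auto
 moreover have "set_mset (image_mset c (mset_set (P - {B}))) \<subseteq> carrier G"
  using calculation(2) assms(2) by auto
 ultimately show ?thesis
  using assms(5) zero by simp
qed

text \<open>The block through \<open>j\<close> carries a unit, which kills the term of every
  partition.\<close>

lemma pev_slot_zero:
 assumes c: "c \<in> fam G" and j: "j \<in> J" and slot: "!!B. B \<subseteq> J ==> j \<in> B ==> c B = \<one>\<^bsub>G\<^esub>"
 shows "pev H \<phi> c J = \<one>\<^bsub>H\<^esub>"
 unfolding pev_def
proof (rule H.finprod_one_eqI)
 fix P assume P: "P \<in> parts J"
 obtain B where "B \<in> P" "j \<in> B" "B \<subseteq> J"
  using parts_slot[OF P j] by blast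
 then show "\<phi> (image_mset c (mset_set P)) = \<one>\<^bsub>H\<^esub>"
  using term_zero[OF c partsD(2,4)[OF P]] slot by blast
qed

lemma pev_restrict:
 assumes c: "c \<in> fam G" and "J \<noteq> {}" "Q \<subseteq> parts J"
  and z: "!!P. P \<in> parts J ==> P \<notin> Q ==> \<exists>B\<in>P. c B = \<one>\<^bsub>G\<^esub>"
 shows "pev H \<phi> c J = finprod H (%P. \<phi> (image_mset c (mset_set P))) Q"
 unfolding pev_def
proof (rule H.finprod_mono_neutral_cong_right)
 fix P assume P: "P \<in> parts J - Q"
 then obtain B where "B \<in> P" "c B = \<one>\<^bsub>G\<^esub>" using z by blast
 then show "\<phi> (image_mset c (mset_set P)) = \<one>\<^bsub>H\<^esub>"
  using term_zero[OF c, of P B] partsD(2,4)[of P J] P by blast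
qed (use assms pev_term_closed[OF c assms(2)] in "auto simp: finite_parts")

text \<open>A partition other than the one into singletons has a block with vanishing coefficient.
  This is how a component of an arrow is recovered from its action: directions \<open>J\<close> with
  only linear coefficients isolate the component of arity \<open>card J\<close>.\<close>

lemma pev_singletons:
 assumes c: "c \<in> fam G" and "J \<noteq> {}" "finite J"
  and z: "!!B. B \<subseteq> J ==> B \<noteq> {} ==> \<nexists>j. B = {j} ==> c B = \<one>\<^bsub>G\<^esub>"
 shows "pev H \<phi> c J = \<phi> {#c {j}. j \<in># mset_set J#}"
proof -
 let ?P = "(%j. {j}) ` J"
 have inj: "inj_on (%j. {j}) J" by (auto simp: inj_on_def)
 have "pev H \<phi> c J = finprod H (%P. \<phi> (image_mset c (mset_set P))) {?P}"
 proof (rule pev_restrict[OF c assms(2)])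
  show "{?P} \<subseteq> parts J" using assms parts_singletons by auto
  fix P assume P: "P \<in> parts J" "P \<notin> {?P}"
  have "\<exists>B\<in>P. \<nexists>j. B = {j}"
  proof (rule ccontr)
   assume "\<not> ?thesis"
   then have *: "\<exists>j. B = {j}" if "B \<in> P" for B using that by blast
   have "P \<subseteq> ?P"
   proof
    fix B assume "B \<in> P"
    moreover then obtain j where "B = {j}" using * by blast
    ultimately show "B \<in> ?P" using partsD(6)[OF P(1)] by auto
   qed
   moreover have "{j} \<in> P" if "j \<in> J" for j
   proof -
    have "j \<in> \<Union>P" using partsD(3)[OF P(1)] that by simp
    then obtain B where "B \<in> P" "j \<in> B" by blast
    then show ?thesis using *[of B] by auto
   qed
   ultimately show False using P(2) by auto
  qed
  then show "\<exists>B\<in>P. c B = \<one>\<^bsub>G\<^esub>"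
   using z partsD(4,6)[OF P(1)] by metis
 qed
 also have "... = \<phi> (image_mset c (mset_set ?P))"
  using pev_term_closed[OF c assms(2) parts_singletons[OF assms(3)]]
  by (simp add: H.finprod_insert[of "{}"])
 also have "image_mset c (mset_set ?P) = {#c {j}. j \<in># mset_set J#}"
  using inj by (simp add: image_mset_mset_set[symmetric] multiset.map_comp o_def)
 finally show ?thesis .
qed

end

section \<open>Splitting off a group of directions\<close>

text \<open>Turns an element of \<open>I + P\<close>, with \<open>P\<close> a set of blocks of
  \<open>J\<close>, into a set of directions of \<open>I + J\<close>: elements of \<open>I\<close>
  become singletons, blocks stay as they are.\<close>

fun block :: "'i + 'j set => ('i + 'j) set" where
 "block (Inl i) = {Inl i}"
| "block (Inr B) = Inr ` B"

lemma inj_block: "inj block"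
proof (rule injI)
 fix x y :: "'i + 'j set" assume "block x = block y"
 then show "x = y"
  by (cases x; cases y) (auto simp: inj_image_eq_iff)
qed

text \<open>The union of the sets \<open>block x\<close> for \<open>x\<close> in \<open>D\<close>,
  spelled out by summands.\<close>

definition unblock :: "('i + 'j set) set => ('i + 'j) set" where
 "unblock D = Inl ` (Inl -` D) \<union> Inr ` \<Union>(Inr -` D)"

text \<open>Turns the blocks of a partition of \<open>J\<close> into directions of their own, products of two of which vanish.\<close>

definition fuse :: "'a monoid => (('i + 'j) set => 'a) => ('i + 'j set) set => 'a" where
 "fuse G a D = (if unblock D \<noteq> {} \<and> (Inr -` D = {} \<or> (\<exists>B. Inr -` D = {B})) then a (unblock D) else \<one>\<^bsub>G\<^esub>)"

lemma range_block_Inl: "b \<in> range block ==> Inl i \<in> b ==> b = {Inl i}"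
 and range_block_Inr: "b \<in> range block ==> Inr j \<in> b ==> \<exists>B. b = Inr ` B \<and> j \<in> B"
proof -
 show "b = {Inl i}" if "b \<in> range block" "Inl i \<in> b"
  using that(1)
 proof
  fix x assume "b = block x" then show ?thesis using that by (cases x) auto
 qed
 show "\<exists>B. b = Inr ` B \<and> j \<in> B" if "b \<in> range block" "Inr j \<in> b"
  using that(1)
 proof
  fix x assume "b = block x" then show ?thesis using that by (cases x) auto
 qed
qed

context symadd
begin

lemma fuse_fam: "a \<in> fam G ==> fuse G a \<in> fam G"
 by (auto simp: fam_def fuse_def)

text \<open>Only one partition of \<open>B\<close> contributes: its left directions as singletons
  and its right directions together as one block, where the fused coefficient is \<open>a B\<close>.
  Any other partition has a block outside the range of \<open>block\<close> or at least two right
  blocks, and gets the unit.\<close>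

lemma finprod_fuse:
 fixes a :: "('i + 'j) set => 'a"
 assumes a: "a \<in> fam G" and B: "finite B" "B \<noteq> {}"
 shows "finprod G (%\<pi>. if \<pi> \<subseteq> range block then fuse G a (block -` \<pi>) else \<one>\<^bsub>G\<^esub>) (parts B) = a B"
  (is "finprod G ?h _ = _")
proof -
 \<comment> \<open>The preimage under \<open>block\<close> of the one contributing partition. If
   \<open>B\<close> has no right directions, no right block may be listed, as it would be
   empty.\<close>
 define D0 :: "('i + 'j set) set" where
  "D0 = Inl ` (Inl -` B) \<union> (if Inr -` B = {} then {} else {Inr (Inr -` B)})"
 have B_split: "B = (Inl -` B) |+| (Inr -` B)"
  by (auto simp: image_iff) (metis sum.exhaust)
 have *: "block ` D0 \<in> parts B"
 proof (rule partsI)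
  show "\<Union> (block ` D0) = B"
   by (subst B_split) (auto simp: D0_def)
  show "{} \<notin> block ` D0" by (auto simp: D0_def)
  fix b b' i assume "b \<in> block ` D0" "b' \<in> block ` D0" "i \<in> b" "i \<in> b'"
  then show "b = b'" by (auto simp: D0_def split: if_splits)
 qed (rule B)
 have unblock_D0: "unblock D0 = B"
  by (subst B_split) (auto simp: unblock_def D0_def image_iff)
 have h0: "?h (block ` D0) = a B"
 proof -
  have "Inr -` D0 = {} \<or> (\<exists>B. Inr -` D0 = {B})" by (auto simp: D0_def)
  then show ?thesis
   using B by (simp add: inj_vimage_image_eq[OF inj_block] fuse_def unblock_D0 image_subset_iff)
 qed
 have "\<pi> = block ` D0" if \<pi>: "\<pi> \<in> parts B" "?h \<pi> \<noteq> \<one>\<^bsub>G\<^esub>" for \<pi>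
 proof -
  have sub: "\<pi> \<subseteq> range block" using \<pi>(2) by (auto split: if_splits)
  define D where "D = block -` \<pi>"
  have \<pi>D: "\<pi> = block ` D" using sub unfolding D_def by blast
  have D: "Inr -` D = {} \<or> (\<exists>B. Inr -` D = {B})"
   using \<pi>(2) sub unfolding D_def fuse_def by (auto split: if_splits)
  have l: "Inl i \<in> D \<longleftrightarrow> Inl i \<in> B" for i
  proof
   assume "Inl i \<in> B"
   then obtain b where "b \<in> \<pi>" "Inl i \<in> b" using partsD(3)[OF \<pi>(1)] by blast
   moreover then have "b = {Inl i}" by (meson sub range_block_Inl subsetD)
   ultimately show "Inl i \<in> D" by (simp add: D_def)
  qed (use partsD(6)[OF \<pi>(1)] in "auto simp: D_def")
  have r: "\<exists>Q. j \<in> Q \<and> Inr Q \<in> D" if j: "Inr j \<in> B" for j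
  proof -
   obtain b where b: "b \<in> \<pi>" "Inr j \<in> b" using partsD(3)[OF \<pi>(1)] j by blast
   then obtain Q where "b = Inr ` Q" "j \<in> Q" by (meson sub range_block_Inr subsetD)
   then show ?thesis using b by (auto simp: D_def)
  qed
  have r': "Q \<noteq> {}" "j \<in> Q ==> Inr j \<in> B" if "Inr Q \<in> D" for Q j
   using that partsD(4,6)[OF \<pi>(1)] by (auto simp: D_def)
  have only: "Q = Inr -` B" if Q: "Inr Q \<in> D" for Q
  proof (intro equalityI subsetI)
   fix j assume "j \<in> Inr -` B"
   then obtain Q' where Q': "j \<in> Q'" "Inr Q' \<in> D" using r by auto
   moreover have "Q' = Q" using D Q Q'(2) by auto
   ultimately show "j \<in> Q" by simp
  qed (use r'(2)[OF Q] in simp)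
  have "D = D0"
  proof (rule Set.set_eqI)
   fix x
   show "x \<in> D \<longleftrightarrow> x \<in> D0"
   proof (cases x)
    case (Inl i)
    then show ?thesis using l by (auto simp: D0_def)
   next
    case (Inr Q)
    have "Inr Q \<in> D \<longleftrightarrow> Q \<noteq> {} \<and> Q = Inr -` B"
    proof
     assume "Inr Q \<in> D"
     then show "Q \<noteq> {} \<and> Q = Inr -` B" using only r'(1) by metis
    next
     assume Q: "Q \<noteq> {} \<and> Q = Inr -` B"
     then obtain j where j: "j \<in> Q" by auto
     then obtain Q' where Q': "j \<in> Q'" "Inr Q' \<in> D" using r Q by auto
     then show "Inr Q \<in> D" using Q only by metis
    qed
    then show ?thesis using Inr by (auto simp: D0_def)
   qed
  qed
  then show ?thesis using \<pi>D by simp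
 qed
 moreover have h_closed: "?h \<pi> \<in> carrier G" if \<pi>: "\<pi> \<in> parts B" for \<pi>
 proof -
  have "block -` \<pi> \<noteq> {}" if "\<pi> \<subseteq> range block"
   using that parts_nonempty[OF \<pi> B(2)] by blast
  then show ?thesis using famD[OF fuse_fam[OF a]] by simp
 qed
 ultimately have "finprod G ?h (parts B) = finprod G ?h {block ` D0}"
  using * by (intro G.finprod_mono_neutral_cong_right finite_parts Pi_I) blast+
 also have "... = ?h (block ` D0)"
  using famD[OF a B(2)] h0 by (simp add: G.finprod_insert[of "{}"])
 finally show ?thesis using h0 by simp
qed

text \<open>Writing each coefficient of \<open>a\<close> as a sum over partitions with one surviving
  term (\<open>finprod_fuse\<close>) brings the left side into the form of \<open>pev_core\<close>.
  The partitions of \<open>I + J\<close> that remain consist of singletons from \<open>I\<close> and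
  the blocks of a partition \<open>P\<close> of \<open>J\<close>. In this way an action at arbitrary
  coefficients in the directions \<open>J\<close> is computed from actions at cubes where products
  of two directions from \<open>P\<close> vanish.\<close>

lemma pev_fuse:
 fixes a :: "('i + 'j) set => 'a"
 assumes a: "a \<in> fam G" and fin: "finite I" "finite J" and ne: "I \<noteq> {} \<or> J \<noteq> {}"
 shows "pev H \<phi> a (I |+| J) =
  finprod H (%P. pev H \<phi> (fuse G a) (I |+| P)) (parts J)"
proof -
 let ?J = "I |+| J"
 let ?h = "%\<pi>. if \<pi> \<subseteq> range block then fuse G a (block -` \<pi>) else \<one>\<^bsub>G\<^esub>"
 let ?R = "%P. block ` (I |+| P) :: ('i + 'j) set set"
 have h: "?h \<in> fam G"
  unfolding fam_def
 proof (intro CollectI allI impI)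
  fix B :: "('i + 'j) set set" assume "B \<noteq> {}"
  then have "block -` B \<noteq> {}" if "B \<subseteq> range block" using that by blast
  then show "?h B \<in> carrier G" using famD[OF fuse_fam[OF a]] by simp
 qed
 have J: "?J \<noteq> {}" "finite ?J" using fin ne by auto
 have R: "?R P \<in> parts ?J" if P: "P \<in> parts J" for P
 proof (rule partsI)
  show "\<Union> (?R P) = ?J" using partsD(3)[OF P] by auto
  show "{} \<notin> ?R P" using partsD(4)[OF P] by auto
  fix b b' i assume "b \<in> ?R P" "b' \<in> ?R P" "i \<in> b" "i \<in> b'"
  then obtain x x' where x: "b = block x" "x \<in> I |+| P" "b' = block x'" "x' \<in> I |+| P"
   "i \<in> block x" "i \<in> block x'" by auto
  then have "x = x'"
   by (cases x; cases x') (auto dest: partsD(7)[OF P])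
  then show "b = b'" using x by simp
 qed (rule J)
 have inj: "inj_on ?R (parts J)"
 proof (rule inj_onI)
  fix P P' assume "?R P = ?R P'"
  then have "I |+| P = (I |+| P' :: ('i + 'j set) set)"
   by (simp only: inj_image_eq_iff[OF inj_block])
  then have "Inr -` (I |+| P) = Inr -` (I |+| P' :: ('i + 'j set) set)"
   by (rule arg_cong)
  moreover have "Inr -` (Inl ` I :: ('i + 'j set) set) = {}" by auto
  ultimately show "P = P'" by (simp add: inj_vimage_image_eq)
 qed
 \<comment> \<open>Some member \<open>b\<close> of \<rho> is not of the form \<open>block x\<close>,
   so \<open>?h\<close> vanishes on every set of blocks containing \<open>b\<close>: a slot of
   zeros.\<close>
 have outside: "pev H \<phi> ?h \<rho> = \<one>\<^bsub>H\<^esub>" if \<rho>: "\<rho> \<in> parts ?J - ?R ` parts J" for \<rho>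
 proof -
  have \<rho>': "\<rho> \<in> parts ?J" using \<rho> by simp
  have "\<not> \<rho> \<subseteq> range block"
  proof
   assume sub: "\<rho> \<subseteq> range block"
   let ?P = "Inr -` (block -` \<rho>)"
   have l: "Inl i \<in> block -` \<rho> \<longleftrightarrow> i \<in> I" for i
   proof
    assume "i \<in> I"
    then have "Inl i \<in> \<Union>\<rho>" using partsD(3)[OF \<rho>'] by auto
    then obtain b where "b \<in> \<rho>" "Inl i \<in> b" by auto
    moreover then have "b = {Inl i}" by (meson sub range_block_Inl subsetD)
    ultimately show "Inl i \<in> block -` \<rho>" by simp
   qed (use partsD(6)[OF \<rho>'] in auto)
   have "\<rho> = block ` (block -` \<rho>)" using sub by blast
   also have "block -` \<rho> = Inl ` I \<union> Inr ` ?P"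
   proof (rule Set.set_eqI)
    fix x show "x \<in> block -` \<rho> \<longleftrightarrow> x \<in> Inl ` I \<union> Inr ` ?P"
     by (cases x) (use l in "auto simp del: vimage_eq simp: vimage_def")
   qed
   finally have eq: "\<rho> = ?R ?P" .
   have "?P \<in> parts J"
   proof (rule partsI)
    show "\<Union> ?P = J"
    proof (intro equalityI subsetI)
     fix j assume "j \<in> J"
     then have "Inr j \<in> \<Union>\<rho>" using partsD(3)[OF \<rho>'] by auto
     then obtain b where b: "b \<in> \<rho>" "Inr j \<in> b" by auto
     then obtain B where "b = Inr ` B" "j \<in> B" by (meson sub range_block_Inr subsetD)
     then show "j \<in> \<Union> ?P" using b by auto
    next
     fix j assume "j \<in> \<Union> ?P"
     then obtain B where "Inr ` B \<in> \<rho>" "j \<in> B" by auto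
     then show "j \<in> J" using partsD(6)[OF \<rho>'] by blast
    qed
    show "{} \<notin> ?P" using partsD(4)[OF \<rho>'] by auto
    fix b b' i assume b: "b \<in> ?P" "b' \<in> ?P" "i \<in> b" "i \<in> b'"
    then have "Inr ` b = (Inr ` b' :: ('i + 'j) set)"
     using partsD(7)[OF \<rho>', of "Inr ` b" "Inr ` b'" "Inr i"] by auto
    then show "b = b'" by (simp add: inj_image_eq_iff)
   qed (rule fin)
   then show False using \<rho> eq by blast
  qed
  then obtain b where b: "b \<in> \<rho>" "b \<notin> range block" by auto
  show ?thesis
   by (rule pev_slot_zero[OF h b(1)]) (use b in auto)
 qed
 have inside: "pev H \<phi> ?h (?R P) = pev H \<phi> (fuse G a) (I |+| P)" if P: "P \<in> parts J" for P
 proof -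
  have "P \<noteq> {}" if "J \<noteq> {}" using parts_nonempty[OF P that] .
  then have ne': "I |+| P \<noteq> {}" using ne by auto
  then have "pev H \<phi> ?h (?R P) = pev H \<phi> (%D. ?h (block ` D)) (I |+| P)"
   by (intro pev_reindex[OF h]) (auto intro: inj_on_subset[OF inj_block])
  also have "(%D. ?h (block ` D)) = fuse G a"
   by (simp add: inj_vimage_image_eq[OF inj_block] image_subset_iff)
  finally show ?thesis .
 qed
 have h_closed: "pev H \<phi> ?h \<rho> \<in> carrier H" if "\<rho> \<in> parts ?J" for \<rho>
  using pev_closed[OF h] parts_nonempty[OF that J(1)] by blast
 have "(%B. finprod G ?h (parts B)) \<in> fam G"
  unfolding fam_def
  by (intro CollectI allI impI G.finprod_closed Pi_I famD[OF h] parts_nonempty)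
 then have "pev H \<phi> a ?J = pev H \<phi> (%B. finprod G ?h (parts B)) ?J"
  by (rule pev_cong[OF _ J(1)]) (rule finprod_fuse[OF a])
 also have "... = finprod H (%\<rho>. pev H \<phi> ?h \<rho>) (parts ?J)"
  by (rule pev_core[OF h J(1)])
 also have "... = finprod H (%\<rho>. pev H \<phi> ?h \<rho>) (?R ` parts J)"
  by (rule H.finprod_mono_neutral_cong_right) (use R outside h_closed in "auto simp: finite_parts")
 also have "... = finprod H (%P. pev H \<phi> (fuse G a) (I |+| P)) (parts J)"
 proof (rule H.finprod_bij)
  show "bij_betw ?R (parts J) (?R ` parts J)" using inj by (simp add: bij_betw_def)
  show "(%P. pev H \<phi> (fuse G a) (I |+| P)) \<in> parts J \<rightarrow> carrier H"
   using inside h_closed R by (metis (no_types, lifting) Pi_I)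
 qed (rule inside)
 finally show ?thesis .
qed

end

section \<open>Maps with a given domain of definition\<close>

text \<open>The partial points \<open>Z \<rightarrow> X\<close> whose domain of definition is the restriction idempotent \<open>e\<close>;
 for \<open>e\<close> an identity these are the total maps.\<close>

abbreviation (input) "tcm \<equiv> total_comm_monoid"

definition pt :: "('o, 'm) crcat => 'o => 'm => 'o => 'm set" where
 "pt C Z e X = {f \<in> Hom C Z X. Rst C f = e}"

abbreviation (input) "mpt C Z e A \<equiv> pt C Z e (mcar A)"

section \<open>Elementary identities in restriction categories\<close>

context category
begin

lemma Hom_Obj: "f \<in> Hom C X Y ==> X \<in> Obj C" "f \<in> Hom C X Y ==> Y \<in> Obj C"
 using Dom_Obj Cod_Obj by (auto simp: Hom_def)

lemma HomD: "f \<in> Hom C X Y ==> f \<in> Arr C" "f \<in> Hom C X Y ==> Dom C f = X" "f \<in> Hom C X Y ==> Cod C f = Y"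
 by (auto simp: Hom_def)

end

context restriction_category
begin

lemma ptD: "f \<in> pt C Z e X ==> f \<in> Hom C Z X" "f \<in> pt C Z e X ==> Rst C f = e"
 by (auto simp: pt_def)

lemmas ptH = ptD(1)

lemma ptI: "f \<in> Hom C Z X ==> Rst C f = e ==> f \<in> pt C Z e X"
 by (auto simp: pt_def)

lemma Rst_Ide: "X \<in> Obj C ==> Rst C (Ide C X) = Ide C X"
 using R1[OF Ide_Hom] Comp_Ide[OF Rst_Hom[OF Ide_Hom]] by simp

lemma Ide_pt: "X \<in> Obj C ==> Ide C X \<in> pt C X (Ide C X) X"
 by (simp add: ptI Ide_Hom Rst_Ide)

lemma Rst_Rst: "f \<in> Hom C X Y ==> Rst C (Rst C f) = Rst C f"
 using R3[of f X Y "Ide C X" X] Comp_Ide[OF Rst_Hom, of f X Y] Rst_Ide Ide_Hom Hom_Obj(1) by simp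

lemma Rst_idem: "f \<in> Hom C X Y ==> Rst C f \<cdot> Rst C f = Rst C f"
 using R3[of f X Y f Y] R1[of f X Y] by simp

lemma Rst_Comp: "f \<in> Hom C X Y ==> g \<in> Hom C Y Z ==> Rst C (f \<cdot> Rst C g) = Rst C (f \<cdot> g)"
proof -
 assume f: "f \<in> Hom C X Y" and g: "g \<in> Hom C Y Z"
 note fg = Comp_Hom[OF f g]
 have "Rst C (f \<cdot> Rst C g) = Rst C (f \<cdot> g) \<cdot> Rst C f"
  by (simp add: R4[OF f g] R3[OF fg f])
 also have "... = Rst C f \<cdot> Rst C (f \<cdot> g)"
  by (rule R2[OF fg f])
 also have "... = Rst C (Rst C f \<cdot> (f \<cdot> g))"
  by (rule R3[OF f fg, symmetric])
 also have "Rst C f \<cdot> (f \<cdot> g) = f \<cdot> g"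
  using Comp_assoc[OF Rst_Hom[OF f] f g] R1[OF f] by simp
 finally show ?thesis .
qed

lemma pt_idem:
 assumes "f \<in> pt C Z e X"
 shows "e \<in> Hom C Z Z" "Rst C e = e" "e \<cdot> e = e" "e \<cdot> f = f" "e \<in> pt C Z e Z"
proof -
 note f = ptD[OF assms]
 show "e \<in> Hom C Z Z" "Rst C e = e" "e \<cdot> e = e" "e \<cdot> f = f"
  using Rst_Hom[OF f(1)] Rst_Rst[OF f(1)] Rst_idem[OF f(1)] R1[OF f(1)] f(2) by auto
 then show "e \<in> pt C Z e Z" by (simp add: pt_def)
qed

lemma pt_Comp:
 assumes "f \<in> pt C Z e X" "g \<in> pt C X (Ide C X) Y"
 shows "f \<cdot> g \<in> pt C Z e Y"
proof (rule ptI)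
 note f = ptD[OF assms(1)] and g = ptD[OF assms(2)]
 show "f \<cdot> g \<in> Hom C Z Y" by (rule Comp_Hom[OF f(1) g(1)])
 show "Rst C (f \<cdot> g) = e"
  using Rst_Comp[OF f(1) g(1)] Comp_Ide[OF f(1)] f(2) g(2) by simp
qed

lemma precomp_pt:
 assumes "u \<in> Hom C Z' Z" "f \<in> pt C Z e X"
 shows "u \<cdot> f \<in> pt C Z' (Rst C (u \<cdot> e)) X"
 using Comp_Hom[OF assms(1) ptH[OF assms(2)]] Rst_Comp[OF assms(1) ptH[OF assms(2)]] ptD(2)[OF assms(2)]
 by (auto intro: ptI)

lemma restrict_pt:
 assumes "d \<in> pt C Z d Z" "f \<in> pt C Z e X"
 shows "d \<cdot> f \<in> pt C Z (d \<cdot> e) X"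
 using Comp_Hom[OF ptH[OF assms(1)] ptH[OF assms(2)]] R3[OF ptH[OF assms(1)] ptH[OF assms(2)]]
  ptD(2)[OF assms(1)] ptD(2)[OF assms(2)]
 by (auto intro: ptI)

lemma idem_comp:
 assumes "d \<in> pt C Z d Z" "e \<in> pt C Z e Z"
 shows "d \<cdot> e \<in> pt C Z (d \<cdot> e) Z" "d \<cdot> e = e \<cdot> d"
proof -
 show "d \<cdot> e \<in> pt C Z (d \<cdot> e) Z" by (rule restrict_pt[OF assms])
 show "d \<cdot> e = e \<cdot> d"
  using R2[OF ptH[OF assms(1)] ptH[OF assms(2)]] assms by (simp add: ptD(2))
qed

lemma Rst_Comp_total: "f \<in> Hom C X Y ==> g \<in> pt C Y (Ide C Y) Z ==> Rst C (f \<cdot> g) = Rst C f"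
 using pt_Comp[OF ptI[OF _ refl]] ptD(2) by blast

end

section \<open>The terminal object and pairing\<close>

context cartesian_restriction_category
begin

abbreviation (input) "zmap \<equiv> zero_map C"
abbreviation (input) "powp \<equiv> powprod C"
abbreviation (input) "FObj \<equiv> faa_Obj C"
abbreviation (input) "FComp \<equiv> faa_Comp C"
abbreviation (input) "darr \<equiv> delta_arr C"
abbreviation (input) "dobj \<equiv> delta_obj C"

lemma Bang_pt: "X \<in> Obj C ==> Bang C X \<in> pt C X (Ide C X) (Unit C)"
 using Bang_Hom[of X] Bang_total[of X] by (auto simp: pt_def total_map_def Hom_def)

lemma total_map_iff: "f \<in> Hom C X Y ==> total_map C f \<longleftrightarrow> f \<in> pt C X (Ide C X) Y"
 by (auto simp: total_map_def pt_def Hom_def)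

lemma Unit_eq: "f \<in> Hom C X (Unit C) ==> g \<in> Hom C X (Unit C) ==> Rst C f = Rst C g ==> f = g"
 using Unit_restriction[of f X] Unit_restriction[of g X] by simp

text \<open>Both maps go into the terminal object, so it suffices to compare their domains.\<close>

lemma Comp_Bang: "u \<in> Hom C Z X ==> u \<cdot> Bang C X = Rst C u \<cdot> Bang C Z"
proof (rule Unit_eq)
 assume u: "u \<in> Hom C Z X"
 show "u \<cdot> Bang C X \<in> Hom C Z (Unit C)" "Rst C u \<cdot> Bang C Z \<in> Hom C Z (Unit C)"
  using Comp_Hom[OF u Bang_Hom] Comp_Hom[OF Rst_Hom[OF u] Bang_Hom] Hom_Obj[OF u] by auto
 show "Rst C (u \<cdot> Bang C X) = Rst C (Rst C u \<cdot> Bang C Z)"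
  using Rst_Comp_total[OF u Bang_pt] Rst_Comp_total[OF Rst_Hom[OF u] Bang_pt] Rst_Rst[OF u] Hom_Obj[OF u]
  by simp
qed

lemma Pi0_pt: "X \<in> Obj C ==> Y \<in> Obj C ==> Pi0 C X Y \<in> pt C (Prod C X Y) (Ide C (Prod C X Y)) X"
 using Pi0_Hom Pi0_total total_map_iff[OF Pi0_Hom] by blast

lemma Pi1_pt: "X \<in> Obj C ==> Y \<in> Obj C ==> Pi1 C X Y \<in> pt C (Prod C X Y) (Ide C (Prod C X Y)) Y"
 using Pi1_Hom Pi1_total total_map_iff[OF Pi1_Hom] by blast

lemma Rst_Pairing:
 assumes f: "f \<in> Hom C Z X" and g: "g \<in> Hom C Z Y"
 shows "Rst C (Pairing C f g) = Rst C f \<cdot> Rst C g"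
proof -
 have "Rst C (Pairing C f g) = Rst C (Rst C g \<cdot> f)"
  using Rst_Comp_total[OF Pairing_Hom[OF f g] Pi0_pt] Pairing_Pi0[OF f g] Hom_Obj[OF f] Hom_Obj[OF g] by simp
 also have "... = Rst C f \<cdot> Rst C g"
  using R3[OF g f] R2[OF f g] by simp
 finally show ?thesis .
qed

lemma Pairing_pt:
 assumes f: "f \<in> pt C Z e X" and g: "g \<in> pt C Z e Y"
 shows "Pairing C f g \<in> pt C Z e (Prod C X Y)" "Pairing C f g \<cdot> Pi0 C X Y = f" "Pairing C f g \<cdot> Pi1 C X Y = g"
proof -
 note f' = ptD[OF f] and g' = ptD[OF g]
 show "Pairing C f g \<in> pt C Z e (Prod C X Y)"
  using Rst_Pairing[OF f'(1) g'(1)] f' g' pt_idem(3)[OF f] by (intro ptI Pairing_Hom) auto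
 show "Pairing C f g \<cdot> Pi0 C X Y = f" "Pairing C f g \<cdot> Pi1 C X Y = g"
  using Pairing_Pi0[OF f'(1) g'(1)] Pairing_Pi1[OF f'(1) g'(1)] f' g' pt_idem(4)[OF f] pt_idem(4)[OF g]
  by auto
qed

text \<open>The projections are total, so both components of \<open>p\<close> have the domain of
  \<open>p\<close>, and the mutual restriction in the pairing does nothing.\<close>

lemma Pairing_eta:
 assumes p: "p \<in> Hom C Z (Prod C X Y)" and "X \<in> Obj C" "Y \<in> Obj C"
 shows "p = Pairing C (p \<cdot> Pi0 C X Y) (p \<cdot> Pi1 C X Y)"
proof (rule Pairing_unique)
 note q = Pi0_pt[OF assms(2,3)] Pi1_pt[OF assms(2,3)]
 show h: "p \<cdot> Pi0 C X Y \<in> Hom C Z X" "p \<cdot> Pi1 C X Y \<in> Hom C Z Y"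
  by (rule Comp_Hom[OF p ptH[OF q(1)]], rule Comp_Hom[OF p ptH[OF q(2)]])
 show "p \<cdot> Pi0 C X Y = Rst C (p \<cdot> Pi1 C X Y) \<cdot> (p \<cdot> Pi0 C X Y)"
  "p \<cdot> Pi1 C X Y = Rst C (p \<cdot> Pi0 C X Y) \<cdot> (p \<cdot> Pi1 C X Y)"
  using R1[OF h(1)] R1[OF h(2)] Rst_Comp_total[OF p q(1)] Rst_Comp_total[OF p q(2)] by auto
qed fact

lemma Pairing_ext:
 assumes "p \<in> Hom C Z (Prod C X Y)" "q \<in> Hom C Z (Prod C X Y)" "X \<in> Obj C" "Y \<in> Obj C"
  and "p \<cdot> Pi0 C X Y = q \<cdot> Pi0 C X Y" "p \<cdot> Pi1 C X Y = q \<cdot> Pi1 C X Y"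
 shows "p = q"
 using Pairing_eta[OF assms(1,3,4)] Pairing_eta[OF assms(2,3,4)] assms(5,6) by simp

text \<open>The restrictions in the defining equations of the pairing are carried past
  \<open>u\<close> by \<open>R4\<close>: \<open>u \<cdot> Rst C g\<close> equals
  \<open>Rst C (u \<cdot> g) \<cdot> u\<close>.\<close>

lemma Comp_Pairing:
 assumes u: "u \<in> Hom C W Z" and f: "f \<in> Hom C Z X" and g: "g \<in> Hom C Z Y"
 shows "u \<cdot> Pairing C f g = Pairing C (u \<cdot> f) (u \<cdot> g)"
proof (rule Pairing_unique)
 show h: "u \<cdot> f \<in> Hom C W X" "u \<cdot> g \<in> Hom C W Y" "u \<cdot> Pairing C f g \<in> Hom C W (Prod C X Y)"
  by (rule Comp_Hom[OF u f], rule Comp_Hom[OF u g], rule Comp_Hom[OF u Pairing_Hom[OF f g]])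
 have obj: "X \<in> Obj C" "Y \<in> Obj C" using Hom_Obj(2)[OF f] Hom_Obj(2)[OF g] by auto
 have "u \<cdot> Pairing C f g \<cdot> Pi0 C X Y = u \<cdot> (Rst C g \<cdot> f)"
  using Comp_assoc[OF u Pairing_Hom[OF f g] Pi0_Hom[OF obj]] Pairing_Pi0[OF f g] by simp
 also have "... = (u \<cdot> Rst C g) \<cdot> f"
  by (rule Comp_assoc[OF u Rst_Hom[OF g] f, symmetric])
 also have "... = Rst C (u \<cdot> g) \<cdot> (u \<cdot> f)"
  using R4[OF u g] Comp_assoc[OF Rst_Hom[OF h(2)] u f] by simp
 finally show "u \<cdot> Pairing C f g \<cdot> Pi0 C X Y = Rst C (u \<cdot> g) \<cdot> (u \<cdot> f)" .
 have "u \<cdot> Pairing C f g \<cdot> Pi1 C X Y = u \<cdot> (Rst C f \<cdot> g)"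
  using Comp_assoc[OF u Pairing_Hom[OF f g] Pi1_Hom[OF obj]] Pairing_Pi1[OF f g] by simp
 also have "... = (u \<cdot> Rst C f) \<cdot> g"
  by (rule Comp_assoc[OF u Rst_Hom[OF f] g, symmetric])
 also have "... = Rst C (u \<cdot> f) \<cdot> (u \<cdot> g)"
  using R4[OF u f] Comp_assoc[OF Rst_Hom[OF h(1)] u g] by simp
 finally show "u \<cdot> Pairing C f g \<cdot> Pi1 C X Y = Rst C (u \<cdot> f) \<cdot> (u \<cdot> g)" .
qed

subsection \<open>Powers and tuples\<close>

lemma powprod_Obj: "A \<in> Obj C ==> X \<in> Obj C ==> powp A n X \<in> Obj C"
 by (induction n) (auto intro: Prod_Obj)

lemma proj_pt:
 assumes "A \<in> Obj C" "X \<in> Obj C"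
 shows "i < n ==> proj C A n X i \<in> pt C (powp A n X) (Ide C (powp A n X)) A"
  and "proj C A n X n \<in> pt C (powp A n X) (Ide C (powp A n X)) X"
proof -
 show "i < n ==> proj C A n X i \<in> pt C (powp A n X) (Ide C (powp A n X)) A"
 proof (induction n arbitrary: i)
  case (Suc n)
  then show ?case
   using Pi0_pt[OF assms(1) powprod_Obj[OF assms]] pt_Comp[OF Pi1_pt[OF assms(1) powprod_Obj[OF assms]]]
   by (cases i) auto
 qed simp
 show "proj C A n X n \<in> pt C (powp A n X) (Ide C (powp A n X)) X"
  by (induction n) (use assms pt_Comp[OF Pi1_pt[OF assms(1) powprod_Obj[OF assms]]] in "auto intro: Ide_pt")
qed

definition tup :: "'m list => 'm => 'm" where
 "tup zs x = foldr (Pairing C) zs x"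

lemma tup_simps [simp]: "tup [] x = x" "tup (z # zs) x = Pairing C z (tup zs x)"
 by (simp_all add: tup_def)

lemma apply_map_tup: "apply_map C h zs x = tup zs x \<cdot> h"
 by (simp add: apply_map_def tup_def)

lemma tup_Hom:
 "set zs \<subseteq> Hom C Z A ==> x \<in> Hom C Z X ==> tup zs x \<in> Hom C Z (powp A (length zs) X)"
 by (induction zs) (auto intro: Pairing_Hom)

lemma Comp_tup:
 "u \<in> Hom C W Z ==> set zs \<subseteq> Hom C Z A ==> x \<in> Hom C Z X ==>
  u \<cdot> tup zs x = tup (map (%z. u \<cdot> z) zs) (u \<cdot> x)"
 by (induction zs) (auto simp: Comp_Pairing[OF _ _ tup_Hom])

text \<open>With a common domain of definition, pairing does not shrink its entries, so the
  projections return them exactly.\<close>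

lemma tup_pt:
 assumes "set zs \<subseteq> pt C Z e A" "x \<in> pt C Z e X"
 shows "tup zs x \<in> pt C Z e (powp A (length zs) X)"
  and "i < length zs ==> tup zs x \<cdot> proj C A (length zs) X i = zs ! i"
  and "tup zs x \<cdot> proj C A (length zs) X (length zs) = x"
proof -
 have X: "X \<in> Obj C" by (rule Hom_Obj(2)[OF ptH[OF assms(2)]])
 have 1: "tup zs x \<in> pt C Z e (powp A (length zs) X)" if "set zs \<subseteq> pt C Z e A" for zs
  using that by (induction zs) (use assms in "auto intro: Pairing_pt")
 then show "tup zs x \<in> pt C Z e (powp A (length zs) X)" using assms(1) .
 have A: "A \<in> Obj C" if "z \<in> pt C Z e A" for z by (rule Hom_Obj(2)[OF ptH[OF that]])
 show "i < length zs ==> tup zs x \<cdot> proj C A (length zs) X i = zs ! i"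
  using assms(1)
 proof (induction zs arbitrary: i)
  case (Cons z zs)
  then have z: "z \<in> pt C Z e A" "tup zs x \<in> pt C Z e (powp A (length zs) X)" using 1 by auto
  note P = Pairing_pt[OF z]
  show ?case
  proof (cases i)
   case (Suc j)
   have "tup (z # zs) x \<cdot> proj C A (length (z # zs)) X i =
     Pairing C z (tup zs x) \<cdot> Pi1 C A (powp A (length zs) X) \<cdot> proj C A (length zs) X j"
    using Suc Cons.prems A[OF z(1)] X
    by (simp add: Comp_assoc[OF ptH[OF P(1)] Pi1_Hom ptH[OF proj_pt(1)]] powprod_Obj)
   then show ?thesis using Suc Cons P by simp
  qed (use P in simp)
 qed simp
 show "tup zs x \<cdot> proj C A (length zs) X (length zs) = x"
  using assms(1)
 proof (induction zs)
  case Nil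
  then show ?case using Comp_Ide[OF ptH[OF assms(2)]] by simp
 next
  case (Cons z zs)
  then have z: "z \<in> pt C Z e A" "tup zs x \<in> pt C Z e (powp A (length zs) X)" using 1 by auto
  note P = Pairing_pt[OF z]
  have "tup (z # zs) x \<cdot> proj C A (length (z # zs)) X (length (z # zs)) =
    Pairing C z (tup zs x) \<cdot> Pi1 C A (powp A (length zs) X) \<cdot> proj C A (length zs) X (length zs)"
   using A[OF z(1)] X
   by (simp add: Comp_assoc[OF ptH[OF P(1)] Pi1_Hom ptH[OF proj_pt(2)]] powprod_Obj)
  then show ?case using Cons P by simp
 qed
qed

lemma powprod_ext:
 assumes "A \<in> Obj C" "X \<in> Obj C"
 shows "p \<in> Hom C Z (powp A n X) ==> q \<in> Hom C Z (powp A n X) ==>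
  (!!i. i \<le> n ==> p \<cdot> proj C A n X i = q \<cdot> proj C A n X i) ==> p = q"
proof (induction n arbitrary: p q)
 case 0
 from 0(3)[of 0] show ?case using Comp_Ide[of p Z X] Comp_Ide[of q Z X] 0(1,2) by simp
next
 case (Suc n)
 let ?P = "powp A n X"
 have obj: "?P \<in> Obj C" using powprod_Obj[OF assms] .
 have pq: "p \<in> Hom C Z (Prod C A ?P)" "q \<in> Hom C Z (Prod C A ?P)" using Suc.prems by auto
 have "p \<cdot> Pi1 C A ?P = q \<cdot> Pi1 C A ?P"
 proof (rule Suc.IH)
  show "p \<cdot> Pi1 C A ?P \<in> Hom C Z ?P" "q \<cdot> Pi1 C A ?P \<in> Hom C Z ?P"
   using Comp_Hom[OF _ Pi1_Hom[OF assms(1) obj]] pq by auto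
  fix i assume i: "i \<le> n"
  have "proj C A n X i \<in> Hom C ?P (if i < n then A else X)"
   using i ptH[OF proj_pt(1)[OF assms, of i n]] ptH[OF proj_pt(2)[OF assms, of n]] by auto
  from Comp_assoc[OF pq(1) Pi1_Hom[OF assms(1) obj] this] Comp_assoc[OF pq(2) Pi1_Hom[OF assms(1) obj] this]
  show "p \<cdot> Pi1 C A ?P \<cdot> proj C A n X i = q \<cdot> Pi1 C A ?P \<cdot> proj C A n X i"
   using Suc.prems(3)[of "Suc i"] i by simp
 qed
 moreover have "p \<cdot> Pi0 C A ?P = q \<cdot> Pi0 C A ?P" using Suc.prems(3)[of 0] by simp
 ultimately show ?case using Pairing_ext[OF pq assms(1) obj] by simp
qed

lemma tup_eta:
 assumes "A \<in> Obj C" "X \<in> Obj C" "p \<in> pt C Z e (powp A n X)"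
 shows "tup (map (%i. p \<cdot> proj C A n X i) [0..<n]) (p \<cdot> proj C A n X n) = p"
proof (rule powprod_ext[OF assms(1,2)])
 let ?zs = "map (%i. p \<cdot> proj C A n X i) [0..<n]"
 have zs: "set ?zs \<subseteq> pt C Z e A" and x: "p \<cdot> proj C A n X n \<in> pt C Z e X"
  using pt_Comp[OF assms(3) proj_pt(1)[OF assms(1,2)]] pt_Comp[OF assms(3) proj_pt(2)[OF assms(1,2)]] by auto
 note t = tup_pt[OF zs x]
 show "tup ?zs (p \<cdot> proj C A n X n) \<in> Hom C Z (powp A n X)" using t(1) ptD by simp
 show "p \<in> Hom C Z (powp A n X)" using assms(3) ptD by simp
 show "tup ?zs (p \<cdot> proj C A n X n) \<cdot> proj C A n X i = p \<cdot> proj C A n X i" if "i \<le> n" for i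
  using that t(2)[of i] t(3) by (cases "i = n") auto
qed

text \<open>A tuple is defined exactly where all its entries are. Restricting every entry to this
  common domain leaves the tuple unchanged, which reduces statements about arbitrary entries to
  entries with one fixed domain \<open>e\<close>.\<close>

lemma tup_homogeneous:
 assumes "set zs \<subseteq> Hom C Z A" "x \<in> Hom C Z X"
 defines "e \<equiv> Rst C (tup zs x)"
 shows "tup zs x = tup (map (%z. e \<cdot> z) zs) (e \<cdot> x)" "!!z. z \<in> set zs ==> e \<cdot> z \<in> pt C Z e A"
  "e \<cdot> x \<in> pt C Z e X" "e \<in> pt C Z e Z"
proof -
 have t: "tup zs x \<in> Hom C Z (powp A (length zs) X)" by (rule tup_Hom[OF assms(1,2)])
 show e: "e \<in> pt C Z e Z" using pt_idem(5)[OF ptI[OF t]] e_def by simp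
 show "tup zs x = tup (map (%z. e \<cdot> z) zs) (e \<cdot> x)"
  using Comp_tup[OF ptH[OF e] assms(1,2)] R1[OF t] e_def by simp
 \<comment> \<open>The domain of the tuple lies below that of every entry; for idempotents this
   reads \<open>e \<cdot> Rst C z = e\<close>.\<close>
 have key: "(\<forall>z\<in>set zs. Rst C (tup zs x) \<cdot> Rst C z = Rst C (tup zs x)) \<and> Rst C (tup zs x) \<cdot> Rst C x = Rst C (tup zs x)"
  using assms(1)
 proof (induction zs)
  case Nil
  then show ?case using Rst_idem assms(2) by simp
 next
  case (Cons z zs)
  let ?t = "tup zs x"
  have z: "z \<in> Hom C Z A" and t: "?t \<in> Hom C Z (powp A (length zs) X)"
   using Cons.prems tup_Hom[OF _ assms(2)] by auto
  have R: "Rst C (tup (z # zs) x) = Rst C z \<cdot> Rst C ?t" using Rst_Pairing[OF z t] by simp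
  have 1: "Rst C z \<cdot> Rst C ?t \<cdot> Rst C z = Rst C z \<cdot> Rst C ?t"
   using Comp_assoc[OF Rst_Hom[OF z] Rst_Hom[OF t] Rst_Hom[OF z]]
    Comp_assoc[OF Rst_Hom[OF z] Rst_Hom[OF z] Rst_Hom[OF t]] R2[OF z t] Rst_idem[OF z] by simp
  have 2: "Rst C z \<cdot> Rst C ?t \<cdot> Rst C y = Rst C z \<cdot> Rst C ?t" if "y \<in> Hom C Z Y" "Rst C ?t \<cdot> Rst C y = Rst C ?t" for y Y
   using Comp_assoc[OF Rst_Hom[OF z] Rst_Hom[OF t] Rst_Hom[OF that(1)]] that(2) by simp
  show ?case unfolding R
  proof (intro conjI ballI)
   fix y assume "y \<in> set (z # zs)"
   then show "Rst C z \<cdot> Rst C ?t \<cdot> Rst C y = Rst C z \<cdot> Rst C ?t"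
    using 1 2[of y A] Cons by auto
  qed (use 2[OF assms(2)] Cons in auto)
 qed
 show "e \<cdot> z \<in> pt C Z e A" if "z \<in> set zs" for z
  using restrict_pt[OF e, of z "Rst C z" A] key that assms(1) e_def by (auto simp: pt_def)
 show "e \<cdot> x \<in> pt C Z e X"
  using restrict_pt[OF e, of x "Rst C x" X] key assms(2) e_def by (auto simp: pt_def)
qed

subsection \<open>Commutative monoids of points\<close>

lemma madd_Hom:
 assumes "mplus A \<in> Hom C (Prod C (mcar A) (mcar A)) (mcar A)" "f \<in> Hom C Z (mcar A)" "g \<in> Hom C Z (mcar A)"
 shows "madd C A f g \<in> Hom C Z (mcar A)"
 unfolding madd_def by (rule Comp_Hom[OF Pairing_Hom[OF assms(2,3)] assms(1)])

lemma Comp_madd: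
 assumes "mplus A \<in> Hom C (Prod C (mcar A) (mcar A)) (mcar A)" "f \<in> Hom C Z (mcar A)" "g \<in> Hom C Z (mcar A)"
  and u: "u \<in> Hom C W Z"
 shows "u \<cdot> madd C A f g = madd C A (u \<cdot> f) (u \<cdot> g)"
 unfolding madd_def
 using Comp_assoc[OF u Pairing_Hom[OF assms(2,3)] assms(1)] Comp_Pairing[OF u assms(2,3)] by simp

lemma total_comm_monoidD:
 assumes "tcm C A"
 shows "mcar A \<in> Obj C"
  "mplus A \<in> pt C (Prod C (mcar A) (mcar A)) (Ide C (Prod C (mcar A) (mcar A))) (mcar A)"
  "mzero A \<in> pt C (Unit C) (Ide C (Unit C)) (mcar A)"
 using assms total_map_iff by (auto simp: total_comm_monoid_def Let_def)

end

locale crc_monoid = cartesian_restriction_category C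
 for C :: "('o, 'm) crcat" (structure) +
 fixes A :: "('o, 'm) cmon"
 assumes monoid: "tcm C A"
begin

lemmas car_Obj = total_comm_monoidD(1)[OF monoid]
 and plus_pt = total_comm_monoidD(2)[OF monoid]
 and mzero_pt = total_comm_monoidD(3)[OF monoid]

lemmas plus_Hom = ptH[OF plus_pt] and mzero_Hom = ptH[OF mzero_pt]

lemmas add_Hom = madd_Hom[OF plus_Hom] and Comp_add = Comp_madd[OF plus_Hom]

lemma Rst_add:
 "f \<in> Hom C Z (mcar A) ==> g \<in> Hom C Z (mcar A) ==> Rst C (madd C A f g) = Rst C f \<cdot> Rst C g"
 unfolding madd_def using Rst_Comp_total[OF Pairing_Hom plus_pt] Rst_Pairing by simp

lemma add_pt: "f \<in> mpt C Z e A ==> g \<in> mpt C Z e A ==> madd C A f g \<in> mpt C Z e A"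
 using add_Hom Rst_add by (auto simp: pt_def intro: Rst_idem)

lemma zero_pt: "Z \<in> Obj C ==> zmap A Z \<in> mpt C Z (Ide C Z) A"
 unfolding zero_map_def by (rule pt_Comp[OF Bang_pt mzero_pt])

lemma Comp_zero:
 assumes u: "u \<in> Hom C W Z"
 shows "u \<cdot> zmap A Z = Rst C u \<cdot> zmap A W"
 using Comp_assoc[OF u Bang_Hom mzero_Hom] Comp_assoc[OF Rst_Hom[OF u] Bang_Hom mzero_Hom]
  Comp_Bang[OF u] Hom_Obj[OF u] unfolding zero_map_def by simp

lemma zero_e_pt: "e \<in> pt C Z e Z ==> e \<cdot> zmap A Z \<in> mpt C Z e A"
 using pt_Comp[OF _ zero_pt] Hom_Obj[OF ptD(1)] by blast

text \<open>The monoid axiom is the case of the three projections of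
  \<open>A \<times> (A \<times> A)\<close>; pulling it back along the tuple of \<open>f\<close>,
  \<open>g\<close> and \<open>h\<close> gives all points with a common domain.\<close>

lemma add_assoc_pt:
 assumes "f \<in> mpt C Z e A" "g \<in> mpt C Z e A" "h \<in> mpt C Z e A"
 shows "madd C A (madd C A f g) h = madd C A f (madd C A g h)"
proof -
 let ?A = "mcar A"
 let ?u = "tup [f, g] h"
 let ?p = "proj C ?A 2 ?A"
 have fg: "set [f, g] \<subseteq> pt C Z e ?A" using assms by simp
 note t = tup_pt[OF fg assms(3)]
 have u: "?u \<in> Hom C Z (powp ?A 2 ?A)"
  using ptH[OF t(1)] by (simp add: numeral_2_eq_2)
 have p: "?p 0 \<in> Hom C (powp ?A 2 ?A) ?A" "?p 1 \<in> Hom C (powp ?A 2 ?A) ?A"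
  "?p 2 \<in> Hom C (powp ?A 2 ?A) ?A"
  using ptH[OF proj_pt(1)[OF car_Obj car_Obj, of 0 2]] ptH[OF proj_pt(1)[OF car_Obj car_Obj, of 1 2]]
   ptH[OF proj_pt(2)[OF car_Obj car_Obj, of 2]] by auto
 have up: "?u \<cdot> ?p 0 = f" "?u \<cdot> ?p 1 = g" "?u \<cdot> ?p 2 = h"
  using t(2)[of 0] t(2)[of 1] t(3) by (simp_all add: numeral_2_eq_2)
 have "madd C A (madd C A (?p 0) (?p 1)) (?p 2) = madd C A (?p 0) (madd C A (?p 1) (?p 2))"
  using monoid by (simp add: total_comm_monoid_def Let_def)
 then have "?u \<cdot> madd C A (madd C A (?p 0) (?p 1)) (?p 2) = ?u \<cdot> madd C A (?p 0) (madd C A (?p 1) (?p 2))"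
  by simp
 then show ?thesis
  using Comp_add[OF add_Hom[OF p(1,2)] p(3) u] Comp_add[OF p(1) add_Hom[OF p(2,3)] u]
   Comp_add[OF p(1,2) u] Comp_add[OF p(2,3) u] up by simp
qed

text \<open>When the domains differ, the projections of the tuple no longer return the summands.
  Both sides have as domain the idempotent \<open>e\<close> where all three are defined, and cutting
  everything down to \<open>e\<close> reduces to the case of a common domain.\<close>

lemma add_assoc:
 assumes f: "f \<in> Hom C Z (mcar A)" and g: "g \<in> Hom C Z (mcar A)" and h: "h \<in> Hom C Z (mcar A)"
 shows "madd C A (madd C A f g) h = madd C A f (madd C A g h)"
proof -
 let ?A = "mcar A"
 have fg: "set [f, g] \<subseteq> Hom C Z ?A" using assms by simp
 note t = tup_homogeneous[OF fg h]
 define e where "e = Rst C (tup [f, g] h)"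
 have e: "e \<in> Hom C Z Z" using t(4) ptD(1) e_def by simp
 have R: "e = Rst C (madd C A f (madd C A g h))"
  unfolding e_def using Rst_Pairing[OF f Pairing_Hom[OF g h]] Rst_Pairing[OF g h]
   Rst_add[OF f add_Hom[OF g h]] Rst_add[OF g h] by simp
 have R': "e = Rst C (madd C A (madd C A f g) h)"
  using R Rst_add[OF f add_Hom[OF g h]] Rst_add[OF g h] Rst_add[OF add_Hom[OF f g] h] Rst_add[OF f g]
   Comp_assoc[OF Rst_Hom[OF f] Rst_Hom[OF g] Rst_Hom[OF h]] by simp
 have "madd C A (madd C A f g) h = e \<cdot> madd C A (madd C A f g) h"
  unfolding R' by (rule R1[OF add_Hom[OF add_Hom[OF f g] h], symmetric])
 also have "... = madd C A (madd C A (e \<cdot> f) (e \<cdot> g)) (e \<cdot> h)"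
  using Comp_add[OF add_Hom[OF f g] h e] Comp_add[OF f g e] by simp
 also have "... = madd C A (e \<cdot> f) (madd C A (e \<cdot> g) (e \<cdot> h))"
  unfolding e_def by (rule add_assoc_pt) (use t in auto)
 also have "... = e \<cdot> madd C A f (madd C A g h)"
  using Comp_add[OF f add_Hom[OF g h] e] Comp_add[OF g h e] by simp
 also have "... = madd C A f (madd C A g h)"
  unfolding R by (rule R1[OF add_Hom[OF f add_Hom[OF g h]]])
 finally show ?thesis .
qed

lemma add_comm:
 assumes f: "f \<in> Hom C Z (mcar A)" and g: "g \<in> Hom C Z (mcar A)"
 shows "madd C A f g = madd C A g f"
proof -
 let ?A = "mcar A"
 note p = Pi0_Hom[OF car_Obj car_Obj] Pi1_Hom[OF car_Obj car_Obj]
 have key: "madd C A f g = madd C A g f" if f: "f \<in> pt C Z e ?A" and g: "g \<in> pt C Z e ?A" for f g e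
 proof -
  note u = Pairing_pt[OF f g]
  have "madd C A (Pi0 C ?A ?A) (Pi1 C ?A ?A) = madd C A (Pi1 C ?A ?A) (Pi0 C ?A ?A)"
   using monoid by (simp add: total_comm_monoid_def Let_def)
  then have "Pairing C f g \<cdot> madd C A (Pi0 C ?A ?A) (Pi1 C ?A ?A) = Pairing C f g \<cdot> madd C A (Pi1 C ?A ?A) (Pi0 C ?A ?A)"
   by simp
  then show ?thesis
   using Comp_add[OF p ptH[OF u(1)]] Comp_add[OF p(2,1) ptH[OF u(1)]] u(2,3) by simp
 qed
 have fs: "set [f] \<subseteq> Hom C Z ?A" using f by simp
 note t = tup_homogeneous[OF fs g]
 define e where "e = Rst C (tup [f] g)"
 have e: "e \<in> Hom C Z Z" using t(4) ptD(1) e_def by simp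
 have R: "e = Rst C (madd C A f g)" "e = Rst C (madd C A g f)"
  using Rst_Pairing[OF f g] Rst_add[OF f g] Rst_add[OF g f] R2[OF f g] by (auto simp: e_def)
 have "madd C A f g = e \<cdot> madd C A f g"
  unfolding R(1) by (rule R1[OF add_Hom[OF f g], symmetric])
 also have "... = madd C A (e \<cdot> f) (e \<cdot> g)" by (rule Comp_add[OF f g e])
 also have "... = madd C A (e \<cdot> g) (e \<cdot> f)" unfolding e_def by (rule key) (use t in auto)
 also have "... = e \<cdot> madd C A g f" by (rule Comp_add[OF g f e, symmetric])
 also have "... = madd C A g f" unfolding R(2) by (rule R1[OF add_Hom[OF g f]])
 finally show ?thesis .
qed

text \<open>Precomposing the axiom for the identity with \<open>f\<close> produces the zero
  restricted to the domain of \<open>f\<close>. This restriction can be pulled out of the sum, where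
  it is absorbed because the total zero does not shrink the domain of \<open>f\<close>.\<close>

lemma add_zero:
 assumes f: "f \<in> Hom C Z (mcar A)"
 shows "madd C A f (zmap A Z) = f"
proof -
 let ?A = "mcar A"
 have Z: "Z \<in> Obj C" using Hom_Obj[OF f] by simp
 note z = ptD[OF zero_pt[OF Z]] and zA = ptH[OF zero_pt[OF car_Obj]]
 note I = Ide_Hom[OF car_Obj] and R = Rst_Hom[OF f]
 have "madd C A (Ide C ?A) (zmap A ?A) = Ide C ?A"
  using monoid by (simp add: total_comm_monoid_def Let_def)
 then have "f = f \<cdot> madd C A (Ide C ?A) (zmap A ?A)" using Comp_Ide[OF f] by simp
 also have "... = madd C A f (Rst C f \<cdot> zmap A Z)"
  using Comp_add[OF I zA f] Comp_Ide[OF f] Comp_zero[OF f] by simp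
 also have "... = Rst C f \<cdot> madd C A f (zmap A Z)"
  using Comp_add[OF f z(1) R] R1[OF f] by simp
 also have "Rst C f = Rst C (madd C A f (zmap A Z))"
  using Rst_add[OF f z(1)] z(2) Comp_Ide[OF R] by simp
 also have "... \<cdot> madd C A f (zmap A Z) = madd C A f (zmap A Z)"
  by (rule R1[OF add_Hom[OF f z(1)]])
 finally show ?thesis by simp
qed

lemma hom_monoid: "Z \<in> Obj C ==> comm_monoid (hom_monoid C A Z)"
 unfolding hom_monoid_def
 by (rule comm_monoidI)
  (use add_Hom add_assoc add_comm add_zero ptH[OF zero_pt] in "auto simp: add_comm[OF ptH[OF zero_pt]]")

end

text \<open>The unit is the zero restricted to \<open>e\<close>, since the total zero has a
  different domain unless \<open>e\<close> is the identity.\<close>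

definition ptmon :: "('o, 'm) crcat => ('o, 'm) cmon => 'o => 'm => 'm monoid" where
 "ptmon C A Z e = \<lparr>carrier = mpt C Z e A, monoid.mult = madd C A, one = e \<cdot>\<^bsub>C\<^esub> zero_map C A Z\<rparr>"

lemma hom_monoid_simps [simp]:
 "carrier (hom_monoid C A Z) = Hom C Z (mcar A)"
 "monoid.mult (hom_monoid C A Z) = madd C A"
 "one (hom_monoid C A Z) = zero_map C A Z"
 by (simp_all add: hom_monoid_def)

lemma ptmon_simps [simp]:
 "carrier (ptmon C A Z e) = mpt C Z e A"
 "monoid.mult (ptmon C A Z e) = madd C A"
 "one (ptmon C A Z e) = e \<cdot>\<^bsub>C\<^esub> zero_map C A Z"
 by (simp_all add: ptmon_def)

context crc_monoid
begin

lemma add_zero_pt: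
 assumes f: "f \<in> mpt C Z e A"
 shows "madd C A f (e \<cdot> zmap A Z) = f"
proof -
 have Z: "Z \<in> Obj C" using Hom_Obj[OF ptH[OF f]] by simp
 show ?thesis
  using Comp_add[OF ptH[OF f] ptH[OF zero_pt[OF Z]] pt_idem(1)[OF f]] add_zero[OF ptH[OF f]]
   pt_idem(4)[OF f] by simp
qed

lemma ptmon: "e \<in> pt C Z e Z ==> comm_monoid (ptmon C A Z e)"
proof (rule comm_monoidI)
 assume e: "e \<in> pt C Z e Z"
 have comm: "madd C A f g = madd C A g f" if "f \<in> mpt C Z e A" "g \<in> mpt C Z e A" for f g
  by (rule add_comm[OF ptH[OF that(1)] ptH[OF that(2)]])
 fix x y z assume x: "x \<in> carrier (ptmon C A Z e)" and y: "y \<in> carrier (ptmon C A Z e)"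
  and z: "z \<in> carrier (ptmon C A Z e)"
 show "x \<otimes>\<^bsub>ptmon C A Z e\<^esub> y \<in> carrier (ptmon C A Z e)" using x y add_pt by simp
 show "x \<otimes>\<^bsub>ptmon C A Z e\<^esub> y \<otimes>\<^bsub>ptmon C A Z e\<^esub> z = x \<otimes>\<^bsub>ptmon C A Z e\<^esub> (y \<otimes>\<^bsub>ptmon C A Z e\<^esub> z)"
  using x y z add_assoc_pt by simp
 show "\<one>\<^bsub>ptmon C A Z e\<^esub> \<otimes>\<^bsub>ptmon C A Z e\<^esub> x = x"
  using x comm[OF zero_e_pt[OF e], of x] add_zero_pt[of x] by simp
 show "x \<otimes>\<^bsub>ptmon C A Z e\<^esub> y = y \<otimes>\<^bsub>ptmon C A Z e\<^esub> x" using x y comm by simp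
qed (simp add: zero_e_pt)

text \<open>Precomposition with \<open>u\<close> is a homomorphism from the points with domain
  \<open>e\<close> to those with the domain of \<open>u \<cdot> e\<close>; in particular it takes
  restricted zero to restricted zero.\<close>

lemma Comp_finprod:
 assumes u: "u \<in> Hom C W Z" and e: "e \<in> pt C Z e Z" and t: "!!i. i \<in> I ==> t i \<in> mpt C Z e A"
 shows "u \<cdot> finprod (ptmon C A Z e) t I = finprod (ptmon C A W (Rst C (u \<cdot> e))) (%i. u \<cdot> t i) I"
proof (rule finprod_hom[where h = "%x. u \<cdot> x"])
 have Z: "Z \<in> Obj C" using Hom_Obj[OF ptH[OF e]] by simp
 note ue = precomp_pt[OF u e]
 show "comm_monoid (ptmon C A Z e)" by (rule ptmon[OF e])
 show "comm_monoid (ptmon C A W (Rst C (u \<cdot> e)))" by (rule ptmon[OF pt_idem(5)[OF ue]])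
 show "u \<cdot> \<one>\<^bsub>ptmon C A Z e\<^esub> = \<one>\<^bsub>ptmon C A W (Rst C (u \<cdot> e))\<^esub>"
  using Comp_assoc[OF u ptH[OF e] ptH[OF zero_pt[OF Z]]] Comp_zero[OF ptH[OF ue]] by simp
qed (use precomp_pt[OF u] Comp_add[OF _ _ u] t ptD(1) in auto)

text \<open>The sums in the definitions of composition and of \<delta> start from the total zero,
  those with fixed domain from the restricted one. Either is absorbed by a summand of domain
  \<open>e\<close>, so the two agree as soon as there is a summand.\<close>

lemma msum_eq:
 assumes t: "!!i. i \<in> I ==> t i \<in> mpt C Z e A" and "finite I" "I \<noteq> {}"
 shows "msum C A Z t I = finprod (ptmon C A Z e) t I"
 using assms(2,3,1) unfolding msum_def
proof (induction I rule: finite_ne_induct)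
 case (singleton i)
 then have i: "t i \<in> mpt C Z e A" by simp
 interpret H: comm_monoid "hom_monoid C A Z"
  using hom_monoid Hom_Obj[OF ptH[OF i]] by simp
 interpret P: comm_monoid "ptmon C A Z e"
  using ptmon[OF pt_idem(5)[OF i]] by simp
 have "t i \<in> Hom C Z (mcar A)" using ptH[OF i] .
 then have "finprod (hom_monoid C A Z) t {i} = t i"
  using H.finprod_insert[of "{}" i t] H.finprod_empty[of t] by (simp add: add_zero)
 moreover have "finprod (ptmon C A Z e) t {i} = t i"
  using P.finprod_insert[of "{}" i t] P.finprod_empty[of t] i by (simp add: add_zero_pt)
 ultimately show ?case by simp
next
 case (insert i I)
 then have i: "t i \<in> mpt C Z e A" by simp
 interpret H: comm_monoid "hom_monoid C A Z"
  using hom_monoid Hom_Obj[OF ptH[OF i]] by simp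
 interpret P: comm_monoid "ptmon C A Z e"
  using ptmon[OF pt_idem(5)[OF i]] by simp
 have "finprod (hom_monoid C A Z) t (insert i I) = madd C A (t i) (finprod (hom_monoid C A Z) t I)"
  using insert by (subst H.finprod_insert) (auto intro: ptD(1))
 also have "... = finprod (ptmon C A Z e) t (insert i I)"
  using insert by (subst P.finprod_insert) auto
 finally show ?case .
qed

end

section \<open>Arrows of \<open>Faa(C)\<close> acting on points\<close>

context restriction_category
begin

lemma idem_comm_monoid:
 assumes "Z \<in> Obj C"
 shows "comm_monoid \<lparr>carrier = {e. e \<in> pt C Z e Z}, monoid.mult = (\<cdot>), one = Ide C Z\<rparr>"
proof (rule comm_monoidI; simp)
 fix d e h assume e: "d \<in> pt C Z d Z" "e \<in> pt C Z e Z" "h \<in> pt C Z h Z"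
 show "d \<cdot> e \<in> pt C Z (d \<cdot> e) Z" "d \<cdot> e = e \<cdot> d" using idem_comp[OF e(1,2)] by auto
 show "Ide C Z \<cdot> d = d" by (rule Ide_Comp[OF ptH[OF e(1)]])
 show "d \<cdot> e \<cdot> h = d \<cdot> (e \<cdot> h)"
  by (rule Comp_assoc[OF ptH[OF e(1)] ptH[OF e(2)] ptH[OF e(3)]])
qed (use Ide_pt assms in auto)

text \<open>In the order of the semilattice: from \<open>p\<close> below \<open>a \<cdot> r\<close>
  and \<open>q\<close> below \<open>b \<cdot> r\<close> follows that \<open>p \<cdot> q\<close> lies
  below \<open>a \<cdot> (b \<cdot> r)\<close>. This is the comparison of domains for a sum of two
  values whose arguments have different domains.\<close>

lemma idem_absorb:
 assumes idem: "a \<in> pt C Z a Z" "b \<in> pt C Z b Z" "r \<in> pt C Z r Z" "p \<in> pt C Z p Z" "q \<in> pt C Z q Z"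
  and p: "(a \<cdot> r) \<cdot> p = p" and q: "(b \<cdot> r) \<cdot> q = q"
 shows "(a \<cdot> (b \<cdot> r)) \<cdot> (p \<cdot> q) = p \<cdot> q"
proof -
 have Z: "Z \<in> Obj C" using Hom_Obj[OF ptH[OF idem(1)]] by simp
 interpret I: comm_monoid "\<lparr>carrier = {e. e \<in> pt C Z e Z}, monoid.mult = (\<cdot>), one = Ide C Z\<rparr>"
  by (rule idem_comm_monoid[OF Z])
 have closed: "x \<cdot> y \<in> pt C Z (x \<cdot> y) Z" if "x \<in> pt C Z x Z" "y \<in> pt C Z y Z" for x y
  by (rule idem_comp(1)[OF that])
 have assoc: "(x \<cdot> y) \<cdot> z = x \<cdot> (y \<cdot> z)" if "x \<in> pt C Z x Z" "y \<in> pt C Z y Z" "z \<in> pt C Z z Z" for x y z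
  using I.m_assoc[of x y z] that by simp
 have comm: "x \<cdot> y = y \<cdot> x" if "x \<in> pt C Z x Z" "y \<in> pt C Z y Z" for x y
  by (rule idem_comp(2)[OF that])
 have lcomm: "x \<cdot> (y \<cdot> z) = y \<cdot> (x \<cdot> z)" if "x \<in> pt C Z x Z" "y \<in> pt C Z y Z" "z \<in> pt C Z z Z" for x y z
  using I.m_lcomm[of x y z] that by simp
 have lidem: "x \<cdot> (x \<cdot> y) = x \<cdot> y" if "x \<in> pt C Z x Z" "y \<in> pt C Z y Z" for x y
  using assoc[OF that(1) that] pt_idem(3)[OF that(1)] by simp
 have "(a \<cdot> (b \<cdot> r)) \<cdot> (p \<cdot> q) = (a \<cdot> (b \<cdot> r)) \<cdot> (((a \<cdot> r) \<cdot> p) \<cdot> ((b \<cdot> r) \<cdot> q))" unfolding p q ..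
 also have "... = ((a \<cdot> r) \<cdot> p) \<cdot> ((b \<cdot> r) \<cdot> q)"
  by (simp only: assoc comm lcomm lidem closed idem)
 finally show ?thesis unfolding p q .
qed

lemma Rst_Comp_le:
 assumes "f \<in> Hom C X Y" "g \<in> Hom C Y Z"
 shows "Rst C f \<cdot> Rst C (f \<cdot> g) = Rst C (f \<cdot> g)"
 using R3[OF assms(1) Comp_Hom[OF assms]] Comp_assoc[OF Rst_Hom[OF assms(1)] assms] R1[OF assms(1)] by simp

end

section \<open>Testing arrows on points with a common domain\<close>

context cartesian_restriction_category
begin

text \<open>More entries can only shrink the domain. The comparison depends on which entries occur,
  not on their order, so permuting a tuple preserves its domain.\<close>

lemma Rst_tup_mono:
 assumes zs: "set zs \<subseteq> Hom C Z A" "set zs' \<subseteq> set zs" and x: "x \<in> Hom C Z X"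
 shows "Rst C (tup zs x) \<cdot> Rst C (tup zs' x) = Rst C (tup zs x)"
proof -
 let ?e = "Rst C (tup zs x)"
 note t = tup_homogeneous[OF zs(1) x]
 have zs': "set zs' \<subseteq> Hom C Z A" using zs by auto
 have "tup (map (%z. ?e \<cdot> z) zs') (?e \<cdot> x) \<in> pt C Z ?e (powp A (length (map (%z. ?e \<cdot> z) zs')) X)"
  by (rule tup_pt(1)) (use t(2,3) zs in auto)
 then have "Rst C (?e \<cdot> tup zs' x) = ?e"
  using Comp_tup[OF ptH[OF t(4)] zs' x] ptD(2) by simp
 then show ?thesis
  using R3[OF tup_Hom[OF zs(1) x] tup_Hom[OF zs' x]] by simp
qed

lemma tup_restrict_perm:
 assumes "set zs \<subseteq> Hom C Z A" "mset zs' = mset zs" "x \<in> Hom C Z X"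
 shows "Rst C (tup zs' x) = Rst C (tup zs x)"
proof -
 have s: "set zs' = set zs" using assms(2) by (metis set_mset_mset)
 show ?thesis
  using Rst_tup_mono[OF assms(1) _ assms(3), of zs'] Rst_tup_mono[OF _ _ assms(3), of zs' A zs] s assms(1)
   R2[OF tup_Hom[OF assms(1,3)] tup_Hom[OF _ assms(3)], of zs' A] by simp
qed

text \<open>An introduction rule that asks for symmetry and additivity only at points with one
  common domain, and for additivity only in the first slot. \<open>tup_homogeneous\<close> supplies
  the common domain, and symmetry moves any slot to the front.\<close>

lemma faa_ArrI:
 assumes A: "tcm C A" and B: "tcm C B" and X: "X \<in> Obj C" and f0: "f 0 \<in> Hom C X Y"
  and f: "!!n. n \<ge> 1 ==> f n \<in> Hom C (powp (mcar A) n X) (mcar B)"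
   "!!n. n \<ge> 1 ==> Rst C (f n) = Rst C (proj C (mcar A) n X n \<cdot> f 0)"
  and sym: "!!Z e zs zs' x. zs \<noteq> [] ==> set zs \<subseteq> mpt C Z e A ==> x \<in> pt C Z e X ==> mset zs' = mset zs ==>
   tup zs' x \<cdot> f (length zs) = tup zs x \<cdot> f (length zs)"
  and add: "!!Z e zs x a b. set zs \<subseteq> mpt C Z e A ==> x \<in> pt C Z e X ==> a \<in> mpt C Z e A ==>
   b \<in> mpt C Z e A ==> tup (madd C A a b # zs) x \<cdot> f (Suc (length zs)) =
    madd C B (tup (a # zs) x \<cdot> f (Suc (length zs))) (tup (b # zs) x \<cdot> f (Suc (length zs)))"
  and zero: "!!Z e zs x. set zs \<subseteq> mpt C Z e A ==> x \<in> pt C Z e X ==>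
   tup (e \<cdot> zmap A Z # zs) x \<cdot> f (Suc (length zs)) = Rst C (x \<cdot> f 0) \<cdot> zmap B Z"
 shows "FaaArr (A, X) (B, Y) f \<in> faa_Arr C"
proof -
 interpret A: crc_monoid C A by unfold_locales (rule A)
 interpret B: crc_monoid C B by unfold_locales (rule B)
 let ?A = "mcar A"
 have sym': "tup zs' x \<cdot> f (length zs) = tup zs x \<cdot> f (length zs)"
  if zs: "zs \<noteq> []" "set zs \<subseteq> Hom C Z ?A" and x: "x \<in> Hom C Z X" and m: "mset zs' = mset zs" for Z zs zs' x
 proof -
  note t = tup_homogeneous[OF zs(2) x]
  have zs': "set zs' \<subseteq> Hom C Z ?A" using zs m by (metis set_mset_mset)
  note t' = tup_homogeneous[OF zs' x]
  let ?e = "Rst C (tup zs x)"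
  have "tup (map (%z. ?e \<cdot> z) zs') (?e \<cdot> x) \<cdot> f (length (map (%z. ?e \<cdot> z) zs)) =
    tup (map (%z. ?e \<cdot> z) zs) (?e \<cdot> x) \<cdot> f (length (map (%z. ?e \<cdot> z) zs))"
   by (rule sym) (use t(2,3) zs m in auto)
  then show ?thesis using t(1) t'(1) tup_restrict_perm[OF zs(2) m x] by simp
 qed
 have front: "tup (zs[i := c]) x \<cdot> f (length zs) = tup (c # take i zs @ drop (Suc i) zs) x \<cdot> f (length zs)"
  if "i < length zs" "set zs \<subseteq> Hom C Z ?A" "c \<in> Hom C Z ?A" "x \<in> Hom C Z X" for Z zs i c x
 proof -
  have "set (c # take i zs @ drop (Suc i) zs) \<subseteq> Hom C Z ?A"
   using that set_take_subset[of i zs] set_drop_subset[of "Suc i" zs] by auto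
  moreover have "mset (zs[i := c]) = mset (c # take i zs @ drop (Suc i) zs)"
   using that(1) by (simp add: upd_conv_take_nth_drop)
  moreover have l: "length (c # take i zs @ drop (Suc i) zs) = length zs" using that(1) by simp
  ultimately show ?thesis
   using sym'[of "c # take i zs @ drop (Suc i) zs" Z x "zs[i := c]"] that l by (simp del: list.size length_append)
 qed
 \<comment> \<open>If \<open>a\<close> and \<open>b\<close> have different domains, everything is
   cut down to \<open>e\<close>, the domain of the tuple containing both. By \<open>le\<close>
   below, the sum of the two values is defined only within \<open>e\<close>, so nothing is lost on
   the right-hand side.\<close>
 have add': "tup (madd C A a b # zs) x \<cdot> f (Suc (length zs)) =
    madd C B (tup (a # zs) x \<cdot> f (Suc (length zs))) (tup (b # zs) x \<cdot> f (Suc (length zs)))"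
  if zs: "set zs \<subseteq> Hom C Z ?A" and x: "x \<in> Hom C Z X" and a: "a \<in> Hom C Z ?A" and b: "b \<in> Hom C Z ?A" for Z zs x a b
 proof -
  have Z: "Z \<in> Obj C" using Hom_Obj[OF x] by simp
  have ri: "Rst C g \<in> pt C Z (Rst C g) Z" if "g \<in> Hom C Z W" for g W
   using pt_idem(5)[OF ptI[OF that refl]] .
  let ?h = "f (Suc (length zs))"
  have h: "?h \<in> Hom C (powp ?A (Suc (length zs)) X) (mcar B)" using f(1)[of "Suc (length zs)"] by simp
  have abz: "set (a # b # zs) \<subseteq> Hom C Z ?A" and az: "set (a # zs) \<subseteq> Hom C Z ?A" and bz: "set (b # zs) \<subseteq> Hom C Z ?A"
   and sz: "set (madd C A a b # zs) \<subseteq> Hom C Z ?A"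
   using a b zs A.add_Hom by auto
  note t = tup_homogeneous[OF abz x]
  define e where "e = Rst C (tup (a # b # zs) x)"
  have e: "e \<in> Hom C Z Z" using ptH[OF t(4)] e_def by simp
  have tz: "tup zs x \<in> Hom C Z (powp ?A (length zs) X)" by (rule tup_Hom[OF zs x])
  have ta: "tup (a # zs) x \<in> Hom C Z (powp ?A (Suc (length zs)) X)"
   and tb: "tup (b # zs) x \<in> Hom C Z (powp ?A (Suc (length zs)) X)"
   and ts: "tup (madd C A a b # zs) x \<in> Hom C Z (powp ?A (Suc (length zs)) X)"
   using tup_Hom[OF az x] tup_Hom[OF bz x] tup_Hom[OF sz x] by auto
  let ?P = "tup (a # zs) x \<cdot> ?h" and ?Q = "tup (b # zs) x \<cdot> ?h"
  have P: "?P \<in> Hom C Z (mcar B)" and Q: "?Q \<in> Hom C Z (mcar B)"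
   using Comp_Hom[OF ta h] Comp_Hom[OF tb h] by auto
  define ra rb rz rp rq where r: "ra = Rst C a" "rb = Rst C b" "rz = Rst C (tup zs x)" "rp = Rst C ?P" "rq = Rst C ?Q"
  have idem: "ra \<in> pt C Z ra Z" "rb \<in> pt C Z rb Z" "rz \<in> pt C Z rz Z" "rp \<in> pt C Z rp Z" "rq \<in> pt C Z rq Z"
   unfolding r using ri[OF a] ri[OF b] ri[OF tz] ri[OF P] ri[OF Q] by auto
  have e1: "e = ra \<cdot> (rb \<cdot> rz)"
   using Rst_Pairing[OF a Pairing_Hom[OF b tz]] Rst_Pairing[OF b tz] by (simp add: e_def r)
  have e2: "Rst C (tup (madd C A a b # zs) x) = e"
   using Rst_Pairing[OF A.add_Hom[OF a b] tz] A.Rst_add[OF a b] e1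
    Comp_assoc[OF Rst_Hom[OF a] Rst_Hom[OF b] Rst_Hom[OF tz]] by (simp add: r)
  have p: "(ra \<cdot> rz) \<cdot> rp = rp" and q: "(rb \<cdot> rz) \<cdot> rq = rq"
   using Rst_Comp_le[OF ta h] Rst_Comp_le[OF tb h] Rst_Pairing[OF a tz] Rst_Pairing[OF b tz]
   unfolding r by simp_all
  have le: "e \<cdot> (rp \<cdot> rq) = rp \<cdot> rq" unfolding e1 by (rule idem_absorb[OF idem p q])
  have "e \<cdot> madd C B ?P ?Q = e \<cdot> (Rst C (madd C B ?P ?Q) \<cdot> madd C B ?P ?Q)"
   using R1[OF B.add_Hom[OF P Q]] by simp
  also have "... = e \<cdot> (rp \<cdot> rq) \<cdot> madd C B ?P ?Q"
   using Comp_assoc[OF e Rst_Hom[OF B.add_Hom[OF P Q]] B.add_Hom[OF P Q]] B.Rst_add[OF P Q] by (simp add: r)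
  also have "... = madd C B ?P ?Q"
   using le R1[OF B.add_Hom[OF P Q]] B.Rst_add[OF P Q] by (simp add: r)
  finally have rhs: "madd C B ?P ?Q = madd C B (e \<cdot> ?P) (e \<cdot> ?Q)" using B.Comp_add[OF P Q e] by simp
  have "tup (madd C A a b # zs) x = e \<cdot> tup (madd C A a b # zs) x" using R1[OF ts] e2 by simp
  also have "... = tup (madd C A (e \<cdot> a) (e \<cdot> b) # map (%z. e \<cdot> z) zs) (e \<cdot> x)"
   using Comp_tup[OF e sz x] A.Comp_add[OF a b e] by simp
  finally have "tup (madd C A a b # zs) x \<cdot> ?h =
    tup (madd C A (e \<cdot> a) (e \<cdot> b) # map (%z. e \<cdot> z) zs) (e \<cdot> x) \<cdot> f (Suc (length (map (%z. e \<cdot> z) zs)))" by simp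
  also have "... = madd C B (tup ((e \<cdot> a) # map (%z. e \<cdot> z) zs) (e \<cdot> x) \<cdot> ?h) (tup ((e \<cdot> b) # map (%z. e \<cdot> z) zs) (e \<cdot> x) \<cdot> ?h)"
   by (subst add[where Z = Z and e = e]) (use t(2,3) in "auto simp: e_def")
  also have "... = madd C B (e \<cdot> ?P) (e \<cdot> ?Q)"
   using Comp_tup[OF e az x] Comp_tup[OF e bz x] Comp_assoc[OF e ta h] Comp_assoc[OF e tb h] by simp
  finally show ?thesis using rhs by simp
 qed
 have zero': "tup (zmap A Z # zs) x \<cdot> f (Suc (length zs)) =
   Rst C (tup (zmap A Z # zs) x \<cdot> f (Suc (length zs))) \<cdot> zmap B Z"
  if zs: "set zs \<subseteq> Hom C Z ?A" and x: "x \<in> Hom C Z X" for Z zs x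
 proof -
  have Z: "Z \<in> Obj C" using Hom_Obj[OF x] by simp
  note z = ptD[OF A.zero_pt[OF Z]]
  note t = tup_homogeneous[OF zs x]
  define e where "e = Rst C (tup zs x)"
  have e: "e \<in> Hom C Z Z" using ptH[OF t(4)] e_def by simp
  have tz: "tup zs x \<in> Hom C Z (powp ?A (length zs) X)" by (rule tup_Hom[OF zs x])
  have sz: "set (zmap A Z # zs) \<subseteq> Hom C Z ?A" using zs z by simp
  have "Rst C (tup (zmap A Z # zs) x) = e"
   using Rst_Pairing[OF z(1) tz] z(2) Ide_Comp[OF Rst_Hom[OF tz]] by (simp add: e_def)
  then have "tup (zmap A Z # zs) x = e \<cdot> tup (zmap A Z # zs) x"
   using R1[OF tup_Hom[OF sz x]] by simp
  also have "... = tup (e \<cdot> zmap A Z # map (%z. e \<cdot> z) zs) (e \<cdot> x)"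
   using Comp_tup[OF e sz x] by simp
  finally have "tup (zmap A Z # zs) x \<cdot> f (Suc (length zs)) =
    tup (e \<cdot> zmap A Z # map (%z. e \<cdot> z) zs) (e \<cdot> x) \<cdot> f (Suc (length (map (%z. e \<cdot> z) zs)))" by simp
  also have "... = Rst C ((e \<cdot> x) \<cdot> f 0) \<cdot> zmap B Z"
   by (rule zero) (use t(2,3) in "auto simp: e_def")
  finally have eq: "tup (zmap A Z # zs) x \<cdot> f (Suc (length zs)) = Rst C ((e \<cdot> x) \<cdot> f 0) \<cdot> zmap B Z" .
  have ex: "(e \<cdot> x) \<cdot> f 0 \<in> Hom C Z Y" using Comp_Hom[OF Comp_Hom[OF e x] f0] .
  have "Rst C (Rst C ((e \<cdot> x) \<cdot> f 0) \<cdot> zmap B Z) = Rst C ((e \<cdot> x) \<cdot> f 0)"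
   using Rst_Comp_total[OF Rst_Hom[OF ex] B.zero_pt[OF Z]] Rst_Rst[OF ex] by simp
  then show ?thesis using eq by simp
 qed
 have "symmetric_map C A n X (f n)" if "n \<ge> 1" for n
  unfolding symmetric_map_def apply_map_tup
 proof (intro ballI allI impI, elim conjE)
  fix Z zs x \<sigma> assume "length zs = n" "set zs \<subseteq> Hom C Z ?A" "x \<in> Hom C Z X" "\<sigma> permutes {..<n}"
  then show "tup (permute_list \<sigma> zs) x \<cdot> f n = tup zs x \<cdot> f n"
   using sym'[of zs Z x "permute_list \<sigma> zs"] that by (cases "zs = []") auto
 qed
 moreover have "additive_map C A n X B (f n)" for n
  unfolding additive_map_def apply_map_tup
 proof (intro ballI allI impI, elim conjE, intro conjI ballI)
  fix Z zs x i assume Z: "Z \<in> Obj C" and n: "length zs = n" and zs: "set zs \<subseteq> Hom C Z ?A" and x: "x \<in> Hom C Z X" and i: "i < n"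
  let ?zs = "take i zs @ drop (Suc i) zs"
  have zs': "set ?zs \<subseteq> Hom C Z ?A" using zs by (auto dest: in_set_takeD in_set_dropD)
  have l: "Suc (length ?zs) = n" "i < length zs" using i n by auto
  note fr = front[OF l(2) zs _ x, unfolded n]
  show "tup (zs[i := zmap A Z]) x \<cdot> f n = Rst C (tup (zs[i := zmap A Z]) x \<cdot> f n) \<cdot> zmap B Z"
   using zero'[OF zs' x] l fr[OF ptH[OF A.zero_pt[OF Z]]] by simp
  fix a b assume "a \<in> Hom C Z ?A" "b \<in> Hom C Z ?A"
  then show "tup (zs[i := madd C A a b]) x \<cdot> f n = madd C B (tup (zs[i := a]) x \<cdot> f n) (tup (zs[i := b]) x \<cdot> f n)"
   using add'[OF zs' x] l fr[of "madd C A a b"] fr[of a] fr[of b] A.add_Hom by simp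
 qed
 ultimately show ?thesis
  using A B X Hom_Obj(2)[OF f0] f0 f by (auto simp: faa_Arr_def faa_Obj_def)
qed

end

text \<open>By symmetry, on points with a common domain of definition the choice of \<open>zs\<close> is immaterial.\<close>

definition papp :: "('o, 'm) crcat => ('o, 'm) faa_arr => 'm => 'm multiset => 'm" where
 "papp C F x M = apply_map C (faa_seq F (size M)) (SOME zs. mset zs = M) x"

locale faa_arrow = cartesian_restriction_category C
 for C :: "('o, 'm) crcat" (structure) +
 fixes F :: "('o, 'm) faa_arr" and A :: "('o, 'm) cmon" and X :: 'o and B :: "('o, 'm) cmon" and Y :: 'o
 assumes arr: "F \<in> Hom (Faa C) (A, X) (B, Y)"
begin

abbreviation "f \<equiv> faa_seq F"

lemma F_eq: "F = FaaArr (A, X) (B, Y) f" and in_Arr: "F \<in> faa_Arr C" "faa_src F = (A, X)" "faa_tgt F = (B, Y)"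
 using arr by (cases F, auto simp: Hom_def Faa_def)+

lemma objs: "tcm C A" "X \<in> Obj C" "tcm C B" "Y \<in> Obj C"
 and f0: "f 0 \<in> Hom C X Y"
 and fn: "n \<ge> 1 ==> f n \<in> Hom C (powp (mcar A) n X) (mcar B)"
  "n \<ge> 1 ==> Rst C (f n) = Rst C (proj C (mcar A) n X n \<cdot> f 0)"
 and fn_sym: "n \<ge> 1 ==> symmetric_map C A n X (f n)"
 and fn_add: "n \<ge> 1 ==> additive_map C A n X B (f n)"
 using in_Arr(1) in_Arr(2,3) by (auto simp: faa_Arr_def faa_Obj_def)

sublocale A: crc_monoid C A by unfold_locales (rule objs)
sublocale B: crc_monoid C B by unfold_locales (rule objs)

lemma f0_pt: "x \<in> pt C Z e X ==> x \<cdot> f 0 \<in> pt C Z (Rst C (x \<cdot> f 0)) Y"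
 using Comp_Hom[OF ptD(1) f0] by (auto intro: ptI)

lemma dom_idem: "x \<in> Hom C Z X ==> Rst C (x \<cdot> f 0) \<in> pt C Z (Rst C (x \<cdot> f 0)) Z"
 using pt_idem(5)[OF ptI[OF Comp_Hom[OF _ f0] refl]] .

text \<open>By the restriction condition, \<open>f n\<close> is defined where its last projection
  followed by \<open>f 0\<close> is; at a tuple with common domain this depends on \<open>x\<close>
  alone. Hence the values over \<open>x\<close>, whatever the linear arguments and the arity, share
  one domain.\<close>

lemma tup_f_pt:
 assumes "zs \<noteq> []" "set zs \<subseteq> mpt C Z e A" "x \<in> pt C Z e X"
 shows "tup zs x \<cdot> f (length zs) \<in> mpt C Z (Rst C (x \<cdot> f 0)) B"
proof -
 let ?n = "length zs" and ?u = "tup zs x"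
 let ?p = "proj C (mcar A) ?n X ?n"
 have n: "?n \<ge> 1" using assms(1) by (cases zs) auto
 note t = tup_pt[OF assms(2,3)] and p = ptH[OF proj_pt(2)[OF A.car_Obj objs(2)]]
 note u = ptH[OF t(1)]
 show ?thesis
 proof (rule ptI)
  show "?u \<cdot> f ?n \<in> Hom C Z (mcar B)" by (rule Comp_Hom[OF u fn(1)[OF n]])
  have "Rst C (?u \<cdot> f ?n) = Rst C (?u \<cdot> Rst C (?p \<cdot> f 0))"
   using Rst_Comp[OF u fn(1)[OF n]] fn(2)[OF n] by simp
  also have "... = Rst C (?u \<cdot> ?p \<cdot> f 0)"
   using Rst_Comp[OF u Comp_Hom[OF p f0]] Comp_assoc[OF u p f0] by simp
  finally show "Rst C (?u \<cdot> f ?n) = Rst C (x \<cdot> f 0)" using t(3) by simp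
 qed
qed

lemma tup_f_perm:
 assumes "zs \<noteq> []" "set zs \<subseteq> mpt C Z e A" "x \<in> pt C Z e X" "mset zs' = mset zs"
 shows "tup zs' x \<cdot> f (length zs) = tup zs x \<cdot> f (length zs)"
proof -
 obtain p where p: "p permutes {..<length zs}" "permute_list p zs = zs'"
  using mset_eq_permutation[OF assms(4)] by blast
 have n: "length zs \<ge> 1" using assms(1) by (cases zs) auto
 have "set zs \<subseteq> Hom C Z (mcar A)" using assms(2) ptD(1) by auto
 then show ?thesis
  using fn_sym[OF n] p ptH[OF assms(3)] Hom_Obj(1)[OF ptH[OF assms(3)]]
  by (auto simp: symmetric_map_def apply_map_tup)
qed

lemma tup_f_add:
 assumes "set zs \<subseteq> mpt C Z e A" "x \<in> pt C Z e X" "a \<in> mpt C Z e A" "b \<in> mpt C Z e A"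
 shows "tup (madd C A a b # zs) x \<cdot> f (Suc (length zs)) =
  madd C B (tup (a # zs) x \<cdot> f (Suc (length zs))) (tup (b # zs) x \<cdot> f (Suc (length zs)))"
proof -
 have "set (a # zs) \<subseteq> Hom C Z (mcar A)" "length (a # zs) = Suc (length zs)" using assms ptD(1) by auto
 then have "apply_map C (f (Suc (length zs))) ((a # zs)[0 := madd C A a b]) x =
   madd C B (apply_map C (f (Suc (length zs))) ((a # zs)[0 := a]) x) (apply_map C (f (Suc (length zs))) ((a # zs)[0 := b]) x)"
  using fn_add[of "Suc (length zs)"] ptH[OF assms(2)] ptH[OF assms(3)] ptH[OF assms(4)] Hom_Obj(1)[OF ptH[OF assms(2)]]
  unfolding additive_map_def by (metis le_add1 plus_1_eq_Suc zero_less_Suc)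
 then show ?thesis by (simp add: apply_map_tup)
qed

text \<open>The definition of additivity inserts the total zero and yields a zero restricted to an
  unspecified domain. Precomposing with \<open>e\<close> inserts the restricted zero instead, and
  \<open>tup_f_pt\<close> identifies the domain of the result.\<close>

lemma tup_f_zero:
 assumes "set zs \<subseteq> mpt C Z e A" "x \<in> pt C Z e X"
 shows "tup (e \<cdot> zmap A Z # zs) x \<cdot> f (Suc (length zs)) = Rst C (x \<cdot> f 0) \<cdot> zmap B Z"
proof -
 let ?f = "f (Suc (length zs))" and ?z = "e \<cdot> zmap A Z"
 note x = ptD[OF assms(2)] and e = pt_idem[OF assms(2)]
 have Z: "Z \<in> Obj C" using Hom_Obj(1)[OF x(1)] .
 note z = A.zero_pt[OF Z]
 have zs': "set (zmap A Z # zs) \<subseteq> Hom C Z (mcar A)" using assms ptD(1) ptH[OF z] by auto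
 have zs: "set (?z # zs) \<subseteq> mpt C Z e A" using assms A.zero_e_pt[OF e(5)] by simp
 have "map (%z. e \<cdot> z) zs = zs" by (rule map_idI) (use assms(1) in "auto intro: pt_idem(4)")
 then have "tup (?z # zs) x = e \<cdot> tup (zmap A Z # zs) x"
  using Comp_tup[OF e(1) zs' x(1)] e(4) by simp
 have "set (?z # zs) \<subseteq> Hom C Z (mcar A)" "length (?z # zs) = Suc (length zs)" using zs ptD(1) by auto
 then have "apply_map C ?f ((?z # zs)[0 := zmap A Z]) x =
   Rst C (apply_map C ?f ((?z # zs)[0 := zmap A Z]) x) \<cdot> zmap B Z"
  using fn_add[of "Suc (length zs)"] x(1) Z unfolding additive_map_def by (metis le_add1 plus_1_eq_Suc zero_less_Suc)
 then have *: "tup (zmap A Z # zs) x \<cdot> ?f = Rst C (tup (zmap A Z # zs) x \<cdot> ?f) \<cdot> zmap B Z"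
  by (simp add: apply_map_tup)
 let ?t = "tup (zmap A Z # zs) x"
 have t: "?t \<in> Hom C Z (powp (mcar A) (Suc (length zs)) X)" using tup_Hom[OF zs' x(1)] by simp
 have f: "?f \<in> Hom C (powp (mcar A) (Suc (length zs)) X) (mcar B)" using fn(1)[of "Suc (length zs)"] by simp
 note tf = Comp_Hom[OF t f]
 have "tup (?z # zs) x \<cdot> ?f = e \<cdot> (?t \<cdot> ?f)"
  using \<open>tup (?z # zs) x = _\<close> Comp_assoc[OF e(1) t f] by simp
 also have "... = e \<cdot> Rst C (?t \<cdot> ?f) \<cdot> zmap B Z"
  using * Comp_assoc[OF e(1) Rst_Hom[OF tf] ptH[OF B.zero_pt[OF Z]]] by simp
 also have "e \<cdot> Rst C (?t \<cdot> ?f) = Rst C (e \<cdot> (?t \<cdot> ?f))"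
  using R3[OF x(1) tf] x(2) by simp
 also have "e \<cdot> (?t \<cdot> ?f) = tup (?z # zs) x \<cdot> ?f"
  using \<open>tup (?z # zs) x = _\<close> Comp_assoc[OF e(1) t f] by simp
 also have "Rst C (tup (?z # zs) x \<cdot> ?f) = Rst C (x \<cdot> f 0)"
  using ptD(2)[OF tup_f_pt[OF _ zs assms(2)]] by simp
 finally show ?thesis .
qed

lemma papp_mset:
 assumes "set zs \<subseteq> mpt C Z e A" "x \<in> pt C Z e X"
 shows "papp C F x (mset zs) = tup zs x \<cdot> f (length zs)"
proof (cases "zs = []")
 case False
 have "mset (SOME zs'. mset zs' = mset zs) = mset zs" by (rule someI_ex) auto
 from tup_f_perm[OF False assms this] show ?thesis
  by (simp add: papp_def apply_map_tup)
qed (simp add: papp_def apply_map_tup)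

lemma papp_empty: "papp C F x {#} = x \<cdot> f 0"
 by (simp add: papp_def apply_map_tup)

text \<open>The gain from fixing domains: over a base point \<open>x\<close>, the components of all
  arities form a symmetric multiadditive family between two commutative monoids in the ordinary
  sense.\<close>

lemma symadd:
 assumes x: "x \<in> pt C Z e X"
 shows "symadd (ptmon C A Z e) (ptmon C B Z (Rst C (x \<cdot> f 0))) (papp C F x)"
proof (intro symadd.intro symadd_axioms.intro)
 show "comm_monoid (ptmon C A Z e)" by (rule A.ptmon[OF pt_idem(5)[OF x]])
 show "comm_monoid (ptmon C B Z (Rst C (x \<cdot> f 0)))" by (rule B.ptmon[OF dom_idem[OF ptH[OF x]]])
 fix M assume M: "set_mset M \<subseteq> carrier (ptmon C A Z e)"
 obtain zs where zs: "mset zs = M" using ex_mset by blast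
 have zs': "set zs \<subseteq> mpt C Z e A" using M zs by auto
 show "papp C F x M \<in> carrier (ptmon C B Z (Rst C (x \<cdot> f 0)))" if "M \<noteq> {#}"
  using tup_f_pt[OF _ zs' x] papp_mset[OF zs' x] zs that by auto
 have *: "papp C F x (add_mset a M) = tup (a # zs) x \<cdot> f (Suc (length zs))" if "a \<in> mpt C Z e A" for a
  using papp_mset[of "a # zs" Z e x] zs zs' x that by simp
 show "papp C F x (add_mset (a \<otimes>\<^bsub>ptmon C A Z e\<^esub> b) M) =
   papp C F x (add_mset a M) \<otimes>\<^bsub>ptmon C B Z (Rst C (x \<cdot> f 0))\<^esub> papp C F x (add_mset b M)"
  if "a \<in> carrier (ptmon C A Z e)" "b \<in> carrier (ptmon C A Z e)" for a b
  using that tup_f_add[OF zs' x] * A.add_pt by simp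
 show "papp C F x (add_mset \<one>\<^bsub>ptmon C A Z e\<^esub> M) = \<one>\<^bsub>ptmon C B Z (Rst C (x \<cdot> f 0))\<^esub>"
  using tup_f_zero[OF zs' x] * A.zero_e_pt[OF pt_idem(5)[OF x]] by simp
qed

end

section \<open>Arrows of \<open>Faa(C)\<close> acting on cubes\<close>

text \<open>A cube is a point of \<open>X\<close> together with \<open>A\<close>-valued coefficients of the square-free monomials in
 infinitesimal variables, i.e. a point of an iterated tangent object. The Faa di Bruno composite is
 characterised by acting on cubes as the composite of the actions.\<close>

definition cube :: "('o, 'm) crcat => 'o => 'm => ('o, 'm) faa_obj => ('i set => 'm) => bool" where
 "cube C Z e S c \<longleftrightarrow> c {} \<in> pt C Z e (snd S) \<and> (\<forall>J. J \<noteq> {} \<longrightarrow> c J \<in> pt C Z e (mcar (fst S)))"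

text \<open>The stage \<open>Z\<close> and the domain of the values are read off from the base
  point, so that only the arrow and the cube are arguments. The case \<open>J = {}\<close> is
  separate because its value lies in \<open>Y\<close>.\<close>

definition ev :: "('o, 'm) crcat => ('o, 'm) faa_arr => ('i set => 'm) => 'i set => 'm" where
 "ev C F c J = (if J = {} then c {} \<cdot>\<^bsub>C\<^esub> faa_seq F 0
   else pev (ptmon C (fst (faa_tgt F)) (Dom C (c {})) (Rst C (c {} \<cdot>\<^bsub>C\<^esub> faa_seq F 0))) (papp C F (c {})) c J)"

text \<open>The cube over \<open>x\<close> whose only nonzero coefficients are the linear ones,
  \<open>c i\<close> for \<open>i\<close> in \<open>S\<close>. Its evaluation at the whole of
  \<open>S\<close> picks out the single component of arity \<open>card S\<close>.\<close>

definition pcube :: "('o, 'm) crcat => ('o, 'm) cmon => 'o => 'm => 'i set => ('i => 'm) => 'm => 'i set => 'm" where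
 "pcube C A Z e S c x J = (if J = {} then x else if \<exists>i\<in>S. J = {i} then c (the_elem J) else e \<cdot>\<^bsub>C\<^esub> zero_map C A Z)"

lemma pcube_simps [simp]:
 "pcube C A Z e S c x {} = x"
 "i \<in> S ==> pcube C A Z e S c x {i} = c i"
 "J \<noteq> {} ==> \<not> (\<exists>i\<in>S. J = {i}) ==> pcube C A Z e S c x J = e \<cdot>\<^bsub>C\<^esub> zero_map C A Z"
 by (auto simp: pcube_def)

lemma cubeD:
 assumes "cube C Z e S c"
 shows "c {} \<in> pt C Z e (snd S)" "J \<noteq> {} ==> c J \<in> pt C Z e (mcar (fst S))"
 using assms by (auto simp: cube_def)

lemma cube_fam: "cube C Z e S c ==> c \<in> fam (ptmon C (fst S) Z e)"
 by (simp add: cube_def fam_def)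

lemma cube_comp_image: "cube C Z e S c ==> cube C Z e S (%B. c (h ` B))"
 by (simp add: cube_def)

lemma Faa_simps [simp]:
 "Obj (Faa C) = faa_Obj C" "Arr (Faa C) = faa_Arr C" "Dom (Faa C) = faa_src" "Cod (Faa C) = faa_tgt"
 "Ide (Faa C) = faa_Ide C" "Comp (Faa C) = faa_Comp C" "Rst (Faa C) = faa_Rst C" "Unit (Faa C) = faa_Unit C"
 "Bang (Faa C) = faa_Bang C" "Prod (Faa C) = faa_Prod C" "Pi0 (Faa C) = faa_Pi0 C" "Pi1 (Faa C) = faa_Pi1 C"
 "Pairing (Faa C) = faa_Pairing C"
 by (simp_all add: Faa_def)

lemma Hom_Faa: "Hom (Faa C) S T = {F \<in> faa_Arr C. faa_src F = S \<and> faa_tgt F = T}"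
 by (simp add: Hom_def)

context faa_arrow
begin

lemma tgt [simp]: "faa_tgt F = (B, Y)" and src [simp]: "faa_src F = (A, X)"
 using in_Arr by auto

lemma cube_base: "cube C Z e (A, X) c ==> c {} \<in> pt C Z e X" "cube C Z e (A, X) c ==> J \<noteq> {} ==> c J \<in> mpt C Z e A"
 by (simp_all add: cube_def)

lemma ev_empty [simp]: "ev C F c {} = c {} \<cdot> f 0"
 by (simp add: ev_def)

lemma ev_pev:
 assumes "cube C Z e (A, X) c" "J \<noteq> {}"
 shows "ev C F c J = pev (ptmon C B Z (Rst C (c {} \<cdot> f 0))) (papp C F (c {})) c J"
proof -
 have "Dom C (c {}) = Z" using HomD(2)[OF ptH[OF cube_base(1)[OF assms(1)]]] .
 then show ?thesis using assms(2) by (simp add: ev_def)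
qed

lemma symadd_cube:
 assumes "cube C Z e (A, X) c"
 shows "symadd (ptmon C A Z e) (ptmon C B Z (Rst C (c {} \<cdot> f 0))) (papp C F (c {}))"
 using symadd[OF cube_base(1)[OF assms]] .

lemma cube_fam': "cube C Z e (A, X) c ==> c \<in> fam (ptmon C A Z e)"
 using cube_fam[of C Z e "(A, X)" c] by simp

lemma ev_cube:
 fixes c :: "'i set => 'm"
 assumes "cube C Z e (A, X) c"
 shows "cube C Z (Rst C (c {} \<cdot> f 0)) (B, Y) (ev C F c)"
 unfolding cube_def
proof (intro conjI allI impI)
 show "ev C F c {} \<in> pt C Z (Rst C (c {} \<cdot> f 0)) (snd (B, Y))"
  using f0_pt[OF cube_base(1)[OF assms]] by simp
 fix J :: "'i set" assume J: "J \<noteq> {}"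
 show "ev C F c J \<in> pt C Z (Rst C (c {} \<cdot> f 0)) (mcar (fst (B, Y)))"
  unfolding ev_pev[OF assms J]
  using symadd.pev_closed[OF symadd_cube[OF assms] cube_fam'[OF assms] J] by simp
qed

lemma ev_cong:
 assumes c: "cube C Z e (A, X) c" and "c' {} = c {}"
  "!!B. B \<subseteq> J ==> B \<noteq> {} ==> finite B ==> c' B = c B"
 shows "ev C F c' J = ev C F c J"
proof (cases "J = {}")
 case False
 have "pev (ptmon C B Z (Rst C (c {} \<cdot> f 0))) (papp C F (c {})) c' J = pev (ptmon C B Z (Rst C (c {} \<cdot> f 0))) (papp C F (c {})) c J"
  by (rule symadd.pev_cong[OF symadd_cube[OF c] cube_fam'[OF c] False]) (use assms(3) in simp)
 moreover have "Dom C (c {}) = Z" using HomD(2)[OF ptH[OF cube_base(1)[OF c]]] .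
 ultimately show ?thesis using False assms(2) by (simp add: ev_def)
qed (simp add: assms(2))

lemma ev_reindex:
 assumes "cube C Z e (A, X) c" "inj_on h J"
 shows "ev C F c (h ` J) = ev C F (%B. c (h ` B)) J"
proof (cases "J = {}")
 case False
 have "pev (ptmon C B Z (Rst C (c {} \<cdot> f 0))) (papp C F (c {})) c (h ` J) =
   pev (ptmon C B Z (Rst C (c {} \<cdot> f 0))) (papp C F (c {})) (%B. c (h ` B)) J"
  by (rule symadd.pev_reindex[OF symadd_cube[OF assms(1)] cube_fam'[OF assms(1)] False assms(2)])
 moreover have "ev C F c (h ` J) = pev (ptmon C B Z (Rst C (c {} \<cdot> f 0))) (papp C F (c {})) c (h ` J)"
  using False by (intro ev_pev[OF assms(1)]) simp
 moreover have "ev C F (%B. c (h ` B)) J = pev (ptmon C B Z (Rst C (c {} \<cdot> f 0))) (papp C F (c {})) (%B. c (h ` B)) J"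
  using ev_pev[OF cube_comp_image[OF assms(1)] False, of h] by (simp only: image_empty)
 ultimately show ?thesis by (simp only:)
qed simp

lemma papp_precomp:
 assumes u: "u \<in> Hom C W Z" and M: "set_mset M \<subseteq> mpt C Z e A" and x: "x \<in> pt C Z e X"
 shows "u \<cdot> papp C F x M = papp C F (u \<cdot> x) (image_mset (%z. u \<cdot> z) M)"
proof -
 obtain zs where zs: "mset zs = M" using ex_mset by blast
 have zs': "set zs \<subseteq> mpt C Z e A" using M zs by auto
 have uzs: "set (map (%z. u \<cdot> z) zs) \<subseteq> mpt C W (Rst C (u \<cdot> e)) A"
  using zs' precomp_pt[OF u] by auto
 have zsH: "set zs \<subseteq> Hom C Z (mcar A)" using zs' ptD(1) by auto
 note x' = ptH[OF x]
 have fH: "f (length zs) \<in> Hom C (powp (mcar A) (length zs) X) (if zs = [] then Y else mcar B)"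
  using fn(1)[of "length zs"] f0 by (cases zs) auto
 have "u \<cdot> papp C F x M = u \<cdot> tup zs x \<cdot> f (length zs)"
  using papp_mset[OF zs' x] zs Comp_assoc[OF u tup_Hom[OF zsH x'] fH] by simp
 also have "... = tup (map (%z. u \<cdot> z) zs) (u \<cdot> x) \<cdot> f (length zs)"
  using Comp_tup[OF u zsH x'] by simp
 also have "... = papp C F (u \<cdot> x) (mset (map (%z. u \<cdot> z) zs))"
  using papp_mset[OF uzs precomp_pt[OF u x]] by simp
 finally show ?thesis using zs by simp
qed

lemma cube_precomp:
 assumes u: "u \<in> Hom C W Z" and c: "cube C Z e S c"
 shows "cube C W (Rst C (u \<cdot> e)) S (%B. u \<cdot> c B)"
 unfolding cube_def by (intro conjI allI impI precomp_pt[OF u] cubeD[OF c])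

text \<open>Change of stage: precomposition with \<open>u\<close> is a homomorphism of the monoids
  of points and commutes with every component, hence with the sum over partitions.\<close>

lemma ev_precomp:
 assumes u: "u \<in> Hom C W Z" and c: "cube C Z e (A, X) c"
 shows "u \<cdot> ev C F c J = ev C F (%B. u \<cdot> c B) J"
proof (cases "J = {}")
 case True
 then show ?thesis using Comp_assoc[OF u ptH[OF cube_base(1)[OF c]] f0] by simp
next
 case False
 let ?x = "c {}"
 have x: "?x \<in> Hom C Z X" using ptH[OF cube_base(1)[OF c]] .
 interpret S: symadd "ptmon C A Z e" "ptmon C B Z (Rst C (?x \<cdot> f 0))" "papp C F ?x"
  by (rule symadd_cube[OF c])
 have tc: "papp C F ?x (image_mset c (mset_set P)) \<in> mpt C Z (Rst C (?x \<cdot> f 0)) B" if "P \<in> parts J" for P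
  using S.pev_term_closed[OF cube_fam'[OF c] False that] by simp
 have R: "Rst C (u \<cdot> Rst C (?x \<cdot> f 0)) = Rst C (u \<cdot> ?x \<cdot> f 0)"
  using Rst_Comp[OF u Comp_Hom[OF x f0]] Comp_assoc[OF u x f0] by simp
 have eq: "u \<cdot> papp C F ?x (image_mset c (mset_set P)) = papp C F (u \<cdot> ?x) {#u \<cdot> c B. B \<in># mset_set P#}" if P: "P \<in> parts J" for P
 proof -
  have "c B \<in> mpt C Z e A" if "B \<in> P" for B
   using cube_base(2)[OF c, of B] partsD(4)[OF P] that by metis
  then show ?thesis
   using papp_precomp[OF u _ cube_base(1)[OF c], of "image_mset c (mset_set P)"] partsD(2)[OF P]
   by (simp add: image_subset_iff multiset.map_comp o_def)
 qed
 have "u \<cdot> ev C F c J = finprod (ptmon C B W (Rst C (u \<cdot> ?x \<cdot> f 0))) (%P. u \<cdot> papp C F ?x (image_mset c (mset_set P))) (parts J)"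
  unfolding ev_pev[OF c False] pev_def using B.Comp_finprod[OF u dom_idem[OF x] tc, of "parts J" "%P. P"] R by simp
 also have "... = ev C F (%B. u \<cdot> c B) J"
  unfolding ev_pev[OF cube_precomp[OF u c] False] pev_def
 proof (rule comm_monoid.finprod_cong'[OF B.ptmon])
  show "Rst C (u \<cdot> ?x \<cdot> f 0) \<in> pt C W (Rst C (u \<cdot> ?x \<cdot> f 0)) W" by (rule dom_idem[OF Comp_Hom[OF u x]])
  show "(%P. papp C F (u \<cdot> ?x) {#u \<cdot> c B. B \<in># mset_set P#}) \<in> parts J \<rightarrow> carrier (ptmon C B W (Rst C (u \<cdot> ?x \<cdot> f 0)))"
   using precomp_pt[OF u tc] R by (auto simp flip: eq)
 qed (use eq in auto)
 finally show ?thesis .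
qed

lemma pcube_cube:
 assumes "!!i. i \<in> S ==> c i \<in> mpt C Z e A" "x \<in> pt C Z e X"
 shows "cube C Z e (A, X) (pcube C A Z e S c x)"
 using assms A.zero_e_pt[OF pt_idem(5)[OF assms(2)]] by (auto simp: cube_def pcube_def)

lemma ev_pcube:
 assumes c: "!!i. i \<in> S ==> c i \<in> mpt C Z e A" and x: "x \<in> pt C Z e X" and S: "finite S"
 shows "ev C F (pcube C A Z e S c x) S = papp C F x {#c i. i \<in># mset_set S#}"
proof (cases "S = {}")
 case True
 then show ?thesis by (simp add: papp_empty)
next
 case False
 have pc: "cube C Z e (A, X) (pcube C A Z e S c x)" by (rule pcube_cube[OF c x])
 have "{#pcube C A Z e S c x {j}. j \<in># mset_set S#} = {#c i. i \<in># mset_set S#}"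
  by (rule image_mset_cong) (use S in simp)
 moreover have "pcube C A Z e S c x B = \<one>\<^bsub>ptmon C A Z e\<^esub>" if "B \<noteq> {}" "\<nexists>j. B = {j}" for B
  using that by (auto simp: pcube_def)
 ultimately show ?thesis
  using ev_pev[OF pc False] symadd.pev_singletons[OF symadd_cube[OF pc] cube_fam'[OF pc] False S] by simp
qed

end

section \<open>The universal cube\<close>

text \<open>The generic cube with \<open>n\<close> linear directions. Its stage is
  \<open>A^n \<times> X\<close> itself, and the projections are its linear coefficients and its base
  point.\<close>

definition ucube :: "('o, 'm) crcat => ('o, 'm) faa_obj => nat => nat set => 'm" where
 "ucube C S n = (let P = powprod C (mcar (fst S)) n (snd S) in
   pcube C (fst S) P (Ide C P) {..<n} (proj C (mcar (fst S)) n (snd S)) (proj C (mcar (fst S)) n (snd S) n))"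

context faa_arrow
begin

lemma ucube_cube: "cube C (powp (mcar A) n X) (Ide C (powp (mcar A) n X)) (A, X) (ucube C (A, X) n)"
 unfolding ucube_def Let_def fst_conv snd_conv
 by (rule pcube_cube) (use proj_pt[OF A.car_Obj objs(2)] in auto)

lemma ucube_empty: "ucube C (A, X) n {} = proj C (mcar A) n X n"
 by (simp add: ucube_def Let_def)

text \<open>The tuple of all projections is the identity, so the one surviving term is
  \<open>f n\<close> itself: the components can be read off the action.\<close>

lemma ev_ucube: "ev C F (ucube C (A, X) n) {..<n} = f n"
proof -
 let ?P = "powp (mcar A) n X"
 let ?p = "proj C (mcar A) n X"
 let ?zs = "map ?p [0..<n]"
 have P: "?P \<in> Obj C" by (rule powprod_Obj[OF A.car_Obj objs(2)])
 note pp = proj_pt[OF A.car_Obj objs(2)]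
 have zs: "set ?zs \<subseteq> pt C ?P (Ide C ?P) (mcar A)" using pp by auto
 have "tup (map (%i. Ide C ?P \<cdot> ?p i) [0..<n]) (Ide C ?P \<cdot> ?p n) = Ide C ?P"
  by (rule tup_eta[OF A.car_Obj objs(2) Ide_pt[OF P]])
 moreover have "map (%i. Ide C ?P \<cdot> ?p i) [0..<n] = ?zs"
  using Ide_Comp[OF ptH[OF pp(1)]] by simp
 ultimately have t: "tup ?zs (?p n) = Ide C ?P"
  using Ide_Comp[OF ptH[OF pp(2)]] by simp
 have "ev C F (ucube C (A, X) n) {..<n} = papp C F (?p n) {#?p i. i \<in># mset_set {..<n}#}"
  unfolding ucube_def Let_def fst_conv snd_conv by (rule ev_pcube) (use pp in auto)
 also have "{#?p i. i \<in># mset_set {..<n}#} = mset ?zs"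
  by (simp add: mset_set_upto_eq_mset_upto)
 also have "papp C F (?p n) (mset ?zs) = f n"
  using papp_mset[OF zs pp(2)] t Ide_Comp[OF f0] Ide_Comp[OF fn(1)[of n]] by (cases n) auto
 finally show ?thesis .
qed

text \<open>A cube with only linear coefficients in finitely many numbered directions is a change of
  stage of the universal one, so identities proved at \<open>ucube\<close> pass to all of
  these.\<close>

lemma Comp_ucube:
 assumes "set zs \<subseteq> mpt C Z e A" "x \<in> pt C Z e X"
 shows "tup zs x \<cdot> ucube C (A, X) (length zs) J = pcube C A Z e {..<length zs} (%i. zs ! i) x J"
proof -
 let ?P = "powp (mcar A) (length zs) X"
 note t = tup_pt[OF assms]
 note u = ptD[OF t(1)]
 have P: "?P \<in> Obj C" using Hom_Obj[OF u(1)] by simp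
 note z = ptH[OF A.zero_pt[OF P]]
 have "tup zs x \<cdot> (Ide C ?P \<cdot> zmap A ?P) = e \<cdot> zmap A Z"
  using Ide_Comp[OF z] A.Comp_zero[OF u(1)] u(2) by simp
 then show ?thesis
  using t(2,3) by (auto simp: ucube_def Let_def pcube_def)
qed

end

context cartesian_restriction_category
begin

lemma faa_arrowI: "F \<in> Hom (Faa C) (A, X) (B, Y) ==> faa_arrow C F A X B Y"
 by (simp add: faa_arrow_axioms.intro faa_arrow_def cartesian_restriction_category_axioms)

text \<open>Universal cubes have their directions in \<open>nat\<close>, so comparing actions on
  cubes of that type is enough.\<close>

lemma faa_eqI:
 assumes F: "F \<in> Hom (Faa C) S T" and G: "G \<in> Hom (Faa C) S T"
  and eq: "!!Z e (c :: nat set => 'm) J. cube C Z e S c ==> finite J ==> ev C F c J = ev C G c J"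
 shows "F = G"
proof -
 obtain A X B Y where ST: "S = (A, X)" "T = (B, Y)" by (cases S; cases T) auto
 interpret F: faa_arrow C F A X B Y by (rule faa_arrowI) (use F ST in simp)
 interpret G: faa_arrow C G A X B Y by (rule faa_arrowI) (use G ST in simp)
 have "faa_seq F n = faa_seq G n" for n
  using F.ev_ucube[of n] G.ev_ucube[of n] eq[of _ _ "ucube C (A, X) n" "{..<n}"] F.ucube_cube[of n] ST by simp
 then have "faa_seq F = faa_seq G" by (rule ext)
 then show ?thesis using F.F_eq G.F_eq by simp
qed

end

subsection \<open>Composition\<close>

lemma mset_sorted_key_list_of_set:
 assumes inj: "inj_on k P" and "finite P"
 shows "mset (sorted_key_list_of_set k P) = mset_set P"
proof -
 interpret folding_on P "insort_key k" "[]"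
 proof
  fix x y assume "x \<in> P" "y \<in> P"
  then have "k x = k y \<longleftrightarrow> x = y" using inj by (auto dest: inj_onD)
  then show "insort_key k y \<circ> insort_key k x = insort_key k x \<circ> insort_key k y"
   by (cases "x = y") (auto simp: fun_eq_iff intro: insort_key_left_comm)
 qed
 have "finite Q ==> Q \<subseteq> P ==> mset (F Q) = mset_set Q" for Q
  by (induction Q rule: finite_induct) (auto simp: insert)
 then show ?thesis using assms(2) by (simp add: sorted_key_list_of_set_def)
qed

text \<open>Distinct blocks are disjoint and nonempty and therefore have different minima, so the
  listing by minimum neither repeats nor loses a block.\<close>

lemma mset_sorted_key_list_of_set_Min:
 assumes "P \<in> parts (J :: nat set)"
 shows "mset (sorted_key_list_of_set Min P) = mset_set P" "length (sorted_key_list_of_set Min P) = card P"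
proof -
 have "inj_on Min P"
 proof (rule inj_onI)
  fix B B' assume B: "B \<in> P" "B' \<in> P" "Min B = Min B'"
  have "Min B \<in> B" "Min B' \<in> B'"
   using B partsD(4,5)[OF assms] by (metis Min_in)+
  then show "B = B'" using B partsD(7)[OF assms] by metis
 qed
 then show "mset (sorted_key_list_of_set Min P) = mset_set P"
  using partsD(2)[OF assms] by (rule mset_sorted_key_list_of_set)
 then show "length (sorted_key_list_of_set Min P) = card P"
  by (metis size_mset size_mset_set)
qed

locale faa_composable = F: faa_arrow C F A X B Y + G: faa_arrow C G B Y E W
 for C :: "('o, 'm) crcat" (structure) and F A X B Y G E W
begin

abbreviation "g \<equiv> faa_seq G"

lemma comp_cube:
 assumes "cube C Z e (A, X) c"
 shows "cube C Z (Rst C (c {} \<cdot> F.f 0 \<cdot> g 0)) (E, W) (ev C G (ev C F c))"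
 using G.ev_cube[OF F.ev_cube[OF assms]] by simp

lemma comp_reindex:
 assumes c: "cube C Z e (A, X) c" and h: "inj_on h J"
 shows "ev C G (ev C F c) (h ` J) = ev C G (ev C F (%B. c (h ` B))) J"
proof -
 have "ev C G (ev C F c) (h ` J) = ev C G (%B. ev C F c (h ` B)) J"
  by (rule G.ev_reindex[OF F.ev_cube[OF c] h])
 also have "... = ev C G (ev C F (%B. c (h ` B))) J"
  by (rule G.ev_cong[OF F.ev_cube[OF cube_comp_image[OF c]]])
   (use F.ev_reindex[OF c] inj_on_subset[OF h] in auto)
 finally show ?thesis .
qed

lemma comp_cong:
 assumes c: "cube C Z e (A, X) c" and "c' {} = c {}"
  "!!B. B \<subseteq> J ==> B \<noteq> {} ==> finite B ==> c' B = c B"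
 shows "ev C G (ev C F c') J = ev C G (ev C F c) J"
 by (rule G.ev_cong[OF F.ev_cube[OF c]]) (use assms(2,3) in "auto intro!: F.ev_cong[OF c]")

lemma comp_precomp:
 assumes u: "u \<in> Hom C V Z" and c: "cube C Z e (A, X) c"
 shows "u \<cdot> ev C G (ev C F c) J = ev C G (ev C F (%B. u \<cdot> c B)) J"
proof -
 have "u \<cdot> ev C G (ev C F c) J = ev C G (%B. u \<cdot> ev C F c B) J"
  by (rule G.ev_precomp[OF u F.ev_cube[OF c]])
 then show ?thesis using F.ev_precomp[OF u c] by simp
qed

text \<open>In the defining sum, the inner factor for a block \<open>B\<close> is the coefficient at
  \<open>B\<close> of the image of the universal cube under \<open>F\<close>. The outer sum is then
  precisely the evaluation of \<open>G\<close> at this image.\<close>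

lemma comp_seq: "faa_seq (faa_Comp C F G) n = ev C G (ev C F (ucube C (A, X) n)) {..<n}"
proof (cases "n = 0")
 case True
 then show ?thesis using F.Ide_Comp[OF F.f0] by (simp add: faa_Comp_def Let_def F.ucube_empty)
next
 case False
 let ?Z = "powprod C (mcar A) n X" and ?e = "Ide C (powprod C (mcar A) n X)"
 let ?p = "proj C (mcar A) n X"
 let ?u = "ucube C (A, X) n"
 note u = F.ucube_cube[of n]
 have J: "{..<n} \<noteq> {}" using False by auto
 have P: "?Z \<in> Obj C" by (rule F.powprod_Obj[OF F.A.car_Obj F.objs(2)])
 note pp = F.proj_pt[OF F.A.car_Obj F.objs(2)]
 have x: "?p n \<in> pt C ?Z ?e X" by (rule pp(2))
 let ?e' = "Rst C (?p n \<cdot> F.f 0)"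
 have x': "?p n \<cdot> F.f 0 \<in> pt C ?Z ?e' Y" by (rule F.f0_pt[OF x])
 \<comment> \<open>The list in the definition contains the variables from \<open>B\<close> only. The
   cube with linear coefficients on \<open>B\<close> may be enlarged to the universal one, since an
   evaluation at \<open>B\<close> looks only at subsets of \<open>B\<close>.\<close>
 have inner: "apply_map C (F.f (card B)) (map ?p (sorted_list_of_set B)) (?p n) = ev C F ?u B"
  if B: "B \<subseteq> {..<n}" for B
 proof -
  have fin: "finite B" using B finite_subset by blast
  have zs: "set (map ?p (sorted_list_of_set B)) \<subseteq> pt C ?Z ?e (mcar A)" using B fin pp(1) by auto
  have "apply_map C (F.f (card B)) (map ?p (sorted_list_of_set B)) (?p n) = papp C F (?p n) (mset (map ?p (sorted_list_of_set B)))"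
   using F.papp_mset[OF zs x] by (simp add: F.apply_map_tup)
  also have "mset (map ?p (sorted_list_of_set B)) = {#?p i. i \<in># mset_set B#}"
   using fin mset_set_set[of "sorted_list_of_set B"] by simp
  also have "papp C F (?p n) ... = ev C F (pcube C A ?Z ?e B ?p (?p n)) B"
   by (rule F.ev_pcube[symmetric]) (use x B fin pp(1) in auto)
  also have "... = ev C F ?u B"
   by (rule F.ev_cong[OF u]) (use B in "auto simp: ucube_def Let_def pcube_def")
  finally show ?thesis .
 qed
 have outer: "apply_map C (g (card P))
   (map (%B. apply_map C (F.f (card B)) (map ?p (sorted_list_of_set B)) (?p n)) (sorted_key_list_of_set Min P)) (?p n \<cdot> F.f 0) =
   papp C G (?p n \<cdot> F.f 0) (image_mset (ev C F ?u) (mset_set P))" if P: "P \<in> parts {..<n}" for P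
 proof -
  let ?l = "sorted_key_list_of_set Min P"
  note l = mset_sorted_key_list_of_set_Min[OF P]
  have set: "set ?l = P" using l(1) partsD(2)[OF P] by (metis finite_set_mset_mset_set set_mset_mset)
  have mp: "map (%B. apply_map C (F.f (card B)) (map ?p (sorted_list_of_set B)) (?p n)) ?l = map (ev C F ?u) ?l"
   using inner partsD(6)[OF P] set by simp
  have "set (map (ev C F ?u) ?l) \<subseteq> pt C ?Z ?e' (mcar B)"
  proof -
   have "ev C F ?u b \<in> pt C ?Z ?e' (mcar B)" if "b \<in> P" for b
    using cubeD(2)[OF F.ev_cube[OF u], of b] partsD(4)[OF P] that unfolding F.ucube_empty fst_conv by metis
   then show ?thesis using set by auto
  qed
  then show ?thesis
   unfolding mp using G.papp_mset[OF _ x', of "map (ev C F ?u) ?l"] l by (simp add: F.apply_map_tup)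
 qed
 interpret S: symadd "ptmon C B ?Z ?e'" "ptmon C E ?Z (Rst C (?p n \<cdot> F.f 0 \<cdot> g 0))" "papp C G (?p n \<cdot> F.f 0)"
  by (rule G.symadd[OF x'])
 have fam: "ev C F ?u \<in> fam (ptmon C B ?Z ?e')"
  using cube_fam[OF F.ev_cube[OF u]] by (simp add: F.ucube_empty)
 have tc: "papp C G (?p n \<cdot> F.f 0) (image_mset (ev C F ?u) (mset_set P)) \<in> pt C ?Z (Rst C (?p n \<cdot> F.f 0 \<cdot> g 0)) (mcar E)"
  if "P \<in> parts {..<n}" for P using S.pev_term_closed[OF fam J that] by simp
 have "{P. partition_on {..<n} P} = parts {..<n}" by (simp add: parts_def)
 then have "faa_seq (faa_Comp C F G) n =
   msum C E ?Z (%P. apply_map C (g (card P)) (map (%B. apply_map C (F.f (card B)) (map ?p (sorted_list_of_set B)) (?p n))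
              (sorted_key_list_of_set Min P)) (?p n \<cdot> F.f 0)) (parts {..<n})"
  using False by (simp add: faa_Comp_def Let_def)
 \<comment> \<open>Passing to the sum with fixed domain requires a term to be present; the partition
   into singletons provides one.\<close>
 also have "... = finprod (ptmon C E ?Z (Rst C (?p n \<cdot> F.f 0 \<cdot> g 0))) (%P. apply_map C (g (card P)) (map (%B. apply_map C (F.f (card B)) (map ?p (sorted_list_of_set B)) (?p n))
              (sorted_key_list_of_set Min P)) (?p n \<cdot> F.f 0)) (parts {..<n})"
  by (rule G.B.msum_eq) (use outer tc parts_singletons[of "{..<n}"] in "auto simp: finite_parts")
 also have "... = pev (ptmon C E ?Z (Rst C (?p n \<cdot> F.f 0 \<cdot> g 0))) (papp C G (?p n \<cdot> F.f 0)) (ev C F ?u) {..<n}"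
  unfolding pev_def by (rule S.H.finprod_cong') (use outer tc in auto)
 also have "... = ev C G (ev C F ?u) {..<n}"
  using G.ev_pev[OF F.ev_cube[OF u] J] by (simp add: F.ucube_empty)
 finally show ?thesis .
qed

lemma comp_point:
 assumes "set zs \<subseteq> mpt C Z e A" "x \<in> pt C Z e X"
 shows "F.tup zs x \<cdot> faa_seq (faa_Comp C F G) (length zs) =
  ev C G (ev C F (pcube C A Z e {..<length zs} (%i. zs ! i) x)) {..<length zs}"
 using comp_precomp[OF F.ptH[OF F.tup_pt(1)[OF assms]] F.ucube_cube] F.Comp_ucube[OF assms] comp_seq by simp

end

section \<open>Additivity in a direction, and closure under composition\<close>

context faa_arrow
begin

text \<open>Additivity in a direction rather than in an argument. The relation assumed between
  \<open>c\<close>, \<open>c1\<close> and \<open>c2\<close> at sets containing \<open>j\<close> is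
  the one concluded for their images, so the lemma can be applied along a composite.\<close>

lemma ev_slot_add:
 assumes c: "cube C Z e (A, X) c" "cube C Z e (A, X) c1" "cube C Z e (A, X) c2"
  and base: "c1 {} = c {}" "c2 {} = c {}" and j: "j \<in> J"
  and other: "!!B. B \<subseteq> J ==> B \<noteq> {} ==> j \<notin> B ==> c1 B = c B \<and> c2 B = c B"
  and slot: "!!B. B \<subseteq> J ==> j \<in> B ==> c B = madd C A (c1 B) (c2 B)"
 shows "ev C F c J = madd C B (ev C F c1 J) (ev C F c2 J)"
proof -
 have J: "J \<noteq> {}" using j by auto
 have "pev (ptmon C B Z (Rst C (c {} \<cdot> f 0))) (papp C F (c {})) c J =
   pev (ptmon C B Z (Rst C (c {} \<cdot> f 0))) (papp C F (c {})) c1 J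
    \<otimes>\<^bsub>ptmon C B Z (Rst C (c {} \<cdot> f 0))\<^esub> pev (ptmon C B Z (Rst C (c {} \<cdot> f 0))) (papp C F (c {})) c2 J"
  by (rule symadd.pev_slot_add[OF symadd_cube[OF c(1)] cube_fam'[OF c(1)] cube_fam'[OF c(2)] cube_fam'[OF c(3)] j])
   (use other slot in auto)
 then show ?thesis
  using ev_pev[OF c(1) J] ev_pev[OF c(2) J] ev_pev[OF c(3) J] base by simp
qed

lemma ev_slot_zero:
 assumes c: "cube C Z e (A, X) c" and j: "j \<in> J"
  and slot: "!!B. B \<subseteq> J ==> j \<in> B ==> c B = e \<cdot> zmap A Z"
 shows "ev C F c J = Rst C (c {} \<cdot> f 0) \<cdot> zmap B Z"
proof -
 have J: "J \<noteq> {}" using j by auto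
 show ?thesis
  using symadd.pev_slot_zero[OF symadd_cube[OF c] cube_fam'[OF c] j] slot ev_pev[OF c J] by simp
qed

end

context faa_composable
begin

lemma comp_fields: "faa_src (faa_Comp C F G) = (A, X)" "faa_tgt (faa_Comp C F G) = (E, W)"
 "faa_seq (faa_Comp C F G) 0 = F.f 0 \<cdot> g 0"
 by (simp_all add: faa_Comp_def Let_def)

text \<open>By \<open>comp_point\<close>, the components of the composite are iterated evaluations
  at cubes with linear coefficients. Permuting arguments is then a reindexing of directions, and a
  sum or zero in the first argument is a sum or zero in direction \<open>0\<close>, passed through
  \<open>F\<close> and then through \<open>G\<close>.\<close>

lemma comp_Hom: "faa_Comp C F G \<in> Hom (Faa C) (A, X) (E, W)"
proof -
 let ?h = "faa_seq (faa_Comp C F G)"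
 have h0: "?h 0 \<in> Hom C X W" using F.Comp_Hom[OF F.f0 G.f0] comp_fields by simp
 have hn: "?h n \<in> pt C (powprod C (mcar A) n X) (Rst C (proj C (mcar A) n X n \<cdot> ?h 0)) (mcar E)" if n: "n \<ge> 1" for n
 proof -
  have p: "proj C (mcar A) n X n \<in> Hom C (powprod C (mcar A) n X) X"
   using F.ptH[OF F.proj_pt(2)[OF F.A.car_Obj F.objs(2)]] .
  have "{..<n} \<noteq> {}" using n by (auto simp: lessThan_empty_iff)
  then show ?thesis
   using cubeD(2)[OF comp_cube[OF F.ucube_cube], of "{..<n}" n] comp_seq[of n]
    F.Comp_assoc[OF p F.f0 G.f0] by (simp add: F.ucube_empty comp_fields)
 qed
 \<comment> \<open>An injective renaming preserves and reflects singletons, hence the pattern of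
   vanishing coefficients in a cube that is purely linear.\<close>
 have sing: "(p ` B = {j}) \<longleftrightarrow> (\<exists>i. B = {i} \<and> j = p i)" if "inj p" for p :: "nat => nat" and B j
 proof
  assume eq: "p ` B = {j}"
  then obtain i where i: "i \<in> B" "p i = j" by blast
  have "k = i" if "k \<in> B" for k
   using eq i that \<open>inj p\<close> by (metis image_eqI injD singletonD)
  then show "\<exists>i. B = {i} \<and> j = p i" using i by blast
 qed auto
 have "FaaArr (A, X) (E, W) ?h \<in> faa_Arr C"
 proof (rule F.faa_ArrI[where Y = W])
  show "tcm C A" "tcm C E" "X \<in> Obj C" by (rule F.objs G.objs)+
  show "?h 0 \<in> Hom C X W" by (rule h0)
  show "?h n \<in> Hom C (powprod C (mcar A) n X) (mcar E)" "Rst C (?h n) = Rst C (proj C (mcar A) n X n \<cdot> ?h 0)"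
   if "n \<ge> 1" for n using F.ptD[OF hn[OF that]] .
 next
  fix Z e zs zs' x
  assume zs: "zs \<noteq> []" "set zs \<subseteq> mpt C Z e A" and x: "x \<in> pt C Z e X" and m: "mset zs' = mset zs"
  obtain p where p: "p permutes {..<length zs}" "permute_list p zs = zs'"
   using mset_eq_permutation[OF m] by blast
  have l: "length zs' = length zs" using m by (metis size_mset)
  have zs': "set zs' \<subseteq> mpt C Z e A" using zs m by (metis set_mset_mset)
  let ?c = "pcube C A Z e {..<length zs} (%i. zs ! i) x"
  let ?c' = "pcube C A Z e {..<length zs} (%i. zs' ! i) x"
  have c: "cube C Z e (A, X) ?c" by (rule F.pcube_cube[OF _ x]) (use zs in auto)
  have pi: "inj p" using permutes_inj[OF p(1)] .
  have "?c' B = ?c (p ` B)" if B: "B \<subseteq> {..<length zs}" for B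
  proof (cases "\<exists>i. B = {i}")
   case True
   then obtain i where i: "B = {i}" "i < length zs" using B by auto
   then show ?thesis
    using p permute_list_nth[OF p(1) i(2)] permutes_in_image[OF p(1), of i] by simp
  next
   case False
   then have "\<not> (\<exists>j. p ` B = {j})" using sing[OF pi] by blast
   then show ?thesis using False by (auto simp: pcube_def)
  qed
  then have "ev C G (ev C F ?c') {..<length zs} = ev C G (ev C F (%B. ?c (p ` B))) {..<length zs}"
   by (intro comp_cong[OF cube_comp_image[OF c]]) simp_all
  also have "... = ev C G (ev C F ?c) (p ` {..<length zs})"
   by (rule comp_reindex[OF c, symmetric]) (use pi inj_on_subset in blast)
  also have "p ` {..<length zs} = {..<length zs}" by (rule permutes_image[OF p(1)])
  finally show "F.tup zs' x \<cdot> ?h (length zs) = F.tup zs x \<cdot> ?h (length zs)"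
   using comp_point[OF zs(2) x] comp_point[OF zs' x] l by simp
 next
  fix Z e zs x a b
  assume zs: "set zs \<subseteq> mpt C Z e A" and x: "x \<in> pt C Z e X" and ab: "a \<in> mpt C Z e A" "b \<in> mpt C Z e A"
  let ?n = "Suc (length zs)"
  let ?c = "%y. pcube C A Z e {..<?n} (%i. (y # zs) ! i) x"
  have y: "set (y # zs) \<subseteq> mpt C Z e A" if "y \<in> mpt C Z e A" for y using zs that by simp
  have c: "cube C Z e (A, X) (?c y)" if "y \<in> mpt C Z e A" for y
   by (rule F.pcube_cube[OF _ x]) (use y[OF that] nth_mem[of _ "y # zs"] in fastforce)
  note s = F.A.add_pt[OF ab]
  \<comment> \<open>Sets containing \<open>0\<close> other than \<open>{0}\<close> carry zeros in
    all three cubes, and these too must satisfy the additivity relation.\<close>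
  have zz: "madd C A (e \<cdot> zero_map C A Z) (e \<cdot> zero_map C A Z) = e \<cdot> zero_map C A Z"
   by (rule F.A.add_zero_pt[OF F.A.zero_e_pt[OF F.pt_idem(5)[OF x]]])
  have other: "?c a B = ?c (madd C A a b) B \<and> ?c b B = ?c (madd C A a b) B" if "0 \<notin> B" for B
   using that by (auto simp: pcube_def nth_Cons split: nat.split)
  have slot: "?c (madd C A a b) B = madd C A (?c a B) (?c b B)" if "0 \<in> B" for B
  proof (cases "B = {0}")
   case False
   then have "B \<noteq> {}" "\<not> (\<exists>i\<in>{..<?n}. B = {i})" using that by auto
   then show ?thesis using zz by simp
  qed simp
  have inner: "ev C F (?c (madd C A a b)) K = madd C B (ev C F (?c a) K) (ev C F (?c b) K)" if "0 \<in> K" for K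
   by (rule F.ev_slot_add[OF c[OF s] c[OF ab(1)] c[OF ab(2)] _ _ that]) (use other slot in auto)
  have inner': "ev C F (?c y) B = ev C F (?c (madd C A a b)) B" if "0 \<notin> B" "y = a \<or> y = b" for B y
   by (rule F.ev_cong[OF c[OF s]]) (use that other in auto)
  have "ev C G (ev C F (?c (madd C A a b))) {..<?n} =
    madd C E (ev C G (ev C F (?c a)) {..<?n}) (ev C G (ev C F (?c b)) {..<?n})"
  proof (rule G.ev_slot_add[where j = 0])
   show "cube C Z (Rst C (x \<cdot> F.f 0)) (B, Y) (ev C F (?c (madd C A a b)))"
    "cube C Z (Rst C (x \<cdot> F.f 0)) (B, Y) (ev C F (?c a))" "cube C Z (Rst C (x \<cdot> F.f 0)) (B, Y) (ev C F (?c b))"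
    using F.ev_cube[OF c[OF s]] F.ev_cube[OF c[OF ab(1)]] F.ev_cube[OF c[OF ab(2)]] by simp_all
  qed (use inner inner' in auto)
  then show "F.tup (madd C A a b # zs) x \<cdot> ?h ?n = madd C E (F.tup (a # zs) x \<cdot> ?h ?n) (F.tup (b # zs) x \<cdot> ?h ?n)"
   using comp_point[OF y[OF s] x] comp_point[OF y[OF ab(1)] x] comp_point[OF y[OF ab(2)] x]
   by (simp only: list.size add_Suc_right add_0_right)
 next
  fix Z e zs x
  assume zs: "set zs \<subseteq> mpt C Z e A" and x: "x \<in> pt C Z e X"
  let ?n = "Suc (length zs)"
  let ?zs = "e \<cdot> zero_map C A Z # zs"
  let ?c = "pcube C A Z e {..<?n} (%i. ?zs ! i) x"
  have y: "set ?zs \<subseteq> mpt C Z e A" using zs F.A.zero_e_pt[OF F.pt_idem(5)[OF x]] by simp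
  have c: "cube C Z e (A, X) ?c"
   by (rule F.pcube_cube[OF _ x]) (use y nth_mem[of _ ?zs] in fastforce)
  have slot: "?c B = e \<cdot> zero_map C A Z" if "0 \<in> B" for B
  proof (cases "B = {0}")
   case False
   then have "B \<noteq> {}" "\<not> (\<exists>i\<in>{..<?n}. B = {i})" using that by auto
   then show ?thesis by simp
  qed simp
  have inner: "ev C F ?c K = Rst C (x \<cdot> F.f 0) \<cdot> zero_map C B Z" if "0 \<in> K" for K
   using F.ev_slot_zero[OF c that] slot by simp
  have "ev C G (ev C F ?c) {..<?n} = Rst C (ev C F ?c {} \<cdot> g 0) \<cdot> zero_map C E Z"
  proof (rule G.ev_slot_zero[where j = 0])
   show "cube C Z (Rst C (x \<cdot> F.f 0)) (B, Y) (ev C F ?c)" using F.ev_cube[OF c] by simp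
  qed (use inner in auto)
  then show "F.tup ?zs x \<cdot> ?h ?n = Rst C (x \<cdot> ?h 0) \<cdot> zero_map C E Z"
   using comp_point[OF y x] F.Comp_assoc[OF F.ptH[OF x] F.f0 G.f0] by (simp add: comp_fields del: F.tup_simps)
 qed
 moreover have "FaaArr (A, X) (E, W) ?h = faa_Comp C F G"
  using comp_fields by (cases "faa_Comp C F G") auto
 ultimately show ?thesis by (simp add: Hom_Faa comp_fields)
qed

text \<open>Transfers \<open>comp_point\<close> from lists to an arbitrary finite index set by
  enumerating it. The form is needed with the blocks of a partition as directions.\<close>

lemma papp_comp:
 assumes d: "!!i. i \<in> S ==> d i \<in> mpt C Z e A" and x: "x \<in> pt C Z e X" and S: "finite S"
 shows "papp C (faa_Comp C F G) x {#d i. i \<in># mset_set S#} = ev C G (ev C F (pcube C A Z e S d x)) S"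
proof -
 interpret FG: faa_arrow C "faa_Comp C F G" A X E W by (rule F.faa_arrowI[OF comp_Hom])
 obtain l where l: "distinct l" "set l = S" using finite_distinct_list[OF S] by blast
 let ?zs = "map d l"
 have zs: "set ?zs \<subseteq> mpt C Z e A" using d l by auto
 have inj: "inj_on (%i. l ! i) {..<length l}" using l(1) by (auto simp: inj_on_def nth_eq_iff_index_eq)
 have im: "(%i. l ! i) ` {..<length l} = S" using l(2) by (auto simp: in_set_conv_nth)
 let ?c = "pcube C A Z e S d x"
 have c: "cube C Z e (A, X) ?c" by (rule F.pcube_cube[OF d x])
 have "papp C (faa_Comp C F G) x {#d i. i \<in># mset_set S#} = papp C (faa_Comp C F G) x (mset ?zs)"
  using l mset_set_set[OF l(1)] by simp
 also have "... = F.tup ?zs x \<cdot> faa_seq (faa_Comp C F G) (length ?zs)" by (rule FG.papp_mset[OF zs x])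
 also have "... = ev C G (ev C F (pcube C A Z e {..<length ?zs} (%i. ?zs ! i) x)) {..<length ?zs}"
  by (rule comp_point[OF zs x])
 also have "... = ev C G (ev C F (%B. ?c ((%i. l ! i) ` B))) {..<length l}"
  unfolding length_map
 proof (rule comp_cong[OF cube_comp_image[OF c]])
  fix B assume B: "B \<subseteq> {..<length l}" "B \<noteq> {}"
  show "pcube C A Z e {..<length l} (%i. ?zs ! i) x B = ?c ((%i. l ! i) ` B)"
  proof (cases "\<exists>i. B = {i}")
   case True
   then show ?thesis using B l(2) by auto
  next
   case False
   have "\<not> (\<exists>j. (%i. l ! i) ` B = {j})"
   proof
    assume "\<exists>j. (%i. l ! i) ` B = {j}"
    then have "card ((%i. l ! i) ` B) = 1" by auto
    then have "card B = 1" using card_image[OF inj_on_subset[OF inj B(1)]] by simp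
    then show False using False by (auto simp: card_1_singleton_iff)
   qed
   then show ?thesis using False B(2) by (auto simp: pcube_def)
  qed
 qed simp
 also have "... = ev C G (ev C F ?c) S"
  using comp_reindex[OF c inj] im by simp
 finally show ?thesis .
qed

text \<open>The chain rule. The composite at \<open>c\<close> is a sum over partitions \<rho> of
  \<open>J\<close>, each term being \<open>G\<close> after \<open>F\<close> at the cube with the
  blocks of \<rho> as linear directions. The coefficients of that cube after \<open>F\<close> are
  the terms \<open>h D\<close> of the sums for \<open>F\<close> at \<open>c\<close>, and
  \<open>pev_core\<close>, read from right to left, assembles them into \<open>G\<close> evaluated
  at the image of \<open>c\<close>.\<close>

lemma ev_comp:
 fixes c :: "'i set => 'm"
 assumes c: "cube C Z e (A, X) c" and fin: "finite J"
 shows "ev C (faa_Comp C F G) c J = ev C G (ev C F c) J"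
proof (cases "J = {}")
 case True
 then show ?thesis
  using F.Comp_assoc[OF F.ptH[OF F.cube_base(1)[OF c]] F.f0 G.f0] by (simp add: ev_def comp_fields)
next
 case False
 interpret FG: faa_arrow C "faa_Comp C F G" A X E W by (rule F.faa_arrowI[OF comp_Hom])
 let ?x = "c {}"
 let ?e' = "Rst C (?x \<cdot> F.f 0)" and ?e'' = "Rst C (?x \<cdot> F.f 0 \<cdot> g 0)"
 note x = F.cube_base(1)[OF c]
 note x' = F.f0_pt[OF x]
 interpret SF: symadd "ptmon C A Z e" "ptmon C B Z ?e'" "papp C F ?x" by (rule F.symadd[OF x])
 interpret SG: symadd "ptmon C B Z ?e'" "ptmon C E Z ?e''" "papp C G (?x \<cdot> F.f 0)" by (rule G.symadd[OF x'])
 \<comment> \<open>For a set \<open>D\<close> of blocks, \<open>h D\<close> is the term of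
   \<open>F\<close> with these blocks as arguments. The second branch is a default that keeps all
   values in the monoid: the empty block would insert the base point as a linear argument, and an
   infinite \<open>D\<close> would give the empty multiset.\<close>
 define h where "h D = (if {} \<notin> D \<and> finite D then papp C F ?x (image_mset c (mset_set D)) else ?e' \<cdot> zero_map C B Z)" for D
 have h: "h \<in> fam (ptmon C B Z ?e')"
  unfolding fam_def
 proof (intro CollectI allI impI)
  fix D :: "'i set set" assume D: "D \<noteq> {}"
  show "h D \<in> carrier (ptmon C B Z ?e')"
   using SF.closed_fam[OF F.cube_fam'[OF c] _ D] F.B.zero_e_pt[OF F.pt_idem(5)[OF x']] by (simp add: h_def)
 qed
 have tc: "papp C (faa_Comp C F G) ?x (image_mset c (mset_set \<rho>)) = pev (ptmon C E Z ?e'') (papp C G (?x \<cdot> F.f 0)) h \<rho>"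
  if \<rho>: "\<rho> \<in> parts J" for \<rho>
 proof -
  have d: "c B \<in> mpt C Z e A" if "B \<in> \<rho>" for B
   using F.cube_base(2)[OF c, of B] partsD(4)[OF \<rho>] that by metis
  have ne: "\<rho> \<noteq> {}" by (rule parts_nonempty[OF \<rho> False])
  let ?p = "pcube C A Z e \<rho> c ?x"
  have p: "cube C Z e (A, X) ?p" by (rule F.pcube_cube[OF d x])
  have Fp: "cube C Z ?e' (B, Y) (ev C F ?p)" using F.ev_cube[OF p] by simp
  have "ev C F ?p D = h D" if D: "D \<subseteq> \<rho>" for D
  proof -
   have "finite D" "{} \<notin> D" using D partsD(2,4)[OF \<rho>] finite_subset by auto
   then have "h D = papp C F ?x (image_mset c (mset_set D))" by (simp add: h_def)
   also have "... = ev C F (pcube C A Z e D c ?x) D"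
    by (rule F.ev_pcube[symmetric]) (use d D x \<open>finite D\<close> in auto)
   also have "... = ev C F ?p D"
    by (rule F.ev_cong[OF p]) (use D in "auto simp: pcube_def")
   finally show ?thesis by simp
  qed
  then have "pev (ptmon C E Z ?e'') (papp C G (?x \<cdot> F.f 0)) h \<rho> = pev (ptmon C E Z ?e'') (papp C G (?x \<cdot> F.f 0)) (ev C F ?p) \<rho>"
   by (intro SG.pev_cong[OF _ ne]) (use G.cube_fam'[OF Fp] in auto)
  also have "... = ev C G (ev C F ?p) \<rho>" using G.ev_pev[OF Fp ne] by simp
  also have "... = papp C (faa_Comp C F G) ?x (image_mset c (mset_set \<rho>))"
   by (rule papp_comp[symmetric]) (use d x partsD(2)[OF \<rho>] in auto)
  finally show ?thesis by simp
 qed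
 have e: "?x \<cdot> faa_seq (faa_Comp C F G) 0 = ?x \<cdot> F.f 0 \<cdot> g 0"
  using F.Comp_assoc[OF F.ptH[OF x] F.f0 G.f0] by (simp add: comp_fields)
 have cl: "pev (ptmon C E Z ?e'') (papp C G (?x \<cdot> F.f 0)) h \<rho> \<in> carrier (ptmon C E Z ?e'')" if "\<rho> \<in> parts J" for \<rho>
  by (rule SG.pev_closed[OF h parts_nonempty[OF that False]])
 have "ev C (faa_Comp C F G) c J = finprod (ptmon C E Z ?e'') (%\<rho>. papp C (faa_Comp C F G) ?x (image_mset c (mset_set \<rho>))) (parts J)"
  using FG.ev_pev[OF c False] e by (simp add: pev_def)
 also have "... = finprod (ptmon C E Z ?e'') (%\<rho>. pev (ptmon C E Z ?e'') (papp C G (?x \<cdot> F.f 0)) h \<rho>) (parts J)"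
  by (rule SG.H.finprod_cong') (use tc cl in auto)
 also have "... = pev (ptmon C E Z ?e'') (papp C G (?x \<cdot> F.f 0)) (%K. finprod (ptmon C B Z ?e') h (parts K)) J"
  by (rule SG.pev_core[OF h False, symmetric])
 also have "... = pev (ptmon C E Z ?e'') (papp C G (?x \<cdot> F.f 0)) (ev C F c) J"
 proof (rule SG.pev_cong[OF _ False])
  show "ev C F c \<in> fam (ptmon C B Z ?e')" by (rule G.cube_fam'[OF F.ev_cube[OF c]])
  fix K assume K: "K \<subseteq> J" "K \<noteq> {}" "finite K"
  have "ev C F c K = finprod (ptmon C B Z ?e') (%P. papp C F ?x (image_mset c (mset_set P))) (parts K)"
   using F.ev_pev[OF c K(2)] by (simp add: pev_def)
  also have "... = finprod (ptmon C B Z ?e') h (parts K)"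
  proof (rule SF.H.finprod_cong')
   show "h \<in> parts K \<rightarrow> carrier (ptmon C B Z ?e')" using famD[OF h parts_nonempty[OF _ K(2)]] by blast
  qed (auto simp: h_def dest: partsD(2,4))
  finally show "ev C F c K = finprod (ptmon C B Z ?e') h (parts K)" .
 qed
 also have "... = ev C G (ev C F c) J" using G.ev_pev[OF F.ev_cube[OF c] False] by simp
 finally show ?thesis .
qed

end

section \<open>\<open>Faa(C)\<close> is a Cartesian restriction category\<close>

context cartesian_restriction_category
begin

abbreviation (input) "FC \<equiv> Faa C"

lemma Faa_arrow_cases:
 assumes "F \<in> Hom FC S T"
 obtains A X B Y where "S = (A, X)" "T = (B, Y)" "faa_arrow C F A X B Y"
 using assms faa_arrowI by (cases S; cases T) auto

lemma Faa_fields: "F \<in> Hom FC S T ==> faa_src F = S" "F \<in> Hom FC S T ==> faa_tgt F = T"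
 by (auto simp: Hom_Faa)

lemma Faa_Objs: "F \<in> Hom FC S T ==> S \<in> FObj" "F \<in> Hom FC S T ==> T \<in> FObj"
 by (auto elim!: Faa_arrow_cases simp: faa_Obj_def faa_arrow.objs)

lemma Faa_composable:
 assumes "F \<in> Hom FC S T" "G \<in> Hom FC T U"
 obtains A X B Y E W where "S = (A, X)" "T = (B, Y)" "U = (E, W)" "faa_composable C F A X B Y G E W"
 using Faa_arrow_cases[OF assms(1)] Faa_arrow_cases[OF assms(2)] faa_composable.intro by (metis prod.inject)

lemma Faa_Comp_Hom: "F \<in> Hom FC S T ==> G \<in> Hom FC T U ==> FComp F G \<in> Hom FC S U"
 by (metis Faa_composable faa_composable.comp_Hom)

lemma Faa_Comp_0: "faa_seq (FComp F G) 0 = faa_seq F 0 \<cdot> faa_seq G 0"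
 by (simp add: faa_Comp_def Let_def)

lemma Faa_ev_Comp:
 assumes "F \<in> Hom FC S T" "G \<in> Hom FC T U" "cube C Z e S c" "finite J"
 shows "ev C (FComp F G) c J = ev C G (ev C F c) J"
 using Faa_composable[OF assms(1,2)] faa_composable.ev_comp assms(3,4) by metis

lemma Faa_0: "F \<in> Hom FC S T ==> faa_seq F 0 \<in> Hom C (snd S) (snd T)"
 by (auto elim!: Faa_arrow_cases simp: faa_arrow.f0)

lemma Faa_n:
 assumes "F \<in> Hom FC S T"
 shows "n \<ge> 1 ==> faa_seq F n \<in> Hom C (powp (mcar (fst S)) n (snd S)) (mcar (fst T))"
  and "Rst C (faa_seq F n) = Rst C (proj C (mcar (fst S)) n (snd S) n \<cdot> faa_seq F 0)"
proof -
 obtain A X B Y where ST: "S = (A, X)" "T = (B, Y)" and F: "faa_arrow C F A X B Y"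
  using Faa_arrow_cases[OF assms] .
 interpret F: faa_arrow C F A X B Y by (rule F)
 show "n \<ge> 1 ==> faa_seq F n \<in> Hom C (powp (mcar (fst S)) n (snd S)) (mcar (fst T))"
  using F.fn ST by simp
 show "Rst C (faa_seq F n) = Rst C (proj C (mcar (fst S)) n (snd S) n \<cdot> faa_seq F 0)"
  using F.fn(2)[of n] Ide_Comp[OF F.f0] ST by (cases n) auto
qed

lemma Faa_ev_cube: "F \<in> Hom FC S T ==> cube C Z e S c ==> cube C Z (Rst C (c {} \<cdot> faa_seq F 0)) T (ev C F c)"
 by (metis Faa_arrow_cases faa_arrow.ev_cube)

lemma Faa_ev_precomp: "F \<in> Hom FC S T ==> cube C Z e S c ==> u \<in> Hom C W Z ==> u \<cdot> ev C F c J = ev C F (%B. u \<cdot> c B) J"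
 by (metis Faa_arrow_cases faa_arrow.ev_precomp)

lemma Faa_ev_cong:
 assumes "F \<in> Hom FC S T" "cube C Z e S c" "c' {} = c {}" "!!B. B \<subseteq> J ==> B \<noteq> {} ==> finite B ==> c' B = c B"
 shows "ev C F c' J = ev C F c J"
 using Faa_arrow_cases[OF assms(1)] faa_arrow.ev_cong[of C F _ _ _ _ Z e c c' J] assms(2-4) by metis

lemma Faa_ev_ucube: "F \<in> Hom FC S T ==> ev C F (ucube C S n) {..<n} = faa_seq F n"
 by (metis Faa_arrow_cases faa_arrow.ev_ucube)

lemma ucube_cube:
 assumes "S \<in> FObj"
 shows "cube C (powp (mcar (fst S)) n (snd S)) (Ide C (powp (mcar (fst S)) n (snd S))) S (ucube C S n)"
  and "ucube C S n {} = proj C (mcar (fst S)) n (snd S) n"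
proof -
 obtain A X where S: "S = (A, X)" "tcm C A" "X \<in> Obj C" using assms by (auto simp: faa_Obj_def)
 interpret A: crc_monoid C A by unfold_locales (rule S)
 show "cube C (powp (mcar (fst S)) n (snd S)) (Ide C (powp (mcar (fst S)) n (snd S))) S (ucube C S n)"
  using proj_pt[OF A.car_Obj S(3)] A.zero_e_pt[OF Ide_pt[OF powprod_Obj[OF A.car_Obj S(3)]]]
  by (auto simp: S(1) cube_def ucube_def Let_def pcube_def)
 show "ucube C S n {} = proj C (mcar (fst S)) n (snd S) n" by (simp add: ucube_def Let_def)
qed

subsection \<open>Arrows that are linear up to a restriction\<close>

definition mhom :: "('o, 'm) cmon => ('o, 'm) cmon => 'm => bool" where
 "mhom A B g \<longleftrightarrow> g \<in> pt C (mcar A) (Ide C (mcar A)) (mcar B) \<and>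
   (\<forall>Z e. \<forall>a\<in>mpt C Z e A. \<forall>b\<in>mpt C Z e A. madd C A a b \<cdot> g = madd C B (a \<cdot> g) (b \<cdot> g)) \<and>
   mzero A \<cdot> g = mzero B"

text \<open>An arrow that is linear with coefficient \<open>g\<close>, cut down to the domain of
  \<open>f\<close>. Identities, restriction idempotents, projections, maps to the terminal object
  and the structure maps of \<delta>(A) all have this form, so a single computation of the action
  serves for all of them.\<close>

definition semilin :: "('o, 'm) faa_obj => ('o, 'm) faa_obj => 'm => 'm => ('o, 'm) faa_arr" where
 "semilin S T f g = FaaArr S T (%n. if n = 0 then f
   else Rst C (proj C (mcar (fst S)) n (snd S) n \<cdot> f) \<cdot>
    (if n = 1 then Pi0 C (mcar (fst S)) (snd S) \<cdot> g
    else zmap (fst T) (powp (mcar (fst S)) n (snd S))))"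

context
 fixes A B :: "('o, 'm) cmon" and X Y :: 'o and f g :: 'm
 assumes A: "tcm C A" and B: "tcm C B"
  and f: "f \<in> Hom C X Y" and g: "mhom A B g"
begin

interpretation A: crc_monoid C A by unfold_locales (rule A)
interpretation B: crc_monoid C B by unfold_locales (rule B)

private abbreviation "L \<equiv> semilin (A, X) (B, Y) f g"
private abbreviation "k n \<equiv> (if n = 1 then Pi0 C (mcar A) X \<cdot> g else zmap B (powp (mcar A) n X))"

private lemma XY: "X \<in> Obj C" "Y \<in> Obj C" using Hom_Obj[OF f] by auto

private lemma g_pt: "g \<in> pt C (mcar A) (Ide C (mcar A)) (mcar B)" using g by (simp add: mhom_def)

private lemma k_pt: "n \<ge> 1 ==> k n \<in> pt C (powp (mcar A) n X) (Ide C (powp (mcar A) n X)) (mcar B)"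
 using pt_Comp[OF Pi0_pt[OF A.car_Obj XY(1)] g_pt] B.zero_pt[OF powprod_Obj[OF A.car_Obj XY(1)], of n] by simp

private lemma L_seq: "n \<ge> 1 ==> faa_seq L n = Rst C (proj C (mcar A) n X n \<cdot> f) \<cdot> k n" "faa_seq L 0 = f"
 by (simp_all add: semilin_def)

private lemma pf: "proj C (mcar A) n X n \<cdot> f \<in> Hom C (powp (mcar A) n X) Y"
 by (rule Comp_Hom[OF ptH[OF proj_pt(2)[OF A.car_Obj XY(1)]] f])

private lemma L_pt: "n \<ge> 1 ==> faa_seq L n \<in> pt C (powp (mcar A) n X) (Rst C (proj C (mcar A) n X n \<cdot> f)) (mcar B)"
 unfolding L_seq(1) by (rule pt_Comp[OF pt_idem(5)[OF ptI[OF pf refl]] k_pt])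

private lemma tup_L:
 assumes zs: "zs \<noteq> []" "set zs \<subseteq> mpt C Z e A" and x: "x \<in> pt C Z e X"
 shows "tup zs x \<cdot> faa_seq L (length zs) =
  Rst C (x \<cdot> f) \<cdot> (if length zs = 1 then hd zs \<cdot> g else zmap B Z)"
proof -
 let ?n = "length zs" and ?u = "tup zs x"
 let ?p = "proj C (mcar A) ?n X ?n"
 have n: "?n \<ge> 1" using zs(1) by (cases zs) auto
 note t = tup_pt[OF zs(2) x] and p = ptH[OF proj_pt(2)[OF A.car_Obj XY(1)]]
 note u = ptH[OF t(1)] and xf = Comp_Hom[OF ptH[OF x] f] and kk = ptH[OF k_pt[OF n]]
 have Z: "Z \<in> Obj C" using Hom_Obj(1)[OF ptH[OF x]] .
 have up: "?u \<cdot> (?p \<cdot> f) = x \<cdot> f" using Comp_assoc[OF u p f] t(3) by simp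
 have "?u \<cdot> faa_seq L ?n = ?u \<cdot> Rst C (?p \<cdot> f) \<cdot> k ?n"
  unfolding L_seq(1)[OF n] by (rule Comp_assoc[OF u Rst_Hom[OF pf] kk, symmetric])
 also have "?u \<cdot> Rst C (?p \<cdot> f) = Rst C (x \<cdot> f) \<cdot> ?u" using R4[OF u pf] up by simp
 also have "Rst C (x \<cdot> f) \<cdot> ?u \<cdot> k ?n = Rst C (x \<cdot> f) \<cdot> (?u \<cdot> k ?n)" by (rule Comp_assoc[OF Rst_Hom[OF xf] u kk])
 also have "... = Rst C (x \<cdot> f) \<cdot> (if ?n = 1 then hd zs \<cdot> g else zmap B Z)"
 proof (cases "?n = 1")
  case True
  then obtain z where z: "zs = [z]" by (auto simp: length_Suc_conv)
  then have z': "z \<in> mpt C Z e A" using zs by simp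
  have "?u \<cdot> k ?n = z \<cdot> g"
   using z Comp_assoc[OF ptH[OF Pairing_pt(1)[OF z' x]] Pi0_Hom[OF A.car_Obj XY(1)] ptH[OF g_pt]] Pairing_pt(2)[OF z' x]
   by simp
  then show ?thesis using True z by simp
 next
  case False
  have "?u \<cdot> k ?n = e \<cdot> zmap B Z" using False B.Comp_zero[OF u] ptD(2)[OF t(1)] by simp
  moreover have "Rst C (x \<cdot> f) \<cdot> e = Rst C (x \<cdot> f)"
   using Rst_Comp_le[OF ptH[OF x] f] R2[OF xf ptH[OF x]] ptD(2)[OF x] by simp
  ultimately show ?thesis
   using False Comp_assoc[OF Rst_Hom[OF xf] pt_idem(1)[OF x] ptH[OF B.zero_pt[OF Z]]] by simp
 qed
 finally show ?thesis .
qed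

lemma semilin_Hom: "semilin (A, X) (B, Y) f g \<in> Hom FC (A, X) (B, Y)"
proof -
 have "FaaArr (A, X) (B, Y) (faa_seq L) \<in> faa_Arr C"
 proof (rule faa_ArrI[OF A B XY(1), where Y = Y])
  show "faa_seq L 0 \<in> Hom C X Y" using f L_seq by simp
  show "faa_seq L n \<in> Hom C (powp (mcar A) n X) (mcar B)"
   "Rst C (faa_seq L n) = Rst C (proj C (mcar A) n X n \<cdot> faa_seq L 0)" if "n \<ge> 1" for n
   using ptD[OF L_pt[OF that]] L_seq by auto
 next
  fix Z e zs zs' x
  assume zs: "zs \<noteq> []" "set zs \<subseteq> mpt C Z e A" and x: "x \<in> pt C Z e X" and m: "mset zs' = mset zs"
  have l: "length zs' = length zs" using m by (metis size_mset)
  have zs': "zs' \<noteq> []" "set zs' \<subseteq> mpt C Z e A" using zs m l by (auto simp flip: set_mset_mset)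
  have "hd zs' = hd zs" if "length zs = 1"
   using that l m by (auto simp: length_Suc_conv)
  then show "tup zs' x \<cdot> faa_seq L (length zs) = tup zs x \<cdot> faa_seq L (length zs)"
   using tup_L[OF zs x] tup_L[OF zs' x] l by auto
 next
  fix Z e zs x a b
  assume zs: "set zs \<subseteq> mpt C Z e A" and x: "x \<in> pt C Z e X" and ab: "a \<in> mpt C Z e A" "b \<in> mpt C Z e A"
  have y: "tup (y # zs) x \<cdot> faa_seq L (Suc (length zs)) = Rst C (x \<cdot> f) \<cdot> (if zs = [] then y \<cdot> g else zmap B Z)"
   if "y \<in> mpt C Z e A" for y
   using tup_L[of "y # zs" Z e x] that zs x by (auto simp del: tup_simps)
  have Z: "Z \<in> Obj C" using Hom_Obj(1)[OF ptH[OF x]] .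
  note r = Rst_Hom[OF Comp_Hom[OF ptH[OF x] f]]
  have "Rst C (x \<cdot> f) \<cdot> madd C B (a \<cdot> g) (b \<cdot> g) = madd C B (Rst C (x \<cdot> f) \<cdot> (a \<cdot> g)) (Rst C (x \<cdot> f) \<cdot> (b \<cdot> g))"
   by (rule B.Comp_add[OF _ _ r]) (use pt_Comp[OF _ g_pt] ab ptD(1) in blast)+
  moreover have "madd C B (Rst C (x \<cdot> f) \<cdot> zmap B Z) (Rst C (x \<cdot> f) \<cdot> zmap B Z) = Rst C (x \<cdot> f) \<cdot> zmap B Z"
   using B.Comp_add[OF ptH[OF B.zero_pt[OF Z]] ptH[OF B.zero_pt[OF Z]] r] B.add_zero[OF ptH[OF B.zero_pt[OF Z]]] by simp
  moreover have "madd C A a b \<cdot> g = madd C B (a \<cdot> g) (b \<cdot> g)" using g ab by (simp add: mhom_def)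
  ultimately show "tup (madd C A a b # zs) x \<cdot> faa_seq L (Suc (length zs)) =
    madd C B (tup (a # zs) x \<cdot> faa_seq L (Suc (length zs))) (tup (b # zs) x \<cdot> faa_seq L (Suc (length zs)))"
   using y[OF A.add_pt[OF ab]] y[OF ab(1)] y[OF ab(2)] by (simp del: tup_simps)
 next
  fix Z e zs x
  assume zs: "set zs \<subseteq> mpt C Z e A" and x: "x \<in> pt C Z e X"
  have Z: "Z \<in> Obj C" using Hom_Obj(1)[OF ptH[OF x]] .
  note r = Rst_Hom[OF Comp_Hom[OF ptH[OF x] f]] and e = pt_idem[OF x]
  have "zmap A Z \<cdot> g = zmap B Z"
   using g Comp_assoc[OF Bang_Hom[OF Z] A.mzero_Hom ptH[OF g_pt]] by (simp add: mhom_def zero_map_def)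
  then have "e \<cdot> zmap A Z \<cdot> g = e \<cdot> zmap B Z"
   using Comp_assoc[OF e(1) ptH[OF A.zero_pt[OF Z]] ptH[OF g_pt]] by simp
  moreover have "Rst C (x \<cdot> f) \<cdot> e = Rst C (x \<cdot> f)"
   using Rst_Comp_le[OF ptH[OF x] f] R2[OF Comp_Hom[OF ptH[OF x] f] ptH[OF x]] ptD(2)[OF x] by simp
  ultimately have "Rst C (x \<cdot> f) \<cdot> (e \<cdot> zmap A Z \<cdot> g) = Rst C (x \<cdot> f) \<cdot> zmap B Z"
   using Comp_assoc[OF r e(1) ptH[OF B.zero_pt[OF Z]]] by simp
  then show "tup (e \<cdot> zmap A Z # zs) x \<cdot> faa_seq L (Suc (length zs)) = Rst C (x \<cdot> faa_seq L 0) \<cdot> zmap B Z"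
   using tup_L[of "e \<cdot> zmap A Z # zs" Z e x] A.zero_e_pt[OF e(5)] zs x L_seq(2)
   by (auto simp del: tup_simps)
 qed
 then show ?thesis by (simp add: Hom_Faa semilin_def)
qed

text \<open>Components of arity two and more are restricted zeros, so only the partition
  \<open>{J}\<close> contributes: each coefficient is treated separately, by \<open>g\<close> and a
  restriction.\<close>

lemma ev_semilin:
 assumes c: "cube C Z e (A, X) c" and J: "finite J" "J \<noteq> {}"
 shows "ev C (semilin (A, X) (B, Y) f g) c J = Rst C (c {} \<cdot> f) \<cdot> (c J \<cdot> g)"
proof -
 interpret L: faa_arrow C L A X B Y by (rule faa_arrowI[OF semilin_Hom])
 note x = L.cube_base(1)[OF c]
 let ?M = "ptmon C B Z (Rst C (c {} \<cdot> f))"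
 interpret S: symadd "ptmon C A Z e" ?M "papp C L (c {})" using L.symadd[OF x] by (simp add: L_seq(2))
 have tc: "papp C L (c {}) (image_mset c (mset_set P)) = (if P = {J} then Rst C (c {} \<cdot> f) \<cdot> (c J \<cdot> g) else \<one>\<^bsub>?M\<^esub>)"
  if P: "P \<in> parts J" for P
 proof -
  obtain l where l: "distinct l" "set l = P" using finite_distinct_list[OF partsD(2)[OF P]] by blast
  have ne: "P \<noteq> {}" by (rule parts_nonempty[OF P J(2)])
  have zs: "set (map c l) \<subseteq> mpt C Z e A" "map c l \<noteq> []"
  proof -
   have "c b \<in> mpt C Z e A" if "b \<in> P" for b
    using L.cube_base(2)[OF c, of b] partsD(4)[OF P] that by metis
   then show "set (map c l) \<subseteq> mpt C Z e A" "map c l \<noteq> []" using l ne by auto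
  qed
  have "image_mset c (mset_set P) = mset (map c l)" using mset_set_set[OF l(1)] l(2) by simp
  then have eq: "papp C L (c {}) (image_mset c (mset_set P)) =
    Rst C (c {} \<cdot> f) \<cdot> (if length l = 1 then hd (map c l) \<cdot> g else zmap B Z)"
   using L.papp_mset[OF zs(1) x] tup_L[OF zs(2,1) x] by simp
  have "length l = 1 \<longleftrightarrow> P = {J}"
  proof
   assume "length l = 1"
   then obtain b where "l = [b]" by (auto simp: length_Suc_conv)
   then show "P = {J}" using l partsD(3)[OF P] by auto
  next
   assume "P = {J}"
   then show "length l = 1" using l distinct_card[OF l(1)] by simp
  qed
  moreover have "hd (map c l) = c J" if "P = {J}" "length l = 1"
   using that l by (auto simp: length_Suc_conv)
  ultimately show ?thesis using eq by auto
 qed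
 have term0: "Rst C (c {} \<cdot> f) \<cdot> (c J \<cdot> g) \<in> carrier ?M"
  using S.pev_term_closed[OF L.cube_fam'[OF c] J(2) parts_top[OF J]] tc[OF parts_top[OF J]] by simp
 have "ev C L c J = pev ?M (papp C L (c {})) c J" using L.ev_pev[OF c J(2)] by (simp add: L_seq(2))
 also have "... = finprod ?M (%P. Rst C (c {} \<cdot> f) \<cdot> (c J \<cdot> g)) {{J}}"
  unfolding pev_def
  by (rule S.H.finprod_mono_neutral_cong_right)
   (use tc tc[OF parts_top[OF J]] term0 parts_top[OF J] S.H.one_closed in "auto simp: finite_parts")
 also have "... = Rst C (c {} \<cdot> f) \<cdot> (c J \<cdot> g)"
  using S.H.finprod_insert[of "{}" "{J}" "%P. Rst C (c {} \<cdot> f) \<cdot> (c J \<cdot> g)"] term0 S.H.r_one[OF term0] by simp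
 finally show ?thesis .
qed

lemma ev_semilin_total:
 assumes "f \<in> pt C X (Ide C X) Y" and c: "cube C Z e (A, X) c" and J: "finite J" "J \<noteq> {}"
 shows "ev C (semilin (A, X) (B, Y) f g) c J = c J \<cdot> g"
proof -
 have x: "c {} \<in> pt C Z e X" "c J \<in> mpt C Z e A" using cubeD[OF c] J by auto
 have "Rst C (c {} \<cdot> f) = e" using ptD(2)[OF pt_Comp[OF x(1) assms(1)]] .
 then show ?thesis
  using ev_semilin[OF c J] pt_idem(4)[OF pt_Comp[OF x(2) g_pt]] by simp
qed

lemma faa_linear_semilin:
 assumes "f \<in> pt C X (Ide C X) Y"
 shows "faa_linear C (A, X) (B, Y) f (Pi0 C (mcar A) X \<cdot> g) = semilin (A, X) (B, Y) f g"
proof -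
 have "Rst C (proj C (mcar A) n X n \<cdot> f) \<cdot> k n = k n" if n: "n \<ge> 1" for n
  using ptD(2)[OF pt_Comp[OF proj_pt(2)[OF A.car_Obj XY(1), of n] assms]] Ide_Comp[OF ptH[OF k_pt[OF n]]] by simp
 then have "(if n = 0 then f else if n = 1 then Pi0 C (mcar A) X \<cdot> g else zmap B (powp (mcar A) n X)) =
   (if n = 0 then f else Rst C (proj C (mcar A) n X n \<cdot> f) \<cdot> k n)" for n
  by (cases "n = 0") auto
 then show ?thesis unfolding faa_linear_def semilin_def fst_conv snd_conv by presburger
qed

end

section \<open>Identities and restrictions as semilinear arrows\<close>

lemma mhom_Ide:
 assumes "tcm C A"
 shows "mhom A A (Ide C (mcar A))"
proof -
 interpret A: crc_monoid C A by unfold_locales (rule assms)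
 show ?thesis
  using Ide_pt[OF A.car_Obj] Comp_Ide[OF ptD(1)] A.add_pt Comp_Ide[OF A.mzero_Hom] unfolding mhom_def by metis
qed

lemma faa_Ide_semilin:
 assumes "tcm C A" "X \<in> Obj C"
 shows "faa_Ide C (A, X) = semilin (A, X) (A, X) (Ide C X) (Ide C (mcar A))"
 using faa_linear_semilin[OF assms(1,1) Ide_Hom[OF assms(2)] mhom_Ide[OF assms(1)] Ide_pt[OF assms(2)]]
  Comp_Ide[OF Pi0_Hom[OF total_comm_monoidD(1)[OF assms(1)] assms(2)]]
 by (simp add: faa_Ide_def)

lemma faa_Rst_semilin:
 assumes "F \<in> Hom FC (A, X) (B, Y)"
 shows "faa_Rst C F = semilin (A, X) (A, X) (Rst C (faa_seq F 0)) (Ide C (mcar A))"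
proof -
 interpret F: faa_arrow C F A X B Y by (rule faa_arrowI[OF assms])
 have "Rst C (proj C (mcar A) n X n \<cdot> Rst C (faa_seq F 0)) = Rst C (proj C (mcar A) n X n \<cdot> faa_seq F 0)" for n
  by (rule Rst_Comp[OF ptH[OF proj_pt(2)[OF F.A.car_Obj F.objs(2)]] F.f0])
 then show ?thesis
  using Comp_Ide[OF Pi0_Hom[OF F.A.car_Obj F.objs(2)]] by (auto simp: faa_Rst_def semilin_def Let_def fun_eq_iff)
qed

lemma Faa_Rst_Hom:
 assumes "F \<in> Hom FC S T"
 shows "faa_Rst C F \<in> Hom FC S S"
proof -
 obtain A X B Y where ST: "S = (A, X)" "T = (B, Y)" and F: "faa_arrow C F A X B Y"
  using Faa_arrow_cases[OF assms] .
 interpret F: faa_arrow C F A X B Y by (rule F)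
 show ?thesis
  unfolding faa_Rst_semilin[OF F.arr] ST
  by (rule semilin_Hom[OF F.objs(1,1) Rst_Hom[OF F.f0] mhom_Ide[OF F.objs(1)]])
qed

lemma Faa_Rst_0: "faa_seq (faa_Rst C F) 0 = Rst C (faa_seq F 0)"
 by (simp add: faa_Rst_def Let_def)

text \<open>All components of a restriction are determined by its source and the domain of the base
  map.\<close>

lemma Faa_Rst_eq:
 assumes "F \<in> Hom FC S T" "G \<in> Hom FC S U" "Rst C (faa_seq F 0) = Rst C (faa_seq G 0)"
 shows "faa_Rst C F = faa_Rst C G"
 using assms faa_Rst_semilin by (cases S; cases T; cases U) metis

lemma ev_faa_Rst:
 assumes "F \<in> Hom FC S T" and c: "cube C Z e S c" and J: "finite J"
 shows "ev C (faa_Rst C F) c J = Rst C (c {} \<cdot> faa_seq F 0) \<cdot> c J"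
proof -
 obtain A X B Y where ST: "S = (A, X)" "T = (B, Y)" and F: "faa_arrow C F A X B Y"
  using Faa_arrow_cases[OF assms(1)] .
 interpret F: faa_arrow C F A X B Y by (rule F)
 have c': "cube C Z e (A, X) c" using c ST by simp
 note x = ptH[OF F.cube_base(1)[OF c']]
 show ?thesis
 proof (cases "J = {}")
  case True
  then show ?thesis using R4[OF x F.f0] by (simp add: ev_def Faa_Rst_0)
 next
  case False
  have "Rst C (c {} \<cdot> Rst C (faa_seq F 0)) = Rst C (c {} \<cdot> faa_seq F 0)" by (rule Rst_Comp[OF x F.f0])
  then show ?thesis
   unfolding faa_Rst_semilin[OF F.arr]
   using ev_semilin[OF F.objs(1,1) Rst_Hom[OF F.f0] mhom_Ide[OF F.objs(1)] c' J False]
    Comp_Ide[OF ptH[OF F.cube_base(2)[OF c' False]]] by simp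
 qed
qed

lemma ev_faa_Ide:
 assumes "S \<in> FObj" and c: "cube C Z e S c" and J: "finite J"
 shows "ev C (faa_Ide C S) c J = c J"
proof -
 obtain A X where S: "S = (A, X)" "tcm C A" "X \<in> Obj C" using assms by (auto simp: faa_Obj_def)
 have c': "cube C Z e (A, X) c" using c S by simp
 show ?thesis
 proof (cases "J = {}")
  case True
  then show ?thesis
   using cubeD(1)[OF c'] Comp_Ide[OF ptD(1)] by (simp add: ev_def S faa_Ide_def faa_linear_def)
 next
  case False
  show ?thesis
   unfolding S(1) faa_Ide_semilin[OF S(2,3)]
   using ev_semilin_total[OF S(2,2) Ide_Hom[OF S(3)] mhom_Ide[OF S(2)] Ide_pt[OF S(3)] c' J False]
    cubeD(2)[OF c' False] Comp_Ide[OF ptD(1)] by simp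
 qed
qed

lemma Faa_Ide_Hom: "S \<in> FObj ==> faa_Ide C S \<in> Hom FC S S"
 using semilin_Hom[OF _ _ Ide_Hom mhom_Ide] faa_Ide_semilin by (cases S) (simp add: faa_Obj_def)

section \<open>The category and restriction axioms\<close>

lemma Faa_category: "category FC"
proof
 show "Dom FC f \<in> Obj FC" "Cod FC f \<in> Obj FC" if "f \<in> Arr FC" for f
  using that Faa_Objs[of f "faa_src f" "faa_tgt f"] by (simp_all add: Hom_Faa)
 show "Ide FC X \<in> Hom FC X X" if "X \<in> Obj FC" for X using Faa_Ide_Hom that by simp
 show c: "f \<star> g \<in> Hom FC X Z" if "f \<in> Hom FC X Y" "g \<in> Hom FC Y Z" for f g X Y Z
  using Faa_Comp_Hom that by simp
 show "Ide FC X \<star> f = f" if f: "f \<in> Hom FC X Y" for f X Y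
 proof (rule faa_eqI[OF _ f])
  note I = Faa_Ide_Hom[OF Faa_Objs(1)[OF f]]
  show "Ide FC X \<star> f \<in> Hom FC X Y" using Faa_Comp_Hom[OF I f] by simp
  fix Z e and c :: "nat set => 'm" and J :: "nat set" assume c: "cube C Z e X c" and J: "finite J"
  have "ev C (FComp (faa_Ide C X) f) c J = ev C f (ev C (faa_Ide C X) c) J" by (rule Faa_ev_Comp[OF I f c J])
  also have "... = ev C f c J"
   by (rule Faa_ev_cong[OF f c]) (use ev_faa_Ide[OF Faa_Objs(1)[OF f] c] in auto)
  finally show "ev C (Ide FC X \<star> f) c J = ev C f c J" by simp
 qed
 show "f \<star> Ide FC Y = f" if f: "f \<in> Hom FC X Y" for f X Y
 proof (rule faa_eqI[OF _ f])
  note I = Faa_Ide_Hom[OF Faa_Objs(2)[OF f]]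
  show "f \<star> Ide FC Y \<in> Hom FC X Y" using Faa_Comp_Hom[OF f I] by simp
  fix Z e and c :: "nat set => 'm" and J :: "nat set" assume c: "cube C Z e X c" and J: "finite J"
  show "ev C (f \<star> Ide FC Y) c J = ev C f c J"
   using Faa_ev_Comp[OF f I c J] ev_faa_Ide[OF Faa_Objs(2)[OF f] Faa_ev_cube[OF f c] J] by simp
 qed
 show "f \<star> g \<star> h = f \<star> (g \<star> h)"
  if f: "f \<in> Hom FC W X" and g: "g \<in> Hom FC X Y" and h: "h \<in> Hom FC Y Z" for f g h W X Y Z
 proof (rule faa_eqI)
  note fg = Faa_Comp_Hom[OF f g] and gh = Faa_Comp_Hom[OF g h]
  show "f \<star> g \<star> h \<in> Hom FC W Z" "f \<star> (g \<star> h) \<in> Hom FC W Z"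
   using Faa_Comp_Hom[OF fg h] Faa_Comp_Hom[OF f gh] by simp_all
  fix V e and c :: "nat set => 'm" and J :: "nat set" assume c: "cube C V e W c" and J: "finite J"
  have "ev C (FComp (FComp f g) h) c J = ev C h (ev C (FComp f g) c) J" by (rule Faa_ev_Comp[OF fg h c J])
  also have "... = ev C h (ev C g (ev C f c)) J"
   by (rule Faa_ev_cong[OF h Faa_ev_cube[OF g Faa_ev_cube[OF f c]]]) (use Faa_ev_Comp[OF f g c] in auto)
  also have "... = ev C (FComp g h) (ev C f c) J" by (rule Faa_ev_Comp[OF g h Faa_ev_cube[OF f c] J, symmetric])
  also have "... = ev C (FComp f (FComp g h)) c J" by (rule Faa_ev_Comp[OF f gh c J, symmetric])
  finally show "ev C (f \<star> g \<star> h) c J = ev C (f \<star> (g \<star> h)) c J" by simp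
 qed
qed

lemma cube_dom: "F \<in> Hom FC S T ==> cube C Z e S c ==> c {} \<cdot> faa_seq F 0 \<in> Hom C Z (snd T)"
 using Comp_Hom[OF ptH[OF cubeD(1)] Faa_0] by blast

text \<open>The restriction of \<open>F\<close> acts on a cube by restricting all its entries, so the restriction axioms
 reduce to those of \<open>C\<close>.\<close>

lemma Faa_restriction_category: "restriction_category FC"
proof (intro restriction_category.intro Faa_category restriction_category_axioms.intro)
 show "Rst FC f \<in> Hom FC X X" if "f \<in> Hom FC X Y" for f X Y using Faa_Rst_Hom[OF that] by simp
next
 fix f X Y assume f: "f \<in> Hom FC X Y"
 note r = Faa_Rst_Hom[OF f]
 show "Rst FC f \<star> f = f"
 proof (rule faa_eqI[OF _ f])
  show "Rst FC f \<star> f \<in> Hom FC X Y" using Faa_Comp_Hom[OF r f] by simp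
  fix Z e and c :: "nat set => 'm" and J :: "nat set" assume c: "cube C Z e X c" and J: "finite J"
  note d = cube_dom[OF f c]
  let ?d = "Rst C (c {} \<cdot> faa_seq f 0)"
  have "ev C (FComp (faa_Rst C f) f) c J = ev C f (ev C (faa_Rst C f) c) J" by (rule Faa_ev_Comp[OF r f c J])
  \<comment> \<open>Restricting all entries of a cube to \<open>?d\<close> is a change of stage
    along \<open>?d\<close>. So \<open>?d\<close> comes out of the evaluation, where it is absorbed
    because the value has exactly this domain.\<close>
  also have "... = ev C f (%B. ?d \<cdot> c B) J"
  proof (rule Faa_ev_cong[OF f])
   show "cube C Z (Rst C (?d \<cdot> e)) X (%B. ?d \<cdot> c B)"
    using precomp_pt[OF Rst_Hom[OF d]] cubeD[OF c] unfolding cube_def by blast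
  qed (use ev_faa_Rst[OF f c] in auto)
  also have "... = ?d \<cdot> ev C f c J" by (rule Faa_ev_precomp[OF f c Rst_Hom[OF d], symmetric])
  also have "... = ev C f c J"
   using cubeD[OF Faa_ev_cube[OF f c]] pt_idem(4) by (cases "J = {}") blast+
  finally show "ev C (Rst FC f \<star> f) c J = ev C f c J" by simp
 qed
next
 \<comment> \<open>Two restrictions in succession restrict every entry to the product of the two
   domains. By \<open>R2\<close> this is symmetric in \<open>f\<close> and \<open>g\<close>, and by
   \<open>R3\<close> it is the domain occurring in the third axiom.\<close>
 have key: "ev C (FComp (faa_Rst C f) (faa_Rst C g)) c J =
   (Rst C (c {} \<cdot> faa_seq f 0) \<cdot> Rst C (c {} \<cdot> faa_seq g 0)) \<cdot> c J"
  if f: "f \<in> Hom FC X Y" and g: "g \<in> Hom FC X V" and c: "cube C Z e X c" and J: "finite J"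
  for f g X Y V Z e and c :: "nat set => 'm" and J
 proof -
  note rf = Faa_Rst_Hom[OF f] and rg = Faa_Rst_Hom[OF g]
  let ?df = "Rst C (c {} \<cdot> faa_seq f 0)" and ?dg = "Rst C (c {} \<cdot> faa_seq g 0)"
  note d = cube_dom[OF f c] cube_dom[OF g c]
  have cJ: "\<exists>W. c J \<in> Hom C Z W" using cubeD[OF c] ptD(1) by metis
  have c0: "c {} \<in> Hom C Z (snd X)" using cubeD(1)[OF c] ptD(1) by blast
  have "ev C (FComp (faa_Rst C f) (faa_Rst C g)) c J = ev C (faa_Rst C g) (ev C (faa_Rst C f) c) J"
   by (rule Faa_ev_Comp[OF rf rg c J])
  also have "... = Rst C (ev C (faa_Rst C f) c {} \<cdot> faa_seq g 0) \<cdot> ev C (faa_Rst C f) c J"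
   by (rule ev_faa_Rst[OF g Faa_ev_cube[OF rf c] J])
  also have "... = Rst C (?df \<cdot> c {} \<cdot> faa_seq g 0) \<cdot> (?df \<cdot> c J)"
   using ev_faa_Rst[OF f c] J by simp
  also have "Rst C (?df \<cdot> c {} \<cdot> faa_seq g 0) = ?df \<cdot> ?dg"
   using R3[OF d] Comp_assoc[OF Rst_Hom[OF d(1)] c0 Faa_0[OF g]] by simp
  also have "?df \<cdot> ?dg \<cdot> (?df \<cdot> c J) = (?df \<cdot> ?dg \<cdot> ?df) \<cdot> c J"
   using cJ Comp_assoc[OF Comp_Hom[OF Rst_Hom[OF d(1)] Rst_Hom[OF d(2)]] Rst_Hom[OF d(1)]] by fastforce
  also have "?df \<cdot> ?dg \<cdot> ?df = ?df \<cdot> ?dg"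
   using R2[OF d] Comp_assoc[OF Rst_Hom[OF d(2)] Rst_Hom[OF d(1)] Rst_Hom[OF d(1)]] Rst_idem[OF d(1)] by simp
  finally show ?thesis .
 qed
 fix f g X Y Z assume f: "f \<in> Hom FC X Y" and g: "g \<in> Hom FC X Z"
 note rf = Faa_Rst_Hom[OF f] and rg = Faa_Rst_Hom[OF g]
 show "Rst FC f \<star> Rst FC g = Rst FC g \<star> Rst FC f"
 proof (rule faa_eqI)
  show "Rst FC f \<star> Rst FC g \<in> Hom FC X X" "Rst FC g \<star> Rst FC f \<in> Hom FC X X"
   using Faa_Comp_Hom[OF rf rg] Faa_Comp_Hom[OF rg rf] by simp_all
  fix V e and c :: "nat set => 'm" and J :: "nat set" assume c: "cube C V e X c" and J: "finite J"
  show "ev C (Rst FC f \<star> Rst FC g) c J = ev C (Rst FC g \<star> Rst FC f) c J"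
   using key[OF f g c J] key[OF g f c J] R2[OF cube_dom[OF f c] cube_dom[OF g c]] by simp
 qed
 show "Rst FC (Rst FC f \<star> g) = Rst FC f \<star> Rst FC g"
 proof (rule faa_eqI)
  note rfg = Faa_Comp_Hom[OF rf g]
  show "Rst FC (Rst FC f \<star> g) \<in> Hom FC X X" "Rst FC f \<star> Rst FC g \<in> Hom FC X X"
   using Faa_Comp_Hom[OF rf rg] Faa_Rst_Hom[OF rfg] by simp_all
  fix V e and c :: "nat set => 'm" and J :: "nat set" assume c: "cube C V e X c" and J: "finite J"
  have c0: "c {} \<in> Hom C V (snd X)" using cubeD(1)[OF c] ptD(1) by blast
  note d = cube_dom[OF f c] cube_dom[OF g c] and f0 = Faa_0[OF f] and g0 = Faa_0[OF g]
  have "c {} \<cdot> (Rst C (faa_seq f 0) \<cdot> faa_seq g 0) = Rst C (c {} \<cdot> faa_seq f 0) \<cdot> (c {} \<cdot> faa_seq g 0)"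
   using Comp_assoc[OF c0 Rst_Hom[OF f0] g0] R4[OF c0 f0] Comp_assoc[OF Rst_Hom[OF d(1)] c0 g0] by simp
  then have "Rst C (c {} \<cdot> faa_seq (FComp (faa_Rst C f) g) 0) = Rst C (c {} \<cdot> faa_seq f 0) \<cdot> Rst C (c {} \<cdot> faa_seq g 0)"
   using R3[OF d] by (simp add: Faa_Comp_0 Faa_Rst_0)
  then show "ev C (Rst FC (Rst FC f \<star> g)) c J = ev C (Rst FC f \<star> Rst FC g) c J"
   using key[OF f g c J] ev_faa_Rst[OF rfg c J] by simp
 qed
next
 fix f g X Y Z assume f: "f \<in> Hom FC X Y" and g: "g \<in> Hom FC Y Z"
 note fg = Faa_Comp_Hom[OF f g] and rg = Faa_Rst_Hom[OF g]
 note rfg = Faa_Rst_Hom[OF fg]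
 show "f \<star> Rst FC g = Rst FC (f \<star> g) \<star> f"
 proof (rule faa_eqI)
  show "f \<star> Rst FC g \<in> Hom FC X Y" "Rst FC (f \<star> g) \<star> f \<in> Hom FC X Y"
   using Faa_Comp_Hom[OF f rg] Faa_Comp_Hom[OF rfg f] by simp_all
  fix V e and c :: "nat set => 'm" and J :: "nat set" assume c: "cube C V e X c" and J: "finite J"
  have c0: "c {} \<in> Hom C V (snd X)" using cubeD(1)[OF c] ptD(1) by blast
  note d = cube_dom[OF fg c]
  let ?d = "Rst C (c {} \<cdot> faa_seq (FComp f g) 0)"
  have "ev C (FComp f (faa_Rst C g)) c J = Rst C (ev C f c {} \<cdot> faa_seq g 0) \<cdot> ev C f c J"
   using Faa_ev_Comp[OF f rg c J] ev_faa_Rst[OF g Faa_ev_cube[OF f c] J] by simp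
  also have "Rst C (ev C f c {} \<cdot> faa_seq g 0) = ?d"
   using Comp_assoc[OF c0 Faa_0[OF f] Faa_0[OF g]] by (simp add: ev_def Faa_Comp_0)
  also have "?d \<cdot> ev C f c J = ev C f (%B. ?d \<cdot> c B) J" by (rule Faa_ev_precomp[OF f c Rst_Hom[OF d]])
  also have "... = ev C f (ev C (faa_Rst C (FComp f g)) c) J"
   by (rule Faa_ev_cong[OF f Faa_ev_cube[OF rfg c]]) (use ev_faa_Rst[OF fg c] in auto)
  also have "... = ev C (FComp (faa_Rst C (FComp f g)) f) c J" by (rule Faa_ev_Comp[OF rfg f c J, symmetric])
  finally show "ev C (f \<star> Rst FC g) c J = ev C (Rst FC (f \<star> g) \<star> f) c J" by simp
 qed
qed

end

context cartesian_restriction_category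
begin

subsection \<open>Products of monoids\<close>

text \<open>The axioms are equations for projections and identities, which are total, so the laws at
  total points imply them.\<close>

lemma total_comm_monoidI:
 assumes "mcar A \<in> Obj C"
  and plus: "mplus A \<in> pt C (Prod C (mcar A) (mcar A)) (Ide C (Prod C (mcar A) (mcar A))) (mcar A)"
  and zero: "mzero A \<in> pt C (Unit C) (Ide C (Unit C)) (mcar A)"
  and "!!Z a b c. a \<in> mpt C Z (Ide C Z) A ==> b \<in> mpt C Z (Ide C Z) A ==> c \<in> mpt C Z (Ide C Z) A ==>
   madd C A (madd C A a b) c = madd C A a (madd C A b c)"
  and "!!Z a b. a \<in> mpt C Z (Ide C Z) A ==> b \<in> mpt C Z (Ide C Z) A ==> madd C A a b = madd C A b a"
  and "!!Z a. a \<in> mpt C Z (Ide C Z) A ==> madd C A a (zmap A Z) = a"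
 shows "tcm C A"
proof -
 have "proj C (mcar A) 2 (mcar A) i \<in> pt C (powp (mcar A) 2 (mcar A)) (Ide C (powp (mcar A) 2 (mcar A))) (mcar A)" if "i \<le> 2" for i
  using proj_pt(1)[OF assms(1,1), of i 2] proj_pt(2)[OF assms(1,1), of 2] that by (cases "i = 2") auto
 note p = this[of 0, simplified] this[of 1, simplified] this[of 2, simplified]
 show ?thesis
  unfolding total_comm_monoid_def Let_def
  using assms(1) ptH[OF plus] ptH[OF zero] total_map_iff[OF ptH[OF plus]] total_map_iff[OF ptH[OF zero]] plus zero
   assms(4)[OF p] assms(5)[OF Pi0_pt Pi1_pt] assms(6)[OF Ide_pt] by simp
qed

lemma pt_Unit_eq: "f \<in> pt C Z e (Unit C) ==> g \<in> pt C Z e (Unit C) ==> f = g"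
 using Unit_eq[of f Z g] ptD[of f Z e "Unit C"] ptD[of g Z e "Unit C"] by simp

lemma unit_cmon: "tcm C (unit_cmon C)"
proof (rule total_comm_monoidI)
 let ?U = "unit_cmon C"
 show U: "mcar ?U \<in> Obj C" by (simp add: unit_cmon_def Unit_Obj)
 show plus: "mplus ?U \<in> pt C (Prod C (mcar ?U) (mcar ?U)) (Ide C (Prod C (mcar ?U) (mcar ?U))) (mcar ?U)"
  using Bang_pt[OF Prod_Obj[OF Unit_Obj Unit_Obj]] by (simp add: unit_cmon_def)
 show zero: "mzero ?U \<in> pt C (Unit C) (Ide C (Unit C)) (mcar ?U)"
  using Bang_pt[OF Unit_Obj] by (simp add: unit_cmon_def)
 have eq: "x = y" if "x \<in> pt C Z e (mcar ?U)" "y \<in> pt C Z e (mcar ?U)" for x y Z e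
  using pt_Unit_eq that by (simp add: unit_cmon_def)
 have add: "madd C ?U a b \<in> pt C Z e (mcar ?U)" if "a \<in> pt C Z e (mcar ?U)" "b \<in> pt C Z e (mcar ?U)" for a b Z e
  unfolding madd_def by (rule pt_Comp[OF Pairing_pt(1)[OF that] plus])
 have z: "zmap ?U Z \<in> pt C Z (Ide C Z) (mcar ?U)" if "Z \<in> Obj C" for Z
  unfolding zero_map_def by (rule pt_Comp[OF Bang_pt[OF that] zero])
 fix Z a b c assume a: "a \<in> pt C Z (Ide C Z) (mcar ?U)"
 show "madd C ?U a (zmap ?U Z) = a"
  by (rule eq[OF add[OF a z] a]) (rule Hom_Obj(1)[OF ptH[OF a]])
 assume b: "b \<in> pt C Z (Ide C Z) (mcar ?U)"
 show "madd C ?U a b = madd C ?U b a" by (rule eq[OF add[OF a b] add[OF b a]])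
 assume c: "c \<in> pt C Z (Ide C Z) (mcar ?U)"
 show "madd C ?U (madd C ?U a b) c = madd C ?U a (madd C ?U b c)"
  by (rule eq[OF add[OF add[OF a b] c] add[OF a add[OF b c]]])
qed

context
 fixes A B :: "('o, 'm) cmon"
 assumes A: "tcm C A" and B: "tcm C B"
begin

interpretation A: crc_monoid C A by unfold_locales (rule A)
interpretation B: crc_monoid C B by unfold_locales (rule B)

lemma mcar_prod [simp]: "mcar (prod_cmon C A B) = Prod C (mcar A) (mcar B)"
 by (simp add: prod_cmon_def Let_def)

lemma prod_plus_pt:
 "mplus (prod_cmon C A B) \<in> pt C (Prod C (Prod C (mcar A) (mcar B)) (Prod C (mcar A) (mcar B)))
   (Ide C (Prod C (Prod C (mcar A) (mcar B)) (Prod C (mcar A) (mcar B)))) (Prod C (mcar A) (mcar B))"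
proof -
 note P = Prod_Obj[OF A.car_Obj B.car_Obj]
 note pq = Pi0_pt[OF P P] Pi1_pt[OF P P] and lr = Pi0_pt[OF A.car_Obj B.car_Obj] Pi1_pt[OF A.car_Obj B.car_Obj]
 show ?thesis
  unfolding prod_cmon_def Let_def cmon.sel
  by (rule Pairing_pt(1)[OF A.add_pt[OF pt_Comp[OF pq(1) lr(1)] pt_Comp[OF pq(2) lr(1)]]
     B.add_pt[OF pt_Comp[OF pq(1) lr(2)] pt_Comp[OF pq(2) lr(2)]]])
qed

lemma madd_prod:
 assumes x: "x \<in> pt C Z e (Prod C (mcar A) (mcar B))" and y: "y \<in> pt C Z e (Prod C (mcar A) (mcar B))"
 shows "madd C (prod_cmon C A B) x y =
  Pairing C (madd C A (x \<cdot> Pi0 C (mcar A) (mcar B)) (y \<cdot> Pi0 C (mcar A) (mcar B)))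
   (madd C B (x \<cdot> Pi1 C (mcar A) (mcar B)) (y \<cdot> Pi1 C (mcar A) (mcar B)))"
proof -
 note P = Prod_Obj[OF A.car_Obj B.car_Obj]
 note pq = Pi0_Hom[OF P P] Pi1_Hom[OF P P] and lr = Pi0_Hom[OF A.car_Obj B.car_Obj] Pi1_Hom[OF A.car_Obj B.car_Obj]
 note xy = Pairing_pt[OF x y]
 note u = ptH[OF xy(1)]
 have "Pairing C x y \<cdot> (Pi0 C (Prod C (mcar A) (mcar B)) (Prod C (mcar A) (mcar B)) \<cdot> l) = x \<cdot> l"
  "Pairing C x y \<cdot> (Pi1 C (Prod C (mcar A) (mcar B)) (Prod C (mcar A) (mcar B)) \<cdot> l) = y \<cdot> l"
  if "l \<in> Hom C (Prod C (mcar A) (mcar B)) W" for l W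
  using Comp_assoc[OF u pq(1) that] Comp_assoc[OF u pq(2) that] xy by auto
 note c = this[OF lr(1)] this[OF lr(2)]
 have "madd C (prod_cmon C A B) x y = Pairing C x y \<cdot> mplus (prod_cmon C A B)"
  by (simp add: madd_def)
 then show ?thesis
  unfolding prod_cmon_def Let_def cmon.sel
  using Comp_Pairing[OF u A.add_Hom[OF Comp_Hom[OF pq(1) lr(1)] Comp_Hom[OF pq(2) lr(1)]] B.add_Hom[OF Comp_Hom[OF pq(1) lr(2)] Comp_Hom[OF pq(2) lr(2)]]]
   A.Comp_add[OF Comp_Hom[OF pq(1) lr(1)] Comp_Hom[OF pq(2) lr(1)] u] B.Comp_add[OF Comp_Hom[OF pq(1) lr(2)] Comp_Hom[OF pq(2) lr(2)] u] c
  by simp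
qed

lemma zero_map_prod: "Z \<in> Obj C ==> zmap (prod_cmon C A B) Z = Pairing C (zmap A Z) (zmap B Z)"
 using Comp_Pairing[OF Bang_Hom A.mzero_Hom B.mzero_Hom] by (simp add: zero_map_def prod_cmon_def Let_def)

lemma madd_prod_Pi:
 assumes x: "x \<in> pt C Z e (Prod C (mcar A) (mcar B))" and y: "y \<in> pt C Z e (Prod C (mcar A) (mcar B))"
 shows "madd C (prod_cmon C A B) x y \<cdot> Pi0 C (mcar A) (mcar B) = madd C A (x \<cdot> Pi0 C (mcar A) (mcar B)) (y \<cdot> Pi0 C (mcar A) (mcar B))"
  "madd C (prod_cmon C A B) x y \<cdot> Pi1 C (mcar A) (mcar B) = madd C B (x \<cdot> Pi1 C (mcar A) (mcar B)) (y \<cdot> Pi1 C (mcar A) (mcar B))"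
  "madd C (prod_cmon C A B) x y \<in> pt C Z e (Prod C (mcar A) (mcar B))"
proof -
 note lr = Pi0_pt[OF A.car_Obj B.car_Obj] Pi1_pt[OF A.car_Obj B.car_Obj]
 note p = Pairing_pt[OF A.add_pt[OF pt_Comp[OF x lr(1)] pt_Comp[OF y lr(1)]] B.add_pt[OF pt_Comp[OF x lr(2)] pt_Comp[OF y lr(2)]]]
 show "madd C (prod_cmon C A B) x y \<cdot> Pi0 C (mcar A) (mcar B) = madd C A (x \<cdot> Pi0 C (mcar A) (mcar B)) (y \<cdot> Pi0 C (mcar A) (mcar B))"
  "madd C (prod_cmon C A B) x y \<cdot> Pi1 C (mcar A) (mcar B) = madd C B (x \<cdot> Pi1 C (mcar A) (mcar B)) (y \<cdot> Pi1 C (mcar A) (mcar B))"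
  "madd C (prod_cmon C A B) x y \<in> pt C Z e (Prod C (mcar A) (mcar B))"
  unfolding madd_prod[OF x y] by (rule p(2), rule p(3), rule p(1))
qed

lemma prod_cmon: "tcm C (prod_cmon C A B)"
proof (rule total_comm_monoidI; (unfold mcar_prod)?)
 let ?AB = "prod_cmon C A B" and ?P = "Prod C (mcar A) (mcar B)"
 let ?l = "Pi0 C (mcar A) (mcar B)" and ?r = "Pi1 C (mcar A) (mcar B)"
 note lr = Pi0_pt[OF A.car_Obj B.car_Obj] Pi1_pt[OF A.car_Obj B.car_Obj]
 have ext: "x = y" if "x \<in> pt C Z e ?P" "y \<in> pt C Z e ?P" "x \<cdot> ?l = y \<cdot> ?l" "x \<cdot> ?r = y \<cdot> ?r" for x y Z e
  by (rule Pairing_ext[OF ptH[OF that(1)] ptH[OF that(2)] A.car_Obj B.car_Obj that(3,4)])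
 show "?P \<in> Obj C" by (rule Prod_Obj[OF A.car_Obj B.car_Obj])
 show "mplus ?AB \<in> pt C (Prod C ?P ?P) (Ide C (Prod C ?P ?P)) ?P" by (rule prod_plus_pt)
 show "mzero ?AB \<in> pt C (Unit C) (Ide C (Unit C)) ?P"
  using Pairing_pt(1)[OF A.mzero_pt B.mzero_pt] by (simp add: prod_cmon_def Let_def)
 fix Z a b c assume a: "a \<in> pt C Z (Ide C Z) ?P"
 note al = pt_Comp[OF a lr(1)] and ar = pt_Comp[OF a lr(2)]
 have Z: "Z \<in> Obj C" by (rule Hom_Obj(1)[OF ptH[OF a]])
 note z = Pairing_pt[OF A.zero_pt[OF Z] B.zero_pt[OF Z]]
 show "madd C ?AB a (zmap ?AB Z) = a"
  unfolding zero_map_prod[OF Z]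
  by (rule ext[OF madd_prod_Pi(3)[OF a z(1)] a])
   (use madd_prod_Pi[OF a z(1)] z A.add_zero[OF ptH[OF al]] B.add_zero[OF ptH[OF ar]] in auto)
 assume b: "b \<in> pt C Z (Ide C Z) ?P"
 note bl = pt_Comp[OF b lr(1)] and br = pt_Comp[OF b lr(2)]
 show "madd C ?AB a b = madd C ?AB b a"
  by (rule ext[OF madd_prod_Pi(3)[OF a b] madd_prod_Pi(3)[OF b a]])
   (use madd_prod_Pi[OF a b] madd_prod_Pi[OF b a] A.add_comm[OF ptH[OF al] ptH[OF bl]] B.add_comm[OF ptH[OF ar] ptH[OF br]] in auto)
 assume c: "c \<in> pt C Z (Ide C Z) ?P"
 note cl = pt_Comp[OF c lr(1)] and cr = pt_Comp[OF c lr(2)]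
 note ab = madd_prod_Pi[OF a b] and bc = madd_prod_Pi[OF b c]
 note abc = madd_prod_Pi[OF ab(3) c] and abc' = madd_prod_Pi[OF a bc(3)]
 show "madd C ?AB (madd C ?AB a b) c = madd C ?AB a (madd C ?AB b c)"
  by (rule ext[OF abc(3) abc'(3)])
   (use abc(1,2) abc'(1,2) ab(1,2) bc(1,2) A.add_assoc_pt[OF al bl cl] B.add_assoc_pt[OF ar br cr] in auto)
qed

lemma mhom_Pi: "mhom (prod_cmon C A B) A (Pi0 C (mcar A) (mcar B))" "mhom (prod_cmon C A B) B (Pi1 C (mcar A) (mcar B))"
proof -
 note z = Pairing_pt(2,3)[OF A.mzero_pt B.mzero_pt]
 have m: "mzero (prod_cmon C A B) = Pairing C (mzero A) (mzero B)" by (simp add: prod_cmon_def Let_def)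
 show "mhom (prod_cmon C A B) A (Pi0 C (mcar A) (mcar B))"
  unfolding mhom_def mcar_prod m
  by (intro conjI allI ballI Pi0_pt[OF A.car_Obj B.car_Obj] z madd_prod_Pi)
 show "mhom (prod_cmon C A B) B (Pi1 C (mcar A) (mcar B))"
  unfolding mhom_def mcar_prod m
  by (intro conjI allI ballI Pi1_pt[OF A.car_Obj B.car_Obj] z madd_prod_Pi)
qed

end

lemma mhom_Bang:
 assumes A: "tcm C A"
 shows "mhom A (unit_cmon C) (Bang C (mcar A))"
proof -
 interpret A: crc_monoid C A by unfold_locales (rule A)
 interpret U: crc_monoid C "unit_cmon C" by unfold_locales (rule unit_cmon)
 have u: "mcar (unit_cmon C) = Unit C" by (simp add: unit_cmon_def)
 note b = Bang_pt[OF A.car_Obj]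
 have "mzero A \<cdot> Bang C (mcar A) = mzero (unit_cmon C)"
  by (rule pt_Unit_eq[OF pt_Comp[OF A.mzero_pt b] U.mzero_pt[unfolded u]])
 moreover have "madd C A x y \<cdot> Bang C (mcar A) = madd C (unit_cmon C) (x \<cdot> Bang C (mcar A)) (y \<cdot> Bang C (mcar A))"
  if "x \<in> mpt C Z e A" "y \<in> mpt C Z e A" for x y Z e
  by (rule pt_Unit_eq[OF pt_Comp[OF A.add_pt[OF that] b]])
   (rule U.add_pt[unfolded u, OF pt_Comp[OF that(1) b] pt_Comp[OF that(2) b]])
 ultimately show ?thesis using b by (simp add: mhom_def u)
qed

lemma faa_Bang_semilin:
 assumes A: "tcm C A" and X: "X \<in> Obj C"
 shows "faa_Bang C (A, X) = semilin (A, X) (faa_Unit C) (Bang C X) (Bang C (mcar A))"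
proof -
 let ?L = "semilin (A, X) (unit_cmon C, Unit C) (Bang C X) (Bang C (mcar A))"
 have L: "?L \<in> Hom FC (A, X) (unit_cmon C, Unit C)"
  by (rule semilin_Hom[OF A unit_cmon Bang_Hom[OF X] mhom_Bang[OF A]])
 have "faa_seq ?L n = Bang C (powp (mcar A) n X)" for n
 proof (cases "n = 0")
  case False
  note P = powprod_Obj[OF total_comm_monoidD(1)[OF A] X, of n]
  have "Rst C (faa_seq ?L n) = Ide C (powp (mcar A) n X)"
   using Faa_n(2)[OF L, of n] ptD(2)[OF pt_Comp[OF proj_pt(2)[OF total_comm_monoidD(1)[OF A] X] Bang_pt[OF X]]]
   by (simp add: semilin_def)
  then have "faa_seq ?L n \<in> pt C (powp (mcar A) n X) (Ide C (powp (mcar A) n X)) (Unit C)"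
   using Faa_n(1)[OF L, of n] False by (simp add: pt_def unit_cmon_def)
  then show ?thesis by (rule pt_Unit_eq[OF _ Bang_pt[OF P]])
 qed (simp add: semilin_def)
 then show ?thesis by (simp add: faa_Bang_def faa_Unit_def semilin_def fun_eq_iff)
qed

text \<open>Every component maps into the terminal object and is thus determined by its domain,
  which in turn comes from the base map.\<close>

lemma Faa_Unit_eq:
 assumes F: "F \<in> Hom FC S (faa_Unit C)" and G: "G \<in> Hom FC S (faa_Unit C)"
  and R: "Rst C (faa_seq F 0) = Rst C (faa_seq G 0)"
 shows "F = G"
proof -
 have U: "snd (faa_Unit C) = Unit C" "mcar (fst (faa_Unit C)) = Unit C" by (simp_all add: faa_Unit_def unit_cmon_def)
 have 0: "faa_seq F 0 = faa_seq G 0"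
  by (rule Unit_eq[OF Faa_0[OF F, unfolded U] Faa_0[OF G, unfolded U] R])
 have "faa_seq F n = faa_seq G n" for n
 proof (cases n)
  case (Suc m)
  then have n: "n \<ge> 1" by simp
  show ?thesis
   by (rule Unit_eq[OF Faa_n(1)[OF F n, unfolded U] Faa_n(1)[OF G n, unfolded U]])
    (simp add: Faa_n(2)[OF F] Faa_n(2)[OF G] 0)
 qed (use 0 in simp)
 then have "faa_seq F = faa_seq G" by (rule ext)
 then show ?thesis using Faa_fields[OF F] Faa_fields[OF G] by (cases F; cases G) simp
qed

subsection \<open>Products in \<open>Faa(C)\<close>\<close>

lemma faa_Pi_semilin:
 assumes S: "(A, X) \<in> FObj" and T: "(B, Y) \<in> FObj"
 shows "faa_Pi0 C (A, X) (B, Y) = semilin (prod_cmon C A B, Prod C X Y) (A, X) (Pi0 C X Y) (Pi0 C (mcar A) (mcar B))"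
  "faa_Pi1 C (A, X) (B, Y) = semilin (prod_cmon C A B, Prod C X Y) (B, Y) (Pi1 C X Y) (Pi1 C (mcar A) (mcar B))"
proof -
 have A: "tcm C A" "X \<in> Obj C" and B: "tcm C B" "Y \<in> Obj C"
  using S T by (auto simp: faa_Obj_def)
 note l = faa_linear_semilin[OF prod_cmon[OF A(1) B(1)] A(1) Pi0_Hom[OF A(2) B(2)] mhom_Pi(1)[OF A(1) B(1)] Pi0_pt[OF A(2) B(2)]]
 note r = faa_linear_semilin[OF prod_cmon[OF A(1) B(1)] B(1) Pi1_Hom[OF A(2) B(2)] mhom_Pi(2)[OF A(1) B(1)] Pi1_pt[OF A(2) B(2)]]
 have m: "mcar (prod_cmon C A B) = Prod C (mcar A) (mcar B)" by (simp add: prod_cmon_def Let_def)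
 show "faa_Pi0 C (A, X) (B, Y) = semilin (prod_cmon C A B, Prod C X Y) (A, X) (Pi0 C X Y) (Pi0 C (mcar A) (mcar B))"
  "faa_Pi1 C (A, X) (B, Y) = semilin (prod_cmon C A B, Prod C X Y) (B, Y) (Pi1 C X Y) (Pi1 C (mcar A) (mcar B))"
  using l r by (simp_all add: faa_Pi0_def faa_Pi1_def faa_Prod_def m)
qed

lemma faa_Pi_Hom:
 assumes S: "S \<in> FObj" and T: "T \<in> FObj"
 shows "faa_Pi0 C S T \<in> Hom FC (faa_Prod C S T) S" "faa_Pi1 C S T \<in> Hom FC (faa_Prod C S T) T"
  "faa_seq (faa_Pi0 C S T) 0 = Pi0 C (snd S) (snd T)" "faa_seq (faa_Pi1 C S T) 0 = Pi1 C (snd S) (snd T)"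
proof -
 obtain A X B Y where ST: "S = (A, X)" "T = (B, Y)" by (cases S; cases T) auto
 have A: "tcm C A" "X \<in> Obj C" and B: "tcm C B" "Y \<in> Obj C"
  using S T ST by (auto simp: faa_Obj_def)
 note m = prod_cmon[OF A(1) B(1)]
 show "faa_Pi0 C S T \<in> Hom FC (faa_Prod C S T) S" "faa_Pi1 C S T \<in> Hom FC (faa_Prod C S T) T"
  using semilin_Hom[OF m A(1) Pi0_Hom[OF A(2) B(2)] mhom_Pi(1)[OF A(1) B(1)]]
   semilin_Hom[OF m B(1) Pi1_Hom[OF A(2) B(2)] mhom_Pi(2)[OF A(1) B(1)]]
   faa_Pi_semilin S T ST by (auto simp: faa_Prod_def)
 show "faa_seq (faa_Pi0 C S T) 0 = Pi0 C (snd S) (snd T)" "faa_seq (faa_Pi1 C S T) 0 = Pi1 C (snd S) (snd T)"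
  using faa_Pi_semilin S T ST by (auto simp: semilin_def)
qed

lemma ev_faa_Pi:
 assumes S: "S \<in> FObj" and T: "T \<in> FObj" and c: "cube C Z e (faa_Prod C S T) c" and J: "finite J"
 shows "ev C (faa_Pi0 C S T) c J = c J \<cdot> (if J = {} then Pi0 C (snd S) (snd T) else Pi0 C (mcar (fst S)) (mcar (fst T)))"
  "ev C (faa_Pi1 C S T) c J = c J \<cdot> (if J = {} then Pi1 C (snd S) (snd T) else Pi1 C (mcar (fst S)) (mcar (fst T)))"
proof -
 obtain A X B Y where ST: "S = (A, X)" "T = (B, Y)" by (cases S; cases T) auto
 have A: "tcm C A" "X \<in> Obj C" and B: "tcm C B" "Y \<in> Obj C"
  using S T ST by (auto simp: faa_Obj_def)
 note m = prod_cmon[OF A(1) B(1)]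
 have c': "cube C Z e (prod_cmon C A B, Prod C X Y) c" using c ST by (simp add: faa_Prod_def)
 show "ev C (faa_Pi0 C S T) c J = c J \<cdot> (if J = {} then Pi0 C (snd S) (snd T) else Pi0 C (mcar (fst S)) (mcar (fst T)))"
  using ev_semilin_total[OF m A(1) Pi0_Hom[OF A(2) B(2)] mhom_Pi(1)[OF A(1) B(1)] Pi0_pt[OF A(2) B(2)] c' J]
   faa_Pi_Hom(3)[OF S T] faa_Pi_semilin(1) S T ST by (cases "J = {}") (auto simp: ev_def)
 show "ev C (faa_Pi1 C S T) c J = c J \<cdot> (if J = {} then Pi1 C (snd S) (snd T) else Pi1 C (mcar (fst S)) (mcar (fst T)))"
  using ev_semilin_total[OF m B(1) Pi1_Hom[OF A(2) B(2)] mhom_Pi(2)[OF A(1) B(1)] Pi1_pt[OF A(2) B(2)] c' J]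
   faa_Pi_Hom(4)[OF S T] faa_Pi_semilin(2) S T ST by (cases "J = {}") (auto simp: ev_def)
qed

text \<open>Evaluation at the universal cube turns the entrywise action of a projection into a
  formula for components, so that the universal property of pairing can be checked in each component
  separately.\<close>

lemma Faa_Comp_Pi_seq:
 assumes H: "H \<in> Hom FC V (faa_Prod C S T)" and S: "S \<in> FObj" and T: "T \<in> FObj"
 shows "faa_seq (FComp H (faa_Pi0 C S T)) n = faa_seq H n \<cdot> (if n = 0 then Pi0 C (snd S) (snd T) else Pi0 C (mcar (fst S)) (mcar (fst T)))"
  "faa_seq (FComp H (faa_Pi1 C S T)) n = faa_seq H n \<cdot> (if n = 0 then Pi1 C (snd S) (snd T) else Pi1 C (mcar (fst S)) (mcar (fst T)))"
proof -
 note p = faa_Pi_Hom[OF S T]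
 note u = ucube_cube(1)[OF Faa_Objs(1)[OF H], of n]
 note Hu = Faa_ev_cube[OF H u]
 have e: "({..<n} = {}) = (n = 0)" by (simp add: lessThan_empty_iff)
 show "faa_seq (FComp H (faa_Pi0 C S T)) n = faa_seq H n \<cdot> (if n = 0 then Pi0 C (snd S) (snd T) else Pi0 C (mcar (fst S)) (mcar (fst T)))"
  using Faa_ev_ucube[OF Faa_Comp_Hom[OF H p(1)], of n] Faa_ev_Comp[OF H p(1) u, of "{..<n}"] ev_faa_Pi(1)[OF S T Hu, of "{..<n}"]
   Faa_ev_ucube[OF H, of n] e by simp
 show "faa_seq (FComp H (faa_Pi1 C S T)) n = faa_seq H n \<cdot> (if n = 0 then Pi1 C (snd S) (snd T) else Pi1 C (mcar (fst S)) (mcar (fst T)))"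
  using Faa_ev_ucube[OF Faa_Comp_Hom[OF H p(2)], of n] Faa_ev_Comp[OF H p(2) u, of "{..<n}"] ev_faa_Pi(2)[OF S T Hu, of "{..<n}"]
   Faa_ev_ucube[OF H, of n] e by simp
qed

text \<open>On the universal cube the restriction of \<open>G\<close> acts as precomposition with
  the domain of component \<open>n\<close> of \<open>G\<close>, and evaluation commutes with
  precomposition.\<close>

lemma Faa_Rst_Comp_seq:
 assumes F: "F \<in> Hom FC S T" and G: "G \<in> Hom FC S U"
 shows "faa_seq (FComp (faa_Rst C G) F) n = Rst C (faa_seq G n) \<cdot> faa_seq F n"
proof -
 note r = Faa_Rst_Hom[OF G]
 note u = ucube_cube[OF Faa_Objs(1)[OF F], of n]
 let ?d = "Rst C (ucube C S n {} \<cdot> faa_seq G 0)"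
 note d = Rst_Hom[OF cube_dom[OF G u(1)]]
 have "faa_seq (FComp (faa_Rst C G) F) n = ev C F (ev C (faa_Rst C G) (ucube C S n)) {..<n}"
  using Faa_ev_ucube[OF Faa_Comp_Hom[OF r F], of n] Faa_ev_Comp[OF r F u(1), of "{..<n}"] by simp
 also have "... = ev C F (%B. ?d \<cdot> ucube C S n B) {..<n}"
 proof (rule Faa_ev_cong[OF F])
  show "cube C (powp (mcar (fst S)) n (snd S)) (Rst C (?d \<cdot> Ide C (powp (mcar (fst S)) n (snd S)))) S (%B. ?d \<cdot> ucube C S n B)"
   using precomp_pt[OF d] cubeD[OF u(1)] unfolding cube_def by blast
 qed (use ev_faa_Rst[OF G u(1)] in auto)
 also have "... = ?d \<cdot> ev C F (ucube C S n) {..<n}" by (rule Faa_ev_precomp[OF F u(1) d, symmetric])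
 finally show ?thesis using Faa_ev_ucube[OF F] Faa_n(2)[OF G, of n] u(2) by simp
qed

lemma faa_Pairing_Hom:
 assumes F: "F \<in> Hom FC V S" and G: "G \<in> Hom FC V T"
 shows "faa_Pairing C F G \<in> Hom FC V (faa_Prod C S T)"
proof -
 obtain A X B Y where VS: "V = (A, X)" "S = (B, Y)" and F': "faa_arrow C F A X B Y"
  using Faa_arrow_cases[OF F] .
 obtain D W where T: "T = (D, W)" by (cases T)
 interpret F: faa_arrow C F A X B Y by (rule F')
 interpret G: faa_arrow C G A X D W by (rule faa_arrowI) (use G VS T in simp)
 let ?p = "%n. Pairing C (faa_seq F n) (faa_seq G n)"
 note BD = prod_cmon[OF F.objs(3) G.objs(3)]
 interpret BD: crc_monoid C "prod_cmon C B D" by unfold_locales (rule BD)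
 have m: "mcar (prod_cmon C B D) = Prod C (mcar B) (mcar D)" by (simp add: prod_cmon_def Let_def)
 note lr = Pi0_pt[OF F.B.car_Obj G.B.car_Obj] Pi1_pt[OF F.B.car_Obj G.B.car_Obj]
 have point: "tup zs x \<cdot> ?p (length zs) = Pairing C (tup zs x \<cdot> faa_seq F (length zs)) (tup zs x \<cdot> faa_seq G (length zs))"
  if zs: "zs \<noteq> []" "set zs \<subseteq> mpt C Z e A" and x: "x \<in> pt C Z e X" for zs x Z e
 proof -
  have n: "length zs \<ge> 1" using zs(1) by (cases zs) auto
  show ?thesis
   by (rule Comp_Pairing[OF ptH[OF tup_pt(1)[OF zs(2) x]] F.fn(1)[OF n] G.fn(1)[OF n]])
 qed
 have Rr: "Rst C (x \<cdot> ?p 0) = Rst C (x \<cdot> faa_seq F 0) \<cdot> Rst C (x \<cdot> faa_seq G 0)" if x: "x \<in> pt C Z e X" for x Z e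
  using Comp_Pairing[OF ptH[OF x] F.f0 G.f0] Rst_Pairing[OF Comp_Hom[OF ptH[OF x] F.f0] Comp_Hom[OF ptH[OF x] G.f0]] by simp
 text \<open>The two components of a value of the pairing have different domains of definition, so both are
  first cut down to the common one.\<close>
 have pair: "Pairing C a b = Pairing C (d \<cdot> a) (d \<cdot> b) \<and> d \<cdot> a \<in> mpt C Z d B \<and> d \<cdot> b \<in> mpt C Z d D"
  if a: "a \<in> mpt C Z p B" and b: "b \<in> mpt C Z q D" and d: "d = p \<cdot> q" for a b p q d Z
 proof -
  note ip = pt_idem(5)[OF a] and iq = pt_idem(5)[OF b]
  note dd = idem_comp[OF ip iq]
  have dp: "d \<cdot> p = d" and dq: "d \<cdot> q = d"
   using Comp_assoc[OF ptH[OF iq] ptH[OF ip] ptH[OF ip]] Comp_assoc[OF ptH[OF ip] ptH[OF iq] ptH[OF iq]]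
    pt_idem(3)[OF ip] pt_idem(3)[OF iq] dd(2) d by simp_all
  have id: "d \<in> pt C Z d Z" using dd(1) d by simp
  have "Rst C (Pairing C a b) = d" using Rst_Pairing[OF ptH[OF a] ptH[OF b]] ptD(2)[OF a] ptD(2)[OF b] d by simp
  then have "Pairing C a b = d \<cdot> Pairing C a b" using R1[OF Pairing_Hom[OF ptH[OF a] ptH[OF b]]] by simp
  also have "... = Pairing C (d \<cdot> a) (d \<cdot> b)" by (rule Comp_Pairing[OF ptH[OF id] ptH[OF a] ptH[OF b]])
  finally show ?thesis using restrict_pt[OF id a] restrict_pt[OF id b] dp dq by simp
 qed
 have "FaaArr (A, X) (prod_cmon C B D, Prod C Y W) ?p \<in> faa_Arr C"
 proof (rule faa_ArrI[OF F.objs(1) BD F.objs(2), where Y = "Prod C Y W"])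
  show "?p 0 \<in> Hom C X (Prod C Y W)" by (rule Pairing_Hom[OF F.f0 G.f0])
  fix n :: nat assume n: "n \<ge> 1"
  show "?p n \<in> Hom C (powp (mcar A) n X) (mcar (prod_cmon C B D))"
   unfolding m by (rule Pairing_Hom[OF F.fn(1)[OF n] G.fn(1)[OF n]])
  show "Rst C (?p n) = Rst C (proj C (mcar A) n X n \<cdot> ?p 0)"
   unfolding Rr[OF proj_pt(2)[OF F.A.car_Obj F.objs(2)]]
   using Rst_Pairing[OF F.fn(1)[OF n] G.fn(1)[OF n]] F.fn(2)[OF n] G.fn(2)[OF n] by simp
 next
  fix Z e zs zs' x
  assume zs: "zs \<noteq> []" "set zs \<subseteq> mpt C Z e A" and x: "x \<in> pt C Z e X" and mm: "mset zs' = mset zs"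
  have l: "length zs' = length zs" using mm by (metis size_mset)
  have zs': "zs' \<noteq> []" "set zs' \<subseteq> mpt C Z e A" using zs mm l by (auto simp flip: set_mset_mset)
  show "tup zs' x \<cdot> ?p (length zs) = tup zs x \<cdot> ?p (length zs)"
   using point[OF zs x] point[OF zs' x] F.tup_f_perm[OF zs x mm] G.tup_f_perm[OF zs x mm] l by simp
 next
  fix Z e zs x a b
  assume zs: "set zs \<subseteq> mpt C Z e A" and x: "x \<in> pt C Z e X" and ab: "a \<in> mpt C Z e A" "b \<in> mpt C Z e A"
  let ?n = "Suc (length zs)"
  let ?d = "Rst C (x \<cdot> faa_seq F 0) \<cdot> Rst C (x \<cdot> faa_seq G 0)"
  define vF where "vF y = tup (y # zs) x \<cdot> faa_seq F ?n" for y
  define vG where "vG y = tup (y # zs) x \<cdot> faa_seq G ?n" for y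
  have v: "vF y \<in> mpt C Z (Rst C (x \<cdot> faa_seq F 0)) B" "vG y \<in> mpt C Z (Rst C (x \<cdot> faa_seq G 0)) D"
   "tup (y # zs) x \<cdot> ?p ?n = Pairing C (vF y) (vG y)" if "y \<in> mpt C Z e A" for y
   using F.tup_f_pt[of "y # zs" Z e x] G.tup_f_pt[of "y # zs" Z e x] point[of "y # zs" Z e x] zs x that
   by (simp_all add: vF_def vG_def del: tup_simps)
  note s = F.A.add_pt[OF ab]
  note va = v[OF ab(1)] and vb = v[OF ab(2)] and vs = v[OF s]
  note pa = pair[OF va(1,2) refl] and pb = pair[OF vb(1,2) refl] and ps = pair[OF vs(1,2) refl]
  have d: "?d \<in> Hom C Z Z" using ptH[OF pt_idem(5)] pa by blast
  have sum: "vF (madd C A a b) = madd C B (vF a) (vF b)" "vG (madd C A a b) = madd C D (vG a) (vG b)"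
   using F.tup_f_add[OF zs x ab] G.tup_f_add[OF zs x ab] by (simp_all add: vF_def vG_def)
  have "Pairing C (?d \<cdot> vF a) (?d \<cdot> vG a) \<in> pt C Z ?d (Prod C (mcar B) (mcar D))"
   "Pairing C (?d \<cdot> vF b) (?d \<cdot> vG b) \<in> pt C Z ?d (Prod C (mcar B) (mcar D))"
   using Pairing_pt(1) pa pb by blast+
  from madd_prod[OF F.objs(3) G.objs(3) this]
  have "madd C (prod_cmon C B D) (Pairing C (?d \<cdot> vF a) (?d \<cdot> vG a)) (Pairing C (?d \<cdot> vF b) (?d \<cdot> vG b)) =
    Pairing C (madd C B (?d \<cdot> vF a) (?d \<cdot> vF b)) (madd C D (?d \<cdot> vG a) (?d \<cdot> vG b))"
   using Pairing_pt(2,3)[of "?d \<cdot> vF a" Z ?d "mcar B" "?d \<cdot> vG a" "mcar D"]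
    Pairing_pt(2,3)[of "?d \<cdot> vF b" Z ?d "mcar B" "?d \<cdot> vG b" "mcar D"] pa pb by simp
  also have "... = Pairing C (?d \<cdot> vF (madd C A a b)) (?d \<cdot> vG (madd C A a b))"
   using F.B.Comp_add[OF ptH[OF va(1)] ptH[OF vb(1)] d] G.B.Comp_add[OF ptH[OF va(2)] ptH[OF vb(2)] d] sum by simp
  finally show "tup (madd C A a b # zs) x \<cdot> ?p ?n = madd C (prod_cmon C B D) (tup (a # zs) x \<cdot> ?p ?n) (tup (b # zs) x \<cdot> ?p ?n)"
   using va(3) vb(3) vs(3) pa pb ps by metis
 next
  fix Z e zs x
  assume zs: "set zs \<subseteq> mpt C Z e A" and x: "x \<in> pt C Z e X"
  let ?zs = "e \<cdot> zmap A Z # zs"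
  have zs': "set ?zs \<subseteq> mpt C Z e A" "?zs \<noteq> []" using zs F.A.zero_e_pt[OF pt_idem(5)[OF x]] by auto
  have Z: "Z \<in> Obj C" using Hom_Obj(1)[OF ptH[OF x]] .
  let ?rF = "Rst C (x \<cdot> faa_seq F 0)" and ?rG = "Rst C (x \<cdot> faa_seq G 0)"
  note iF = F.dom_idem[OF ptH[OF x]] and iG = G.dom_idem[OF ptH[OF x]]
  note zF = F.B.zero_pt[OF Z] and zG = G.B.zero_pt[OF Z]
  note dd = idem_comp[OF iF iG]
  have dF: "?rF \<cdot> ?rG \<cdot> ?rF = ?rF \<cdot> ?rG" and dG: "?rF \<cdot> ?rG \<cdot> ?rG = ?rF \<cdot> ?rG"
   using Comp_assoc[OF ptH[OF iG] ptH[OF iF] ptH[OF iF]] Comp_assoc[OF ptH[OF iF] ptH[OF iG] ptH[OF iG]]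
    pt_idem(3)[OF iF] pt_idem(3)[OF iG] dd(2) by simp_all
  have "tup ?zs x \<cdot> ?p (Suc (length zs)) = Pairing C (?rF \<cdot> zmap B Z) (?rG \<cdot> zmap D Z)"
   using point[OF zs'(2,1) x] F.tup_f_zero[OF zs x] G.tup_f_zero[OF zs x] by simp
  also have "... = Pairing C ((?rF \<cdot> ?rG) \<cdot> (?rF \<cdot> zmap B Z)) ((?rF \<cdot> ?rG) \<cdot> (?rG \<cdot> zmap D Z))"
   using pair[OF F.B.zero_e_pt[OF iF] G.B.zero_e_pt[OF iG] refl] by blast
  also have "... = Pairing C ((?rF \<cdot> ?rG) \<cdot> zmap B Z) ((?rF \<cdot> ?rG) \<cdot> zmap D Z)"
   using Comp_assoc[OF ptH[OF dd(1)] ptH[OF iF] ptH[OF zF]] Comp_assoc[OF ptH[OF dd(1)] ptH[OF iG] ptH[OF zG]] dF dG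
   by simp
  also have "... = (?rF \<cdot> ?rG) \<cdot> zmap (prod_cmon C B D) Z"
   unfolding zero_map_prod[OF F.objs(3) G.objs(3) Z]
   by (rule Comp_Pairing[OF ptH[OF dd(1)] ptH[OF zF] ptH[OF zG], symmetric])
  finally show "tup ?zs x \<cdot> ?p (Suc (length zs)) = Rst C (x \<cdot> ?p 0) \<cdot> zmap (prod_cmon C B D) Z"
   unfolding Rr[OF x] .
 qed
 then show ?thesis by (simp add: Hom_Faa faa_Pairing_def faa_Prod_def VS T)
qed

text \<open>Total arrows are those with a total base map. Both universal properties then reduce to
  the ones in \<open>C\<close>, for each component separately.\<close>

lemma Faa_crc: "cartesian_restriction_category FC"
proof (intro cartesian_restriction_category.intro Faa_restriction_category cartesian_restriction_category_axioms.intro;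
  (unfold Faa_simps)?)
 have tot: "total_map FC F" if F: "F \<in> Hom FC S T" and "Rst C (faa_seq F 0) = Ide C (snd S)" for F S T
 proof -
  obtain A X where S: "S = (A, X)" "tcm C A" "X \<in> Obj C" using Faa_Objs(1)[OF F] by (auto simp: faa_Obj_def)
  obtain B Y where T: "T = (B, Y)" by (cases T)
  have "faa_Rst C F = faa_Ide C S"
   using faa_Rst_semilin[OF F[unfolded S T]] faa_Ide_semilin[OF S(2,3)] that(2) S(1) by simp
  then show ?thesis using F Faa_fields[OF F] by (simp add: total_map_def Hom_Faa)
 qed
 have tot0: "Rst C (faa_seq F 0) = Ide C (snd S)" if F: "F \<in> Hom FC S T" "total_map FC F" for F S T
 proof -
  have "faa_Rst C F = faa_Ide C S" using that Faa_fields[OF F(1)] by (simp add: total_map_def)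
  then have "Rst C (faa_seq F 0) = faa_seq (faa_Ide C S) 0" using Faa_Rst_0[of F] by simp
  then show ?thesis by (cases S) (simp add: faa_Ide_def faa_linear_def)
 qed
 have U: "snd (faa_Unit C) = Unit C" by (simp add: faa_Unit_def)
 have bang: "faa_Bang C S \<in> Hom FC S (faa_Unit C)" "faa_seq (faa_Bang C S) 0 = Bang C (snd S)"
  "Rst C (Bang C (snd S)) = Ide C (snd S)" if "S \<in> FObj" for S
 proof -
  obtain A X where AX: "S = (A, X)" "tcm C A" "X \<in> Obj C" using \<open>S \<in> FObj\<close> by (auto simp: faa_Obj_def)
  show "faa_Bang C S \<in> Hom FC S (faa_Unit C)"
   using semilin_Hom[OF AX(2) unit_cmon Bang_Hom[OF AX(3)] mhom_Bang[OF AX(2)]] faa_Bang_semilin[OF AX(2,3)]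
   by (simp add: AX(1) faa_Unit_def)
  show "faa_seq (faa_Bang C S) 0 = Bang C (snd S)" by (simp add: AX(1) faa_Bang_def)
  show "Rst C (Bang C (snd S)) = Ide C (snd S)" using ptD(2)[OF Bang_pt[OF AX(3)]] AX(1) by simp
 qed
 show "faa_Unit C \<in> FObj" using unit_cmon Unit_Obj by (simp add: faa_Unit_def faa_Obj_def)
 show "faa_Bang C S \<in> Hom FC S (faa_Unit C)" "total_map FC (faa_Bang C S)" if "S \<in> FObj" for S
  using bang[OF that] tot[OF bang(1)[OF that]] by simp_all
 show "F = faa_Bang C S" if F: "F \<in> Hom FC S (faa_Unit C)" "total_map FC F" for F S
 proof -
  note S = Faa_Objs(1)[OF F(1)]
  show ?thesis by (rule Faa_Unit_eq[OF F(1) bang(1)[OF S]]) (use bang[OF S] tot0[OF F] in simp)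
 qed
 show "F = FComp (faa_Rst C F) (faa_Bang C S)" if F: "F \<in> Hom FC S (faa_Unit C)" for F S
 proof -
  note S = Faa_Objs(1)[OF F]
  have F0: "faa_seq F 0 \<in> Hom C (snd S) (Unit C)" using Faa_0[OF F] U by simp
  show ?thesis
   by (rule Faa_Unit_eq[OF F Faa_Comp_Hom[OF Faa_Rst_Hom[OF F] bang(1)[OF S]]])
    (use Unit_restriction[OF F0] bang(2)[OF S] in "simp add: Faa_Comp_0 Faa_Rst_0")
 qed
 fix S T assume S: "S \<in> FObj" and T: "T \<in> FObj"
 obtain A X where AX: "S = (A, X)" "tcm C A" "X \<in> Obj C" using S by (auto simp: faa_Obj_def)
 obtain B Y where BY: "T = (B, Y)" "tcm C B" "Y \<in> Obj C" using T by (auto simp: faa_Obj_def)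
 show "faa_Prod C S T \<in> FObj"
  using prod_cmon[OF AX(2) BY(2)] Prod_Obj[OF AX(3) BY(3)] by (simp add: AX BY faa_Prod_def faa_Obj_def)
 note p = faa_Pi_Hom[OF S T]
 show "faa_Pi0 C S T \<in> Hom FC (faa_Prod C S T) S" "faa_Pi1 C S T \<in> Hom FC (faa_Prod C S T) T" by (rule p(1), rule p(2))
 show "total_map FC (faa_Pi0 C S T)" "total_map FC (faa_Pi1 C S T)"
  using tot[OF p(1)] tot[OF p(2)] p(3,4) ptD(2)[OF Pi0_pt[OF AX(3) BY(3)]] ptD(2)[OF Pi1_pt[OF AX(3) BY(3)]]
  by (simp_all add: AX(1) BY(1) faa_Prod_def)
next
 fix F G V S T assume F: "F \<in> Hom FC V S" and G: "G \<in> Hom FC V T"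
 note S = Faa_Objs(2)[OF F] and T = Faa_Objs(2)[OF G]
 note p = faa_Pi_Hom[OF S T]
 show P: "faa_Pairing C F G \<in> Hom FC V (faa_Prod C S T)" by (rule faa_Pairing_Hom[OF F G])
 note rF = Faa_Comp_Hom[OF Faa_Rst_Hom[OF F] G] and rG = Faa_Comp_Hom[OF Faa_Rst_Hom[OF G] F]
 have eqI: "H = K" if "H \<in> Hom FC V U" "K \<in> Hom FC V U" "!!n. faa_seq H n = faa_seq K n" for H K U
  using Faa_fields[OF that(1)] Faa_fields[OF that(2)] that(3) by (cases H; cases K) (simp add: fun_eq_iff)
 have ps: "faa_seq (faa_Pairing C F G) n = Pairing C (faa_seq F n) (faa_seq G n)" for n
  by (simp add: faa_Pairing_def)
 have HF: "faa_seq F n \<in> Hom C (powp (mcar (fst V)) n (snd V)) (if n = 0 then snd S else mcar (fst S))"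
  and HG: "faa_seq G n \<in> Hom C (powp (mcar (fst V)) n (snd V)) (if n = 0 then snd T else mcar (fst T))" for n
  using Faa_0[OF F] Faa_n(1)[OF F, of n] Faa_0[OF G] Faa_n(1)[OF G, of n] by (cases "n = 0"; simp)+
 show "FComp (faa_Pairing C F G) (faa_Pi0 C S T) = FComp (faa_Rst C G) F"
 proof (rule eqI[OF Faa_Comp_Hom[OF P p(1)] rG])
  fix n
  show "faa_seq (FComp (faa_Pairing C F G) (faa_Pi0 C S T)) n = faa_seq (FComp (faa_Rst C G) F) n"
   unfolding Faa_Comp_Pi_seq(1)[OF P S T] Faa_Rst_Comp_seq[OF F G] ps
   using Pairing_Pi0[OF HF[of n] HG[of n]] by (cases "n = 0") simp_all
 qed
 show "FComp (faa_Pairing C F G) (faa_Pi1 C S T) = FComp (faa_Rst C F) G"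
 proof (rule eqI[OF Faa_Comp_Hom[OF P p(2)] rF])
  fix n
  show "faa_seq (FComp (faa_Pairing C F G) (faa_Pi1 C S T)) n = faa_seq (FComp (faa_Rst C F) G) n"
   unfolding Faa_Comp_Pi_seq(2)[OF P S T] Faa_Rst_Comp_seq[OF G F] ps
   using Pairing_Pi1[OF HF[of n] HG[of n]] by (cases "n = 0") simp_all
 qed
 fix H assume H: "H \<in> Hom FC V (faa_Prod C S T)"
  and H0: "FComp H (faa_Pi0 C S T) = FComp (faa_Rst C G) F"
  and H1: "FComp H (faa_Pi1 C S T) = FComp (faa_Rst C F) G"
 show "H = faa_Pairing C F G"
 proof (rule eqI[OF H P])
  fix n
  obtain A X B Y where ST: "S = (A, X)" "T = (B, Y)" by (cases S; cases T) auto
  have "faa_seq H n \<in> Hom C (powp (mcar (fst V)) n (snd V))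
    (Prod C (if n = 0 then snd S else mcar (fst S)) (if n = 0 then snd T else mcar (fst T)))"
   using Faa_0[OF H] Faa_n(1)[OF H, of n] by (cases "n = 0") (simp_all add: ST faa_Prod_def prod_cmon_def Let_def)
  then have "faa_seq H n = Pairing C (faa_seq F n) (faa_seq G n)"
  proof (rule Pairing_unique[OF HF HG])
   show "faa_seq H n \<cdot> Pi0 C (if n = 0 then snd S else mcar (fst S)) (if n = 0 then snd T else mcar (fst T)) = Rst C (faa_seq G n) \<cdot> faa_seq F n"
    unfolding Faa_Rst_Comp_seq[OF F G, of n, symmetric] H0[symmetric] Faa_Comp_Pi_seq(1)[OF H S T] by simp
   show "faa_seq H n \<cdot> Pi1 C (if n = 0 then snd S else mcar (fst S)) (if n = 0 then snd T else mcar (fst T)) = Rst C (faa_seq F n) \<cdot> faa_seq G n"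
    unfolding Faa_Rst_Comp_seq[OF G F, of n, symmetric] H1[symmetric] Faa_Comp_Pi_seq(2)[OF H S T] by simp
  qed
  then show "faa_seq H n = faa_seq (faa_Pairing C F G) n" by (simp add: faa_Pairing_def)
 qed
qed

end

section \<open>\<open>Faa\<close> on functors\<close>

context cartesian_restriction_category
begin

lemma tup_proj:
 assumes "A \<in> Obj C" "X \<in> Obj C"
 shows "tup (map (proj C A n X) [0..<n]) (proj C A n X n) = Ide C (powp A n X)"
proof -
 let ?P = "powp A n X"
 have "map (%i. Ide C ?P \<cdot> proj C A n X i) [0..<n] = map (proj C A n X) [0..<n]"
  using Ide_Comp[OF ptH[OF proj_pt(1)[OF assms]]] by simp
 then show ?thesis
  using tup_eta[OF assms Ide_pt[OF powprod_Obj[OF assms]], of n] Ide_Comp[OF ptH[OF proj_pt(2)[OF assms]], of n]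
  by (simp only:)
qed

text \<open>A functor transports equations between particular maps, not statements about all maps of
  its target. Symmetry and additivity are therefore required only at projections, the generic
  points, and recovered at all points by precomposing with tuples.\<close>

lemma faa_ArrI_generic:
 assumes A: "tcm C A" and B: "tcm C B" and X: "X \<in> Obj C" and f0: "f 0 \<in> Hom C X Y"
  and f: "!!n. n \<ge> 1 ==> f n \<in> Hom C (powp (mcar A) n X) (mcar B)"
   "!!n. n \<ge> 1 ==> Rst C (f n) = Rst C (proj C (mcar A) n X n \<cdot> f 0)"
  and sym: "!!n \<sigma>. n \<ge> 1 ==> \<sigma> permutes {..<n} ==>
   tup (permute_list \<sigma> (map (proj C (mcar A) n X) [0..<n])) (proj C (mcar A) n X n) \<cdot> f n = f n"
  and add: "!!m p. p = proj C (mcar A) (Suc (Suc m)) X ==>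
   tup (madd C A (p 0) (p 1) # map (%i. p (Suc (Suc i))) [0..<m]) (p (Suc (Suc m))) \<cdot> f (Suc m) =
   madd C B (tup (p 0 # map (%i. p (Suc (Suc i))) [0..<m]) (p (Suc (Suc m))) \<cdot> f (Suc m))
    (tup (p 1 # map (%i. p (Suc (Suc i))) [0..<m]) (p (Suc (Suc m))) \<cdot> f (Suc m))"
  and zero: "!!m. tup (zmap A (powp (mcar A) m X) # map (proj C (mcar A) m X) [0..<m]) (proj C (mcar A) m X m) \<cdot> f (Suc m) =
   Rst C (proj C (mcar A) m X m \<cdot> f 0) \<cdot> zmap B (powp (mcar A) m X)"
 shows "FaaArr (A, X) (B, Y) f \<in> faa_Arr C"
proof -
 interpret A: crc_monoid C A by unfold_locales (rule A)
 interpret B: crc_monoid C B by unfold_locales (rule B)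
 let ?A = "mcar A"
 note pp = proj_pt[OF A.car_Obj X]
 have pH: "proj C ?A n X i \<in> Hom C (powp ?A n X) ?A" if "i < n" for i n using ptH[OF pp(1)[OF that]] .
 have pX: "proj C ?A n X n \<in> Hom C (powp ?A n X) X" for n using ptH[OF pp(2)] .
 show ?thesis
 proof (rule faa_ArrI[OF A B X, where Y = Y])
  fix Z e zs zs' x
  assume zs: "zs \<noteq> []" "set zs \<subseteq> pt C Z e ?A" and x: "x \<in> pt C Z e X" and m: "mset zs' = mset zs"
  let ?n = "length zs" and ?u = "tup zs x"
  let ?p = "proj C ?A ?n X"
  obtain \<sigma> where \<sigma>: "\<sigma> permutes {..<?n}" "permute_list \<sigma> zs = zs'" using mset_eq_permutation[OF m] by blast
  have n: "?n \<ge> 1" using zs(1) by (cases zs) auto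
  note t = tup_pt[OF zs(2) x]
  note u = ptH[OF t(1)]
  have "map (%z. ?u \<cdot> z) (map ?p [0..<?n]) = map (%i. zs ! i) [0..<?n]" using t(2) by simp
  then have mp: "map (%z. ?u \<cdot> z) (map ?p [0..<?n]) = zs" by (simp add: map_nth)
  have pl: "map (%z. ?u \<cdot> z) (permute_list \<sigma> (map ?p [0..<?n])) = zs'"
   using permute_list_map[of \<sigma> "map ?p [0..<?n]" "%z. ?u \<cdot> z"] \<sigma> mp by simp
  have s: "set (permute_list \<sigma> (map ?p [0..<?n])) \<subseteq> Hom C (powp ?A ?n X) ?A" using pH \<sigma>(1) by auto
  have tH: "tup (permute_list \<sigma> (map ?p [0..<?n])) (?p ?n) \<in> Hom C (powp ?A ?n X) (powp ?A ?n X)"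
   using tup_Hom[OF s pX] by simp
  have "?u \<cdot> f ?n = ?u \<cdot> (tup (permute_list \<sigma> (map ?p [0..<?n])) (?p ?n) \<cdot> f ?n)" using sym[OF n \<sigma>(1)] by simp
  also have "... = tup zs' x \<cdot> f ?n"
   using Comp_assoc[OF u tH f(1)[OF n]] Comp_tup[OF u s pX] pl t(3) by simp
  finally show "tup zs' x \<cdot> f ?n = ?u \<cdot> f ?n" by simp
 next
  fix Z e zs x a b
  assume zs: "set zs \<subseteq> pt C Z e ?A" and x: "x \<in> pt C Z e X" and ab: "a \<in> pt C Z e ?A" "b \<in> pt C Z e ?A"
  let ?m = "length zs" and ?u = "tup (a # b # zs) x"
  \<comment> \<open>The generic stage for a sum in the first slot has two extra factors: projections
    \<open>0\<close> and \<open>1\<close> are the two summands, the next \<open>?m\<close>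
    projections fill the remaining slots.\<close>
  define p where "p = proj C ?A (Suc (Suc ?m)) X"
  let ?ps = "map (%i. p (Suc (Suc i))) [0..<?m]"
  have abz: "set (a # b # zs) \<subseteq> pt C Z e ?A" using zs ab by simp
  note t = tup_pt[OF abz x]
  have u: "?u \<in> Hom C Z (powp ?A (Suc (Suc ?m)) X)" using ptH[OF t(1)] by simp
  have up: "?u \<cdot> p 0 = a" "?u \<cdot> p 1 = b" "?u \<cdot> p (Suc (Suc ?m)) = x" using t(2)[of 0] t(2)[of 1] t(3) by (simp_all add: p_def)
  have "?u \<cdot> p (Suc (Suc i)) = zs ! i" if "i < ?m" for i using t(2)[of "Suc (Suc i)"] that by (simp add: p_def)
  then have ups: "map (%z. ?u \<cdot> z) ?ps = zs" by (intro nth_equalityI) simp_all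
  have P: "p 0 \<in> Hom C (powp ?A (Suc (Suc ?m)) X) ?A" "p 1 \<in> Hom C (powp ?A (Suc (Suc ?m)) X) ?A"
   "set ?ps \<subseteq> Hom C (powp ?A (Suc (Suc ?m)) X) ?A" "p (Suc (Suc ?m)) \<in> Hom C (powp ?A (Suc (Suc ?m)) X) X"
   using pH[of _ "Suc (Suc ?m)"] pX[of "Suc (Suc ?m)"] by (simp_all add: p_def image_subset_iff del: proj.simps powprod.simps)
  have fH: "f (Suc ?m) \<in> Hom C (powp ?A (Suc ?m) X) (mcar B)" by (rule f(1)) simp
  have k: "?u \<cdot> (tup (q # ?ps) (p (Suc (Suc ?m))) \<cdot> f (Suc ?m)) = tup ((?u \<cdot> q) # zs) x \<cdot> f (Suc ?m)"
   "tup (q # ?ps) (p (Suc (Suc ?m))) \<cdot> f (Suc ?m) \<in> Hom C (powp ?A (Suc (Suc ?m)) X) (mcar B)"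
   if q: "q \<in> Hom C (powp ?A (Suc (Suc ?m)) X) ?A" for q
  proof -
   have s: "set (q # ?ps) \<subseteq> Hom C (powp ?A (Suc (Suc ?m)) X) ?A" using P(3) q by simp
   have tH: "tup (q # ?ps) (p (Suc (Suc ?m))) \<in> Hom C (powp ?A (Suc (Suc ?m)) X) (powp ?A (Suc ?m) X)"
    using tup_Hom[OF s P(4)] by simp
   show "?u \<cdot> (tup (q # ?ps) (p (Suc (Suc ?m))) \<cdot> f (Suc ?m)) = tup ((?u \<cdot> q) # zs) x \<cdot> f (Suc ?m)"
    using Comp_assoc[OF u tH fH] Comp_tup[OF u s P(4)] ups up(3) by (simp del: tup_simps)
   show "tup (q # ?ps) (p (Suc (Suc ?m))) \<cdot> f (Suc ?m) \<in> Hom C (powp ?A (Suc (Suc ?m)) X) (mcar B)"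
    by (rule Comp_Hom[OF tH fH])
  qed
  have "tup (madd C A a b # zs) x \<cdot> f (Suc ?m) = ?u \<cdot> (tup (madd C A (p 0) (p 1) # ?ps) (p (Suc (Suc ?m))) \<cdot> f (Suc ?m))"
   using k(1)[OF A.add_Hom[OF P(1,2)]] A.Comp_add[OF P(1,2) u] up by simp
  also have "... = ?u \<cdot> madd C B (tup (p 0 # ?ps) (p (Suc (Suc ?m))) \<cdot> f (Suc ?m)) (tup (p 1 # ?ps) (p (Suc (Suc ?m))) \<cdot> f (Suc ?m))"
   unfolding add[OF p_def] ..
  also have "... = madd C B (tup (a # zs) x \<cdot> f (Suc ?m)) (tup (b # zs) x \<cdot> f (Suc ?m))"
   unfolding B.Comp_add[OF k(2)[OF P(1)] k(2)[OF P(2)] u] k(1)[OF P(1)] k(1)[OF P(2)] up ..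
  finally show "tup (madd C A a b # zs) x \<cdot> f (Suc ?m) = madd C B (tup (a # zs) x \<cdot> f (Suc ?m)) (tup (b # zs) x \<cdot> f (Suc ?m))" .
 next
  fix Z e zs x
  assume zs: "set zs \<subseteq> pt C Z e ?A" and x: "x \<in> pt C Z e X"
  let ?m = "length zs" and ?u = "tup zs x"
  let ?P = "powp ?A ?m X" and ?p = "proj C ?A ?m X"
  note t = tup_pt[OF zs x]
  note u = ptD[OF t(1)]
  have P: "?P \<in> Obj C" by (rule powprod_Obj[OF A.car_Obj X])
  note zA = ptH[OF A.zero_pt[OF P]] and zB = ptH[OF B.zero_pt[OF P]]
  have Z: "Z \<in> Obj C" using Hom_Obj[OF u(1)] by simp
  have "map (%z. ?u \<cdot> z) (map ?p [0..<?m]) = map (%i. zs ! i) [0..<?m]" using t(2) by simp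
  then have ups: "map (%z. ?u \<cdot> z) (map ?p [0..<?m]) = zs" by (simp add: map_nth)
  have s: "set (zmap A ?P # map ?p [0..<?m]) \<subseteq> Hom C ?P ?A" using pH zA by auto
  have tH: "tup (zmap A ?P # map ?p [0..<?m]) (?p ?m) \<in> Hom C ?P (powp ?A (Suc ?m) X)"
   using tup_Hom[OF s pX] by simp
  have fH: "f (Suc ?m) \<in> Hom C (powp ?A (Suc ?m) X) (mcar B)" by (rule f(1)) simp
  have "tup (e \<cdot> zmap A Z # zs) x \<cdot> f (Suc ?m) = ?u \<cdot> (tup (zmap A ?P # map ?p [0..<?m]) (?p ?m) \<cdot> f (Suc ?m))"
   using Comp_assoc[OF u(1) tH fH] Comp_tup[OF u(1) s pX] ups t(3) A.Comp_zero[OF u(1)] u(2) by simp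
  also have "... = ?u \<cdot> Rst C (?p ?m \<cdot> f 0) \<cdot> zmap B ?P"
   unfolding zero by (rule Comp_assoc[OF u(1) Rst_Hom[OF Comp_Hom[OF pX f0]] zB, symmetric])
  also have "?u \<cdot> Rst C (?p ?m \<cdot> f 0) = Rst C (x \<cdot> f 0) \<cdot> ?u"
   using R4[OF u(1) Comp_Hom[OF pX f0]] Comp_assoc[OF u(1) pX f0] t(3) by simp
  also have "Rst C (x \<cdot> f 0) \<cdot> ?u \<cdot> zmap B ?P = Rst C (x \<cdot> f 0) \<cdot> (e \<cdot> zmap B Z)"
   using Comp_assoc[OF Rst_Hom[OF Comp_Hom[OF ptH[OF x] f0]] u(1) zB] B.Comp_zero[OF u(1)] u(2) by simp
  also have "... = Rst C (x \<cdot> f 0) \<cdot> e \<cdot> zmap B Z"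
   by (rule Comp_assoc[OF Rst_Hom[OF Comp_Hom[OF ptH[OF x] f0]] pt_idem(1)[OF x] ptH[OF B.zero_pt[OF Z]], symmetric])
  also have "Rst C (x \<cdot> f 0) \<cdot> e = Rst C (x \<cdot> f 0)"
   using Rst_Comp_le[OF ptH[OF x] f0] R2[OF Comp_Hom[OF ptH[OF x] f0] ptH[OF x]] ptD(2)[OF x] by simp
  finally show "tup (e \<cdot> zmap A Z # zs) x \<cdot> f (Suc ?m) = Rst C (x \<cdot> f 0) \<cdot> zmap B Z" .
 qed (use f0 f in auto)
qed

end

section \<open>Preservation of monoids, arrows and evaluation by a functor\<close>

definition mon_image :: "('o, 'm, 'p, 'n) crfun => ('o, 'm) cmon => ('p, 'n) cmon" where
 "mon_image F A = CMon (onObj F (mcar A)) (onArr F (mplus A)) (onArr F (mzero A))"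

lemma map_faa_obj_simp [simp]: "map_faa_obj F (A, X) = (mon_image F A, onObj F X)"
 by (simp add: map_faa_obj_def mon_image_def)

lemma mon_image_simps [simp]: "mcar (mon_image F A) = onObj F (mcar A)"
 "mplus (mon_image F A) = onArr F (mplus A)" "mzero (mon_image F A) = onArr F (mzero A)"
 by (simp_all add: mon_image_def)

lemma map_faa_arr_simps [simp]: "faa_src (map_faa_arr F f) = map_faa_obj F (faa_src f)"
 "faa_tgt (map_faa_arr F f) = map_faa_obj F (faa_tgt f)" "faa_seq (map_faa_arr F f) n = onArr F (faa_seq f n)"
 by (simp_all add: map_faa_arr_def)

lemma faa_arr_eqI: "faa_src F = faa_src G ==> faa_tgt F = faa_tgt G ==> (!!n. faa_seq F n = faa_seq G n) ==> F = G"
 by (cases F; cases G) auto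

locale cr_fun = C: cartesian_restriction_category C + D: cartesian_restriction_category D
 for C :: "('o, 'm) crcat" and D :: "('p, 'n) crcat" +
 fixes F :: "('o, 'm, 'p, 'n) crfun"
 assumes F_functor: "cr_functor C D F"
begin

abbreviation "Fo \<equiv> onObj F"
abbreviation "Fa \<equiv> onArr F"
abbreviation (input) "FO \<equiv> map_faa_obj F"
abbreviation (input) "FA \<equiv> map_faa_arr F"
abbreviation (input) "FM \<equiv> mon_image F"

lemma Fo: "X \<in> Obj C ==> Fo X \<in> Obj D"
 using F_functor by (auto simp: cr_functor_def)

lemma Fa: "f \<in> Hom C X Y ==> Fa f \<in> Hom D (Fo X) (Fo Y)"
 using F_functor by (auto simp: cr_functor_def Hom_def)

lemma F_Ide: "X \<in> Obj C ==> Fa (Ide C X) = Ide D (Fo X)"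
 using F_functor by (auto simp: cr_functor_def)

lemma F_Comp: "f \<in> Hom C X Y ==> g \<in> Hom C Y Z ==> Fa (f \<cdot>\<^bsub>C\<^esub> g) = Fa f \<cdot>\<^bsub>D\<^esub> Fa g"
 using F_functor by (auto simp: cr_functor_def Hom_def)

lemma F_Rst: "f \<in> Hom C X Y ==> Fa (Rst C f) = Rst D (Fa f)"
 using F_functor by (auto simp: cr_functor_def Hom_def)

lemma F_Unit: "Fo (Unit C) = Unit D"
 and F_Prod: "X \<in> Obj C ==> Y \<in> Obj C ==> Fo (Prod C X Y) = Prod D (Fo X) (Fo Y)"
 and F_Pi0: "X \<in> Obj C ==> Y \<in> Obj C ==> Fa (Pi0 C X Y) = Pi0 D (Fo X) (Fo Y)"
 and F_Pi1: "X \<in> Obj C ==> Y \<in> Obj C ==> Fa (Pi1 C X Y) = Pi1 D (Fo X) (Fo Y)"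
 using F_functor by (auto simp: cr_functor_def)

lemma F_pt: "f \<in> pt C Z e X ==> Fa f \<in> pt D (Fo Z) (Fa e) (Fo X)"
 using Fa F_Rst by (auto simp: pt_def)

lemma F_pt_total: "f \<in> pt C Z (Ide C Z) X ==> Fa f \<in> pt D (Fo Z) (Ide D (Fo Z)) (Fo X)"
 using F_pt[of f Z "Ide C Z" X] F_Ide C.Hom_Obj(1)[OF C.ptD(1)] by fastforce

lemma F_Bang: "X \<in> Obj C ==> Fa (Bang C X) = Bang D (Fo X)"
 using F_pt_total[OF C.Bang_pt] D.pt_Unit_eq[OF _ D.Bang_pt[OF Fo]] F_Unit by simp

lemma F_Pairing:
 assumes f: "f \<in> Hom C Z X" and g: "g \<in> Hom C Z Y"
 shows "Fa (Pairing C f g) = Pairing D (Fa f) (Fa g)"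
proof (rule D.Pairing_unique[OF Fa[OF f] Fa[OF g]])
 have X: "X \<in> Obj C" and Y: "Y \<in> Obj C" using C.Hom_Obj(2)[OF f] C.Hom_Obj(2)[OF g] .
 note p = C.Pairing_Hom[OF f g]
 show "Fa (Pairing C f g) \<in> Hom D (Fo Z) (Prod D (Fo X) (Fo Y))" using Fa[OF p] F_Prod[OF X Y] by simp
 show "Fa (Pairing C f g) \<cdot>\<^bsub>D\<^esub> Pi0 D (Fo X) (Fo Y) = Rst D (Fa g) \<cdot>\<^bsub>D\<^esub> Fa f"
  using F_Comp[OF p C.Pi0_Hom[OF X Y]] F_Pi0[OF X Y] C.Pairing_Pi0[OF f g] F_Comp[OF C.Rst_Hom[OF g] f] F_Rst[OF g] by simp
 show "Fa (Pairing C f g) \<cdot>\<^bsub>D\<^esub> Pi1 D (Fo X) (Fo Y) = Rst D (Fa f) \<cdot>\<^bsub>D\<^esub> Fa g"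
  using F_Comp[OF p C.Pi1_Hom[OF X Y]] F_Pi1[OF X Y] C.Pairing_Pi1[OF f g] F_Comp[OF C.Rst_Hom[OF f] g] F_Rst[OF f] by simp
qed

lemma F_powprod: "A \<in> Obj C ==> X \<in> Obj C ==> Fo (powprod C A n X) = powprod D (Fo A) n (Fo X)"
 by (induction n) (auto simp: F_Prod C.powprod_Obj)

lemma F_proj: "A \<in> Obj C ==> X \<in> Obj C ==> i \<le> n ==> Fa (proj C A n X i) = proj D (Fo A) n (Fo X) i"
proof (induction n arbitrary: i)
 case 0
 then show ?case by (simp add: F_Ide)
next
 case (Suc n)
 note P = C.powprod_Obj[OF Suc.prems(1,2), of n]
 show ?case
 proof (cases i)
  case 0
  then show ?thesis using F_Pi0[OF Suc.prems(1) P] F_powprod[OF Suc.prems(1,2)] by simp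
 next
  case (Suc j)
  have "proj C A n X j \<in> Hom C (powprod C A n X) (if j = n then X else A)"
   using C.ptH[OF C.proj_pt(1)[OF Suc.prems(1,2), of j n]] C.ptH[OF C.proj_pt(2)[OF Suc.prems(1,2), of n]] Suc.prems(3) Suc by auto
  from F_Comp[OF C.Pi1_Hom[OF Suc.prems(1) P] this] show ?thesis
   using F_Pi1[OF Suc.prems(1) P] F_powprod[OF Suc.prems(1,2)] Suc.IH[of j] Suc.prems Suc by simp
 qed
qed

lemma F_tup:
 "set zs \<subseteq> Hom C Z A ==> x \<in> Hom C Z X ==> Fa (C.tup zs x) = D.tup (map Fa zs) (Fa x)"
 by (induction zs) (auto simp: F_Pairing[OF _ C.tup_Hom])

lemma F_madd:
 assumes "tcm C A" "f \<in> Hom C Z (mcar A)" "g \<in> Hom C Z (mcar A)"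
 shows "Fa (madd C A f g) = madd D (FM A) (Fa f) (Fa g)"
 unfolding madd_def
 using F_Comp[OF C.Pairing_Hom[OF assms(2,3)] C.ptH[OF C.total_comm_monoidD(2)[OF assms(1)]]] F_Pairing[OF assms(2,3)] by simp

lemma F_zero_map:
 assumes "tcm C A" "Z \<in> Obj C"
 shows "Fa (zero_map C A Z) = zero_map D (FM A) (Fo Z)"
 unfolding zero_map_def
 using F_Comp[OF C.Bang_Hom[OF assms(2)] C.ptH[OF C.total_comm_monoidD(3)[OF assms(1)]]] F_Bang[OF assms(2)] by simp

lemma F_cmon:
 assumes "tcm C A"
 shows "tcm D (FM A)"
proof -
 interpret A: crc_monoid C A by unfold_locales (rule assms)
 let ?A = "mcar A" and ?F = "FM A"
 note O = A.car_Obj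
 have P: "Fo (Prod C ?A ?A) = Prod D (Fo ?A) (Fo ?A)" by (rule F_Prod[OF O O])
 have p: "proj C ?A 2 ?A i \<in> Hom C (powprod C ?A 2 ?A) ?A" if "i \<le> 2" for i
  using C.ptH[OF C.proj_pt(1)[OF O O, of i 2]] C.ptH[OF C.proj_pt(2)[OF O O, of 2]] that by (cases "i = 2") auto
 have p': "proj C ?A 2 ?A 0 \<in> Hom C (powprod C ?A 2 ?A) ?A" "proj C ?A 2 ?A 1 \<in> Hom C (powprod C ?A 2 ?A) ?A"
  "proj C ?A 2 ?A 2 \<in> Hom C (powprod C ?A 2 ?A) ?A" using p[of 0] p[of 1] p[of 2] by simp_all
 have Fp: "Fa (proj C ?A 2 ?A 0) = proj D (Fo ?A) 2 (Fo ?A) 0" "Fa (proj C ?A 2 ?A 1) = proj D (Fo ?A) 2 (Fo ?A) 1"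
  "Fa (proj C ?A 2 ?A 2) = proj D (Fo ?A) 2 (Fo ?A) 2"
  using F_proj[OF O O, of 0 2] F_proj[OF O O, of 1 2] F_proj[OF O O, of 2 2] by simp_all
 note q = C.Pi0_Hom[OF O O] C.Pi1_Hom[OF O O]
 have e: "madd C A (madd C A (proj C ?A 2 ?A 0) (proj C ?A 2 ?A 1)) (proj C ?A 2 ?A 2) = madd C A (proj C ?A 2 ?A 0) (madd C A (proj C ?A 2 ?A 1) (proj C ?A 2 ?A 2))"
  "madd C A (Pi0 C ?A ?A) (Pi1 C ?A ?A) = madd C A (Pi1 C ?A ?A) (Pi0 C ?A ?A)"
  "madd C A (Ide C ?A) (zero_map C A ?A) = Ide C ?A"
  using assms by (simp_all add: total_comm_monoid_def Let_def)
 have "madd D ?F (madd D ?F (proj D (Fo ?A) 2 (Fo ?A) 0) (proj D (Fo ?A) 2 (Fo ?A) 1)) (proj D (Fo ?A) 2 (Fo ?A) 2) =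
   madd D ?F (proj D (Fo ?A) 2 (Fo ?A) 0) (madd D ?F (proj D (Fo ?A) 2 (Fo ?A) 1) (proj D (Fo ?A) 2 (Fo ?A) 2))"
  using arg_cong[OF e(1), of Fa]
  unfolding F_madd[OF assms A.add_Hom[OF p'(1,2)] p'(3)] F_madd[OF assms p'(1) A.add_Hom[OF p'(2,3)]]
   F_madd[OF assms p'(1,2)] F_madd[OF assms p'(2,3)] Fp .
 moreover have "madd D ?F (Pi0 D (Fo ?A) (Fo ?A)) (Pi1 D (Fo ?A) (Fo ?A)) = madd D ?F (Pi1 D (Fo ?A) (Fo ?A)) (Pi0 D (Fo ?A) (Fo ?A))"
  using arg_cong[OF e(2), of Fa]
  unfolding F_madd[OF assms q] F_madd[OF assms q(2,1)] F_Pi0[OF O O] F_Pi1[OF O O] .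
 moreover have "madd D ?F (Ide D (Fo ?A)) (zero_map D ?F (Fo ?A)) = Ide D (Fo ?A)"
  using arg_cong[OF e(3), of Fa]
  unfolding F_madd[OF assms C.Ide_Hom[OF O] C.ptH[OF A.zero_pt[OF O]]] F_Ide[OF O] F_zero_map[OF assms O] .
 moreover have "Fa (mplus A) \<in> pt D (Prod D (Fo ?A) (Fo ?A)) (Ide D (Prod D (Fo ?A) (Fo ?A))) (Fo ?A)"
  using F_pt_total[OF A.plus_pt] P by simp
 moreover have "Fa (mzero A) \<in> pt D (Unit D) (Ide D (Unit D)) (Fo ?A)"
  using F_pt_total[OF A.mzero_pt] F_Unit by simp
 ultimately show ?thesis
  unfolding total_comm_monoid_def Let_def mon_image_simps
  using D.total_map_iff D.ptD(1) Fo[OF O] by blast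
qed

lemma F_ptmon_finprod:
 assumes A: "tcm C A" and e: "e \<in> pt C Z e Z" and t: "t \<in> I \<rightarrow> mpt C Z e A"
 shows "Fa (finprod (ptmon C A Z e) t I) = finprod (ptmon D (FM A) (Fo Z) (Fa e)) (%i. Fa (t i)) I"
proof -
 interpret A: crc_monoid C A by unfold_locales (rule A)
 interpret FA: crc_monoid D "FM A" by unfold_locales (rule F_cmon[OF A])
 have Z: "Z \<in> Obj C" using C.Hom_Obj(1)[OF C.ptH[OF e]] .
 have Fe: "Fa e \<in> pt D (Fo Z) (Fa e) (Fo Z)" by (rule F_pt[OF e])
 show ?thesis
  by (rule finprod_hom[OF A.ptmon[OF e] FA.ptmon[OF Fe]])
   (use t F_pt F_madd[OF A C.ptD(1) C.ptD(1)] F_Comp[OF C.ptH[OF e] C.ptH[OF A.zero_pt[OF Z]]] F_zero_map[OF A Z] in auto)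
qed

text \<open>Each condition of \<open>faa_ArrI_generic\<close> for the image arrow is the image of
  the corresponding equation in \<open>C\<close>, because projections go to projections.\<close>

lemma map_faa_Hom:
 assumes G: "G \<in> Hom (Faa C) (A, X) (B, Y)"
 shows "FA G \<in> Hom (Faa D) (FM A, Fo X) (FM B, Fo Y)"
proof -
 interpret G: faa_arrow C G A X B Y by (rule C.faa_arrowI[OF G])
 let ?A = "mcar A"
 interpret FA: crc_monoid D "FM A" by unfold_locales (rule F_cmon[OF G.objs(1)])
 note O = G.A.car_Obj G.objs(2)
 note pp = C.proj_pt[OF O]
 have pH: "proj C ?A n X i \<in> Hom C (powprod C ?A n X) ?A" if "i < n" for i n using C.ptH[OF pp(1)[OF that]] .
 have pX: "proj C ?A n X n \<in> Hom C (powprod C ?A n X) X" for n using C.ptH[OF pp(2)] .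
 have Fp: "Fa (proj C ?A n X i) = proj D (Fo ?A) n (Fo X) i" if "i \<le> n" for i n by (rule F_proj[OF O that])
 have PO: "powprod C ?A n X \<in> Obj C" for n by (rule C.powprod_Obj[OF O])
 have Ft: "Fa (C.tup zs x \<cdot>\<^bsub>C\<^esub> G.f (length zs)) = D.tup (map Fa zs) (Fa x) \<cdot>\<^bsub>D\<^esub> Fa (G.f (length zs))"
  if "zs \<noteq> []" "set zs \<subseteq> Hom C Z ?A" "x \<in> Hom C Z X" for zs Z x
 proof -
  have "length zs \<ge> 1" using that(1) by (cases zs) auto
  then show ?thesis using F_Comp[OF C.tup_Hom[OF that(2,3)] G.fn(1)] F_tup[OF that(2,3)] by simp
 qed
 have "FaaArr (FM A, Fo X) (FM B, Fo Y) (%n. Fa (G.f n)) \<in> faa_Arr D"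
 proof (rule D.faa_ArrI_generic[OF F_cmon[OF G.objs(1)] F_cmon[OF G.objs(3)] Fo[OF G.objs(2)], where Y = "Fo Y"]; (unfold mon_image_simps)?)
  show "Fa (G.f 0) \<in> Hom D (Fo X) (Fo Y)" by (rule Fa[OF G.f0])
  show "Fa (G.f n) \<in> Hom D (powprod D (Fo ?A) n (Fo X)) (Fo (mcar B))" if "n \<ge> 1" for n
   using Fa[OF G.fn(1)[OF that]] F_powprod[OF O] by simp
  show "Rst D (Fa (G.f n)) = Rst D (proj D (Fo ?A) n (Fo X) n \<cdot>\<^bsub>D\<^esub> Fa (G.f 0))" if "n \<ge> 1" for n
   using arg_cong[OF G.fn(2)[OF that], of Fa] F_Rst[OF G.fn(1)[OF that]] F_Rst[OF C.Comp_Hom[OF pX G.f0]] F_Comp[OF pX G.f0] Fp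
   by simp
 next
  fix n :: nat and \<sigma> assume n: "n \<ge> 1" and \<sigma>: "\<sigma> permutes {..<n}"
  let ?zs = "map (proj C ?A n X) [0..<n]"
  have zs: "set ?zs \<subseteq> pt C (powprod C ?A n X) (Ide C (powprod C ?A n X)) ?A" "?zs \<noteq> []" using pp(1) n by auto
  have zs': "set (permute_list \<sigma> ?zs) \<subseteq> Hom C (powprod C ?A n X) ?A" "permute_list \<sigma> ?zs \<noteq> []" "length (permute_list \<sigma> ?zs) = n"
   using pH \<sigma> n by (auto simp flip: length_0_conv)
  have "C.tup (permute_list \<sigma> ?zs) (proj C ?A n X n) \<cdot>\<^bsub>C\<^esub> G.f n = G.f n"
   using G.tup_f_perm[OF zs(2,1) pp(2), of "permute_list \<sigma> ?zs"] \<sigma> C.tup_proj[OF O] C.Ide_Comp[OF G.fn(1)[OF n]] by simp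
  then have "Fa (G.f n) = D.tup (map Fa (permute_list \<sigma> ?zs)) (Fa (proj C ?A n X n)) \<cdot>\<^bsub>D\<^esub> Fa (G.f n)"
   using Ft[OF zs'(2,1) pX] zs'(3) by simp
  moreover have "map Fa (permute_list \<sigma> ?zs) = permute_list \<sigma> (map (proj D (Fo ?A) n (Fo X)) [0..<n])"
  proof -
   have "map (proj D (Fo ?A) n (Fo X)) [0..<n] = map Fa ?zs" using Fp by simp
   then show ?thesis using permute_list_map[of \<sigma> ?zs Fa] \<sigma> by (simp only: length_map length_upt minus_nat.diff_0)
  qed
  ultimately show "D.tup (permute_list \<sigma> (map (proj D (Fo ?A) n (Fo X)) [0..<n])) (proj D (Fo ?A) n (Fo X) n) \<cdot>\<^bsub>D\<^esub> Fa (G.f n) = Fa (G.f n)"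
   using Fp by simp
 next
  fix m and p assume p: "p = proj D (Fo ?A) (Suc (Suc m)) (Fo X)"
  define q where "q = proj C ?A (Suc (Suc m)) X"
  let ?P = "powprod C ?A (Suc (Suc m)) X"
  let ?zs = "map (%i. q (Suc (Suc i))) [0..<m]"
  have qp: "Fa (q i) = p i" if "i \<le> Suc (Suc m)" for i using Fp[OF that] by (simp add: p q_def)
  have q: "q i \<in> pt C ?P (Ide C ?P) ?A" if "i < Suc (Suc m)" for i using pp(1)[OF that] by (simp add: q_def)
  have qX: "q (Suc (Suc m)) \<in> pt C ?P (Ide C ?P) X" unfolding q_def by (rule pp(2))
  have zs: "set ?zs \<subseteq> pt C ?P (Ide C ?P) ?A" using q by (auto simp del: powprod.simps)
  have q01: "q 0 \<in> pt C ?P (Ide C ?P) ?A" "q 1 \<in> pt C ?P (Ide C ?P) ?A" using q by (auto simp del: powprod.simps)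
  have H: "set (y # ?zs) \<subseteq> Hom C ?P ?A" if "y \<in> pt C ?P (Ide C ?P) ?A" for y
   using zs that by (auto simp del: powprod.simps intro: C.ptD(1))
  have l: "length (y # ?zs) = Suc m" for y by simp
  note s = G.A.add_pt[OF q01]
  have mp: "map Fa ?zs = map (%i. p (Suc (Suc i))) [0..<m]" using qp by simp
  have v: "Fa (C.tup (y # ?zs) (q (Suc (Suc m))) \<cdot>\<^bsub>C\<^esub> G.f (Suc m)) =
    D.tup (Fa y # map (%i. p (Suc (Suc i))) [0..<m]) (p (Suc (Suc m))) \<cdot>\<^bsub>D\<^esub> Fa (G.f (Suc m))"
   if "y \<in> pt C ?P (Ide C ?P) ?A" for y
   using Ft[OF _ H[OF that] C.ptH[OF qX]] qp[of "Suc (Suc m)"] unfolding l list.map(2) mp by simp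
  have vH: "C.tup (y # ?zs) (q (Suc (Suc m))) \<cdot>\<^bsub>C\<^esub> G.f (Suc m) \<in> Hom C ?P (mcar B)" if "y \<in> pt C ?P (Ide C ?P) ?A" for y
   using C.Comp_Hom[OF C.tup_Hom[OF H[OF that] C.ptH[OF qX]] G.fn(1)] unfolding l by simp
  have "C.tup (madd C A (q 0) (q 1) # ?zs) (q (Suc (Suc m))) \<cdot>\<^bsub>C\<^esub> G.f (Suc m) =
    madd C B (C.tup (q 0 # ?zs) (q (Suc (Suc m))) \<cdot>\<^bsub>C\<^esub> G.f (Suc m)) (C.tup (q 1 # ?zs) (q (Suc (Suc m))) \<cdot>\<^bsub>C\<^esub> G.f (Suc m))"
   using G.tup_f_add[OF zs qX q01] by simp
  from arg_cong[OF this, of Fa]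
  show "D.tup (madd D (FM A) (p 0) (p 1) # map (%i. p (Suc (Suc i))) [0..<m]) (p (Suc (Suc m))) \<cdot>\<^bsub>D\<^esub> Fa (G.f (Suc m)) =
   madd D (FM B) (D.tup (p 0 # map (%i. p (Suc (Suc i))) [0..<m]) (p (Suc (Suc m))) \<cdot>\<^bsub>D\<^esub> Fa (G.f (Suc m)))
    (D.tup (p 1 # map (%i. p (Suc (Suc i))) [0..<m]) (p (Suc (Suc m))) \<cdot>\<^bsub>D\<^esub> Fa (G.f (Suc m)))"
   unfolding v[OF s] F_madd[OF G.objs(3) vH[OF q01(1)] vH[OF q01(2)]] v[OF q01(1)] v[OF q01(2)]
    F_madd[OF G.objs(1) C.ptH[OF q01(1)] C.ptH[OF q01(2)]]
   using qp[of 0] qp[of 1] by simp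
 next
  fix m
  let ?P = "powprod C ?A m X"
  let ?zs = "map (proj C ?A m X) [0..<m]"
  note z = G.A.zero_pt[OF PO] and zB = G.B.zero_pt[OF PO]
  have zs: "set ?zs \<subseteq> pt C ?P (Ide C ?P) ?A" using pp(1) by auto
  have H: "set (zero_map C A ?P # ?zs) \<subseteq> Hom C ?P ?A" using zs C.ptH[OF z] by (auto intro: C.ptD(1))
  have mp: "map (%i. Fa (proj C ?A m X i)) [0..<m] = map (proj D (Fo ?A) m (Fo X)) [0..<m]" using Fp by simp
  have "C.tup (zero_map C A ?P # ?zs) (proj C ?A m X m) \<cdot>\<^bsub>C\<^esub> G.f (Suc m) = Rst C (proj C ?A m X m \<cdot>\<^bsub>C\<^esub> G.f 0) \<cdot>\<^bsub>C\<^esub> zero_map C B ?P"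
   using G.tup_f_zero[OF zs pp(2)] C.Ide_Comp[OF C.ptH[OF z]] by simp
  from arg_cong[OF this, of Fa]
  show "D.tup (zero_map D (FM A) (powprod D (Fo ?A) m (Fo X)) # map (proj D (Fo ?A) m (Fo X)) [0..<m]) (proj D (Fo ?A) m (Fo X) m) \<cdot>\<^bsub>D\<^esub> Fa (G.f (Suc m)) =
   Rst D (proj D (Fo ?A) m (Fo X) m \<cdot>\<^bsub>D\<^esub> Fa (G.f 0)) \<cdot>\<^bsub>D\<^esub> zero_map D (FM B) (powprod D (Fo ?A) m (Fo X))"
   using Ft[OF _ H pX] F_Comp[OF C.Rst_Hom[OF C.Comp_Hom[OF pX G.f0]] C.ptH[OF zB]] F_Rst[OF C.Comp_Hom[OF pX G.f0]] F_Comp[OF pX G.f0]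
    F_zero_map[OF G.objs(1) PO] F_zero_map[OF G.objs(3) PO] F_powprod[OF O, of m] Fp mp by (simp add: o_def)
 qed
 then show ?thesis by (simp add: Hom_Faa map_faa_arr_def)
qed

lemma F_papp:
 assumes G: "G \<in> Hom (Faa C) (A, X) (B, Y)" and M: "set_mset M \<subseteq> mpt C Z e A" and x: "x \<in> pt C Z e X"
 shows "Fa (papp C G x M) = papp D (FA G) (Fa x) (image_mset Fa M)"
proof -
 interpret G: faa_arrow C G A X B Y by (rule C.faa_arrowI[OF G])
 interpret FG: faa_arrow D "FA G" "FM A" "Fo X" "FM B" "Fo Y" by (rule D.faa_arrowI[OF map_faa_Hom[OF G]])
 obtain zs where zs: "mset zs = M" using ex_mset by blast
 have zs': "set zs \<subseteq> mpt C Z e A" using M zs by auto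
 have zsH: "set zs \<subseteq> Hom C Z (mcar A)" using zs' by (auto intro: C.ptD(1))
 have Fzs: "set (map Fa zs) \<subseteq> pt D (Fo Z) (Fa e) (mcar (FM A))" using zs' F_pt by auto
 have fH: "G.f (length zs) \<in> Hom C (powprod C (mcar A) (length zs) X) (if zs = [] then Y else mcar B)"
  using G.fn(1)[of "length zs"] G.f0 by (cases zs) auto
 show ?thesis
  using G.papp_mset[OF zs' x] FG.papp_mset[OF Fzs F_pt[OF x]] zs F_Comp[OF C.tup_Hom[OF zsH C.ptH[OF x]] fH]
   F_tup[OF zsH C.ptH[OF x]] by simp
qed

lemma F_cube: "cube C Z e (A, X) c ==> cube D (Fo Z) (Fa e) (FM A, Fo X) (%J. Fa (c J))"
 using F_pt by (simp add: cube_def)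

text \<open>A functor is a homomorphism on points with a fixed domain and commutes with each
  component, hence with the sum over partitions.\<close>

lemma F_ev:
 assumes G: "G \<in> Hom (Faa C) (A, X) (B, Y)" and c: "cube C Z e (A, X) c"
 shows "Fa (ev C G c J) = ev D (FA G) (%J. Fa (c J)) J"
proof -
 interpret G: faa_arrow C G A X B Y by (rule C.faa_arrowI[OF G])
 interpret FG: faa_arrow D "FA G" "FM A" "Fo X" "FM B" "Fo Y" by (rule D.faa_arrowI[OF map_faa_Hom[OF G]])
 note x = G.cube_base(1)[OF c]
 note xH = C.ptH[OF x]
 show ?thesis
 proof (cases "J = {}")
  case True
  then show ?thesis using F_Comp[OF xH G.f0] by simp
 next
  case False
  let ?e = "Rst C (c {} \<cdot>\<^bsub>C\<^esub> G.f 0)"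
  interpret S: symadd "ptmon C A Z e" "ptmon C B Z ?e" "papp C G (c {})" by (rule G.symadd[OF x])
  have Fe: "Fa ?e = Rst D (Fa (c {}) \<cdot>\<^bsub>D\<^esub> Fa (G.f 0))"
   using F_Rst[OF C.Comp_Hom[OF xH G.f0]] F_Comp[OF xH G.f0] by simp
  have t: "papp C G (c {}) (image_mset c (mset_set P)) \<in> pt C Z ?e (mcar B)" if "P \<in> parts J" for P
   using S.pev_term_closed[OF G.cube_fam'[OF c] False that] by simp
  have eq: "Fa (papp C G (c {}) (image_mset c (mset_set P))) = papp D (FA G) (Fa (c {})) {#Fa (c B). B \<in># mset_set P#}"
   if P: "P \<in> parts J" for P
  proof -
   have "c B \<in> mpt C Z e A" if "B \<in> P" for B
    using G.cube_base(2)[OF c, of B] partsD(4)[OF P] that by metis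
   then have "set_mset (image_mset c (mset_set P)) \<subseteq> mpt C Z e A" using partsD(2)[OF P] by auto
   from F_papp[OF G this x] show ?thesis by (simp add: multiset.map_comp o_def)
  qed
  have "Fa (ev C G c J) = finprod (ptmon D (FM B) (Fo Z) (Fa ?e)) (%P. Fa (papp C G (c {}) (image_mset c (mset_set P)))) (parts J)"
   unfolding G.ev_pev[OF c False] pev_def
   by (rule F_ptmon_finprod[OF G.objs(3) G.dom_idem[OF xH]]) (use t in auto)
  also have "... = ev D (FA G) (%J. Fa (c J)) J"
   unfolding FG.ev_pev[OF F_cube[OF c] False] pev_def
  proof (subst Fe[symmetric, folded map_faa_arr_simps], rule comm_monoid.finprod_cong'[OF FG.B.ptmon])
   show "Fa ?e \<in> pt D (Fo Z) (Fa ?e) (Fo Z)" using F_pt[OF G.dom_idem[OF xH]] .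
   show "(%P. papp D (FA G) (Fa (c {})) {#Fa (c B). B \<in># mset_set P#}) \<in> parts J \<rightarrow> carrier (ptmon D (FM B) (Fo Z) (Fa ?e))"
    using F_pt[OF t] by (auto simp flip: eq)
  qed (use eq in auto)
  finally show ?thesis .
 qed
qed

lemma F_ucube:
 assumes "(A, X) \<in> faa_Obj C"
 shows "Fa (ucube C (A, X) n J) = ucube D (FM A, Fo X) n J"
proof -
 have A: "tcm C A" "X \<in> Obj C" using assms by (auto simp: faa_Obj_def)
 interpret A: crc_monoid C A by unfold_locales (rule A)
 note P = C.powprod_Obj[OF A.car_Obj A(2), of n]
 have "Fa (Ide C (powprod C (mcar A) n X) \<cdot>\<^bsub>C\<^esub> zero_map C A (powprod C (mcar A) n X)) =
   Ide D (powprod D (Fo (mcar A)) n (Fo X)) \<cdot>\<^bsub>D\<^esub> zero_map D (FM A) (powprod D (Fo (mcar A)) n (Fo X))"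
  using F_Comp[OF C.Ide_Hom[OF P] C.ptH[OF A.zero_pt[OF P]]] F_Ide[OF P] F_zero_map[OF A(1) P] F_powprod[OF A.car_Obj A(2)] by simp
 then show ?thesis
  using F_proj[OF A.car_Obj A(2), of _ n] by (auto simp: ucube_def Let_def pcube_def)
qed

text \<open>The components of a composite are iterated evaluations at the universal cube. A functor
  preserves evaluations and universal cubes, so no two sums over partitions have to be
  compared.\<close>

lemma map_faa_Comp:
 assumes G: "G \<in> Hom (Faa C) (A, X) (B, Y)" and H: "H \<in> Hom (Faa C) (B, Y) (E, W)"
 shows "FA (faa_Comp C G H) = faa_Comp D (FA G) (FA H)"
proof (rule faa_arr_eqI)
 interpret GH: faa_composable C G A X B Y H E W by (intro faa_composable.intro C.faa_arrowI G H)
 interpret FGH: faa_composable D "FA G" "FM A" "Fo X" "FM B" "Fo Y" "FA H" "FM E" "Fo W"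
  by (intro faa_composable.intro D.faa_arrowI map_faa_Hom[OF G] map_faa_Hom[OF H])
 have S: "(A, X) \<in> faa_Obj C" using C.Faa_Objs(1)[OF G] .
 note u = GH.F.ucube_cube
 show "faa_seq (FA (faa_Comp C G H)) n = faa_seq (faa_Comp D (FA G) (FA H)) n" for n
  unfolding map_faa_arr_simps FGH.comp_seq GH.comp_seq
  using F_ev[OF H GH.F.ev_cube[OF u]] F_ev[OF G u] F_ucube[OF S] by simp
qed (simp_all add: faa_Comp_def Let_def)

lemma Faa_Obj_map: "S \<in> faa_Obj C ==> FO S \<in> faa_Obj D"
 using F_cmon Fo by (cases S) (auto simp: faa_Obj_def)

lemma mon_image_prod:
 assumes A: "tcm C A" and B: "tcm C B"
 shows "FM (prod_cmon C A B) = prod_cmon D (FM A) (FM B)"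
proof -
 interpret A: crc_monoid C A by unfold_locales (rule A)
 interpret B: crc_monoid C B by unfold_locales (rule B)
 note O = A.car_Obj B.car_Obj
 note P = C.Prod_Obj[OF O]
 note pq = C.Pi0_Hom[OF P P] C.Pi1_Hom[OF P P] and lr = C.Pi0_Hom[OF O] C.Pi1_Hom[OF O]
 note c = C.Comp_Hom[OF pq(1) lr(1)] C.Comp_Hom[OF pq(2) lr(1)] C.Comp_Hom[OF pq(1) lr(2)] C.Comp_Hom[OF pq(2) lr(2)]
 show ?thesis
 proof (rule cmon.expand, intro conjI; unfold mon_image_simps; unfold prod_cmon_def Let_def cmon.sel mon_image_simps)
 qed (use F_Pairing[OF A.add_Hom[OF c(1,2)] B.add_Hom[OF c(3,4)]] F_Pairing[OF A.mzero_Hom B.mzero_Hom]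
   F_madd[OF A c(1,2)] F_madd[OF B c(3,4)] F_Comp[OF pq(1) lr(1)] F_Comp[OF pq(2) lr(1)] F_Comp[OF pq(1) lr(2)] F_Comp[OF pq(2) lr(2)]
   F_Pi0[OF P P] F_Pi1[OF P P] F_Pi0[OF O] F_Pi1[OF O] F_Prod[OF O] in simp_all)
qed

lemma map_faa_linear:
 assumes A: "tcm C A" "X \<in> Obj C" and B: "tcm C B"
 shows "FA (faa_linear C (A, X) (B, Y) f g) = faa_linear D (FM A, Fo X) (FM B, Fo Y) (Fa f) (Fa g)"
proof (rule faa_arr_eqI)
 interpret A: crc_monoid C A by unfold_locales (rule A)
 show "faa_seq (FA (faa_linear C (A, X) (B, Y) f g)) n = faa_seq (faa_linear D (FM A, Fo X) (FM B, Fo Y) (Fa f) (Fa g)) n" for n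
  using F_zero_map[OF B C.powprod_Obj[OF A.car_Obj A(2)]] F_powprod[OF A.car_Obj A(2)] by (simp add: faa_linear_def)
qed (simp_all add: faa_linear_def)

lemma Faa_functor: "cr_functor (Faa C) (Faa D) (Faa_fun C F)"
proof -
 have hom: "FA f \<in> Hom (Faa D) (FO S) (FO T)" if "f \<in> Hom (Faa C) S T" for f S T
  using map_faa_Hom that by (cases S; cases T) simp
 have arr: "f \<in> Hom (Faa C) (faa_src f) (faa_tgt f)" if "f \<in> faa_Arr C" for f using that by (simp add: Hom_Faa)
 have objs: "faa_src f \<in> faa_Obj C" "faa_tgt f \<in> faa_Obj C" if "f \<in> faa_Arr C" for f using C.Faa_Objs[OF arr[OF that]] .
 have inArr: "f \<in> faa_Arr C" if "f \<in> Hom (Faa C) S T" for f S T using that by (simp add: Hom_Faa)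
 have Ide: "FA (faa_Ide C S) = faa_Ide D (FO S)" if S: "S \<in> faa_Obj C" for S
 proof -
  obtain A X where AX: "S = (A, X)" "tcm C A" "X \<in> Obj C" using S by (auto simp: faa_Obj_def)
  show ?thesis
   using map_faa_linear[OF AX(2,3,2), of X "Ide C X" "Pi0 C (mcar A) X"] F_Ide[OF AX(3)] F_Pi0[OF C.total_comm_monoidD(1)[OF AX(2)] AX(3)]
   by (simp add: AX(1) faa_Ide_def)
 qed
 have Comp: "FA (faa_Comp C f g) = faa_Comp D (FA f) (FA g)"
  if "f \<in> faa_Arr C" "g \<in> faa_Arr C" "faa_tgt f = faa_src g" for f g
  using map_faa_Comp arr[OF that(1)] arr[OF that(2)] that(3) by (cases "faa_src f"; cases "faa_src g"; cases "faa_tgt g") simp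
 have Rst: "FA (faa_Rst C f) = faa_Rst D (FA f)" if f: "f \<in> faa_Arr C" for f
 proof (rule faa_arr_eqI)
  obtain A X B Y where AB: "faa_src f = (A, X)" "faa_tgt f = (B, Y)" by (cases "faa_src f"; cases "faa_tgt f") auto
  interpret f: faa_arrow C f A X B Y by (rule C.faa_arrowI) (use arr[OF f] AB in simp)
  note O = f.A.car_Obj f.objs(2)
  fix n
  note P = C.powprod_Obj[OF O, of n] and p = C.ptH[OF C.proj_pt(2)[OF O, of n]]
  note pf = C.Comp_Hom[OF p f.f0]
  have "Fa (Rst C (proj C (mcar A) n X n \<cdot>\<^bsub>C\<^esub> f.f 0)) = Rst D (proj D (Fo (mcar A)) n (Fo X) n \<cdot>\<^bsub>D\<^esub> Fa (f.f 0))"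
   using F_Rst[OF pf] F_Comp[OF p f.f0] F_proj[OF O, of n n] by simp
  moreover have "Pi0 C (mcar A) X \<in> Hom C (powprod C (mcar A) n X) (mcar A)" if "n = 1" using C.Pi0_Hom[OF O] that by simp
  ultimately have "Fa (Rst C (proj C (mcar A) n X n \<cdot>\<^bsub>C\<^esub> f.f 0) \<cdot>\<^bsub>C\<^esub> (if n = 1 then Pi0 C (mcar A) X else zero_map C A (powprod C (mcar A) n X))) =
    Rst D (proj D (Fo (mcar A)) n (Fo X) n \<cdot>\<^bsub>D\<^esub> Fa (f.f 0)) \<cdot>\<^bsub>D\<^esub>
     (if n = 1 then Pi0 D (Fo (mcar A)) (Fo X) else zero_map D (FM A) (powprod D (Fo (mcar A)) n (Fo X)))"
   using F_Comp[OF C.Rst_Hom[OF pf] C.ptH[OF f.A.zero_pt[OF P]]] F_Comp[OF C.Rst_Hom[OF pf], of "Pi0 C (mcar A) X" "mcar A"]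
    F_zero_map[OF f.objs(1) P] F_powprod[OF O, of n] F_Pi0[OF O]
   by (auto simp del: proj.simps powprod.simps)
  then show "faa_seq (FA (faa_Rst C f)) n = faa_seq (faa_Rst D (FA f)) n"
   using F_Rst[OF f.f0]
   by (simp add: faa_Rst_def Let_def del: proj.simps powprod.simps One_nat_def)
 qed (simp_all add: faa_Rst_def Let_def)
 have Unit: "FO (faa_Unit C) = faa_Unit D"
  using F_Unit F_Bang[OF C.Unit_Obj] F_Bang[OF C.Prod_Obj[OF C.Unit_Obj C.Unit_Obj]] F_Prod[OF C.Unit_Obj C.Unit_Obj]
  by (simp add: faa_Unit_def unit_cmon_def mon_image_def)
 have Prod: "FO (faa_Prod C S T) = faa_Prod D (FO S) (FO T) \<and>
   FA (faa_Pi0 C S T) = faa_Pi0 D (FO S) (FO T) \<and>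
   FA (faa_Pi1 C S T) = faa_Pi1 D (FO S) (FO T)"
  if S: "S \<in> faa_Obj C" and T: "T \<in> faa_Obj C" for S T
 proof -
  obtain A X where AX: "S = (A, X)" "tcm C A" "X \<in> Obj C" using S by (auto simp: faa_Obj_def)
  obtain B Y where BY: "T = (B, Y)" "tcm C B" "Y \<in> Obj C" using T by (auto simp: faa_Obj_def)
  note O = C.total_comm_monoidD(1)[OF AX(2)] C.total_comm_monoidD(1)[OF BY(2)]
  note P = C.Prod_Obj[OF O] C.Prod_Obj[OF AX(3) BY(3)]
  note m = C.prod_cmon[OF AX(2) BY(2)]
  have pr: "FO (faa_Prod C S T) = faa_Prod D (FO S) (FO T)"
   using mon_image_prod[OF AX(2) BY(2)] F_Prod[OF AX(3) BY(3)] by (simp add: AX(1) BY(1) faa_Prod_def)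
  moreover have "FA (faa_Pi0 C S T) = faa_Pi0 D (FO S) (FO T)"
   "FA (faa_Pi1 C S T) = faa_Pi1 D (FO S) (FO T)"
   using map_faa_linear[OF m P(2) AX(2)] map_faa_linear[OF m P(2) BY(2)] pr
    F_Pi0[OF AX(3) BY(3)] F_Pi1[OF AX(3) BY(3)] F_Comp[OF C.Pi0_Hom[OF P] C.Pi0_Hom[OF O]] F_Comp[OF C.Pi0_Hom[OF P] C.Pi1_Hom[OF O]]
    F_Pi0[OF P] F_Pi0[OF O] F_Pi1[OF O] F_Prod[OF O] F_Prod[OF AX(3) BY(3)]
   by (simp_all add: AX(1) BY(1) faa_Pi0_def faa_Pi1_def faa_Prod_def)
  ultimately show ?thesis by simp
 qed
 have comp: "faa_Comp C f g \<in> faa_Arr C" if "f \<in> faa_Arr C" "g \<in> faa_Arr C" "faa_tgt f = faa_src g" for f g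
  using inArr[OF C.Faa_Comp_Hom[OF arr[OF that(1)], of g "faa_tgt g"]] arr[OF that(2)] that(3) by simp
 show ?thesis
  unfolding cr_functor_def Faa_fun_def crfun.sel Faa_simps
 proof (intro conjI ballI impI restrict_PiE_iff[THEN iffD2])
  show "FO S \<in> faa_Obj D" if "S \<in> faa_Obj C" for S by (rule Faa_Obj_map[OF that])
  show "FA f \<in> faa_Arr D" if "f \<in> faa_Arr C" for f
   using hom[OF arr[OF that]] by (simp add: Hom_Faa)
  show "faa_src (restrict (FA) (faa_Arr C) f) = restrict (FO) (faa_Obj C) (faa_src f)"
   "faa_tgt (restrict (FA) (faa_Arr C) f) = restrict (FO) (faa_Obj C) (faa_tgt f)"
   if "f \<in> faa_Arr C" for f using that objs[OF that] by simp_all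
  show "restrict (FA) (faa_Arr C) (faa_Ide C S) = faa_Ide D (restrict (FO) (faa_Obj C) S)"
   if "S \<in> faa_Obj C" for S using Ide[OF that] inArr[OF C.Faa_Ide_Hom[OF that]] that by simp
  show "restrict (FA) (faa_Arr C) (faa_Comp C f g) =
    faa_Comp D (restrict (FA) (faa_Arr C) f) (restrict (FA) (faa_Arr C) g)"
   if "f \<in> faa_Arr C" "g \<in> faa_Arr C" "faa_tgt f = faa_src g" for f g using Comp[OF that] comp[OF that] that by simp
  show "restrict (FA) (faa_Arr C) (faa_Rst C f) = faa_Rst D (restrict (FA) (faa_Arr C) f)"
   if "f \<in> faa_Arr C" for f using Rst[OF that] inArr[OF C.Faa_Rst_Hom[OF arr[OF that]]] that by simp
  show "restrict (FO) (faa_Obj C) (faa_Unit C) = faa_Unit D"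
   using Unit cartesian_restriction_category.Unit_Obj[OF C.Faa_crc] by simp
  fix S T assume S: "S \<in> faa_Obj C" and T: "T \<in> faa_Obj C"
  have "faa_Prod C S T \<in> faa_Obj C" using cartesian_restriction_category.Prod_Obj[OF C.Faa_crc] S T by simp
  then show "restrict (FO) (faa_Obj C) (faa_Prod C S T) = faa_Prod D (restrict (FO) (faa_Obj C) S) (restrict (FO) (faa_Obj C) T)"
   using Prod[OF S T] S T by simp
  show "restrict (FA) (faa_Arr C) (faa_Pi0 C S T) = faa_Pi0 D (restrict (FO) (faa_Obj C) S) (restrict (FO) (faa_Obj C) T)"
   "restrict (FA) (faa_Arr C) (faa_Pi1 C S T) = faa_Pi1 D (restrict (FO) (faa_Obj C) S) (restrict (FO) (faa_Obj C) T)"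
   using Prod[OF S T] S T inArr[OF C.faa_Pi_Hom(1)[OF S T]] inArr[OF C.faa_Pi_Hom(2)[OF S T]] by simp_all
 qed
qed

end

section \<open>The comultiplication on arrows\<close>

text \<open>Cubes with two kinds of directions that are linear in the first kind: no coefficient involves
 two directions of the first kind.\<close>

definition lin :: "('o, 'm) crcat => ('o, 'm) cmon => 'o => 'm => 'k set => ('k => 'i set => 'm) => ('i set => 'm) => ('k + 'i) set => 'm" where
 "lin C A Z e K s c B = (if Inl -` B = {} then c (Inr -` B)
   else if \<exists>k\<in>K. Inl -` B = {k} then s (the_elem (Inl -` B)) (Inr -` B) else e \<cdot>\<^bsub>C\<^esub> zero_map C A Z)"

lemma lin_Inr: "Inl -` B = {} ==> lin C A Z e K s c B = c (Inr -` B)"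
 and lin_Inl: "k \<in> K ==> Inl -` B = {k} ==> lin C A Z e K s c B = s k (Inr -` B)"
 and lin_zero: "Inl -` B \<noteq> {} ==> \<not> (\<exists>k\<in>K. Inl -` B = {k}) ==> lin C A Z e K s c B = e \<cdot>\<^bsub>C\<^esub> zero_map C A Z"
 by (auto simp: lin_def)

lemma lin_empty [simp]: "lin C A Z e K s c {} = c {}"
 by (simp add: lin_Inr)

lemma sum_set_eq: "B = (Inl -` B) |+| (Inr -` B)"
 by (auto simp: image_iff) (metis sum.exhaust)

lemma vimage_Inl_Un [simp]: "Inl -` (I |+| J) = I" "Inr -` (I |+| J) = J"
 by auto

lemma vimage_Inl_simps [simp]: "Inl -` Inl ` I = I" "Inr -` Inr ` J = J" "Inl -` Inr ` J = {}" "Inr -` Inl ` I = {}"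
 by auto

lemma eq_Inl:
 assumes "Inl i \<in> B" "!!y. Inl y \<in> B ==> y = i" "!!j. Inr j \<notin> B"
 shows "B = {Inl i}"
proof -
 have "x = Inl i" if "x \<in> B" for x using assms that by (metis sum.exhaust)
 then show ?thesis using assms(1) by blast
qed

lemma eq_Inr:
 assumes "Inr j \<in> B" "!!y. Inr y \<in> B ==> y = j" "!!i. Inl i \<notin> B"
 shows "B = {Inr j}"
proof -
 have "x = Inr j" if "x \<in> B" for x using assms that by (metis sum.exhaust)
 then show ?thesis using assms(1) by blast
qed

text \<open>The partition of \<open>{..<n} \<union> {..<r}\<close> described by an index of the sum defining \<open>\<delta>\<close>.\<close>

definition index_part :: "nat => nat => nat set \<times> (nat => nat) => (nat + nat) set set" where
 "index_part n r = (%(S, \<phi>). (%j. {Inl (\<phi> j), Inr j}) ` S \<union> (%i. {Inl i}) ` ({..<n} - \<phi> ` S) \<union> (%j. {Inr j}) ` ({..<r} - S))"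

section \<open>Partial matchings as partitions\<close>

definition at_most_one :: "'a set => bool" where
 "at_most_one S \<longleftrightarrow> (\<forall>x\<in>S. \<forall>y\<in>S. x = y)"

lemma at_most_oneD: "at_most_one S ==> x \<in> S ==> y \<in> S ==> x = y"
 by (simp add: at_most_one_def)

lemma at_most_one_iff: "at_most_one S \<longleftrightarrow> S = {} \<or> (\<exists>x. S = {x})"
proof
 assume "at_most_one S"
 then show "S = {} \<or> (\<exists>x. S = {x})" unfolding at_most_one_def by fast
qed (auto simp: at_most_one_def)

text \<open>A partition whose blocks have at most one element from either side is a partial
  matching: its two-element blocks form the graph of an injection defined on a set \<open>S\<close>
  of right elements, and all other blocks are singletons.\<close>

lemma index_part_bij:
 "bij_betw (index_part n r) (delta_index n r)
   {P \<in> parts ({..<n} |+| {..<r}). \<forall>B\<in>P. at_most_one (Inl -` B) \<and> at_most_one (Inr -` B)}"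
  (is "bij_betw _ _ ?good")
proof (rule bij_betwI')
 fix p q assume p: "p \<in> delta_index n r" and q: "q \<in> delta_index n r"
 obtain S \<phi> where p': "p = (S, \<phi>)" "S \<subseteq> {..<r}" "\<phi> \<in> S \<rightarrow>\<^sub>E {..<n}" "inj_on \<phi> S" using p by (auto simp: delta_index_def)
 obtain T \<psi> where q': "q = (T, \<psi>)" "T \<subseteq> {..<r}" "\<psi> \<in> T \<rightarrow>\<^sub>E {..<n}" "inj_on \<psi> T" using q by (auto simp: delta_index_def)
 have mem: "{Inl i, Inr j} \<in> index_part n r (S, \<phi>) \<longleftrightarrow> j \<in> S \<and> i = \<phi> j" for i j S \<phi>
  by (auto simp: index_part_def doubleton_eq_iff)
 show "(index_part n r p = index_part n r q) = (p = q)"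
 proof
  assume "index_part n r p = index_part n r q"
  then have *: "j \<in> S \<and> i = \<phi> j \<longleftrightarrow> j \<in> T \<and> i = \<psi> j" for i j
   using mem[of i j S \<phi>] mem[of i j T \<psi>] p'(1) q'(1) by simp
  have ST: "S = T" using * by blast
  moreover have "\<phi> = \<psi>"
   by (rule PiE_ext[OF p'(3)]) (use q'(3) ST * in auto)
  ultimately show "p = q" using p' q' by simp
 qed simp
next
 fix p assume "p \<in> delta_index n r"
 then obtain S \<phi> where p: "p = (S, \<phi>)" "S \<subseteq> {..<r}" "\<phi> \<in> S \<rightarrow>\<^sub>E {..<n}" "inj_on \<phi> S" by (auto simp: delta_index_def)
 have "index_part n r p \<in> parts ({..<n} |+| {..<r})"
 proof (rule partsI)
  show "\<Union> (index_part n r p) = {..<n} |+| {..<r}"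
  proof (intro equalityI subsetI)
   fix x assume "x \<in> \<Union> (index_part n r p)"
   then show "x \<in> {..<n} |+| {..<r}" using p by (auto simp: index_part_def dest: PiE_mem)
  next
   fix x assume x: "x \<in> Inl ` {..<n} \<union> (Inr ` {..<r} :: (nat + nat) set)"
   then consider i where "x = Inl i" "i < n" | j where "x = Inr j" "j < r" by auto
   then show "x \<in> \<Union> (index_part n r p)"
   proof cases
    case 1
    then show ?thesis by (cases "i \<in> \<phi> ` S") (auto simp: index_part_def p(1))
   next
    case 2
    then show ?thesis by (cases "j \<in> S") (auto simp: index_part_def p(1))
   qed
  qed
  show "{} \<notin> index_part n r p" by (auto simp: index_part_def p(1))
  fix B B' x assume "B \<in> index_part n r p" "B' \<in> index_part n r p" "x \<in> B" "x \<in> B'"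
  then show "B = B'" using p(4) by (auto simp: index_part_def p(1) inj_on_def)
 qed simp
 moreover have "at_most_one (Inl -` B) \<and> at_most_one (Inr -` B)" if "B \<in> index_part n r p" for B
  using that by (auto simp: index_part_def p(1) at_most_one_def)
 ultimately show "index_part n r p \<in> ?good" by simp
next
 fix P assume "P \<in> ?good"
 then have P: "P \<in> parts ({..<n} |+| {..<r})"
  and amo: "\<forall>B\<in>P. at_most_one (Inl -` B) \<and> at_most_one (Inr -` B)" by simp_all
 have one: "x = y" if "B \<in> P" "Inl x \<in> B" "Inl y \<in> B" for B x y
  by (rule at_most_oneD[of "Inl -` B"]) (use amo that in simp_all)
 have one': "x = y" if "B \<in> P" "Inr x \<in> B" "Inr y \<in> B" for B x y
  by (rule at_most_oneD[of "Inr -` B"]) (use amo that in simp_all)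
 note PD = partsD[OF P]
 \<comment> \<open>The matched right elements; \<phi> sends each to its left partner, which is
   unique because blocks are disjoint.\<close>
 define S where "S = {j. \<exists>i. {Inl i, Inr j} \<in> P}"
 define \<phi> where "\<phi> = (\<lambda>j\<in>S. THE i. {Inl i, Inr j} \<in> P)"
 have bl: "B = {Inl i, Inr j}" if "B \<in> P" "Inl i \<in> B" "Inr j \<in> B" for B i j
 proof -
  have "x = Inl i \<or> x = Inr j" if "x \<in> B" for x using one[OF \<open>B \<in> P\<close> \<open>Inl i \<in> B\<close>] one'[OF \<open>B \<in> P\<close> \<open>Inr j \<in> B\<close>] that by (metis sum.exhaust)
  then show ?thesis using that(2,3) by blast
 qed
 have \<phi>: "{Inl i, Inr j} \<in> P \<longleftrightarrow> j \<in> S \<and> \<phi> j = i" for i j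
 proof
  assume ij: "{Inl i, Inr j} \<in> P"
  have u: "i' = i" if "{Inl i', Inr j} \<in> P" for i'
   using PD(7)[OF ij that, of "Inr j"] by (auto simp: doubleton_eq_iff)
  have "(THE i. {Inl i, Inr j} \<in> P) = i" by (rule the_equality) (rule ij, rule u)
  then show "j \<in> S \<and> \<phi> j = i" using ij by (auto simp: S_def \<phi>_def)
 next
  assume j: "j \<in> S \<and> \<phi> j = i"
  then obtain i' where i': "{Inl i', Inr j} \<in> P" by (auto simp: S_def)
  have u: "i'' = i'" if "{Inl i'', Inr j} \<in> P" for i''
   using PD(7)[OF i' that, of "Inr j"] by (auto simp: doubleton_eq_iff)
  have "(THE i. {Inl i, Inr j} \<in> P) = i'" by (rule the_equality) (rule i', rule u)
  then show "{Inl i, Inr j} \<in> P" using j i' by (auto simp: \<phi>_def)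
 qed
 have "S \<subseteq> {..<r}" using PD(6) by (fastforce simp: S_def)
 moreover have "\<phi> \<in> S \<rightarrow>\<^sub>E {..<n}"
 proof (rule PiE_I)
  fix j assume "j \<in> S"
  then have "{Inl (\<phi> j), Inr j} \<in> P" using \<phi> by simp
  from PD(6)[OF this] show "\<phi> j \<in> {..<n}" by auto
 qed (simp add: \<phi>_def)
 moreover have "inj_on \<phi> S"
 proof (rule inj_onI)
  fix j j' assume "j \<in> S" "j' \<in> S" "\<phi> j = \<phi> j'"
  then have "{Inl (\<phi> j), Inr j} \<in> P" "{Inl (\<phi> j), Inr j'} \<in> P" using \<phi> by simp_all
  from PD(7)[OF this, of "Inl (\<phi> j)"] show "j = j'" by (auto simp: doubleton_eq_iff)
 qed
 ultimately have idx: "(S, \<phi>) \<in> delta_index n r" by (simp add: delta_index_def)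
 have "P = index_part n r (S, \<phi>)"
 proof (intro equalityI subsetI)
  fix B assume B: "B \<in> P"
  then have ne: "B \<noteq> {}" using PD(4) by metis
  show "B \<in> index_part n r (S, \<phi>)"
  proof (cases "\<exists>i. Inl i \<in> B")
   case True
   then obtain i where i: "Inl i \<in> B" by auto
   show ?thesis
   proof (cases "\<exists>j. Inr j \<in> B")
    case True
    then obtain j where j: "Inr j \<in> B" by auto
    from bl[OF B i j] show ?thesis using \<phi>[of i j] B by (auto simp: index_part_def)
   next
    case False
    have eq: "B = {Inl i}" by (rule eq_Inl[OF i one[OF B _ i]]) (use False in auto)
    have "i \<notin> \<phi> ` S"
    proof
     assume "i \<in> \<phi> ` S"
     then obtain j where "{Inl i, Inr j} \<in> P" using \<phi> by auto
     from PD(7)[OF B this, of "Inl i"] show False using eq by auto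
    qed
    moreover have "i < n" using PD(6)[OF B] i by auto
    ultimately show ?thesis using eq by (simp add: index_part_def)
   qed
  next
   case False
   then obtain j where j: "Inr j \<in> B" using ne by (metis ex_in_conv sum.exhaust)
   have eq: "B = {Inr j}" by (rule eq_Inr[OF j one'[OF B _ j]]) (use False in auto)
   have "j \<notin> S"
   proof
    assume "j \<in> S"
    then have "{Inl (\<phi> j), Inr j} \<in> P" using \<phi> by simp
    from PD(7)[OF B this, of "Inr j"] show False using eq by auto
   qed
   moreover have "j < r" using PD(6)[OF B] j by auto
   ultimately show ?thesis using eq by (simp add: index_part_def)
  qed
 next
  fix B assume "B \<in> index_part n r (S, \<phi>)"
  then consider j where "j \<in> S" "B = {Inl (\<phi> j), Inr j}" | i where "i < n" "i \<notin> \<phi> ` S" "B = {Inl i}"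
   | j where "j < r" "j \<notin> S" "B = {Inr j}" by (auto simp: index_part_def)
  then show "B \<in> P"
  proof cases
   case 1
   then show ?thesis using \<phi>[of "\<phi> j" j] by simp
  next
   case 2
   then have "Inl i \<in> \<Union>P" using PD(3) by simp
   then obtain B' where B': "B' \<in> P" "Inl i \<in> B'" by auto
   have "Inr j \<notin> B'" for j
   proof
    assume "Inr j \<in> B'"
    from bl[OF B' this] have "{Inl i, Inr j} \<in> P" using B' by simp
    then show False using \<phi>[of i j] 2(2) by auto
   qed
   then have "B' = {Inl i}" by (intro eq_Inl[OF B'(2) one[OF B'(1) _ B'(2)]]) auto
   then show ?thesis using B' 2 by simp
  next
   case 3
   then have "Inr j \<in> \<Union>P" using PD(3) by simp
   then obtain B' where B': "B' \<in> P" "Inr j \<in> B'" by auto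
   have "Inl i \<notin> B'" for i
   proof
    assume "Inl i \<in> B'"
    from bl[OF B'(1) this B'(2)] have "{Inl i, Inr j} \<in> P" using B' by simp
    then show False using \<phi>[of i j] 3(2) by auto
   qed
   then have "B' = {Inr j}" by (intro eq_Inr[OF B'(2) one'[OF B'(1) _ B'(2)]]) auto
   then show ?thesis using B' 3 by simp
  qed
 qed
 then show "\<exists>p\<in>delta_index n r. P = index_part n r p" using idx by blast
qed

text \<open>Blocks are sorted by their left elements: each left variable \<open>i\<close>
  contributes its pair or its singleton, and the unmatched right elements follow. This is the
  arrangement of arguments in the formula for \<delta>.\<close>

lemma mset_index_part:
 assumes "(S, \<phi>) \<in> delta_index n r"
 shows "image_mset L (mset_set (index_part n r (S, \<phi>))) =
  {#if i \<in> \<phi> ` S then L {Inl i, Inr (inv_into S \<phi> i)} else L {Inl i}. i \<in># mset [0..<n]#} +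
  {#L {Inr j}. j \<in># mset_set ({..<r} - S)#}"
proof -
 have p: "S \<subseteq> {..<r}" "\<phi> \<in> S \<rightarrow>\<^sub>E {..<n}" "inj_on \<phi> S" using assms by (auto simp: delta_index_def)
 have fin: "finite S" using p(1) finite_subset by blast
 let ?P1 = "(%j. {Inl (\<phi> j), Inr j}) ` S" and ?P2 = "(%i. {Inl i}) ` ({..<n} - \<phi> ` S)" and ?P3 = "(%j. {Inr j}) ` ({..<r} - S)"
 have "index_part n r (S, \<phi>) = ?P1 \<union> ?P2 \<union> ?P3" by (simp add: index_part_def)
 also have "mset_set ... = mset_set (?P1 \<union> ?P2) + mset_set ?P3"
  by (rule mset_set_Union) (use fin in auto)
 also have "mset_set (?P1 \<union> ?P2) = mset_set ?P1 + mset_set ?P2"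
  by (rule mset_set_Union) (use fin in auto)
 also have "mset_set ?P1 = {#{Inl (\<phi> j), Inr j}. j \<in># mset_set S#}"
  by (rule image_mset_mset_set[symmetric]) (auto simp: inj_on_def doubleton_eq_iff)
 also have "mset_set ?P2 = {#{Inl i}. i \<in># mset_set ({..<n} - \<phi> ` S)#}"
  by (rule image_mset_mset_set[symmetric]) (auto simp: inj_on_def)
 also have "mset_set ?P3 = {#{Inr j}. j \<in># mset_set ({..<r} - S)#}"
  by (rule image_mset_mset_set[symmetric]) (auto simp: inj_on_def)
 finally have eq: "image_mset L (mset_set (index_part n r (S, \<phi>))) =
   {#L {Inl (\<phi> j), Inr j}. j \<in># mset_set S#} + {#L {Inl i}. i \<in># mset_set ({..<n} - \<phi> ` S)#} + {#L {Inr j}. j \<in># mset_set ({..<r} - S)#}"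
  by (simp add: multiset.map_comp o_def)
 have n: "mset [0..<n] = mset_set (\<phi> ` S) + mset_set ({..<n} - \<phi> ` S)"
 proof -
  have "{..<n} = \<phi> ` S \<union> ({..<n} - \<phi> ` S)" using p(2) by auto
  then have "mset_set {..<n} = mset_set (\<phi> ` S \<union> ({..<n} - \<phi> ` S))" by simp
  also have "... = mset_set (\<phi> ` S) + mset_set ({..<n} - \<phi> ` S)" by (rule mset_set_Union) (use fin in auto)
  finally show ?thesis by (simp add: mset_set_upto_eq_mset_upto)
 qed
 have 1: "{#if i \<in> \<phi> ` S then L {Inl i, Inr (inv_into S \<phi> i)} else L {Inl i}. i \<in># mset_set (\<phi> ` S)#} = {#L {Inl (\<phi> j), Inr j}. j \<in># mset_set S#}"
  unfolding image_mset_mset_set[OF p(3), symmetric] multiset.map_comp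
  by (rule image_mset_cong) (use fin p(3) in auto)
 have 2: "{#if i \<in> \<phi> ` S then L {Inl i, Inr (inv_into S \<phi> i)} else L {Inl i}. i \<in># mset_set ({..<n} - \<phi> ` S)#} = {#L {Inl i}. i \<in># mset_set ({..<n} - \<phi> ` S)#}"
  by (rule image_mset_cong) auto
 show ?thesis unfolding eq n image_mset_union 1 2 ..
qed

context faa_arrow
begin

lemma lin_cube:
 fixes s :: "'k => 'i set => 'm"
 assumes "!!k J. k \<in> K ==> s k J \<in> mpt C Z e A" and c: "cube C Z e (A, X) c"
 shows "cube C Z e (A, X) (lin C A Z e K s c)"
 unfolding cube_def fst_conv snd_conv
proof (intro conjI allI impI)
 show "lin C A Z e K s c {} \<in> pt C Z e X" using cube_base(1)[OF c] by simp
 fix B :: "('k + 'i) set" assume B: "B \<noteq> {}"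
 consider "Inl -` B = {}" | k where "k \<in> K" "Inl -` B = {k}" | "Inl -` B \<noteq> {}" "\<not> (\<exists>k\<in>K. Inl -` B = {k})" by blast
 then show "lin C A Z e K s c B \<in> mpt C Z e A"
 proof cases
  case 1
  have "Inr -` B \<noteq> {}" using B 1 sum_set_eq[of B] by (metis Un_empty image_is_empty)
  then show ?thesis using cube_base(2)[OF c] 1 by (simp add: lin_Inr)
 next
  case 2
  then show ?thesis using assms(1) by (simp add: lin_Inl)
 next
  case 3
  then show ?thesis using A.zero_e_pt[OF pt_idem(5)[OF cube_base(1)[OF c]]] by (simp add: lin_zero)
 qed
qed

text \<open>The cube is linear in the left directions, and its parts have only linear coefficients
  in the right ones, so a block with two elements on one side carries zero. By
  \<open>index_part_bij\<close> the surviving partitions are the pairs \<open>(S, \<phi>)\<close>: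
  the sum in the definition of \<delta> is an evaluation of \<open>F\<close>.\<close>

lemma ev_lin_pcube:
 assumes n: "n \<ge> 1" and v: "!!i j. i < n ==> j < r ==> v i j \<in> mpt C Z e A" and a: "!!i. i < n ==> a i \<in> mpt C Z e A"
  and w: "!!j. j < r ==> w j \<in> mpt C Z e A" and x: "x \<in> pt C Z e X"
 shows "ev C F (lin C A Z e {..<n} (%i. pcube C A Z e {..<r} (v i) (a i)) (pcube C A Z e {..<r} w x)) ({..<n} |+| {..<r}) =
  finprod (ptmon C B Z (Rst C (x \<cdot> f 0)))
   (%(S, \<phi>). papp C F x ({#if i \<in> \<phi> ` S then v i (inv_into S \<phi> i) else a i. i \<in># mset [0..<n]#} + {#w j. j \<in># mset_set ({..<r} - S)#}))
   (delta_index n r)"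
  "(S, \<phi>) \<in> delta_index n r ==> papp C F x ({#if i \<in> \<phi> ` S then v i (inv_into S \<phi> i) else a i. i \<in># mset [0..<n]#} + {#w j. j \<in># mset_set ({..<r} - S)#})
   \<in> mpt C Z (Rst C (x \<cdot> f 0)) B"
proof -
 let ?s = "%i. pcube C A Z e {..<r} (v i) (a i)" and ?c = "pcube C A Z e {..<r} w x"
 let ?L = "lin C A Z e {..<n} ?s ?c"
 let ?J = "{..<n} |+| {..<r} :: (nat + nat) set"
 let ?good = "{P \<in> parts ?J. \<forall>B\<in>P. at_most_one (Inl -` B) \<and> at_most_one (Inr -` B)}"
 let ?t = "%(S, \<phi>). papp C F x ({#if i \<in> \<phi> ` S then v i (inv_into S \<phi> i) else a i. i \<in># mset [0..<n]#} + {#w j. j \<in># mset_set ({..<r} - S)#})"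
 have c: "cube C Z e (A, X) ?c" by (rule pcube_cube) (use w x in auto)
 have s: "?s i J \<in> mpt C Z e A" if "i < n" for i and J :: "nat set"
  using v[OF that] a[OF that] A.zero_e_pt[OF pt_idem(5)[OF x]] by (auto simp: pcube_def)
 have L: "cube C Z e (A, X) ?L" by (rule lin_cube[OF _ c]) (use s in auto)
 have J: "?J \<noteq> {}" using n by (auto simp: lessThan_empty_iff)
 interpret S: symadd "ptmon C A Z e" "ptmon C B Z (Rst C (x \<cdot> f 0))" "papp C F x" by (rule symadd[OF x])
 have tm: "papp C F x (image_mset ?L (mset_set (index_part n r p))) = ?t p" if p: "p \<in> delta_index n r" for p
 proof -
  obtain S \<phi> where p': "p = (S, \<phi>)" "(S, \<phi>) \<in> delta_index n r" using p by (cases p) auto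
  then have S: "S \<subseteq> {..<r}" "inj_on \<phi> S" by (auto simp: delta_index_def)
  have "{#if i \<in> \<phi> ` S then ?L {Inl i, Inr (inv_into S \<phi> i)} else ?L {Inl i}. i \<in># mset [0..<n]#} =
    {#if i \<in> \<phi> ` S then v i (inv_into S \<phi> i) else a i. i \<in># mset [0..<n]#}"
  proof (rule image_mset_cong)
   fix i assume "i \<in># mset [0..<n]"
   then have i: "i < n" by simp
   have "?L {Inl i} = a i"
   proof -
    have "Inl -` {Inl i :: nat + nat} = {i}" "Inr -` {Inl i :: nat + nat} = {}" by auto
    then show ?thesis using i lin_Inl[of i "{..<n}" "{Inl i}" C A Z e ?s ?c] by simp
   qed
   moreover have "?L {Inl i, Inr (inv_into S \<phi> i)} = v i (inv_into S \<phi> i)" if im: "i \<in> \<phi> ` S"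
   proof -
    have "inv_into S \<phi> i < r" using inv_into_into[OF im] S(1) by auto
    moreover have "Inl -` {Inl i :: nat + nat, Inr (inv_into S \<phi> i)} = {i}" "Inr -` {Inl i :: nat + nat, Inr (inv_into S \<phi> i)} = {inv_into S \<phi> i}" by auto
    ultimately show ?thesis using i lin_Inl[of i "{..<n}" "{Inl i, Inr (inv_into S \<phi> i)}" C A Z e ?s ?c] by simp
   qed
   ultimately show "(if i \<in> \<phi> ` S then ?L {Inl i, Inr (inv_into S \<phi> i)} else ?L {Inl i}) = (if i \<in> \<phi> ` S then v i (inv_into S \<phi> i) else a i)" by simp
  qed
  moreover have "{#?L {Inr j}. j \<in># mset_set ({..<r} - S)#} = {#w j. j \<in># mset_set ({..<r} - S)#}"
  proof (rule image_mset_cong)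
   fix j assume "j \<in># mset_set ({..<r} - S)"
   then have "j < r" by simp
   moreover have "Inl -` {Inr j :: nat + nat} = {}" "Inr -` {Inr j :: nat + nat} = {j}" by auto
   ultimately show "?L {Inr j} = w j" using lin_Inr[of "{Inr j}" C A Z e "{..<n}" ?s ?c] by simp
  qed
  ultimately show ?thesis using mset_index_part[OF p'(2), of ?L] p'(1) by simp
 qed
 have good: "index_part n r p \<in> ?good" if "p \<in> delta_index n r" for p
  using bij_betw_apply[OF index_part_bij that] .
 have tc: "?t p \<in> mpt C Z (Rst C (x \<cdot> f 0)) B" if p: "p \<in> delta_index n r" for p
  using S.pev_term_closed[OF cube_fam'[OF L] J, of "index_part n r p"] good[OF p] tm[OF p] by simp
 then show "(S, \<phi>) \<in> delta_index n r ==> papp C F x ({#if i \<in> \<phi> ` S then v i (inv_into S \<phi> i) else a i. i \<in># mset [0..<n]#} + {#w j. j \<in># mset_set ({..<r} - S)#})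
   \<in> mpt C Z (Rst C (x \<cdot> f 0)) B" by fastforce
 have "ev C F ?L ?J = pev (ptmon C B Z (Rst C (x \<cdot> f 0))) (papp C F x) ?L ?J"
  using ev_pev[OF L J] by simp
 also have "... = finprod (ptmon C B Z (Rst C (x \<cdot> f 0))) (%P. papp C F x (image_mset ?L (mset_set P))) ?good"
 proof (rule S.pev_restrict[OF cube_fam'[OF L] J])
  fix P assume "P \<in> parts ?J" "P \<notin> ?good"
  then obtain D where D: "D \<in> P" "\<not> at_most_one (Inl -` D) \<or> \<not> at_most_one (Inr -` D)" by auto
  have "?L D = e \<cdot> zmap A Z"
  proof (cases "at_most_one (Inl -` D)")
   case False
   then show ?thesis by (intro lin_zero) (auto simp: at_most_one_iff)
  next
   case True
   then have r: "Inr -` D \<noteq> {}" "\<not> (\<exists>j\<in>{..<r}. Inr -` D = {j})" using D by (auto simp: at_most_one_iff)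
   consider "Inl -` D = {}" | k where "k < n" "Inl -` D = {k}" | "Inl -` D \<noteq> {}" "\<not> (\<exists>k\<in>{..<n}. Inl -` D = {k})" by blast
   then show ?thesis
   proof cases
    case 1
    then show ?thesis using r by (simp add: lin_Inr)
   next
    case 2
    then show ?thesis using r lin_Inl[of k "{..<n}" D C A Z e ?s ?c] by simp
   next
    case 3
    then show ?thesis by (simp add: lin_zero)
   qed
  qed
  then show "\<exists>B\<in>P. ?L B = \<one>\<^bsub>ptmon C A Z e\<^esub>" using D(1) by auto
 qed auto
 also have "... = finprod (ptmon C B Z (Rst C (x \<cdot> f 0))) ?t (delta_index n r)"
  by (rule S.H.finprod_bij[OF index_part_bij]) (use tm tc in auto)
 finally show "ev C F ?L ?J = finprod (ptmon C B Z (Rst C (x \<cdot> f 0))) ?t (delta_index n r)" .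
qed

end

section \<open>Congruence and reindexing for linear cubes\<close>

lemma lin_cong:
 assumes "!!k. k \<in> K ==> s' k (Inr -` B) = s k (Inr -` B)" "c' (Inr -` B) = c (Inr -` B)"
 shows "lin C A Z e K s' c' B = lin C A Z e K s c B"
proof -
 consider "Inl -` B = {}" | k where "k \<in> K" "Inl -` B = {k}" | "Inl -` B \<noteq> {}" "\<not> (\<exists>k\<in>K. Inl -` B = {k})" by blast
 then show ?thesis
  by cases (use assms in "simp_all add: lin_Inr lin_Inl lin_zero")
qed

lemma lin_map_sum:
 assumes g: "inj_on g K" and B: "Inl -` B \<subseteq> K"
 shows "lin C A Z e (g ` K) s c (map_sum g h ` B) = lin C A Z e K (%k J. s (g k) (h ` J)) (%J. c (h ` J)) B"
proof -
 have i: "Inl -` (map_sum g h ` B) = g ` (Inl -` B)"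
 proof (intro equalityI subsetI)
  fix x assume "x \<in> Inl -` (map_sum g h ` B)"
  then obtain y where "y \<in> B" "Inl x = map_sum g h y" by auto
  then show "x \<in> g ` (Inl -` B)" by (cases y) auto
 qed force
 have r: "Inr -` (map_sum g h ` B) = h ` (Inr -` B)"
 proof (intro equalityI subsetI)
  fix x assume "x \<in> Inr -` (map_sum g h ` B)"
  then obtain y where "y \<in> B" "Inr x = map_sum g h y" by auto
  then show "x \<in> h ` (Inr -` B)" by (cases y) auto
 qed force
 consider "Inl -` B = {}" | k where "k \<in> K" "Inl -` B = {k}" | "Inl -` B \<noteq> {}" "\<not> (\<exists>k\<in>K. Inl -` B = {k})" by blast
 then show ?thesis
 proof cases
  case 1
  then show ?thesis using i r by (simp add: lin_Inr)
 next
  case 2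
  then show ?thesis
   using i r lin_Inl[of "g k" "g ` K" "map_sum g h ` B" C A Z e s c] lin_Inl[of k K B C A Z e "%k J. s (g k) (h ` J)" "%J. c (h ` J)"] by simp
 next
  case 3
  have "Inl -` B = {k}" if k: "k \<in> K" "g ` (Inl -` B) = {g k}" for k
  proof -
   have "g ` (Inl -` B) = g ` {k}" using k by simp
   then show ?thesis using inj_on_image_eq_iff[OF g B, of "{k}"] k(1) by simp
  qed
  then have "\<not> (\<exists>k\<in>g ` K. Inl -` (map_sum g h ` B) = {k})" using i 3(2) by auto
  then show ?thesis using 3 i by (simp add: lin_zero)
 qed
qed

lemma pcube_cong:
 assumes "!!i. i \<in> S ==> c' i = c i"
 shows "pcube C A Z e S c' x J = pcube C A Z e S c x J"
 using assms by (auto simp: pcube_def)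

lemma pcube_image:
 assumes h: "inj_on h S" and J: "J \<subseteq> S"
 shows "pcube C A Z e (h ` S) c x (h ` J) = pcube C A Z e S (%j. c (h j)) x J"
proof -
 have "h ` J = {h j} \<longleftrightarrow> J = {j}" if "j \<in> S" for j
  using inj_on_image_eq_iff[OF h J, of "{j}"] that by simp
 then show ?thesis by (auto simp: pcube_def)
qed

context faa_arrow
begin

lemma Comp_pcube:
 assumes u: "u \<in> Hom C W Z" and e: "e \<in> pt C Z e Z"
 shows "u \<cdot> pcube C A Z e S c x J = pcube C A W (Rst C (u \<cdot> e)) S (%i. u \<cdot> c i) (u \<cdot> x) J"
proof -
 have Z: "Z \<in> Obj C" using Hom_Obj[OF u] by simp
 have "u \<cdot> (e \<cdot> zmap A Z) = Rst C (u \<cdot> e) \<cdot> zmap A W"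
  using Comp_assoc[OF u ptH[OF e] ptH[OF A.zero_pt[OF Z]]] A.Comp_zero[OF Comp_Hom[OF u ptH[OF e]]] by simp
 then show ?thesis by (auto simp: pcube_def)
qed

lemma Comp_lin:
 assumes u: "u \<in> Hom C W Z" and e: "e \<in> pt C Z e Z"
 shows "u \<cdot> lin C A Z e K s c D = lin C A W (Rst C (u \<cdot> e)) K (%k J. u \<cdot> s k J) (%J. u \<cdot> c J) D"
proof -
 have Z: "Z \<in> Obj C" using Hom_Obj[OF u] by simp
 have "u \<cdot> (e \<cdot> zmap A Z) = Rst C (u \<cdot> e) \<cdot> zmap A W"
  using Comp_assoc[OF u ptH[OF e] ptH[OF A.zero_pt[OF Z]]] A.Comp_zero[OF Comp_Hom[OF u ptH[OF e]]] by simp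
 then show ?thesis by (auto simp: lin_def)
qed

lemma ev_lin_reindex:
 assumes s: "!!k J. k \<in> g ` K ==> s k J \<in> mpt C Z e A" and c: "cube C Z e (A, X) c"
  and inj: "inj_on g K" "inj_on h J"
 shows "ev C F (lin C A Z e (g ` K) s c) (g ` K |+| h ` J) =
  ev C F (lin C A Z e K (%k J. s (g k) (h ` J)) (%J. c (h ` J))) (K |+| J)"
proof -
 have L: "cube C Z e (A, X) (lin C A Z e (g ` K) s c)" by (rule lin_cube[OF s c])
 have im: "g ` K |+| h ` J = map_sum g h ` (K |+| J)"
  by (simp add: image_Un image_image)
 have i: "inj_on (map_sum g h) (K |+| J)"
 proof (rule inj_onI)
  fix x y assume "x \<in> K |+| J" "y \<in> K |+| J" "map_sum g h x = map_sum g h y"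
  then show "x = y" using inj by (cases x; cases y) (auto dest: inj_onD)
 qed
 have "ev C F (lin C A Z e (g ` K) s c) (g ` K |+| h ` J) =
   ev C F (%B. lin C A Z e (g ` K) s c (map_sum g h ` B)) (K |+| J)"
  unfolding im by (rule ev_reindex[OF L i])
 also have "... = ev C F (lin C A Z e K (%k J. s (g k) (h ` J)) (%J. c (h ` J))) (K |+| J)"
 proof (rule ev_cong[OF cube_comp_image[OF L], symmetric])
  fix B assume "B \<subseteq> K |+| J"
  then have "Inl -` B \<subseteq> K" by auto
  then show "lin C A Z e K (%k J. s (g k) (h ` J)) (%J. c (h ` J)) B = lin C A Z e (g ` K) s c (map_sum g h ` B)"
   using lin_map_sum[OF inj(1)] by metis
 qed simp
 finally show ?thesis .
qed

lemma ev_lin_cong: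
 assumes s: "!!k J. k \<in> K ==> s k J \<in> mpt C Z e A" and c: "cube C Z e (A, X) c"
  and eq: "!!k B. k \<in> K ==> B \<subseteq> J ==> finite B ==> s' k B = s k B" "!!B. B \<subseteq> J ==> finite B ==> c' B = c B"
 shows "ev C F (lin C A Z e K s' c') (K |+| J) = ev C F (lin C A Z e K s c) (K |+| J)"
proof (rule ev_cong[OF lin_cube[OF s c]])
 show "lin C A Z e K s' c' {} = lin C A Z e K s c {}" using eq(2)[of "{}"] by simp
 fix B assume B: "B \<subseteq> K |+| J" "finite B"
 have "Inr -` B \<subseteq> J" "finite (Inr -` B)" using B by (auto intro: finite_vimageI)
 then show "lin C A Z e K s' c' B = lin C A Z e K s c B" by (intro lin_cong) (simp_all add: eq)
qed

end

subsection \<open>The components of \<open>\<delta>(f)\<close>\<close>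

text \<open>Component \<open>n\<close> of \<delta>(F) for \<open>n \<ge> 1\<close>. It has a name of
  its own because it is itself an arrow of \<open>Faa(C)\<close> whose action has to be
  computed.\<close>

definition delta_cmp :: "('o, 'm) crcat => ('o, 'm) faa_arr => nat => ('o, 'm) faa_arr" where
 "delta_cmp C F n = (let A = fst (faa_src F); X = snd (faa_src F); B = fst (faa_tgt F)
   in FaaArr (powprod (Faa C) (A, mcar A) n (A, X)) (B, mcar B) (%r. if r = 0 then faa_seq F n else delta_entry C F n r))"

lemma mcar_prod_cmon [simp]: "mcar (prod_cmon C A B) = Prod C (mcar A) (mcar B)"
 by (simp add: prod_cmon_def Let_def)

lemma faa_Prod_sel: "fst (faa_Prod C S T) = prod_cmon C (fst S) (fst T)" "snd (faa_Prod C S T) = Prod C (snd S) (snd T)"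
 by (simp_all add: faa_Prod_def split: prod.splits)

lemma powprod_Faa [simp]: "snd (powprod (Faa C) (A, A0) n (A', X)) = powprod C A0 n X"
 "mcar (fst (powprod (Faa C) (A, A0) n (A', X))) = powprod C (mcar A) n (mcar A')"
 by (induction n) (auto simp: faa_Prod_sel)

context cartesian_restriction_category
begin

text \<open>Projections act entrywise, but the base point lies in \<open>A^n \<times> X\<close> and
  the coefficients lie in \<open>A^n \<times> A\<close>, whence the distinction by
  \<open>J\<close>.\<close>

lemma ev_proj_Faa:
 assumes A: "tcm C A" and X: "X \<in> Obj C" and "finite J"
 shows "cube C Z e (powprod FC (A, mcar A) n (A, X)) c ==> i \<le> n ==>
  ev C (proj FC (A, mcar A) n (A, X) i) c J = c J \<cdot> proj C (mcar A) n (if J = {} then X else mcar A) i"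
proof (induction n arbitrary: c e i)
 case 0
 have "c J \<in> pt C Z e (if J = {} then X else mcar A)" using cubeD[OF 0(1)] by auto
 then show ?case
  using ev_faa_Ide[of "(A, X)" Z e c J] assms 0 Comp_Ide[OF ptD(1)] by (auto simp: faa_Obj_def)
next
 case (Suc n)
 interpret D: cartesian_restriction_category "Faa C" by (rule Faa_crc)
 have AO: "mcar A \<in> Obj C" using total_comm_monoidD(1)[OF A] .
 have S: "(A, mcar A) \<in> FObj" and S': "(A, X) \<in> FObj" using A X AO by (auto simp: faa_Obj_def)
 let ?T = "powprod FC (A, mcar A) n (A, X)"
 have T: "?T \<in> FObj" using D.powprod_Obj[of "(A, mcar A)" "(A, X)" n] S S' by simp
 have c: "cube C Z e (faa_Prod C (A, mcar A) ?T) c" using Suc.prems(1) by simp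
 note Pi = ev_faa_Pi[OF S T c]
 show ?case
 proof (cases i)
  case 0
  then show ?thesis using Pi(1)[OF assms(3)] by simp
 next
  case (Suc i')
  let ?Y = "if J = {} then X else mcar A"
  have Y: "?Y \<in> Obj C" using X AO by simp
  have cJ: "c J \<in> Hom C Z (Prod C (mcar A) (powp (mcar A) n ?Y))"
   using ptH[OF cubeD(1)[OF c]] ptH[OF cubeD(2)[OF c, of J]] by (auto simp: faa_Prod_sel)
  note p1 = faa_Pi_Hom(2)[OF S T]
  have pi: "proj FC (A, mcar A) n (A, X) i' \<in> Hom FC ?T (if i' < n then (A, mcar A) else (A, X))"
   using D.ptH[OF D.proj_pt(1)[of "(A, mcar A)" "(A, X)" i' n]] D.ptH[OF D.proj_pt(2)[of "(A, mcar A)" "(A, X)" n]]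
    S S' Suc.prems(2) Suc by (cases "i' = n") auto
  have pC: "proj C (mcar A) n ?Y i' \<in> Hom C (powp (mcar A) n ?Y) (if i' < n then mcar A else ?Y)"
   using ptH[OF proj_pt(1)[OF AO Y, of i' n]] ptH[OF proj_pt(2)[OF AO Y, of n]]
    Suc.prems(2) Suc by (cases "i' = n") auto
  have "ev C (proj FC (A, mcar A) (Suc n) (A, X) i) c J =
    ev C (proj FC (A, mcar A) n (A, X) i') (ev C (faa_Pi1 C (A, mcar A) ?T) c) J"
   using Faa_ev_Comp[OF p1 pi c assms(3)] Suc by simp
  also have "... = ev C (faa_Pi1 C (A, mcar A) ?T) c J \<cdot> proj C (mcar A) n ?Y i'"
   by (rule Suc.IH[OF Faa_ev_cube[OF p1 c]]) (use Suc.prems Suc in simp)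
  also have "... = c J \<cdot> Pi1 C (mcar A) (powp (mcar A) n ?Y) \<cdot> proj C (mcar A) n ?Y i'"
   using Pi(2)[OF assms(3)] by auto
  also have "... = c J \<cdot> (Pi1 C (mcar A) (powp (mcar A) n ?Y) \<cdot> proj C (mcar A) n ?Y i')"
   by (rule Comp_assoc[OF cJ Pi1_Hom[OF AO powprod_Obj[OF AO Y]] pC])
  finally show ?thesis using Suc by simp
 qed
qed

lemma powprod_Faa_cmon:
 assumes A: "tcm C A" and X: "X \<in> Obj C"
 shows "tcm C (fst (powprod FC (A, mcar A) n (A, X)))"
proof -
 interpret D: cartesian_restriction_category "Faa C" by (rule Faa_crc)
 have "(A, mcar A) \<in> Obj FC" "(A, X) \<in> Obj FC" using A X total_comm_monoidD(1)[OF A] by (auto simp: faa_Obj_def)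
 from D.powprod_Obj[OF this, of n] show ?thesis by (auto simp: faa_Obj_def)
qed

text \<open>The monoid on \<open>A^n \<times> A\<close> arises from iterated product monoids, so its
  addition is computed in each coordinate.\<close>

lemma madd_powprod_proj:
 assumes A: "tcm C A" and X: "X \<in> Obj C"
 shows "a \<in> pt C Z e (powp (mcar A) n (mcar A)) ==> b \<in> pt C Z e (powp (mcar A) n (mcar A)) ==> i \<le> n ==>
  madd C (fst (powprod FC (A, mcar A) n (A, X))) a b \<cdot> proj C (mcar A) n (mcar A) i =
  madd C A (a \<cdot> proj C (mcar A) n (mcar A) i) (b \<cdot> proj C (mcar A) n (mcar A) i)"
proof (induction n arbitrary: a b i)
 case 0
 interpret A: crc_monoid C A by unfold_locales (rule A)
 show ?case using 0 Comp_Ide[OF ptD(1)] A.add_pt[of a Z e b] by simp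
next
 case (Suc n)
 interpret A: crc_monoid C A by unfold_locales (rule A)
 let ?M = "fst (powprod FC (A, mcar A) n (A, X))" and ?V = "powp (mcar A) n (mcar A)"
 have M: "tcm C ?M" by (rule powprod_Faa_cmon[OF A X])
 have V: "?V \<in> Obj C" by (rule powprod_Obj[OF A.car_Obj A.car_Obj])
 have eq: "fst (powprod FC (A, mcar A) (Suc n) (A, X)) = prod_cmon C A ?M"
  by (simp add: faa_Prod_sel)
 have ab: "a \<in> pt C Z e (Prod C (mcar A) (mcar ?M))" "b \<in> pt C Z e (Prod C (mcar A) (mcar ?M))" using Suc.prems by simp_all
 note s = madd_prod_Pi[OF A M ab]
 note P1 = Pi1_pt[OF A.car_Obj V]
 have p1: "c \<cdot> Pi1 C (mcar A) ?V \<in> pt C Z e ?V" if "c \<in> pt C Z e (Prod C (mcar A) (mcar ?M))" for c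
  using pt_Comp[OF _ P1] that by simp
 show ?case
 proof (cases i)
  case 0
  then show ?thesis using s(1) eq by simp
 next
  case (Suc i')
  have pC: "proj C (mcar A) n (mcar A) i' \<in> Hom C ?V (mcar A)"
   using ptH[OF proj_pt(1)[OF A.car_Obj A.car_Obj, of i' n]] ptH[OF proj_pt(2)[OF A.car_Obj A.car_Obj, of n]]
    Suc.prems(3) Suc by (cases "i' = n") auto
  have as: "c \<cdot> (Pi1 C (mcar A) ?V \<cdot> proj C (mcar A) n (mcar A) i') = c \<cdot> Pi1 C (mcar A) ?V \<cdot> proj C (mcar A) n (mcar A) i'"
   if "c \<in> pt C Z e (Prod C (mcar A) (mcar ?M))" for c
   using Comp_assoc[OF ptH[OF that] _ pC] ptH[OF P1] by simp
  show ?thesis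
   using Suc.IH[OF p1[OF ab(1)] p1[OF ab(2)], of i'] s(2,3) as ab Suc.prems(3) Suc eq by simp
 qed
qed

lemma zero_powprod_proj:
 assumes A: "tcm C A" and X: "X \<in> Obj C" and Z: "Z \<in> Obj C"
 shows "i \<le> n ==> zmap (fst (powprod FC (A, mcar A) n (A, X))) Z \<cdot> proj C (mcar A) n (mcar A) i = zmap A Z"
proof (induction n arbitrary: i)
 case 0
 interpret A: crc_monoid C A by unfold_locales (rule A)
 show ?case using Comp_Ide[OF ptH[OF A.zero_pt[OF Z]]] by simp
next
 case (Suc n)
 interpret A: crc_monoid C A by unfold_locales (rule A)
 let ?M = "fst (powprod FC (A, mcar A) n (A, X))" and ?V = "powp (mcar A) n (mcar A)"
 have M: "tcm C ?M" by (rule powprod_Faa_cmon[OF A X])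
 interpret M: crc_monoid C ?M by unfold_locales (rule M)
 have V: "?V \<in> Obj C" by (rule powprod_Obj[OF A.car_Obj A.car_Obj])
 have eq: "zmap (fst (powprod FC (A, mcar A) (Suc n) (A, X))) Z = Pairing C (zmap A Z) (zmap ?M Z)"
  using zero_map_prod[OF A M Z] by (simp add: faa_Prod_sel)
 have zM: "zmap ?M Z \<in> pt C Z (Ide C Z) ?V" using M.zero_pt[OF Z] by simp
 note P = Pairing_pt[OF A.zero_pt[OF Z] zM]
 show ?case
 proof (cases i)
  case 0
  then show ?thesis using eq P(2) by simp
 next
  case (Suc i')
  have pC: "proj C (mcar A) n (mcar A) i' \<in> Hom C ?V (mcar A)"
   using ptH[OF proj_pt(1)[OF A.car_Obj A.car_Obj, of i' n]] ptH[OF proj_pt(2)[OF A.car_Obj A.car_Obj, of n]]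
    Suc.prems Suc by (cases "i' = n") auto
  show ?thesis
   using Suc.IH[of i'] Comp_assoc[OF ptH[OF P(1)] Pi1_Hom[OF A.car_Obj V] pC] P(3) eq Suc Suc.prems by simp
 qed
qed

end

lemma finite_delta_index: "finite (delta_index n r)"
proof (rule finite_subset)
 show "delta_index n r \<subseteq> (SIGMA S : Pow {..<r}. S \<rightarrow>\<^sub>E {..<n})" by (auto simp: delta_index_def)
 show "finite (SIGMA S : Pow {..<r}. S \<rightarrow>\<^sub>E {..<n})"
  by (intro finite_SigmaI finite_PiE) (auto intro: finite_subset)
qed

lemma delta_index_nonempty: "delta_index n r \<noteq> {}"
proof -
 \<comment> \<open>The empty matching; the only extensional function on the empty set is constantly
   \<open>undefined\<close>.\<close>
 have "({}, %x. undefined) \<in> delta_index n r" by (simp add: delta_index_def)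
 then show ?thesis by blast
qed

section \<open>The components as evaluations at generic cubes\<close>

locale faa_cmp = faa_arrow C F A X B Y
 for C :: "('o, 'm) crcat" (structure) and F A X B Y +
 fixes n :: nat
 assumes n: "n \<ge> 1"
begin

abbreviation "V \<equiv> powp (mcar A) n (mcar A)"
abbreviation "W \<equiv> powp (mcar A) n X"
abbreviation "p \<equiv> proj C (mcar A) n (mcar A)"
abbreviation "q \<equiv> proj C (mcar A) n X"
abbreviation "VW \<equiv> powprod (Faa C) (A, mcar A) n (A, X)"
abbreviation "M \<equiv> fst VW"
abbreviation "cmp \<equiv> delta_cmp C F n"
abbreviation "dseq \<equiv> faa_seq cmp"

lemma V: "V \<in> Obj C" and W: "W \<in> Obj C"
 using powprod_Obj A.car_Obj objs(2) by auto

lemma p_pt: "i \<le> n ==> p i \<in> mpt C V (Ide C V) A"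
 using proj_pt(1)[OF A.car_Obj A.car_Obj, of i n] proj_pt(2)[OF A.car_Obj A.car_Obj, of n] by (cases "i = n") auto

lemma q_pt: "i < n ==> q i \<in> mpt C W (Ide C W) A" "q n \<in> pt C W (Ide C W) X"
 using proj_pt[OF A.car_Obj objs(2)] by auto

lemma VW: "VW = (M, W)"
 using powprod_Faa(1)[of C A "mcar A" n A X] by (cases VW) simp

sublocale M: crc_monoid C M
 by unfold_locales (rule powprod_Faa_cmon[OF objs(1,2)])

lemma cmp_simps [simp]: "faa_src cmp = VW" "faa_tgt cmp = (B, mcar B)" "dseq 0 = f n"
 by (simp_all add: delta_cmp_def Let_def)

text \<open>The cube at which \<open>F\<close> is evaluated to obtain \<open>cmp\<close> at the point \<open>y\<close> in directions \<open>v\<close>.\<close>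

definition vcube :: "'o => 'm => 'i set => ('i => 'm) => 'm => (nat + 'i) set => 'm" where
 "vcube Z e R v y = lin C A Z e {..<n} (%i. pcube C A Z e R (%j. v j \<cdot> p i) (y \<cdot> q i)) (pcube C A Z e R (%j. v j \<cdot> p n) (y \<cdot> q n))"

lemma vcube_parts:
 fixes R :: "'i set"
 assumes v: "!!j. j \<in> R ==> v j \<in> pt C Z e V" and y: "y \<in> pt C Z e W"
 shows "j \<in> R ==> i \<le> n ==> v j \<cdot> p i \<in> mpt C Z e A" "i < n ==> y \<cdot> q i \<in> mpt C Z e A" "y \<cdot> q n \<in> pt C Z e X"
  "i < n ==> pcube C A Z e R (%j. v j \<cdot> p i) (y \<cdot> q i) J \<in> mpt C Z e A"
  "cube C Z e (A, X) (pcube C A Z e R (%j. v j \<cdot> p n) (y \<cdot> q n))"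
  "cube C Z e (A, X) (vcube Z e R v y)"
proof -
 show v': "j \<in> R ==> i \<le> n ==> v j \<cdot> p i \<in> mpt C Z e A" for i j by (rule pt_Comp[OF v p_pt])
 show y': "i < n ==> y \<cdot> q i \<in> mpt C Z e A" "y \<cdot> q n \<in> pt C Z e X" for i using pt_Comp[OF y] q_pt by auto
 show s: "i < n ==> pcube C A Z e R (%j. v j \<cdot> p i) (y \<cdot> q i) J \<in> mpt C Z e A" for i J
  using v' y' A.zero_e_pt[OF pt_idem(5)[OF y]] by (auto simp: pcube_def)
 show c: "cube C Z e (A, X) (pcube C A Z e R (%j. v j \<cdot> p n) (y \<cdot> q n))"
  by (rule pcube_cube) (use v' y' in auto)
 show "cube C Z e (A, X) (vcube Z e R v y)"
  unfolding vcube_def by (rule lin_cube[OF _ c]) (use s in simp)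
qed

lemma vcube_empty: "vcube Z e R v y {} = y \<cdot> q n"
 by (simp add: vcube_def)

lemma Comp_vcube:
 fixes R :: "'i set"
 assumes u: "u \<in> Hom C Z' Z" and v: "!!j. j \<in> R ==> v j \<in> pt C Z e V" and y: "y \<in> pt C Z e W"
 shows "u \<cdot> vcube Z e R v y D = vcube Z' (Rst C (u \<cdot> e)) R (%j. u \<cdot> v j) (u \<cdot> y) D"
proof -
 note e = pt_idem(5)[OF y]
 have v': "u \<cdot> (v j \<cdot> p i) = u \<cdot> v j \<cdot> p i" if "j \<in> R" "i \<le> n" for i j
  using Comp_assoc[OF u ptH[OF v[OF that(1)]] ptH[OF p_pt[OF that(2)]]] by simp
 have y': "u \<cdot> (y \<cdot> q i) = u \<cdot> y \<cdot> q i" if "i \<le> n" for i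
  using that Comp_assoc[OF u ptH[OF y] ptH[OF q_pt(1)[of i]]] Comp_assoc[OF u ptH[OF y] ptH[OF q_pt(2)]]
  by (cases "i = n") auto
 show ?thesis
  unfolding vcube_def Comp_lin[OF u e] Comp_pcube[OF u e]
  by (rule lin_cong) (auto simp: y' v' intro!: pcube_cong)
qed

text \<open>For \<open>r \<ge> 1\<close> this is \<open>ev_lin_pcube\<close> at the generic point of
  \<open>V^r \<times> W\<close>, with \<open>n\<close> directions for the linear variables of
  \<open>f n\<close> and \<open>r\<close> directions of differentiation. For \<open>r = 0\<close>
  the stored value is \<open>f n\<close>, and the cube is the universal one with its directions
  injected on the left.\<close>

lemma dseq_generic:
 fixes r :: nat
 defines "P \<equiv> proj C V r W" and "Z \<equiv> powp V r W"
 shows "dseq r = ev C F (vcube Z (Ide C Z) {..<r} P (P r)) ({..<n} |+| {..<r})"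
proof -
 have Z: "Z \<in> Obj C" unfolding Z_def by (rule powprod_Obj[OF V W])
 have P: "j < r ==> P j \<in> pt C Z (Ide C Z) V" "P r \<in> pt C Z (Ide C Z) W" for j
  using proj_pt[OF V W] by (auto simp: P_def Z_def)
 note parts = vcube_parts[of "{..<r}" P Z "Ide C Z" "P r"]
 have L: "cube C Z (Ide C Z) (A, X) (vcube Z (Ide C Z) {..<r} P (P r))" using parts(6) P by simp
 show ?thesis
 proof (cases "r = 0")
  case True
  \<comment> \<open>For \<open>r = 0\<close> the stage is \<open>W\<close> itself and its only
    projection is the identity.\<close>
  have PW: "P r = Ide C W" "Z = W" using True by (simp_all add: P_def Z_def)
  have q: "Ide C W \<cdot> q i = q i" if "i \<le> n" for i
   using that Ide_Comp[OF ptH[OF q_pt(1)[of i]]] Ide_Comp[OF ptH[OF q_pt(2)]] by (cases "i = n") auto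
  have "ev C F (vcube Z (Ide C Z) {..<r} P (P r)) ({..<n} |+| {..<r}) =
    ev C F (%D. vcube Z (Ide C Z) {..<r} P (P r) (Inl ` D)) {..<n}"
   using ev_reindex[OF L, of Inl "{..<n}"] True by simp
  also have "... = ev C F (ucube C (A, X) n) {..<n}"
  proof (rule ev_cong[OF ucube_cube])
   show "vcube Z (Ide C Z) {..<r} P (P r) (Inl ` {}) = ucube C (A, X) n {}"
    using PW q by (simp add: vcube_empty ucube_empty)
   fix D :: "nat set" assume D: "D \<subseteq> {..<n}" "D \<noteq> {}"
   show "vcube Z (Ide C Z) {..<r} P (P r) (Inl ` D) = ucube C (A, X) n D"
   proof (cases "\<exists>k<n. D = {k}")
    case True
    then obtain k where k: "k < n" "D = {k}" by auto
    have "Inl -` {Inl k :: nat + nat} = {k}" "Inr -` {Inl k :: nat + nat} = {}" by auto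
    then have "vcube Z (Ide C Z) {..<r} P (P r) {Inl k} = Ide C W \<cdot> q k"
     unfolding vcube_def using lin_Inl[of k "{..<n}" "{Inl k :: nat + nat}" C A Z "Ide C Z"] k PW by simp
    then show ?thesis using k q by (simp add: ucube_def Let_def)
   next
    case False
    then show ?thesis using D PW by (simp add: vcube_def lin_zero ucube_def Let_def)
   qed
  qed
  also have "... = f n" by (rule ev_ucube)
  finally show ?thesis using True by simp
 next
  case False
  let ?v = "%i j. P j \<cdot> p i" and ?a = "%i. P r \<cdot> q i" and ?w = "%j. P j \<cdot> p n" and ?x = "P r \<cdot> q n"
  let ?m = "%S \<phi>. {#if i \<in> \<phi> ` S then ?v i (inv_into S \<phi> i) else ?a i. i \<in># mset [0..<n]#} + {#?w j. j \<in># mset_set ({..<r} - S)#}"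
  have pts: "!!i j. i < n ==> j < r ==> ?v i j \<in> mpt C Z (Ide C Z) A" "!!i. i < n ==> ?a i \<in> mpt C Z (Ide C Z) A"
   "!!j. j < r ==> ?w j \<in> mpt C Z (Ide C Z) A" "?x \<in> pt C Z (Ide C Z) X"
   using parts(1-3) P by auto
  have E1: "ev C F (vcube Z (Ide C Z) {..<r} P (P r)) ({..<n} |+| {..<r}) =
    finprod (ptmon C B Z (Rst C (?x \<cdot> f 0))) (%(S, \<phi>). papp C F ?x (?m S \<phi>)) (delta_index n r)"
   unfolding vcube_def by (rule ev_lin_pcube(1)[OF n]) (fact pts)+
  have E2: "papp C F ?x (?m S \<phi>) \<in> mpt C Z (Rst C (?x \<cdot> f 0)) B" if "(S, \<phi>) \<in> delta_index n r" for S \<phi>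
   by (rule ev_lin_pcube(2)[OF n]) (fact pts that)+
  \<comment> \<open>The list in the definition enumerates the multiset of surviving coefficients.
    Its length is \<open>n + r - card S\<close>, since each matched pair uses one argument for two
    directions.\<close>
  have t: "(case sp of (S, \<phi>) => apply_map C (faa_seq F (n + r - card S))
        (map (%i. if i \<in> \<phi> ` S then ?v i (inv_into S \<phi> i) else ?a i) [0..<n] @ map ?w (sorted_list_of_set ({..<r} - S))) ?x) =
    (case sp of (S, \<phi>) => papp C F ?x (?m S \<phi>))" if "sp \<in> delta_index n r" for sp
  proof -
   obtain S \<phi> where sp: "sp = (S, \<phi>)" by (cases sp) auto
   then have S: "S \<subseteq> {..<r}" using that by (auto simp: delta_index_def)
   then have fin: "finite S" using finite_subset by blast
   let ?zs = "map (%i. if i \<in> \<phi> ` S then ?v i (inv_into S \<phi> i) else ?a i) [0..<n] @ map ?w (sorted_list_of_set ({..<r} - S))"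
   have "card S \<le> r" "card ({..<r} - S) = r - card S" using card_mono[OF _ S] card_Diff_subset[OF fin S] by auto
   then have len: "length ?zs = n + r - card S" by simp
   have zs: "set ?zs \<subseteq> mpt C Z (Ide C Z) A"
   proof -
    have "?v i (inv_into S \<phi> i) \<in> mpt C Z (Ide C Z) A" if "i < n" "i \<in> \<phi> ` S" for i
     using pts(1)[OF that(1)] inv_into_into[OF that(2)] S by auto
    then show ?thesis using pts(2,3) by auto
   qed
   have "mset (sorted_list_of_set ({..<r} - S)) = mset_set ({..<r} - S)" by (metis mset_sorted_list_of_multiset sorted_list_of_mset_set)
   then have "mset ?zs = ?m S \<phi>" by simp
   then have "papp C F ?x (?m S \<phi>) = tup ?zs ?x \<cdot> f (length ?zs)" using papp_mset[OF zs pts(4)] by metis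
   then show ?thesis using len sp by (simp add: apply_map_tup)
  qed
  have tc: "(case sp of (S, \<phi>) => papp C F ?x (?m S \<phi>)) \<in> mpt C Z (Rst C (?x \<cdot> f 0)) B" if "sp \<in> delta_index n r" for sp
   using E2 that by (cases sp) simp
  have "dseq r = msum C B Z (%(S, \<phi>). apply_map C (faa_seq F (n + r - card S))
        (map (%i. if i \<in> \<phi> ` S then ?v i (inv_into S \<phi> i) else ?a i) [0..<n] @ map ?w (sorted_list_of_set ({..<r} - S))) ?x) (delta_index n r)"
   using False unfolding delta_cmp_def delta_entry_def Let_def P_def Z_def src tgt fst_conv snd_conv by simp
  also have "... = finprod (ptmon C B Z (Rst C (?x \<cdot> f 0))) (%(S, \<phi>). apply_map C (faa_seq F (n + r - card S))
        (map (%i. if i \<in> \<phi> ` S then ?v i (inv_into S \<phi> i) else ?a i) [0..<n] @ map ?w (sorted_list_of_set ({..<r} - S))) ?x) (delta_index n r)"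
   by (rule B.msum_eq) (simp_all only: t tc finite_delta_index delta_index_nonempty not_False_eq_True)
  also have "... = finprod (ptmon C B Z (Rst C (?x \<cdot> f 0))) (%(S, \<phi>). papp C F ?x (?m S \<phi>)) (delta_index n r)"
  proof (rule comm_monoid.finprod_cong')
   show "comm_monoid (ptmon C B Z (Rst C (?x \<cdot> f 0)))" by (rule B.ptmon[OF dom_idem[OF ptH[OF pts(4)]]])
   show "(%(S, \<phi>). papp C F ?x (?m S \<phi>)) \<in> delta_index n r \<rightarrow> carrier (ptmon C B Z (Rst C (?x \<cdot> f 0)))"
    using tc by (intro Pi_I) simp
  qed (simp_all only: t)
  also have "... = ev C F (vcube Z (Ide C Z) {..<r} P (P r)) ({..<n} |+| {..<r})"
   by (rule E1[symmetric])
  finally show ?thesis .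
 qed
qed

text \<open>The generic case pulled back along the tuple of arguments.\<close>

lemma tup_dseq:
 assumes vs: "set vs \<subseteq> pt C Z e V" and y: "y \<in> pt C Z e W"
 shows "tup vs y \<cdot> dseq (length vs) =
  ev C F (vcube Z e {..<length vs} (%j. vs ! j) y) (Inl ` {..<n} \<union> Inr ` {..<length vs})"
proof -
 let ?r = "length vs"
 let ?Z = "powp V ?r W" and ?P = "proj C V ?r W"
 have P: "j < ?r ==> ?P j \<in> pt C ?Z (Ide C ?Z) V" "?P ?r \<in> pt C ?Z (Ide C ?Z) W" for j
  using proj_pt[OF V W] by auto
 have c: "cube C ?Z (Ide C ?Z) (A, X) (vcube ?Z (Ide C ?Z) {..<?r} ?P (?P ?r))" by (rule vcube_parts(6)) (use P in auto)
 note t = tup_pt[OF vs y]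
 note u = ptD[OF t(1)]
 have Re: "Rst C (tup vs y \<cdot> Ide C ?Z) = e" using Comp_Ide[OF u(1)] u(2) by simp
 have "tup vs y \<cdot> vcube ?Z (Ide C ?Z) {..<?r} ?P (?P ?r) D = vcube Z e {..<?r} (%j. vs ! j) y D" for D
 proof -
  have "tup vs y \<cdot> vcube ?Z (Ide C ?Z) {..<?r} ?P (?P ?r) D = vcube Z e {..<?r} (%j. tup vs y \<cdot> ?P j) y D"
   using Comp_vcube[OF u(1) P(1) P(2), of "{..<?r}" "%j. j" D] Re t(3) by simp
  also have "... = vcube Z e {..<?r} (%j. vs ! j) y D"
   unfolding vcube_def by (rule lin_cong) (auto simp: t(2) intro!: pcube_cong)
  finally show ?thesis .
 qed
 then show ?thesis unfolding dseq_generic ev_precomp[OF u(1) c] by presburger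
qed

text \<open>The right direction \<open>0\<close> carries \<open>a\<close> and occurs only in
  coefficients whose right part is exactly \<open>{0}\<close>. There the dependence on
  \<open>a\<close> is through one projection of \<open>V\<close>, and projections are
  additive.\<close>

lemma vcube_slot:
 assumes D: "Inr 0 \<in> D"
 shows "vcube Z e {..<Suc m} (%j. (a # zs) ! j) y D =
  (if Inr -` D = {0} then (if Inl -` D = {} then a \<cdot> p n else if \<exists>i<n. Inl -` D = {i} then a \<cdot> p (the_elem (Inl -` D)) else e \<cdot> zmap A Z)
   else e \<cdot> zmap A Z)"
proof -
 have pc: "pcube C A Z e {..<Suc m} (%j. (a # zs) ! j \<cdot> p i) x (Inr -` D) =
   (if Inr -` D = {0} then a \<cdot> p i else e \<cdot> zmap A Z)" for i x
 proof -
  have "Inr -` D = {0}" if "Inr -` D = {j}" for j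
  proof -
   have "0 \<in> Inr -` D" using D by simp
   then show ?thesis using that by auto
  qed
  moreover have "Inr -` D \<noteq> {}" using D by auto
  ultimately show ?thesis by (auto simp: pcube_def)
 qed
 show ?thesis unfolding vcube_def lin_def pc by auto
qed

lemma vcube_nonslot:
 assumes D: "Inr 0 \<notin> D"
 shows "vcube Z e {..<Suc m} (%j. (a # zs) ! j) y D = vcube Z e {..<Suc m} (%j. (b # zs) ! j) y D"
 unfolding vcube_def
proof (rule lin_cong)
 have "pcube C A Z e {..<Suc m} (%j. (a # zs) ! j \<cdot> p i) x (Inr -` D) = pcube C A Z e {..<Suc m} (%j. (b # zs) ! j \<cdot> p i) x (Inr -` D)" for i x
 proof -
  have "j \<noteq> 0" if "Inr -` D = {j}" for j
  proof
   assume "j = 0"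
   then have "0 \<in> Inr -` D" using that by simp
   then show False using D by simp
  qed
  then show ?thesis by (auto simp: pcube_def nth_Cons' simp del: vimage_eq)
 qed
 then show "pcube C A Z e {..<Suc m} (%j. (a # zs) ! j \<cdot> p k) (y \<cdot> q k) (Inr -` D) = pcube C A Z e {..<Suc m} (%j. (b # zs) ! j \<cdot> p k) (y \<cdot> q k) (Inr -` D)"
  "pcube C A Z e {..<Suc m} (%j. (a # zs) ! j \<cdot> p n) (y \<cdot> q n) (Inr -` D) = pcube C A Z e {..<Suc m} (%j. (b # zs) ! j \<cdot> p n) (y \<cdot> q n) (Inr -` D)" for k
  by auto
qed

text \<open>With the components written as evaluations of \<open>F\<close>, symmetry is a
  permutation of the right directions, and additivity is additivity of \<open>F\<close> in the
  direction \<open>Inr 0\<close>. The domain of \<open>f n\<close> is that of its projection to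
  \<open>X\<close> followed by \<open>f 0\<close>, which gives the restriction condition.\<close>

lemma cmp_Hom: "cmp \<in> Hom FC VW (B, mcar B)"
proof -
 have "FaaArr (M, W) (B, mcar B) dseq \<in> faa_Arr C"
 proof (rule faa_ArrI)
  show "tcm C M" "tcm C B" "W \<in> Obj C" by (rule M.monoid objs(3) W)+
  show "dseq 0 \<in> Hom C W (mcar B)" using fn(1)[OF n] by simp
  show "dseq r \<in> Hom C (powp (mcar M) r W) (mcar B)" "Rst C (dseq r) = Rst C (proj C (mcar M) r W r \<cdot> dseq 0)"
   if "r \<ge> 1" for r
  proof -
   let ?Z = "powp V r W" and ?P = "proj C V r W"
   have P: "j < r ==> ?P j \<in> pt C ?Z (Ide C ?Z) V" "?P r \<in> pt C ?Z (Ide C ?Z) W" for j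
    using proj_pt[OF V W] by auto
   have c: "cube C ?Z (Ide C ?Z) (A, X) (vcube ?Z (Ide C ?Z) {..<r} ?P (?P r))" by (rule vcube_parts(6)) (use P in auto)
   have "{..<n} |+| {..<r} \<noteq> ({} :: (nat + nat) set)" using n by (auto simp: lessThan_empty_iff)
   then have d: "dseq r \<in> pt C ?Z (Rst C (?P r \<cdot> q n \<cdot> f 0)) (mcar B)"
    unfolding dseq_generic using cubeD(2)[OF ev_cube[OF c]] by (simp add: vcube_empty)
   note Pr = ptH[OF P(2)] and qn = ptH[OF q_pt(2)]
   have "Rst C (?P r \<cdot> dseq 0) = Rst C (?P r \<cdot> Rst C (f n))" using Rst_Comp[OF Pr fn(1)[OF n]] by simp
   also have "... = Rst C (?P r \<cdot> (q n \<cdot> f 0))" using fn(2)[OF n] Rst_Comp[OF Pr Comp_Hom[OF qn f0]] by simp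
   also have "... = Rst C (dseq r)" using ptD(2)[OF d] Comp_assoc[OF Pr qn f0] by simp
   finally show "Rst C (dseq r) = Rst C (proj C (mcar M) r W r \<cdot> dseq 0)" by simp
   show "dseq r \<in> Hom C (powp (mcar M) r W) (mcar B)" using ptH[OF d] by simp
  qed
 next
  fix Z e zs zs' y
  assume zs: "zs \<noteq> []" "set zs \<subseteq> mpt C Z e M" and y: "y \<in> pt C Z e W" and m: "mset zs' = mset zs"
  obtain \<sigma> where \<sigma>: "\<sigma> permutes {..<length zs}" "permute_list \<sigma> zs = zs'"
   using mset_eq_permutation[OF m] by blast
  have l: "length zs' = length zs" and s: "set zs' = set zs" using m by (metis size_mset, metis set_mset_mset)
  have zsV: "set zs \<subseteq> pt C Z e V" "set zs' \<subseteq> pt C Z e V" using zs(2) s by simp_all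
  let ?R = "{..<length zs}"
  have im: "\<sigma> ` ?R = ?R" and inj: "inj_on \<sigma> ?R" using permutes_image[OF \<sigma>(1)] permutes_inj_on[OF \<sigma>(1)] by auto
  have v: "j \<in> ?R ==> zs ! j \<in> pt C Z e V" and v': "j \<in> ?R ==> zs' ! j \<in> pt C Z e V" for j
   using zsV l by (auto simp: subset_iff)
  note pa = vcube_parts[where R = ?R and v = "%j. zs ! j", OF v y] and pa' = vcube_parts[where R = ?R and v = "%j. zs' ! j", OF v' y]
  have nth: "zs' ! j = zs ! \<sigma> j" if "j < length zs" for j
   using \<sigma> that by (metis permute_list_nth)
  have "tup zs y \<cdot> dseq (length zs) =
    ev C F (lin C A Z e ((%i. i) ` {..<n}) (%i. pcube C A Z e ?R (%j. zs ! j \<cdot> p i) (y \<cdot> q i)) (pcube C A Z e ?R (%j. zs ! j \<cdot> p n) (y \<cdot> q n)))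
     (Inl ` (%i. i) ` {..<n} \<union> Inr ` \<sigma> ` ?R)"
   unfolding tup_dseq[OF zsV(1) y] im by (simp add: vcube_def)
  also have "... = ev C F (lin C A Z e {..<n} (%i J. pcube C A Z e ?R (%j. zs ! j \<cdot> p i) (y \<cdot> q i) (\<sigma> ` J))
    (%J. pcube C A Z e ?R (%j. zs ! j \<cdot> p n) (y \<cdot> q n) (\<sigma> ` J))) (Inl ` {..<n} \<union> Inr ` ?R)"
   by (rule ev_lin_reindex[OF _ pa(5) _ inj]) (use pa(4) in auto)
  also have "... = ev C F (vcube Z e ?R (%j. zs' ! j) y) (Inl ` {..<n} \<union> Inr ` ?R)"
   unfolding vcube_def
  proof (rule ev_lin_cong[OF _ pa'(5)])
   have e: "pcube C A Z e ?R (%j. zs ! j \<cdot> p i) x (\<sigma> ` J) = pcube C A Z e ?R (%j. zs' ! j \<cdot> p i) x J" if "J \<subseteq> ?R" for i x J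
    using pcube_image[OF inj that, of C A Z e "%j. zs ! j \<cdot> p i" x] im
     pcube_cong[of ?R "%j. zs' ! j \<cdot> p i" "%j. zs ! \<sigma> j \<cdot> p i" C A Z e x J] nth by simp
   show "pcube C A Z e ?R (%j. zs ! j \<cdot> p i) (y \<cdot> q i) (\<sigma> ` J) = pcube C A Z e ?R (%j. zs' ! j \<cdot> p i) (y \<cdot> q i) J"
    "pcube C A Z e ?R (%j. zs ! j \<cdot> p n) (y \<cdot> q n) (\<sigma> ` J) = pcube C A Z e ?R (%j. zs' ! j \<cdot> p n) (y \<cdot> q n) J"
    if "J \<subseteq> ?R" for i J using e[OF that] by auto
  qed (use pa'(4) in auto)
  also have "... = tup zs' y \<cdot> dseq (length zs)"
   using tup_dseq[OF zsV(2) y] l by simp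
  finally show "tup zs' y \<cdot> dseq (length zs) = tup zs y \<cdot> dseq (length zs)" by simp
 next
  fix Z e zs y a b
  assume zs: "set zs \<subseteq> mpt C Z e M" and y: "y \<in> pt C Z e W" and ab: "a \<in> mpt C Z e M" "b \<in> mpt C Z e M"
  let ?r = "Suc (length zs)"
  let ?c = "%a. vcube Z e {..<?r} (%j. (a # zs) ! j) y"
  have zsV: "set (c # zs) \<subseteq> pt C Z e V" if "c \<in> pt C Z e V" for c using zs that by simp
  have abV: "a \<in> pt C Z e V" "b \<in> pt C Z e V" using ab by simp_all
  have sV: "madd C M a b \<in> pt C Z e V" using M.add_pt[OF ab] by simp
  have t: "tup (c # zs) y \<cdot> dseq ?r = ev C F (?c c) (Inl ` {..<n} \<union> Inr ` {..<?r})" if "c \<in> pt C Z e V" for c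
   using tup_dseq[OF zsV[OF that] y] by (simp del: tup_simps)
  have cu: "cube C Z e (A, X) (?c c)" if "c \<in> pt C Z e V" for c
   by (rule vcube_parts(6)[OF _ y]) (use zsV[OF that] in "auto simp: subset_iff nth_Cons split: nat.splits")
  have pm: "madd C M a b \<cdot> p i = madd C A (a \<cdot> p i) (b \<cdot> p i)" if "i \<le> n" for i
   by (rule madd_powprod_proj[OF objs(1,2) abV that])
  have zz: "madd C A (e \<cdot> zmap A Z) (e \<cdot> zmap A Z) = e \<cdot> zmap A Z"
   by (rule A.add_zero_pt[OF A.zero_e_pt[OF pt_idem(5)[OF y]]])
  show "tup (madd C M a b # zs) y \<cdot> dseq ?r = madd C B (tup (a # zs) y \<cdot> dseq ?r) (tup (b # zs) y \<cdot> dseq ?r)"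
   unfolding t[OF sV] t[OF abV(1)] t[OF abV(2)]
  proof (rule ev_slot_add[OF cu[OF sV] cu[OF abV(1)] cu[OF abV(2)], where j = "Inr 0"])
   show "?c a {} = ?c (madd C M a b) {}" "?c b {} = ?c (madd C M a b) {}" by (simp_all add: vcube_empty)
   show "Inr 0 \<in> Inl ` {..<n} \<union> Inr ` {..<?r}" by simp
  next
   fix D :: "(nat + nat) set" assume "Inr 0 \<notin> D"
   from vcube_nonslot[OF this] show "?c a D = ?c (madd C M a b) D \<and> ?c b D = ?c (madd C M a b) D" by blast
  next
   fix D :: "(nat + nat) set" assume D: "Inr 0 \<in> D"
   show "?c (madd C M a b) D = madd C A (?c a D) (?c b D)"
    unfolding vcube_slot[OF D] using pm zz by auto
  qed
 next
  fix Z e zs y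
  assume zs: "set zs \<subseteq> mpt C Z e M" and y: "y \<in> pt C Z e W"
  let ?r = "Suc (length zs)" and ?a = "e \<cdot> zmap M Z"
  note e = pt_idem(5)[OF y]
  have Z: "Z \<in> Obj C" using Hom_Obj(1)[OF ptH[OF y]] .
  have aV: "?a \<in> pt C Z e V" using M.zero_e_pt[OF e] by simp
  have zsV: "set (?a # zs) \<subseteq> pt C Z e V" using zs aV by simp
  let ?c = "vcube Z e {..<?r} (%j. (?a # zs) ! j) y"
  have cu: "cube C Z e (A, X) ?c"
   by (rule vcube_parts(6)[OF _ y]) (use zsV in "auto simp: subset_iff nth_Cons split: nat.splits")
  have pz: "?a \<cdot> p i = e \<cdot> zmap A Z" if "i \<le> n" for i
   using Comp_assoc[OF ptH[OF e] ptH[OF M.zero_pt[OF Z]], of "p i" "mcar A"] ptH[OF p_pt[OF that]]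
    zero_powprod_proj[OF objs(1,2) Z that] by simp
  have "tup (?a # zs) y \<cdot> dseq ?r = ev C F ?c (Inl ` {..<n} \<union> Inr ` {..<?r})"
   using tup_dseq[OF zsV y] by (simp del: tup_simps)
  also have "... = Rst C (?c {} \<cdot> f 0) \<cdot> zmap B Z"
  proof (rule ev_slot_zero[OF cu, where j = "Inr 0"])
   fix D :: "(nat + nat) set" assume D: "Inr 0 \<in> D"
   show "?c D = e \<cdot> zmap A Z" unfolding vcube_slot[OF D] using pz by auto
  qed simp
  also have "Rst C (?c {} \<cdot> f 0) = Rst C (y \<cdot> dseq 0)"
  proof -
   note yH = ptH[OF y] and qn = ptH[OF q_pt(2)]
   have "Rst C (y \<cdot> dseq 0) = Rst C (y \<cdot> Rst C (f n))" using Rst_Comp[OF yH fn(1)[OF n]] by simp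
   also have "... = Rst C (y \<cdot> (q n \<cdot> f 0))" using fn(2)[OF n] Rst_Comp[OF yH Comp_Hom[OF qn f0]] by simp
   finally show ?thesis using Comp_assoc[OF yH qn f0] by (simp add: vcube_empty)
  qed
  finally show "tup (?a # zs) y \<cdot> dseq ?r = Rst C (y \<cdot> dseq 0) \<cdot> zmap B Z" .
 qed
 moreover have "FaaArr (M, W) (B, mcar B) dseq = cmp"
  using VW cmp_simps(1,2) by (metis faa_arr.collapse)
 ultimately show ?thesis by (simp add: Hom_Faa)
qed

end

section \<open>The action of the components on arbitrary cubes\<close>

lemma vimage_unblock: "Inl -` unblock D = Inl -` D" "Inr -` unblock D = \<Union>(Inr -` D)"
 by (simp_all add: unblock_def)

lemma unblock_nonempty:
 assumes D: "D \<noteq> {}" and one: "Inr -` D = {} \<or> (\<exists>b. Inr -` D = {b})" and ne: "{} \<notin> Inr -` D"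
 shows "unblock D \<noteq> {}"
proof
 assume "unblock D = {}"
 then have l: "Inl -` D = {}" "\<Union>(Inr -` D) = {}" using vimage_unblock[of D] by auto
 have "Inr -` D \<noteq> {}"
 proof
  assume "Inr -` D = {}"
  with l(1) have "D = {}" by (subst sum_set_eq) simp
  then show False using D by simp
 qed
 then obtain b where b: "Inr -` D = {b}" using one by metis
 then have "b = {}" using l(2) by simp
 then show False using ne b by simp
qed

context faa_cmp
begin

text \<open>Passes from lists of arguments to arbitrary finite sets of directions, as needed when
  the blocks of a partition are the directions.\<close>

lemma papp_cmp:
 fixes R :: "'i set"
 assumes v: "!!j. j \<in> R ==> v j \<in> pt C Z e V" and y: "y \<in> pt C Z e W" and R: "finite R"
 shows "papp C cmp y {#v j. j \<in># mset_set R#} = ev C F (vcube Z e R v y) ({..<n} |+| R)"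
proof -
 interpret K: faa_arrow C cmp M W B "mcar B" using faa_arrowI[of cmp M W B "mcar B"] cmp_Hom VW by simp
 obtain l where l: "distinct l" "set l = R" using finite_distinct_list[OF R] by blast
 let ?vs = "map v l" and ?S = "{..<length l}"
 have vs: "set ?vs \<subseteq> pt C Z e V" using v l by auto
 have "{#v j. j \<in># mset_set R#} = mset ?vs" using mset_set_set[OF l(1)] l(2) by simp
 then have "papp C cmp y {#v j. j \<in># mset_set R#} = tup ?vs y \<cdot> dseq (length ?vs)"
  using K.papp_mset[of ?vs Z e y] vs y by simp
 also have "... = ev C F (vcube Z e ?S (%j. ?vs ! j) y) (Inl ` {..<n} \<union> Inr ` ?S)"
  using tup_dseq[OF vs y] by simp
 also have "... = ev C F (lin C A Z e {..<n} (%i J. pcube C A Z e R (%j. v j \<cdot> p i) (y \<cdot> q i) ((!) l ` J))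
   (%J. pcube C A Z e R (%j. v j \<cdot> p n) (y \<cdot> q n) ((!) l ` J))) (Inl ` {..<n} \<union> Inr ` ?S)"
 proof -
  have inj: "inj_on ((!) l) ?S" and im: "(!) l ` ?S = R"
   using l by (auto simp: inj_on_def nth_eq_iff_index_eq in_set_conv_nth)
  have v': "?vs ! j \<in> pt C Z e V" if "j \<in> ?S" for j using v l that by auto
  note pa = vcube_parts[where R = ?S and v = "%j. ?vs ! j", OF v' y]
  show ?thesis
   unfolding vcube_def
  proof (rule ev_lin_cong[OF _ pa(5), symmetric])
   have e: "pcube C A Z e R (%j. v j \<cdot> p i) x ((!) l ` J) = pcube C A Z e ?S (%j. ?vs ! j \<cdot> p i) x J" if "J \<subseteq> ?S" for i x J
    using pcube_image[OF inj that, of C A Z e "%j. v j \<cdot> p i" x] im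
     pcube_cong[of ?S "%j. ?vs ! j \<cdot> p i" "%j. v (l ! j) \<cdot> p i" C A Z e x J] by simp
   show "pcube C A Z e R (%j. v j \<cdot> p i) (y \<cdot> q i) ((!) l ` J) = pcube C A Z e ?S (%j. ?vs ! j \<cdot> p i) (y \<cdot> q i) J"
    "pcube C A Z e R (%j. v j \<cdot> p n) (y \<cdot> q n) ((!) l ` J) = pcube C A Z e ?S (%j. ?vs ! j \<cdot> p n) (y \<cdot> q n) J"
    if "J \<subseteq> ?S" for i J using e[OF that] by auto
  qed (use pa(4) in auto)
 qed
 also have "... = ev C F (lin C A Z e ((%i. i) ` {..<n}) (%i. pcube C A Z e R (%j. v j \<cdot> p i) (y \<cdot> q i)) (pcube C A Z e R (%j. v j \<cdot> p n) (y \<cdot> q n)))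
     (Inl ` (%i. i) ` {..<n} \<union> Inr ` (!) l ` ?S)"
 proof (rule ev_lin_reindex[symmetric])
  show "inj_on ((!) l) ?S" using l(1) by (auto simp: inj_on_def nth_eq_iff_index_eq)
 qed (use vcube_parts[OF v y] in auto)
 also have "(!) l ` ?S = R" using l(2) by (auto simp: in_set_conv_nth)
 finally show ?thesis by (simp add: vcube_def)
qed

text \<open>At a cube \<open>c\<close> the action is a sum over partitions \<open>P\<close> of
  \<open>J\<close>, each term an evaluation of \<open>F\<close> with directions
  \<open>n + P\<close>. The cubes occurring there are the fusions along \<open>P\<close> of one cube
  on \<open>n + J\<close> that is linear in the left directions, so \<open>pev_fuse\<close>
  collapses the sum into a single evaluation.\<close>

lemma ev_cmp:
 fixes c :: "'i set => 'm"
 assumes c: "cube C Z e VW c" and J: "finite J"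
 shows "ev C cmp c J = ev C F (lin C A Z e {..<n} (%i J. c J \<cdot> (if J = {} then q i else p i)) (%J. c J \<cdot> (if J = {} then q n else p n)))
  ({..<n} |+| J)"
proof -
 interpret K: faa_arrow C cmp M W B "mcar B" using faa_arrowI[of cmp M W B "mcar B"] cmp_Hom VW by simp
 let ?s = "%i J. c J \<cdot> (if J = {} then q i else p i)" and ?c = "%J. c J \<cdot> (if J = {} then q n else p n)"
 let ?L = "lin C A Z e {..<n} ?s ?c"
 have c': "cube C Z e (M, W) c" using c VW by simp
 have y: "c {} \<in> pt C Z e W" and v: "!!D. D \<noteq> {} ==> c D \<in> pt C Z e V" using K.cube_base[OF c'] by simp_all
 have s: "?s i D \<in> mpt C Z e A" if "i < n" for i D
  using pt_Comp[OF y q_pt(1)[OF that]] pt_Comp[OF v p_pt[of i]] that by auto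
 have cc: "cube C Z e (A, X) ?c"
  using pt_Comp[OF y q_pt(2)] pt_Comp[OF v p_pt[of n]] by (auto simp: cube_def)
 have L: "cube C Z e (A, X) ?L" by (rule lin_cube[OF _ cc]) (use s in auto)
 show ?thesis
 proof (cases "J = {}")
  case True
  have "ev C cmp c J = ev C F (vcube Z e {} (%j. undefined) (c {})) ({..<n} |+| ({} :: 'i set))"
  proof -
   have "papp C cmp (c {}) {#} = c {} \<cdot> dseq 0" using K.papp_mset[of "[]" Z e "c {}"] y by simp
   then show ?thesis using papp_cmp[of "{} :: 'i set" _ Z e "c {}"] y True by (simp add: ev_def)
  qed
  also have "... = ev C F ?L ({..<n} |+| ({} :: 'i set))"
   unfolding vcube_def by (rule ev_lin_cong[OF _ cc]) (use s in auto)
  finally show ?thesis using True by simp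
 next
  case False
  have ne: "{..<n} |+| P \<noteq> {}" for P :: "'x set" using n by (auto simp: lessThan_empty_iff)
  let ?x = "c {} \<cdot> q n" and ?H = "ptmon C B Z (Rst C (c {} \<cdot> q n \<cdot> f 0))" and ?G = "ptmon C A Z e"
  have x: "?x \<in> pt C Z e X" by (rule pt_Comp[OF y q_pt(2)])
  interpret S: symadd ?G ?H "papp C F ?x" by (rule symadd[OF x])
  have R: "Rst C (c {} \<cdot> dseq 0) = Rst C (?x \<cdot> f 0)"
  proof -
   note yH = ptH[OF y] and qn = ptH[OF q_pt(2)]
   have "Rst C (c {} \<cdot> dseq 0) = Rst C (c {} \<cdot> Rst C (f n))" using Rst_Comp[OF yH fn(1)[OF n]] by simp
   also have "... = Rst C (c {} \<cdot> (q n \<cdot> f 0))" using fn(2)[OF n] Rst_Comp[OF yH Comp_Hom[OF qn f0]] by simp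
   finally show ?thesis using Comp_assoc[OF yH qn f0] by simp
  qed
  \<comment> \<open>Compared by the number of blocks of \<open>P\<close> in \<open>D\<close>: with
    none or one, the entry of \<open>?L\<close> at the underlying directions is read off; with more,
    both sides vanish.\<close>
  have fuse: "fuse ?G ?L D = vcube Z e P c (c {}) D" if P: "P \<in> parts J" and D: "D \<subseteq> {..<n} |+| P" "D \<noteq> {}" for P D
  proof -
   have Pn: "b \<noteq> {}" if "b \<in> P" for b using partsD(4)[OF P] that by metis
   have sub: "Inl -` D \<subseteq> {..<n}" "Inr -` D \<subseteq> P" using D(1) by auto
   note iu = vimage_unblock[of D]
   have une: "unblock D \<noteq> {}" if "Inr -` D = {} \<or> (\<exists>b. Inr -` D = {b})"
    by (rule unblock_nonempty[OF D(2) that]) (use Pn sub(2) in blast)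
   have z: "pcube C A Z e P w t (Inr -` D) = e \<cdot> zmap A Z" if "Inr -` D \<noteq> {}" "\<not> (\<exists>b. Inr -` D = {b})" for w t
    using that by (intro pcube_simps(3)) auto
   consider "Inr -` D = {}" | b where "Inr -` D = {b}" | "Inr -` D \<noteq> {}" "\<not> (\<exists>b. Inr -` D = {b})" by blast
   then show ?thesis
   proof cases
    case 1
    then have "fuse ?G ?L D = ?L (unblock D)" using une by (simp add: fuse_def)
    also have "... = vcube Z e P c (c {}) D" unfolding vcube_def lin_def iu using 1 by simp
    finally show ?thesis .
   next
    case 2
    then have b: "b \<in> P" using sub(2) by simp
    note Pn[OF b]
    from 2 have "fuse ?G ?L D = ?L (unblock D)" using une by (simp add: fuse_def)
    also have "... = vcube Z e P c (c {}) D" unfolding vcube_def lin_def iu using 2 b Pn[OF b] by simp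
    finally show ?thesis .
   next
    case 3
    then have "fuse ?G ?L D = e \<cdot> zmap A Z" by (auto simp: fuse_def)
    also have "... = vcube Z e P c (c {}) D" unfolding vcube_def lin_def z[OF 3] by simp
    finally show ?thesis .
   qed
  qed
  have vc: "b \<in> P ==> c b \<in> pt C Z e V" if "P \<in> parts J" for P b using partsD(4)[OF that] v by metis
  have term_eq: "papp C cmp (c {}) (image_mset c (mset_set P)) = pev ?H (papp C F ?x) (fuse ?G ?L) ({..<n} |+| P)"
   if P: "P \<in> parts J" for P
  proof -
   have vcu: "cube C Z e (A, X) (vcube Z e P c (c {}))" by (rule vcube_parts(6)[OF vc[OF P] y])
   have "papp C cmp (c {}) (image_mset c (mset_set P)) = ev C F (vcube Z e P c (c {})) ({..<n} |+| P)"
    by (rule papp_cmp[OF vc[OF P] y partsD(2)[OF P]])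
   also have "... = pev ?H (papp C F ?x) (vcube Z e P c (c {})) ({..<n} |+| P)"
    using ev_pev[OF vcu ne] by (simp add: vcube_empty)
   also have "... = pev ?H (papp C F ?x) (fuse ?G ?L) ({..<n} |+| P)"
    by (rule S.pev_cong[OF cube_fam'[OF vcu] ne, symmetric]) (use fuse[OF P] in simp)
   finally show ?thesis .
  qed
  have "ev C cmp c J = finprod ?H (%P. papp C cmp (c {}) (image_mset c (mset_set P))) (parts J)"
   unfolding K.ev_pev[OF c' False] R pev_def ..
  also have "... = finprod ?H (%P. pev ?H (papp C F ?x) (fuse ?G ?L) ({..<n} |+| P)) (parts J)"
  proof (rule S.H.finprod_cong')
   interpret KS: symadd "ptmon C M Z e" ?H "papp C cmp (c {})" by (rule K.symadd_cube[OF c', unfolded R])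
   show "(%P. pev ?H (papp C F ?x) (fuse ?G ?L) ({..<n} |+| P)) \<in> parts J \<rightarrow> carrier ?H"
   proof (rule Pi_I)
    fix P assume P: "P \<in> parts J"
    show "pev ?H (papp C F ?x) (fuse ?G ?L) ({..<n} |+| P) \<in> carrier ?H"
     using KS.pev_term_closed[OF K.cube_fam'[OF c'] False P] unfolding term_eq[OF P] .
   qed
  qed (simp_all only: term_eq)
  also have "... = pev ?H (papp C F ?x) ?L ({..<n} |+| J)"
   by (rule S.pev_fuse[OF cube_fam'[OF L], symmetric]) (use J False in auto)
  also have "... = ev C F ?L ({..<n} |+| J)" using ev_pev[OF L ne] by simp
  finally show ?thesis .
 qed
qed

end

subsection \<open>The monoid \<open>\<delta>(A)\<close>\<close>

context cartesian_restriction_category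
begin

abbreviation (input) "dmon \<equiv> delta_cmon C"

abbreviation (input) "edom w e \<equiv> Rst C (w {} \<cdot> faa_seq e 0)"

lemma ev_at_empty: "ev C F c {} = c {} \<cdot> faa_seq F 0"
 by (simp add: ev_def)

lemma semilin_0: "faa_seq (semilin S T f g) 0 = f"
 by (simp add: semilin_def)

lemma Faa_pt_0:
 assumes f: "f \<in> pt FC S e T" and w: "cube C Z d S w"
 shows "edom w f = edom w e" "cube C Z (edom w e) T (ev C f w)"
proof -
 have fH: "f \<in> Hom FC S T" and e: "e = faa_Rst C f" using f by (auto simp: pt_def)
 show eq: "edom w f = edom w e"
  using Rst_Comp[OF ptH[OF cubeD(1)[OF w]] Faa_0[OF fH]] by (simp add: e Faa_Rst_0)
 show "cube C Z (edom w e) T (ev C f w)" using Faa_ev_cube[OF fH w] eq by simp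
qed

lemma ev_restrict:
 assumes e: "e \<in> pt FC S e S" and g: "g \<in> Hom FC S T" and w: "cube C Z d S w" and J: "finite J"
 shows "ev C (FComp e g) w J = edom w e \<cdot> ev C g w J"
proof -
 have eH: "e \<in> Hom FC S S" and ee: "faa_Rst C e = e" using e by (auto simp: pt_def)
 have r: "edom w e \<in> Hom C Z Z" by (rule Rst_Hom[OF cube_dom[OF eH w]])
 have ce: "ev C e w D = edom w e \<cdot> w D" if "finite D" for D
  using ev_faa_Rst[OF eH w that] ee by simp
 have "ev C (FComp e g) w J = ev C g (ev C e w) J" by (rule Faa_ev_Comp[OF eH g w J])
 also have "... = ev C g (%D. edom w e \<cdot> w D) J"
  by (rule Faa_ev_cong[OF g Faa_ev_cube[OF eH w], symmetric]) (use ce in auto)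
 also have "... = edom w e \<cdot> ev C g w J" by (rule Faa_ev_precomp[OF g w r, symmetric])
 finally show ?thesis .
qed

text \<open>The two projections of the evaluated pairing are the evaluations of the factors, and
  \<open>Pairing_eta\<close> reassembles them.\<close>

lemma ev_Pairing:
 assumes a: "a \<in> pt FC V e S" and b: "b \<in> pt FC V e T" and w: "cube C Z d V w" and J: "finite J"
 shows "ev C (faa_Pairing C a b) w J = Pairing C (ev C a w J) (ev C b w J)"
proof -
 interpret D: cartesian_restriction_category "Faa C" by (rule Faa_crc)
 note S = Faa_Objs(2)[OF D.ptH[OF a]] and T = Faa_Objs(2)[OF D.ptH[OF b]]
 note P = D.Pairing_pt[OF a b, simplified]
 note PH = D.ptH[OF P(1)]
 let ?c = "ev C (faa_Pairing C a b) w"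
 have c: "cube C Z (edom w e) (faa_Prod C S T) ?c" by (rule Faa_pt_0(2)[OF P(1) w])
 have e1: "ev C (faa_Pi0 C S T) ?c J = ev C a w J" "ev C (faa_Pi1 C S T) ?c J = ev C b w J"
  using Faa_ev_Comp[OF PH faa_Pi_Hom(1)[OF S T] w J] Faa_ev_Comp[OF PH faa_Pi_Hom(2)[OF S T] w J] P(2,3) by auto
 let ?X = "if J = {} then snd S else mcar (fst S)" and ?Y = "if J = {} then snd T else mcar (fst T)"
 have XY: "?X \<in> Obj C" "?Y \<in> Obj C" using S T total_comm_monoidD(1) by (auto simp: faa_Obj_def)
 have "?c J \<in> Hom C Z (Prod C ?X ?Y)"
  using ptH[OF cubeD(1)[OF c]] ptH[OF cubeD(2)[OF c, of J]] by (auto simp: faa_Prod_sel)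
 from Pairing_eta[OF this XY] show ?thesis
  using ev_faa_Pi[OF S T c J] e1 by (auto split: if_splits)
qed

text \<open>That addition is itself a homomorphism from \<open>A \<times> A\<close> to
  \<open>A\<close> is the interchange law, which rests on commutativity. It makes addition
  admissible as the linear part of an arrow of \<open>Faa(C)\<close>.\<close>

lemma mhom_mplus:
 assumes A: "tcm C A"
 shows "mhom (prod_cmon C A A) A (mplus A)"
proof -
 interpret A: crc_monoid C A by unfold_locales (rule A)
 let ?P = "Prod C (mcar A) (mcar A)" and ?l = "Pi0 C (mcar A) (mcar A)" and ?r = "Pi1 C (mcar A) (mcar A)"
 note lr = Pi0_pt[OF A.car_Obj A.car_Obj] Pi1_pt[OF A.car_Obj A.car_Obj]
 have "madd C (prod_cmon C A A) a b \<cdot> mplus A = madd C A (a \<cdot> mplus A) (b \<cdot> mplus A)"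
  if ab: "a \<in> pt C Z e ?P" "b \<in> pt C Z e ?P" for Z e a b
 proof -
  have c: "c \<cdot> mplus A = madd C A (c \<cdot> ?l) (c \<cdot> ?r)" if "c \<in> pt C Z e ?P" for c
   using Pairing_eta[OF ptH[OF that] A.car_Obj A.car_Obj] by (simp add: madd_def)
  note p = pt_Comp[OF ab(1) lr(1)] pt_Comp[OF ab(1) lr(2)] pt_Comp[OF ab(2) lr(1)] pt_Comp[OF ab(2) lr(2)]
  interpret M: comm_monoid "ptmon C A Z e" by (rule A.ptmon[OF pt_idem(5)[OF ab(1)]])
  have "madd C (prod_cmon C A A) a b \<cdot> mplus A = madd C A (madd C A (a \<cdot> ?l) (b \<cdot> ?l)) (madd C A (a \<cdot> ?r) (b \<cdot> ?r))"
   unfolding madd_prod[OF A A ab] by (simp add: madd_def)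
  also have "... = madd C A (madd C A (a \<cdot> ?l) (a \<cdot> ?r)) (madd C A (b \<cdot> ?l) (b \<cdot> ?r))"
   using M.m_assoc M.m_lcomm p A.add_pt by simp
  finally show ?thesis using c[OF ab(1)] c[OF ab(2)] by simp
 qed
 moreover have "mzero (prod_cmon C A A) \<cdot> mplus A = mzero A"
 proof -
  have "zmap A (Unit C) = mzero A"
   using Unit_eq[OF Ide_Hom[OF Unit_Obj] Bang_Hom[OF Unit_Obj]] ptD(2)[OF Ide_pt[OF Unit_Obj]] ptD(2)[OF Bang_pt[OF Unit_Obj]]
    Ide_Comp[OF A.mzero_Hom] by (simp add: zero_map_def)
  then show ?thesis using A.add_zero[OF A.mzero_Hom] by (simp add: prod_cmon_def Let_def madd_def)
 qed
 ultimately show ?thesis using A.plus_pt by (simp add: mhom_def)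
qed

lemma mhom_mzero:
 assumes A: "tcm C A"
 shows "mhom (unit_cmon C) A (mzero A)"
proof -
 interpret A: crc_monoid C A by unfold_locales (rule A)
 interpret U: crc_monoid C "unit_cmon C" by unfold_locales (rule unit_cmon)
 have u: "mcar (unit_cmon C) = Unit C" by (simp add: unit_cmon_def)
 have z: "a \<cdot> mzero A = e \<cdot> zmap A Z" if a: "a \<in> pt C Z e (Unit C)" for a Z e
 proof -
  note Z = Hom_Obj(1)[OF ptH[OF a]]
  have "a = e \<cdot> Bang C Z" using Unit_restriction[OF ptH[OF a]] ptD(2)[OF a] by simp
  then show ?thesis using Comp_assoc[OF pt_idem(1)[OF a] Bang_Hom[OF Z] A.mzero_Hom] by (simp add: zero_map_def)
 qed
 have "madd C (unit_cmon C) a b \<cdot> mzero A = madd C A (a \<cdot> mzero A) (b \<cdot> mzero A)"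
  if ab: "a \<in> pt C Z e (Unit C)" "b \<in> pt C Z e (Unit C)" for Z e a b
  using z[OF ab(1)] z[OF ab(2)] z[of "madd C (unit_cmon C) a b" Z e] U.add_pt[of a Z e b] ab u
   A.add_zero_pt[OF A.zero_e_pt[OF pt_idem(5)[OF ab(1)]]] by simp
 moreover have "mzero (unit_cmon C) \<cdot> mzero A = mzero A"
  using Unit_eq[OF Ide_Hom[OF Unit_Obj] Bang_Hom[OF Unit_Obj]] ptD(2)[OF Ide_pt[OF Unit_Obj]] ptD(2)[OF Bang_pt[OF Unit_Obj]]
   Ide_Comp[OF A.mzero_Hom] by (simp add: unit_cmon_def)
 ultimately show ?thesis using A.mzero_pt u by (simp add: mhom_def)
qed

context
 fixes A :: "('o, 'm) cmon"
 assumes A: "tcm C A"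
begin

interpretation A: crc_monoid C A by unfold_locales (rule A)
interpretation D: cartesian_restriction_category "Faa C" by (rule Faa_crc)

lemma delta_cmon_simps:
 "mcar (dmon A) = (A, mcar A)"
 "mplus (dmon A) = semilin (prod_cmon C A A, Prod C (mcar A) (mcar A)) (A, mcar A) (mplus A) (mplus A)"
 "mzero (dmon A) = semilin (unit_cmon C, Unit C) (A, mcar A) (mzero A) (mzero A)"
proof -
 show "mcar (dmon A) = (A, mcar A)" by (simp add: delta_cmon_def Let_def)
 show "mplus (dmon A) = semilin (prod_cmon C A A, Prod C (mcar A) (mcar A)) (A, mcar A) (mplus A) (mplus A)"
  using faa_linear_semilin[OF prod_cmon[OF A A] A A.plus_Hom mhom_mplus[OF A] A.plus_pt]
  by (simp add: delta_cmon_def Let_def faa_Prod_def)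
 show "mzero (dmon A) = semilin (unit_cmon C, Unit C) (A, mcar A) (mzero A) (mzero A)"
  using faa_linear_semilin[OF unit_cmon A A.mzero_Hom mhom_mzero[OF A] A.mzero_pt]
  by (simp add: delta_cmon_def Let_def faa_Unit_def unit_cmon_def)
qed

lemma delta_cmon_Homs:
 "mplus (dmon A) \<in> Hom FC (faa_Prod C (A, mcar A) (A, mcar A)) (A, mcar A)"
 "mzero (dmon A) \<in> Hom FC (faa_Unit C) (A, mcar A)"
 using semilin_Hom[OF prod_cmon[OF A A] A A.plus_Hom mhom_mplus[OF A]] semilin_Hom[OF unit_cmon A A.mzero_Hom mhom_mzero[OF A]]
 by (simp_all add: delta_cmon_simps faa_Prod_def faa_Unit_def)

text \<open>The addition of \<delta>(A) has \<open>mplus A\<close> both as base map and as linear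
  part, so base points and coefficients alike are added in \<open>A\<close>. Laws of \<delta>(A)
  therefore reduce to those of \<open>A\<close> after evaluation.\<close>

lemma ev_delta_madd:
 assumes a: "a \<in> pt FC S e (A, mcar A)" and b: "b \<in> pt FC S e (A, mcar A)" and w: "cube C Z d S w" and J: "finite J"
 shows "ev C (madd FC (dmon A) a b) w J = madd C A (ev C a w J) (ev C b w J)"
proof -
 note P = D.Pairing_pt(1)[OF a b, simplified]
 let ?c = "ev C (faa_Pairing C a b) w"
 have c: "cube C Z (edom w e) (faa_Prod C (A, mcar A) (A, mcar A)) ?c" by (rule Faa_pt_0(2)[OF P w])
 have "ev C (madd FC (dmon A) a b) w J = ev C (mplus (dmon A)) ?c J"
  using Faa_ev_Comp[OF D.ptH[OF P] delta_cmon_Homs(1) w J] by (simp add: madd_def)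
 also have "... = ?c J \<cdot> mplus A"
 proof (cases "J = {}")
  case True
  then show ?thesis by (simp add: ev_at_empty[of "semilin _ _ _ _"] delta_cmon_simps semilin_0)
 next
  case False
  have c': "cube C Z (edom w e) (prod_cmon C A A, Prod C (mcar A) (mcar A)) ?c" using c by (simp add: faa_Prod_def)
  show ?thesis unfolding delta_cmon_simps
   by (rule ev_semilin_total[OF prod_cmon[OF A A] A A.plus_Hom mhom_mplus[OF A] A.plus_pt c' J False])
 qed
 also have "... = madd C A (ev C a w J) (ev C b w J)"
  using ev_Pairing[OF a b w J] by (simp add: madd_def)
 finally show ?thesis .
qed

lemma ev_delta_zero:
 assumes S: "S \<in> FObj" and w: "cube C Z d S w" and J: "finite J"
 shows "ev C (zero_map FC (dmon A) S) w J = d \<cdot> zmap A Z"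
proof -
 have Bp: "faa_Bang C S \<in> pt FC S (faa_Ide C S) (faa_Unit C)" using D.Bang_pt[of S] S by simp
 let ?c = "ev C (faa_Bang C S) w"
 have "Rst C (w {} \<cdot> faa_seq (faa_Ide C S) 0) = d"
  using ptD(2)[OF cubeD(1)[OF w]] ev_faa_Ide[OF S w, of "{}"] by (simp add: ev_def)
 then have c: "cube C Z d (unit_cmon C, Unit C) ?c" using Faa_pt_0(2)[OF Bp w] by (simp add: faa_Unit_def)
 have cJ: "?c J \<in> pt C Z d (Unit C)" using cubeD[OF c] by (cases "J = {}") (auto simp: unit_cmon_def)
 note Z = Hom_Obj(1)[OF ptH[OF cJ]]
 have "ev C (zero_map FC (dmon A) S) w J = ev C (mzero (dmon A)) ?c J"
  using Faa_ev_Comp[OF D.ptH[OF Bp] delta_cmon_Homs(2) w J] by (simp add: zero_map_def)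
 also have "... = ?c J \<cdot> mzero A"
 proof (cases "J = {}")
  case True
  then show ?thesis by (simp add: ev_at_empty[of "semilin _ _ _ _"] delta_cmon_simps semilin_0)
 next
  case False
  show ?thesis unfolding delta_cmon_simps
   by (rule ev_semilin_total[OF unit_cmon A A.mzero_Hom mhom_mzero[OF A] A.mzero_pt c J False])
 qed
 also have "?c J = d \<cdot> Bang C Z" using Unit_restriction[OF ptH[OF cJ]] ptD(2)[OF cJ] by simp
 also have "d \<cdot> Bang C Z \<cdot> mzero A = d \<cdot> zmap A Z"
  unfolding zero_map_def by (rule Comp_assoc[OF pt_idem(1)[OF cJ] Bang_Hom[OF Z] A.mzero_Hom])
 finally show ?thesis .
qed

lemma AA_Obj: "(A, mcar A) \<in> FObj"
 using A A.car_Obj by (simp add: faa_Obj_def)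

text \<open>Each law holds after evaluation at every cube, hence in \<open>Faa(C)\<close> by
  \<open>faa_eqI\<close>.\<close>

lemma delta_cmon: "tcm FC (dmon A)"
proof (rule D.total_comm_monoidI)
 let ?A = "dmon A"
 show "mcar ?A \<in> Obj FC" using AA_Obj by (simp add: delta_cmon_simps)
 have tot: "semilin (E, U) (A, mcar A) f f \<in> pt FC (E, U) (faa_Ide C (E, U)) (A, mcar A)"
  if E: "tcm C E" and f: "f \<in> mpt C U (Ide C U) A" and g: "mhom E A f" for E U f
 proof (rule D.ptI)
  show H: "semilin (E, U) (A, mcar A) f f \<in> Hom FC (E, U) (A, mcar A)" by (rule semilin_Hom[OF E A ptH[OF f] g])
  have EU: "(E, U) \<in> FObj" using E Hom_Obj(1)[OF ptH[OF f]] by (simp add: faa_Obj_def)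
  have "faa_Rst C (semilin (E, U) (A, mcar A) f f) = faa_Rst C (faa_Ide C (E, U))"
  proof (rule Faa_Rst_eq[OF H Faa_Ide_Hom[OF EU]])
   have "faa_seq (faa_Ide C (E, U)) 0 = Ide C U" by (simp add: faa_Ide_def faa_linear_def)
   then show "Rst C (faa_seq (semilin (E, U) (A, mcar A) f f) 0) = Rst C (faa_seq (faa_Ide C (E, U)) 0)"
    using ptD(2)[OF f] ptD(2)[OF Ide_pt[OF Hom_Obj(1)[OF ptH[OF f]]]] by (simp add: semilin_0)
  qed
  then show "Rst FC (semilin (E, U) (A, mcar A) f f) = faa_Ide C (E, U)"
   using D.Rst_Ide[of "(E, U)"] EU by simp
 qed
 show "mplus ?A \<in> pt FC (Prod FC (mcar ?A) (mcar ?A)) (Ide FC (Prod FC (mcar ?A) (mcar ?A))) (mcar ?A)"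
  using tot[OF prod_cmon[OF A A] A.plus_pt mhom_mplus[OF A]] by (simp add: delta_cmon_simps faa_Prod_def)
 show "mzero ?A \<in> pt FC (Unit FC) (Ide FC (Unit FC)) (mcar ?A)"
  using tot[OF unit_cmon A.mzero_pt mhom_mzero[OF A]] by (simp add: delta_cmon_simps faa_Unit_def)
 have madd: "madd FC ?A a b \<in> pt FC S (Ide FC S) (A, mcar A)"
  if "a \<in> pt FC S (Ide FC S) (A, mcar A)" "b \<in> pt FC S (Ide FC S) (A, mcar A)" for S a b
  unfolding madd_def
  by (rule D.pt_Comp[OF D.Pairing_pt(1)[OF that]])
   (use tot[OF prod_cmon[OF A A] A.plus_pt mhom_mplus[OF A]] in "simp add: delta_cmon_simps faa_Prod_def")
 have evH: "ev C a w J \<in> Hom C Z (mcar A)" if "a \<in> pt FC S e (A, mcar A)" "cube C Z d S w" for a S e Z d and w :: "nat set => 'm" and J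
  using ptH[OF cubeD(1)[OF Faa_pt_0(2)[OF that]]] ptH[OF cubeD(2)[OF Faa_pt_0(2)[OF that], of J]] by (cases "J = {}") auto
 show "madd FC ?A (madd FC ?A a b) c = madd FC ?A a (madd FC ?A b c)"
  if "a \<in> pt FC S (Ide FC S) (mcar ?A)" "b \<in> pt FC S (Ide FC S) (mcar ?A)" "c \<in> pt FC S (Ide FC S) (mcar ?A)" for S a b c
 proof -
  note abc = that[unfolded delta_cmon_simps]
  note ab = madd[OF abc(1,2)] and bc = madd[OF abc(2,3)]
  show ?thesis
   by (rule faa_eqI[OF D.ptH[OF madd[OF ab abc(3)]] D.ptH[OF madd[OF abc(1) bc]]])
    (simp add: ev_delta_madd[OF ab abc(3)] ev_delta_madd[OF abc(1) bc] ev_delta_madd[OF abc(1,2)] ev_delta_madd[OF abc(2,3)]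
     A.add_assoc[OF evH[OF abc(1)] evH[OF abc(2)] evH[OF abc(3)]])
 qed
 show "madd FC ?A a b = madd FC ?A b a"
  if "a \<in> pt FC S (Ide FC S) (mcar ?A)" "b \<in> pt FC S (Ide FC S) (mcar ?A)" for S a b
 proof -
  note ab = that[unfolded delta_cmon_simps]
  show ?thesis
   by (rule faa_eqI[OF D.ptH[OF madd[OF ab]] D.ptH[OF madd[OF ab(2,1)]]])
    (simp add: ev_delta_madd[OF ab] ev_delta_madd[OF ab(2,1)] A.add_comm[OF evH[OF ab(1)] evH[OF ab(2)]])
 qed
 show "madd FC ?A a (zero_map FC ?A S) = a" if "a \<in> pt FC S (Ide FC S) (mcar ?A)" for S a
 proof -
  note a = that[unfolded delta_cmon_simps]
  have S: "S \<in> FObj" using Faa_Objs(1)[OF D.ptH[OF a]] .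
  have z: "zero_map FC ?A S \<in> pt FC S (Ide FC S) (A, mcar A)"
   unfolding zero_map_def
   by (rule D.pt_Comp[OF D.Bang_pt])
    (use S tot[OF unit_cmon A.mzero_pt mhom_mzero[OF A]] in "simp_all add: delta_cmon_simps faa_Unit_def")
  show ?thesis
  proof (rule faa_eqI[OF D.ptH[OF madd[OF a z]] D.ptH[OF a]])
   fix Z e and w :: "nat set => 'm" and J :: "nat set" assume w: "cube C Z e S w" and J: "finite J"
   have "Rst C (w {} \<cdot> faa_seq (Ide FC S) 0) = e"
    using ptD(2)[OF cubeD(1)[OF w]] ev_faa_Ide[OF S w, of "{}"] by (simp add: ev_def)
   then have c: "cube C Z e (A, mcar A) (ev C a w)" using Faa_pt_0(2)[OF a w] by simp
   have "ev C a w J \<in> mpt C Z e A" using cubeD[OF c] by (cases "J = {}") auto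
   then show "ev C (madd FC ?A a (zero_map FC ?A S)) w J = ev C a w J"
    using ev_delta_madd[OF a z w J] ev_delta_zero[OF S w J] A.add_zero_pt by simp
  qed
 qed
qed

end

end

section \<open>The components of the comultiplication form an arrow\<close>

context cartesian_restriction_category
begin

lemma proj_Faa_0: "faa_seq (proj FC (A, A0) n (A', X) i) 0 = proj C A0 n X i"
proof (induction n arbitrary: i)
 case 0
 show ?case by (simp add: faa_Ide_def faa_linear_def)
next
 case (Suc n)
 have s: "powprod FC (A, A0) n (A', X) = (fst (powprod FC (A, A0) n (A', X)), powp A0 n X)"
  using powprod_Faa(1)[of C A A0 n A' X] by (metis prod.collapse)
 show ?case
 proof (cases i)
  case 0
  show ?thesis unfolding 0 proj.simps Faa_simps by (subst s) (simp add: faa_Pi0_def faa_linear_def)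
 next
  case (Suc k)
  show ?thesis unfolding Suc proj.simps Faa_simps Faa_Comp_0 Suc.IH by (subst s) (simp add: faa_Pi1_def faa_linear_def)
 qed
qed

lemma ev_delta_zero_e:
 assumes A: "tcm C A" and e: "e \<in> pt FC S e S" and w: "cube C Z d S w" and J: "finite J"
 shows "ev C (FComp e (zero_map FC (dmon A) S)) w J = edom w e \<cdot> zmap A Z"
proof -
 interpret A: crc_monoid C A by unfold_locales (rule A)
 interpret D: cartesian_restriction_category "Faa C" by (rule Faa_crc)
 interpret DA: crc_monoid "Faa C" "dmon A" by unfold_locales (rule delta_cmon[OF A])
 have eH: "e \<in> Hom FC S S" using e by (simp add: pt_def)
 have S: "S \<in> FObj" by (rule Faa_Objs(1)[OF eH])
 have zH: "zero_map FC (dmon A) S \<in> Hom FC S (A, mcar A)"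
  using D.ptH[OF DA.zero_pt[of S]] S by (simp add: delta_cmon_simps[OF A])
 note z0 = cubeD(1)[OF w] and x = cube_dom[OF eH w]
 have Z: "Z \<in> Obj C" using Hom_Obj(1)[OF x] .
 have "edom w e \<cdot> d = edom w e"
  using Rst_Comp_le[OF ptH[OF z0] Faa_0[OF eH]] R2[OF x ptH[OF z0]] ptD(2)[OF z0] by simp
 then show ?thesis
  using ev_restrict[OF e zH w J] ev_delta_zero[OF A S w J] Comp_assoc[OF Rst_Hom[OF x] pt_idem(1)[OF z0] ptH[OF A.zero_pt[OF Z]]] by simp
qed

end

lemma delta_arr_simps: "faa_src (delta_arr C F) = delta_obj C (faa_src F)" "faa_tgt (delta_arr C F) = delta_obj C (faa_tgt F)"
 "faa_seq (delta_arr C F) 0 = F" "k \<ge> 1 ==> faa_seq (delta_arr C F) k = delta_cmp C F k"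
 by (simp_all add: delta_arr_def delta_cmp_def Let_def)

locale faa_delta = faa_arrow C F A X B Y
 for C :: "('o, 'm) crcat" (structure) and F A X B Y
begin

sublocale D: cartesian_restriction_category "Faa C" by (rule Faa_crc)
sublocale DA: crc_monoid "Faa C" "dmon A" by unfold_locales (rule delta_cmon[OF objs(1)])
sublocale DB: crc_monoid "Faa C" "dmon B" by unfold_locales (rule delta_cmon[OF objs(3)])

lemma cmp: "k \<ge> 1 ==> faa_cmp C F A X B Y k"
 by unfold_locales

lemmas cmp_Hom = faa_cmp.cmp_Hom[OF cmp]

lemma AX_Obj: "(A, mcar A) \<in> Obj FC" "(A, X) \<in> Obj FC" "(B, mcar B) \<in> Obj FC" "(B, Y) \<in> Obj FC"
 using objs A.car_Obj B.car_Obj by (auto simp: faa_Obj_def)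

lemma ev_pt:
 assumes "g \<in> pt FC S e (E, E0)" "cube C Z d S w"
 shows "ev C g w {} \<in> pt C Z (edom w e) E0"
  "J \<noteq> {} ==> ev C g w J \<in> mpt C Z (edom w e) E"
 using cubeD[OF Faa_pt_0(2)[OF assms]] by auto

lemma ev_pt':
 assumes "g \<in> pt FC S e (E, mcar E)" "cube C Z d S w"
 shows "ev C g w J \<in> mpt C Z (edom w e) E"
 using ev_pt[OF assms] by (cases "J = {}") auto

text \<open>The tuple evaluated at \<open>w\<close> is a cube whose coordinates, by
  \<open>ev_proj_Faa\<close>, are the evaluations of its entries; \<open>ev_cmp\<close> then
  applies. Arguments of the component become left directions of a cube for \<open>F\<close>, the
  directions of \<open>w\<close> stay on the right.\<close>

lemma ev_tup_cmp:
 assumes zs: "zs \<noteq> []" "set zs \<subseteq> pt FC S e (A, mcar A)" and x: "x \<in> pt FC S e (A, X)"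
  and w: "cube C Z d S w" and J: "finite J"
 shows "ev C (FComp (D.tup zs x) (delta_cmp C F (length zs))) w J =
  ev C F (lin C A Z (edom w e) {..<length zs} (%i. ev C (zs ! i) w) (ev C x w)) (Inl ` {..<length zs} \<union> Inr ` J)"
proof -
 let ?n = "length zs" and ?e = "edom w e"
 have n: "?n \<ge> 1" using zs(1) by (cases zs) auto
 interpret N: faa_cmp C F A X B Y ?n by (rule cmp[OF n])
 note t = D.tup_pt[OF zs(2) x]
 let ?c = "ev C (D.tup zs x) w"
 have c: "cube C Z ?e N.VW ?c" by (rule Faa_pt_0(2)[OF t(1) w])
 have pr: "?c K \<cdot> proj C (mcar A) ?n (if K = {} then X else mcar A) i = (if i = ?n then ev C x w K else ev C (zs ! i) w K)"
  if i: "i \<le> ?n" and K: "finite K" for i K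
 proof -
  note pp = D.proj_pt[OF AX_Obj(1,2)]
  have pH: "proj FC (A, mcar A) ?n (A, X) i \<in> Hom FC N.VW (if i < ?n then (A, mcar A) else (A, X))"
   using D.ptH[OF pp(1)[of i ?n]] D.ptH[OF pp(2)[of ?n]] i by (cases "i = ?n") auto
  have "?c K \<cdot> proj C (mcar A) ?n (if K = {} then X else mcar A) i = ev C (proj FC (A, mcar A) ?n (A, X) i) ?c K"
   using ev_proj_Faa[OF objs(1,2) K c i] by simp
  also have "... = ev C (FComp (D.tup zs x) (proj FC (A, mcar A) ?n (A, X) i)) w K"
   by (rule Faa_ev_Comp[OF D.ptH[OF t(1)] pH w K, symmetric])
  also have "FComp (D.tup zs x) (proj FC (A, mcar A) ?n (A, X) i) = (if i = ?n then x else zs ! i)"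
   using t(2)[of i] t(3) i by (cases "i = ?n") auto
  finally show ?thesis by simp
 qed
 have s: "ev C (zs ! i) w K \<in> pt C Z ?e (mcar A)" if "i < ?n" for i K
  by (rule ev_pt'[OF _ w]) (use zs(2) that in auto)
 have cx: "cube C Z ?e (A, X) (ev C x w)" by (rule Faa_pt_0(2)[OF x w])
 have "ev C (FComp (D.tup zs x) (delta_cmp C F ?n)) w J = ev C (delta_cmp C F ?n) ?c J"
  by (rule Faa_ev_Comp[OF D.ptH[OF t(1)] cmp_Hom[OF n] w J])
 also have "... = ev C F (lin C A Z ?e {..<?n} (%i J. ?c J \<cdot> (if J = {} then N.q i else N.p i)) (%J. ?c J \<cdot> (if J = {} then N.q ?n else N.p ?n)))
  (Inl ` {..<?n} \<union> Inr ` J)" by (rule N.ev_cmp[OF c J])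
 also have "... = ev C F (lin C A Z ?e {..<?n} (%i. ev C (zs ! i) w) (ev C x w)) (Inl ` {..<?n} \<union> Inr ` J)"
 proof (rule ev_lin_cong[OF _ cx])
  show "?c K \<cdot> (if K = {} then N.q i else N.p i) = ev C (zs ! i) w K" if "i \<in> {..<?n}" "finite K" for i K
   using pr[of i K] that by (cases "K = {}") auto
  show "?c K \<cdot> (if K = {} then N.q ?n else N.p ?n) = ev C x w K" if "finite K" for K
   using pr[of ?n K] that by (cases "K = {}") auto
 qed (use s in auto)
 finally show ?thesis .
qed

text \<open>Restrictions in \<open>Faa(C)\<close> depend on the base domain only, so the condition
  reduces to the one for \<open>f k\<close>.\<close>

lemma cmp_Rst:
 assumes k: "k \<ge> 1"
 shows "faa_Rst C (delta_cmp C F k) = faa_Rst C (FComp (proj FC (A, mcar A) k (A, X) k) F)"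
proof (rule Faa_Rst_eq[OF cmp_Hom[OF k]])
 interpret N: faa_cmp C F A X B Y k by (rule cmp[OF k])
 show "FComp (proj FC (A, mcar A) k (A, X) k) F \<in> Hom FC N.VW (B, Y)"
  by (rule Faa_Comp_Hom[OF D.ptH[OF D.proj_pt(2)[OF AX_Obj(1,2)]] arr])
 show "Rst C (faa_seq (delta_cmp C F k) 0) = Rst C (faa_seq (FComp (proj FC (A, mcar A) k (A, X) k) F) 0)"
  using fn(2)[OF k] by (simp add: Faa_Comp_0 proj_Faa_0)
qed

lemma tup_cmp_pt:
 assumes zs: "zs \<noteq> []" "set zs \<subseteq> pt FC S e (A, mcar A)" and x: "x \<in> pt FC S e (A, X)"
 shows "FComp (D.tup zs x) (delta_cmp C F (length zs)) \<in> pt FC S (faa_Rst C (FComp x F)) (B, mcar B)"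
proof -
 let ?n = "length zs" and ?p = "proj FC (A, mcar A) (length zs) (A, X) (length zs)"
 have n: "?n \<ge> 1" using zs(1) by (cases zs) auto
 note t = D.tup_pt[OF zs(2) x]
 note tH = D.ptH[OF t(1)] and cH = cmp_Hom[OF n] and pH = D.ptH[OF D.proj_pt(2)[OF AX_Obj(1,2), of ?n]]
 have "Rst FC (Comp FC (D.tup zs x) (delta_cmp C F ?n)) = Rst FC (Comp FC (D.tup zs x) (Rst FC (delta_cmp C F ?n)))"
  by (rule D.Rst_Comp[OF tH cH, symmetric])
 also have "... = Rst FC (Comp FC (D.tup zs x) (Comp FC ?p F))"
  using D.Rst_Comp[OF tH D.Comp_Hom[OF pH arr]] cmp_Rst[OF n] by simp
 also have "... = Rst FC (Comp FC x F)" using D.Comp_assoc[OF tH pH arr] t(3) by simp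
 finally show "FComp (D.tup zs x) (delta_cmp C F ?n) \<in> pt FC S (faa_Rst C (FComp x F)) (B, mcar B)"
  using D.Comp_Hom[OF tH cH] by (simp add: pt_def)
qed

lemma tup_cmp_perm:
 assumes zs: "zs \<noteq> []" "set zs \<subseteq> pt FC S e (A, mcar A)" and x: "x \<in> pt FC S e (A, X)" and m: "mset zs' = mset zs"
 shows "FComp (D.tup zs' x) (delta_cmp C F (length zs)) = FComp (D.tup zs x) (delta_cmp C F (length zs))"
proof -
 obtain \<sigma> where \<sigma>: "\<sigma> permutes {..<length zs}" "permute_list \<sigma> zs = zs'"
  using mset_eq_permutation[OF m] by blast
 have l: "length zs' = length zs" and s: "set zs' = set zs" using m by (metis size_mset, metis set_mset_mset)
 have zs': "zs' \<noteq> []" "set zs' \<subseteq> pt FC S e (A, mcar A)" using zs s by auto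
 let ?n = "length zs" and ?R = "{..<length zs}"
 have im: "\<sigma> ` ?R = ?R" and inj: "inj_on \<sigma> ?R" using permutes_image[OF \<sigma>(1)] permutes_inj_on[OF \<sigma>(1)] by auto
 have nth: "zs' ! j = zs ! \<sigma> j" if "j < ?n" for j using \<sigma> that by (metis permute_list_nth)
 show ?thesis
 proof (rule faa_eqI[OF D.ptH[OF tup_cmp_pt[OF zs' x, unfolded l]] D.ptH[OF tup_cmp_pt[OF zs x]]])
  fix Z d and w :: "nat set => 'm" and J :: "nat set" assume w: "cube C Z d S w" and J: "finite J"
  let ?e = "edom w e"
  have pt: "ev C (zs ! i) w K \<in> pt C Z ?e (mcar A)" if "i < ?n" for i K
   by (rule ev_pt'[OF _ w]) (use zs(2) that in auto)
  have cx: "cube C Z ?e (A, X) (ev C x w)" by (rule Faa_pt_0(2)[OF x w])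
  have \<sigma>n: "\<sigma> i < ?n" if "i < ?n" for i using im that by blast
  have "ev C (FComp (D.tup zs x) (delta_cmp C F ?n)) w J =
    ev C F (lin C A Z ?e (\<sigma> ` ?R) (%i. ev C (zs ! i) w) (ev C x w)) (Inl ` \<sigma> ` ?R \<union> Inr ` (%j. j) ` J)"
   unfolding im using ev_tup_cmp[OF zs x w J] by simp
  also have "... = ev C F (lin C A Z ?e ?R (%i J. ev C (zs ! \<sigma> i) w ((%j. j) ` J)) (%J. ev C x w ((%j. j) ` J))) (Inl ` ?R \<union> Inr ` J)"
   by (rule ev_lin_reindex[OF _ cx inj]) (use pt im in auto)
  also have "... = ev C F (lin C A Z ?e ?R (%i. ev C (zs' ! i) w) (ev C x w)) (Inl ` ?R \<union> Inr ` J)"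
   by (rule ev_lin_cong[OF _ cx]) (use pt nth \<sigma>n in auto)
  also have "... = ev C (FComp (D.tup zs' x) (delta_cmp C F ?n)) w J"
   using ev_tup_cmp[OF zs' x w J] l by simp
  finally show "ev C (FComp (D.tup zs' x) (delta_cmp C F ?n)) w J = ev C (FComp (D.tup zs x) (delta_cmp C F ?n)) w J" by simp
 qed
qed

lemma lin_slot:
 assumes "Inl 0 \<in> T"
 shows "lin C A Z e {..<Suc m} s c T = (if Inl -` T = {0} then s 0 (Inr -` T) else e \<cdot> zmap A Z)"
proof -
 have "Inl -` T \<noteq> {}" using assms by auto
 moreover have "k = 0" if "Inl -` T = {k}" for k
 proof -
  have "0 \<in> Inl -` T" using assms by simp
  then show ?thesis unfolding that by simp
 qed
 ultimately show ?thesis unfolding lin_def by auto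
qed

lemma lin_nonslot:
 assumes T: "Inl 0 \<notin> T" and s: "!!k. s (Suc k) = s' (Suc k)"
 shows "lin C A Z e K s c T = lin C A Z e K s' c T"
proof -
 have "s k = s' k" if "Inl -` T = {k}" for k
 proof (cases k)
  case 0
  then have "0 \<in> Inl -` T" using that by simp
  then show ?thesis using T by simp
 qed (simp add: s)
 then show ?thesis unfolding lin_def by auto
qed

text \<open>The comparison is made after evaluation at \<open>w\<close>. The first argument is then
  the left direction \<open>Inl 0\<close>, and addition in \<delta>(A) has become addition of
  coefficients, so additivity of \<open>F\<close> in one direction applies.\<close>

lemma tup_cmp_add:
 assumes zs: "set zs \<subseteq> pt FC S e (A, mcar A)" and x: "x \<in> pt FC S e (A, X)"
  and ab: "a \<in> pt FC S e (A, mcar A)" "b \<in> pt FC S e (A, mcar A)"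
 shows "FComp (D.tup (madd FC (dmon A) a b # zs) x) (delta_cmp C F (Suc (length zs))) =
  madd FC (dmon B) (FComp (D.tup (a # zs) x) (delta_cmp C F (Suc (length zs))))
   (FComp (D.tup (b # zs) x) (delta_cmp C F (Suc (length zs))))"
proof -
 let ?m = "Suc (length zs)"
 let ?T = "%c. FComp (D.tup (c # zs) x) (delta_cmp C F ?m)"
 let ?s = "madd FC (dmon A) a b"
 have AA: "mcar (dmon A) = (A, mcar A)" "mcar (dmon B) = (B, mcar B)"
  using delta_cmon_simps(1) objs by auto
 have s: "?s \<in> pt FC S e (A, mcar A)" using DA.add_pt[of a S e b] ab AA by simp
 have T: "?T c \<in> pt FC S (faa_Rst C (FComp x F)) (B, mcar B)" if "c \<in> pt FC S e (A, mcar A)" for c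
  using tup_cmp_pt[OF _ _ x, of "c # zs"] zs that by (simp del: D.tup_simps)
 have TB: "madd FC (dmon B) (?T a) (?T b) \<in> pt FC S (faa_Rst C (FComp x F)) (B, mcar B)"
  using DB.add_pt[of "?T a" S _ "?T b"] T[OF ab(1)] T[OF ab(2)] AA by simp
 show ?thesis
 proof (rule faa_eqI[OF D.ptH[OF T[OF s]] D.ptH[OF TB]])
  fix Z d and w :: "nat set => 'm" and J :: "nat set" assume w: "cube C Z d S w" and J: "finite J"
  let ?e = "edom w e"
  let ?L = "%c. lin C A Z ?e {..<?m} (%i. ev C ((c # zs) ! i) w) (ev C x w)"
  have cx: "cube C Z ?e (A, X) (ev C x w)" by (rule Faa_pt_0(2)[OF x w])
  have L: "cube C Z ?e (A, X) (?L c)" if c: "c \<in> pt FC S e (A, mcar A)" for c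
  proof (rule lin_cube[OF _ cx])
   show "ev C ((c # zs) ! k) w K \<in> pt C Z ?e (mcar A)" if "k \<in> {..<?m}" for k K
    by (rule ev_pt'[OF _ w]) (use c zs that in "auto simp: nth_Cons subset_iff split: nat.splits")
  qed
  have evT: "ev C (?T c) w J = ev C F (?L c) (Inl ` {..<?m} \<union> Inr ` J)" if "c \<in> pt FC S e (A, mcar A)" for c
   using ev_tup_cmp[OF _ _ x w J, of "c # zs"] zs that by (simp del: D.tup_simps)
  have zz: "madd C A (?e \<cdot> zmap A Z) (?e \<cdot> zmap A Z) = ?e \<cdot> zmap A Z"
   by (rule A.add_zero_pt[OF A.zero_e_pt[OF pt_idem(5)[OF cube_base(1)[OF cx]]]])
  have "ev C (?T ?s) w J = madd C B (ev C (?T a) w J) (ev C (?T b) w J)"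
   unfolding evT[OF s] evT[OF ab(1)] evT[OF ab(2)]
  proof (rule ev_slot_add[OF L[OF s] L[OF ab(1)] L[OF ab(2)], where j = "Inl 0"])
   show "?L a {} = ?L ?s {}" "?L b {} = ?L ?s {}" by simp_all
   show "Inl 0 \<in> Inl ` {..<?m} \<union> Inr ` J" by simp
  next
   fix T :: "(nat + nat) set" assume T: "Inl 0 \<notin> T"
   show "?L a T = ?L ?s T \<and> ?L b T = ?L ?s T"
    by (intro conjI lin_nonslot[OF T]) simp_all
  next
   fix T :: "(nat + nat) set" assume sub: "T \<subseteq> Inl ` {..<?m} \<union> Inr ` J" and T: "Inl 0 \<in> T"
   have "Inr -` T \<subseteq> J" using sub by auto
   then have "ev C ?s w (Inr -` T) = madd C A (ev C a w (Inr -` T)) (ev C b w (Inr -` T))"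
    using ev_delta_madd[OF objs(1) ab w] finite_subset[OF _ J] by blast
   then show "?L ?s T = madd C A (?L a T) (?L b T)" unfolding lin_slot[OF T] using zz by simp
  qed
  then show "ev C (?T ?s) w J = ev C (madd FC (dmon B) (?T a) (?T b)) w J"
   using ev_delta_madd[OF objs(3) T[OF ab(1)] T[OF ab(2)] w J] by simp
 qed
qed

lemma tup_cmp_zero:
 assumes zs: "set zs \<subseteq> pt FC S e (A, mcar A)" and x: "x \<in> pt FC S e (A, X)"
 shows "FComp (D.tup (FComp e (zero_map FC (dmon A) S) # zs) x) (delta_cmp C F (Suc (length zs))) =
  FComp (faa_Rst C (FComp x F)) (zero_map FC (dmon B) S)"
proof -
 let ?m = "Suc (length zs)"
 let ?z = "FComp e (zero_map FC (dmon A) S)" and ?xF = "faa_Rst C (FComp x F)"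
 have AA: "mcar (dmon A) = (A, mcar A)" "mcar (dmon B) = (B, mcar B)"
  using delta_cmon_simps(1) objs by auto
 note e = D.pt_idem(5)[OF x]
 have z: "?z \<in> pt FC S e (A, mcar A)" using DA.zero_e_pt[OF e] AA by simp
 have T: "FComp (D.tup (?z # zs) x) (delta_cmp C F ?m) \<in> pt FC S ?xF (B, mcar B)"
  using tup_cmp_pt[OF _ _ x, of "?z # zs"] zs z by (simp del: D.tup_simps)
 have r: "?xF \<in> pt FC S ?xF S" by (rule D.pt_idem(5)[OF T])
 have zB: "FComp ?xF (zero_map FC (dmon B) S) \<in> pt FC S ?xF (B, mcar B)"
  using DB.zero_e_pt[OF r] AA by simp
 show ?thesis
 proof (rule faa_eqI[OF D.ptH[OF T] D.ptH[OF zB]])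
  fix Z d and w :: "nat set => 'm" and J :: "nat set" assume w: "cube C Z d S w" and J: "finite J"
  let ?e = "edom w e"
  let ?L = "lin C A Z ?e {..<?m} (%i. ev C ((?z # zs) ! i) w) (ev C x w)"
  have cx: "cube C Z ?e (A, X) (ev C x w)" by (rule Faa_pt_0(2)[OF x w])
  have L: "cube C Z ?e (A, X) ?L"
  proof (rule lin_cube[OF _ cx])
   show "ev C ((?z # zs) ! k) w K \<in> pt C Z ?e (mcar A)" if "k \<in> {..<?m}" for k K
    by (rule ev_pt'[OF _ w]) (use z zs that in "auto simp: nth_Cons subset_iff split: nat.splits")
  qed
  have xH: "x \<in> Hom FC S (A, X)" by (rule D.ptH[OF x])
  have "ev C (FComp (D.tup (?z # zs) x) (delta_cmp C F ?m)) w J = ev C F ?L (Inl ` {..<?m} \<union> Inr ` J)"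
   using ev_tup_cmp[OF _ _ x w J, of "?z # zs"] zs z by (simp del: D.tup_simps)
  also have "... = Rst C (?L {} \<cdot> f 0) \<cdot> zmap B Z"
  proof (rule ev_slot_zero[OF L, where j = "Inl 0"])
   fix T :: "(nat + nat) set" assume sub: "T \<subseteq> Inl ` {..<?m} \<union> Inr ` J" and T: "Inl 0 \<in> T"
   have "Inr -` T \<subseteq> J" using sub by auto
   then have "ev C ?z w (Inr -` T) = ?e \<cdot> zmap A Z"
    using ev_delta_zero_e[OF objs(1) e w] finite_subset[OF _ J] by blast
   then show "?L T = ?e \<cdot> zmap A Z" unfolding lin_slot[OF T] by simp
  qed simp
  also have "Rst C (?L {} \<cdot> f 0) = edom w ?xF"
  proof -
   note z0 = ptH[OF cubeD(1)[OF w]] and x0 = Faa_0[OF xH, simplified]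
   have "edom w ?xF = Rst C (w {} \<cdot> (faa_seq x 0 \<cdot> f 0))"
    using Rst_Comp[OF z0 Comp_Hom[OF x0 f0]] by (simp add: Faa_Rst_0 Faa_Comp_0)
   then show ?thesis using Comp_assoc[OF z0 x0 f0] by (simp add: ev_at_empty)
  qed
  also have "... \<cdot> zmap B Z = ev C (FComp ?xF (zero_map FC (dmon B) S)) w J"
   by (rule ev_delta_zero_e[OF objs(3) r w J, symmetric])
  finally show "ev C (FComp (D.tup (?z # zs) x) (delta_cmp C F ?m)) w J =
    ev C (FComp ?xF (zero_map FC (dmon B) S)) w J" .
 qed
qed

lemma delta_Hom: "darr F \<in> Hom (Faa FC) (dmon A, A, X) (dmon B, B, Y)"
proof -
 let ?d = "faa_seq (darr F)"
 have AA: "mcar (dmon A) = (A, mcar A)" "mcar (dmon B) = (B, mcar B)"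
  using delta_cmon_simps(1) objs by auto
 have d: "?d (length zs) = delta_cmp C F (length zs)" if "zs \<noteq> []" for zs :: "('o, 'm) faa_arr list"
  using delta_arr_simps(4)[of "length zs" C F] that by (cases zs) auto
 have ds: "?d (Suc k) = delta_cmp C F (Suc k)" for k by (rule delta_arr_simps(4)) simp
 have "FaaArr (dmon A, A, X) (dmon B, B, Y) ?d \<in> faa_Arr FC"
 proof (rule D.faa_ArrI, unfold AA)
  show "tcm FC (dmon A)" "tcm FC (dmon B)" "(A, X) \<in> Obj FC"
   by (rule DA.monoid DB.monoid AX_Obj)+
  show "?d 0 \<in> Hom FC (A, X) (B, Y)" using arr by (simp add: delta_arr_simps)
  show "?d k \<in> Hom FC (powprod FC (A, mcar A) k (A, X)) (B, mcar B)"
   "Rst FC (?d k) = Rst FC (Comp FC (proj FC (A, mcar A) k (A, X) k) (?d 0))" if "k \<ge> 1" for k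
   using cmp_Hom[OF that] cmp_Rst[OF that] that
   by (simp_all add: delta_arr_simps)
 next
  fix S e zs zs' x assume zs: "zs \<noteq> []" and pt: "set zs \<subseteq> pt FC S e (A, mcar A)" "x \<in> pt FC S e (A, X)" "mset zs' = mset zs"
  show "Comp FC (D.tup zs' x) (?d (length zs)) = Comp FC (D.tup zs x) (?d (length zs))"
   unfolding d[OF zs] Faa_simps by (rule tup_cmp_perm[OF zs pt])
 qed (simp_all only: ds delta_arr_simps(3) Faa_simps tup_cmp_add tup_cmp_zero)
 moreover have st: "faa_src (darr F) = (dmon A, A, X)" "faa_tgt (darr F) = (dmon B, B, Y)"
  by (simp_all add: delta_arr_simps delta_obj_def)
 then have "FaaArr (dmon A, A, X) (dmon B, B, Y) ?d = darr F" by (metis faa_arr.collapse)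
 ultimately show ?thesis using st by (simp add: Hom_Faa)
qed

end

subsection \<open>Iterated evaluation\<close>

text \<open>A cube of arrows evaluated at a cube is again a cube, with the two sets of directions side by side.
 The comultiplication is characterised by turning evaluation at a joint cube into iterated evaluation.\<close>

definition cube_join :: "('o, 'm) crcat => ('i set => ('o, 'm) faa_arr) => ('j set => 'm) => ('i + 'j) set => 'm" where
 "cube_join C c w T = ev C (c (Inl -` T)) w (Inr -` T)"

lemma cube_join_Un [simp]: "cube_join C c w (I |+| J) = ev C (c I) w J"
 and cube_join_empty [simp]: "cube_join C c w {} = ev C (c {}) w {}"
 by (simp_all add: cube_join_def)

text \<open>\<open>pev_fuse\<close> groups directions of the right summand, whereas the directions
  to be grouped here, those of the cube of arrows, are on the left.\<close>

abbreviation (input) swap_sum :: "'i + 'j => 'j + 'i" where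
 "swap_sum \<equiv> case_sum Inr Inl"

lemma swap_sum_image: "swap_sum ` (I |+| J) = J |+| I"
 by (simp add: image_Un image_image Un_commute)

lemma vimage_swap_sum: "Inl -` (swap_sum ` T) = Inr -` T" "Inr -` (swap_sum ` T) = Inl -` T"
proof -
 have T: "swap_sum ` T = (Inr -` T) |+| (Inl -` T)"
  by (subst sum_set_eq[of T]) (rule swap_sum_image)
 show "Inl -` (swap_sum ` T) = Inr -` T" "Inr -` (swap_sum ` T) = Inl -` T" unfolding T by (rule vimage_Inl_Un)+
qed

lemma inj_swap_sum: "inj_on swap_sum T"
 by (rule inj_on_subset[OF _ subset_UNIV]) (auto intro!: injI split: sum.splits)

context cartesian_restriction_category
begin

text \<open>The base arrow of \<open>c\<close> ends in \<open>(A, X)\<close>, its coefficients end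
  in \<open>(A, A)\<close>. So a coefficient with at least one direction of either kind lands in
  \<open>A\<close>, and only the joint base point in \<open>X\<close>.\<close>

lemma cube_join_cube:
 fixes c :: "'i set => ('o, 'm) faa_arr" and w :: "'j set => 'm"
 assumes c: "cube FC S e (dobj U) c" and w: "cube C Z d S w" and U: "U \<in> FObj"
 shows "cube C Z (edom w e) U (cube_join C c w)"
 unfolding cube_def
proof (intro conjI allI impI)
 obtain A X where AX: "U = (A, X)" "tcm C A" using U by (auto simp: faa_Obj_def)
 have o: "snd (dobj U) = (A, X)" "mcar (fst (dobj U)) = (A, mcar A)"
  using delta_cmon_simps(1)[OF AX(2)] AX(1) by (auto simp: delta_obj_def)
 note c0 = Faa_pt_0(2)[OF cubeD(1)[OF c, unfolded o] w]
 show "cube_join C c w {} \<in> pt C Z (edom w e) (snd U)"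
  using cubeD(1)[OF c0] AX by simp
 fix T :: "('i + 'j) set" assume T: "T \<noteq> {}"
 show "cube_join C c w T \<in> pt C Z (edom w e) (mcar (fst U))"
 proof (cases "Inl -` T = {}")
  case True
  have "Inr -` T \<noteq> {}"
  proof
   assume "Inr -` T = {}"
   with True have "T = {}" by (subst sum_set_eq) simp
   then show False using T by simp
  qed
  then show ?thesis using cubeD(2)[OF c0] True AX by (simp add: cube_join_def)
 next
  case False
  note c1 = Faa_pt_0(2)[OF cubeD(2)[OF c False, unfolded o] w]
  show ?thesis using cubeD(1)[OF c1] cubeD(2)[OF c1, of "Inr -` T"] AX
   by (cases "Inr -` T = {}") (auto simp: cube_join_def)
 qed
qed

end

context faa_delta
begin

lemma delta_mcar: "mcar (dmon A) = (A, mcar A)" "mcar (dmon B) = (B, mcar B)"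
 using delta_cmon_simps(1) objs by auto

lemma ev_papp_delta:
 assumes c: "!!b. b \<in> P ==> c b \<in> pt FC S e (A, mcar A)" and x: "x \<in> pt FC S e (A, X)"
  and P: "finite P" "P \<noteq> {}" and w: "cube C Z d S w" and J: "finite J"
 shows "ev C (papp FC (darr F) x {#c b. b \<in># mset_set P#}) w J =
  ev C F (lin C A Z (edom w e) P (%b. ev C (c b) w) (ev C x w)) (P |+| J)"
proof -
 interpret dF: faa_arrow "Faa C" "darr F" "dmon A" "(A, X)" "dmon B" "(B, Y)"
  by (rule D.faa_arrowI[OF delta_Hom])
 obtain l where l: "distinct l" "set l = P" using finite_distinct_list[OF P(1)] by blast
 let ?zs = "map c l" and ?e = "edom w e" and ?S = "{..<length l}"
 have zs: "?zs \<noteq> []" "set ?zs \<subseteq> pt FC S e (A, mcar A)" using c l P(2) by auto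
 have n: "length ?zs \<ge> 1" using zs(1) by (cases ?zs) auto
 have "{#c b. b \<in># mset_set P#} = mset ?zs" using mset_set_set[OF l(1)] l(2) by simp
 then have "papp FC (darr F) x {#c b. b \<in># mset_set P#} = FComp (D.tup ?zs x) (delta_cmp C F (length ?zs))"
  using dF.papp_mset[of ?zs S e x] zs(2) x n by (simp add: delta_mcar delta_arr_simps(4))
 then have "ev C (papp FC (darr F) x {#c b. b \<in># mset_set P#}) w J =
   ev C F (lin C A Z ?e ?S (%i. ev C (?zs ! i) w) (ev C x w)) (Inl ` ?S \<union> Inr ` J)"
  using ev_tup_cmp[OF zs x w J] by simp
 also have "... = ev C F (lin C A Z ?e ?S (%i J. ev C (c (l ! i)) w ((%j. j) ` J)) (%J. ev C x w ((%j. j) ` J))) (Inl ` ?S \<union> Inr ` J)"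
 proof (rule ev_lin_cong[symmetric])
  show "ev C (?zs ! k) w K \<in> pt C Z ?e (mcar A)" if "k \<in> ?S" for k K
   by (rule ev_pt'[OF _ w]) (use c l that in auto)
 qed (use Faa_pt_0(2)[OF x w] in auto)
 also have "... = ev C F (lin C A Z ?e ((!) l ` ?S) (%b. ev C (c b) w) (ev C x w)) (Inl ` (!) l ` ?S \<union> Inr ` (%j. j) ` J)"
 proof (rule ev_lin_reindex[symmetric])
  show "ev C (c k) w K \<in> pt C Z ?e (mcar A)" if "k \<in> (!) l ` ?S" for k K
   by (rule ev_pt'[OF _ w]) (use c l that in auto)
  show "inj_on ((!) l) ?S" using l(1) by (auto simp: inj_on_def nth_eq_iff_index_eq)
 qed (use Faa_pt_0(2)[OF x w] in auto)
 also have "(!) l ` ?S = P" using l(2) by (auto simp: in_set_conv_nth)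
 finally show ?thesis by simp
qed

text \<open>Evaluation at \<open>w\<close> enters the sum over partitions \<open>P\<close> of
  \<open>I\<close>. Each term becomes \<open>F\<close> at a cube linear in the directions
  \<open>P\<close>; these cubes are the fusions along \<open>P\<close> of the joint cube, and
  \<open>pev_fuse\<close> sums the terms to one evaluation there.\<close>

lemma ev_ev_delta:
 fixes c :: "'i set => ('o, 'm) faa_arr" and w :: "'j set => 'm"
 assumes c: "cube FC S e (dmon A, A, X) c" and w: "cube C Z d S w" and I: "finite I" and J: "finite J"
 shows "ev C (ev FC (darr F) c I) w J = ev C F (cube_join C c w) (I |+| J)"
proof -
 interpret dF: faa_arrow "Faa C" "darr F" "dmon A" "(A, X)" "dmon B" "(B, Y)"
  by (rule D.faa_arrowI[OF delta_Hom])
 let ?e = "edom w e"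
 have x: "c {} \<in> pt FC S e (A, X)" by (rule dF.cube_base(1)[OF c])
 have v: "c D \<in> pt FC S e (A, mcar A)" if "D \<noteq> {}" for D using dF.cube_base(2)[OF c that] by (simp add: delta_mcar)
 note xH = D.ptH[OF x] and z0 = ptH[OF cubeD(1)[OF w]]
 note x0 = Faa_0[OF xH, simplified]
 have j: "cube C Z ?e (A, X) (cube_join C c w)"
  by (rule cube_join_cube[OF _ w]) (use c AX_Obj in "simp_all add: delta_obj_def")
 show ?thesis
 proof (cases "I = {}")
  case True
  have "ev C (ev FC (darr F) c I) w J = ev C (FComp (c {}) F) w J"
   using True by (simp add: delta_arr_simps)
  also have "... = ev C F (ev C (c {}) w) J" by (rule Faa_ev_Comp[OF xH arr w J])
  also have "... = ev C F (%B. cube_join C c w (Inr ` B)) J" by (simp add: cube_join_def)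
  also have "... = ev C F (cube_join C c w) (Inr ` J)" by (rule ev_reindex[OF j, symmetric]) simp
  finally show ?thesis using True by simp
 next
  case False
  let ?r = "faa_Rst C (FComp (c {}) F)"
  let ?H = "ptmon C B Z (Rst C (cube_join C c w {} \<cdot> f 0))" and ?G = "ptmon C A Z ?e"
  let ?a = "%T. cube_join C c w (swap_sum ` T)"
  interpret S: symadd ?G ?H "papp C F (cube_join C c w {})" by (rule symadd_cube[OF j])
  have a: "cube C Z ?e (A, X) ?a" by (rule cube_comp_image[OF j])
  have r: "?r \<in> pt FC S ?r S" using dF.dom_idem[OF xH] by (simp add: delta_arr_simps)
  have R: "edom w ?r = Rst C (cube_join C c w {} \<cdot> f 0)"
   using Rst_Comp[OF z0 Comp_Hom[OF x0 f0]] Comp_assoc[OF z0 x0 f0]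
   by (simp add: Faa_Rst_0 Faa_Comp_0 ev_at_empty)
  interpret dS: symadd "ptmon FC (dmon A) S e" "ptmon FC (dmon B) S ?r" "papp FC (darr F) (c {})"
   using dF.symadd_cube[OF c] by (simp add: delta_arr_simps)
  have Pne: "P \<noteq> {}" "finite P" if "P \<in> parts I" for P
   using parts_nonempty[OF that False] partsD(2)[OF that] by auto
  have Pne': "b \<noteq> {}" if "P \<in> parts I" "b \<in> P" for P b
   using partsD(4)[OF that(1)] that(2) by metis
  have tc: "papp FC (darr F) (c {}) (image_mset c (mset_set P)) \<in> pt FC S ?r (B, mcar B)" if "P \<in> parts I" for P
   using dS.pev_term_closed[OF dF.cube_fam'[OF c] False that] by (simp add: delta_mcar)
  have ne: "J |+| P \<noteq> {}" if "P \<noteq> {}" for P :: "'x set" using that by auto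
  have fuse: "fuse ?G ?a T = lin C A Z ?e P (%b. ev C (c b) w) (ev C (c {}) w) (swap_sum ` T)"
   if P: "P \<in> parts I" and T: "T \<subseteq> J |+| P" "T \<noteq> {}" for P T
  proof -
   have sub: "Inr -` T \<subseteq> P" using T(1) by auto
   have une: "unblock T \<noteq> {}" if "Inr -` T = {} \<or> (\<exists>b. Inr -` T = {b})"
    by (rule unblock_nonempty[OF T(2) that]) (use Pne'[OF P] sub in blast)
   have au: "?a (unblock T) = ev C (c (\<Union>(Inr -` T))) w (Inl -` T)"
    by (simp add: cube_join_def vimage_swap_sum vimage_unblock)
   consider "Inr -` T = {}" | b where "Inr -` T = {b}" | "Inr -` T \<noteq> {}" "\<not> (\<exists>b. Inr -` T = {b})" by blast
   then show ?thesis
   proof cases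
    case 1
    then have "fuse ?G ?a T = ?a (unblock T)" using une by (simp add: fuse_def)
    then show ?thesis unfolding au lin_def vimage_swap_sum using 1 by simp
   next
    case 2
    then have b: "b \<in> P" using sub by simp
    from 2 have "fuse ?G ?a T = ?a (unblock T)" using une by (simp add: fuse_def)
    then show ?thesis unfolding au lin_def vimage_swap_sum using 2 b by simp
   next
    case 3
    then have "fuse ?G ?a T = ?e \<cdot> zmap A Z" by (auto simp: fuse_def)
    moreover have "lin C A Z ?e P (%b. ev C (c b) w) (ev C (c {}) w) (swap_sum ` T) = ?e \<cdot> zmap A Z"
     by (rule lin_zero) (use 3 in "auto simp only: vimage_swap_sum")
    ultimately show ?thesis by simp
   qed
  qed
  have term_eq: "ev C (papp FC (darr F) (c {}) (image_mset c (mset_set P))) w J =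
    pev ?H (papp C F (cube_join C c w {})) (fuse ?G ?a) (J |+| P)" if P: "P \<in> parts I" for P
  proof -
   let ?L = "lin C A Z ?e P (%b. ev C (c b) w) (ev C (c {}) w)"
   have vP: "c b \<in> pt FC S e (A, mcar A)" if "b \<in> P" for b using v Pne'[OF P that] .
   have L: "cube C Z ?e (A, X) ?L"
    by (rule lin_cube[OF _ Faa_pt_0(2)[OF x w]]) (rule ev_pt'[OF vP w])
   have L': "cube C Z ?e (A, X) (%T. ?L (swap_sum ` T))" by (rule cube_comp_image[OF L])
   have "ev C (papp FC (darr F) (c {}) (image_mset c (mset_set P))) w J = ev C F ?L (P |+| J)"
    by (rule ev_papp_delta[OF vP x Pne(2,1)[OF P] w J])
   also have "... = ev C F (%T. ?L (swap_sum ` T)) (J |+| P)"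
    unfolding swap_sum_image[of J P, symmetric] by (rule ev_reindex[OF L inj_swap_sum])
   also have "... = pev ?H (papp C F (cube_join C c w {})) (%T. ?L (swap_sum ` T)) (J |+| P)"
    using ev_pev[OF L' ne[OF Pne(1)[OF P]]] by simp
   also have "... = pev ?H (papp C F (cube_join C c w {})) (fuse ?G ?a) (J |+| P)"
    by (rule S.pev_cong[OF cube_fam'[OF L'] ne[OF Pne(1)[OF P]], symmetric]) (rule fuse[OF P, symmetric])
   finally show ?thesis .
  qed
  have "ev FC (darr F) c I = finprod (ptmon FC (dmon B) S ?r)
    (%P. papp FC (darr F) (c {}) (image_mset c (mset_set P))) (parts I)"
   using dF.ev_pev[OF c False] by (simp add: pev_def delta_arr_simps)
  \<comment> \<open>Evaluation at \<open>w\<close> is a homomorphism from arrows with domain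
    \<open>?r\<close> to points with the corresponding domain, by \<open>ev_delta_madd\<close> and
    \<open>ev_delta_zero_e\<close>.\<close>
  then have "ev C (ev FC (darr F) c I) w J =
    finprod ?H (%P. ev C (papp FC (darr F) (c {}) (image_mset c (mset_set P))) w J) (parts I)"
  proof (simp only:, intro finprod_hom[where h = "%g. ev C g w J"])
   show "comm_monoid (ptmon FC (dmon B) S ?r)" "comm_monoid ?H" by unfold_locales
   show "(%P. papp FC (darr F) (c {}) (image_mset c (mset_set P))) \<in> parts I \<rightarrow> carrier (ptmon FC (dmon B) S ?r)"
    using tc by (simp add: delta_mcar)
   show "ev C g w J \<in> carrier ?H" if "g \<in> carrier (ptmon FC (dmon B) S ?r)" for g
    using ev_pt'[OF _ w, of g ?r B J] that R by (simp add: delta_mcar)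
   show "ev C \<one>\<^bsub>ptmon FC (dmon B) S ?r\<^esub> w J = \<one>\<^bsub>?H\<^esub>"
    using ev_delta_zero_e[OF objs(3) r w J] R by simp
   show "ev C (g \<otimes>\<^bsub>ptmon FC (dmon B) S ?r\<^esub> h) w J = ev C g w J \<otimes>\<^bsub>?H\<^esub> ev C h w J"
    if "g \<in> carrier (ptmon FC (dmon B) S ?r)" "h \<in> carrier (ptmon FC (dmon B) S ?r)" for g h
    using ev_delta_madd[OF objs(3) _ _ w J, of g ?r h] that by (simp add: delta_mcar)
  qed
  also have "... = finprod ?H (%P. pev ?H (papp C F (cube_join C c w {})) (fuse ?G ?a) (J |+| P)) (parts I)"
  proof (rule S.H.finprod_cong')
   show "(%P. pev ?H (papp C F (cube_join C c w {})) (fuse ?G ?a) (J |+| P)) \<in> parts I \<rightarrow> carrier ?H"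
   proof (rule Pi_I)
    fix P assume P: "P \<in> parts I"
    show "pev ?H (papp C F (cube_join C c w {})) (fuse ?G ?a) (J |+| P) \<in> carrier ?H"
     using ev_pt'[OF tc[OF P] w, of J] R unfolding term_eq[OF P] by simp
   qed
  qed (simp_all only: term_eq)
  also have "... = pev ?H (papp C F (cube_join C c w {})) ?a (J |+| I)"
   by (rule S.pev_fuse[OF cube_fam'[OF a], symmetric]) (use I J False in auto)
  also have "... = ev C F ?a (J |+| I)" using ev_pev[OF a ne[OF False]] by simp
  also have "... = ev C F (cube_join C c w) (I |+| J)"
   unfolding swap_sum_image[of J I, symmetric] by (rule ev_reindex[OF j inj_swap_sum, symmetric])
  finally show ?thesis .
 qed
qed

end

subsection \<open>The comultiplication is a functor\<close>

context cartesian_restriction_category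
begin

lemma Faa_delta: "F \<in> Hom FC (A, X) (B, Y) ==> faa_delta C F A X B Y"
 by (simp add: faa_delta.intro faa_arrowI)

lemma delta_arr_Hom: "F \<in> Hom FC S T ==> darr F \<in> Hom (Faa FC) (dobj S) (dobj T)"
 using faa_delta.delta_Hom[OF Faa_delta] by (cases S; cases T) (simp add: delta_obj_def)

lemma ev_delta_arr:
 assumes "F \<in> Hom FC S T" "cube FC U e (dobj S) c" "cube C Z d U w" "finite I" "finite J"
 shows "ev C (ev FC (darr F) c I) w J = ev C F (cube_join C c w) (I |+| J)"
 using faa_delta.ev_ev_delta[OF Faa_delta] assms by (cases S; cases T) (simp add: delta_obj_def)

lemma delta_obj_simps:
 assumes "S \<in> FObj"
 shows "snd (dobj S) = S" "mcar (fst (dobj S)) = (fst S, mcar (fst S))"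
 using assms delta_cmon_simps(1) by (auto simp: delta_obj_def faa_Obj_def)

lemma delta_obj_Obj: "S \<in> FObj ==> dobj S \<in> faa_Obj FC"
 using delta_cmon by (auto simp: delta_obj_def faa_Obj_def)

lemma AA_Obj': "S \<in> FObj ==> (fst S, mcar (fst S)) \<in> FObj"
 using AA_Obj by (auto simp: faa_Obj_def)

text \<open>Extensionality used twice: on cubes of arrows at the outer level, then for the resulting
  arrows on cubes of points.\<close>

lemma Faa_Faa_eqI:
 assumes P: "P \<in> Hom (Faa FC) S T" and Q: "Q \<in> Hom (Faa FC) S T"
  and eq: "!!U e c I Z d w J. cube FC U e S (c :: nat set => ('o, 'm) faa_arr) ==> finite I ==>
   cube C Z d U (w :: nat set => 'm) ==> finite J ==> ev C (ev FC P c I) w J = ev C (ev FC Q c I) w J"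
 shows "P = Q"
proof -
 interpret D: cartesian_restriction_category "Faa C" by (rule Faa_crc)
 show ?thesis
 proof (rule D.faa_eqI[OF P Q])
  fix U e and c :: "nat set => ('o, 'm) faa_arr" and I :: "nat set" assume c: "cube FC U e S c" and I: "finite I"
  note p = D.Faa_ev_cube[OF P c] and q = D.Faa_ev_cube[OF Q c]
  show "ev FC P c I = ev FC Q c I"
  proof (rule faa_eqI)
   let ?T = "if I = {} then snd T else mcar (fst T)"
   show "ev FC P c I \<in> Hom FC U ?T" "ev FC Q c I \<in> Hom FC U ?T"
    using D.ptH[OF cubeD(1)[OF p]] D.ptH[OF cubeD(1)[OF q]] D.ptH[OF cubeD(2)[OF p, of I]] D.ptH[OF cubeD(2)[OF q, of I]]
    by (cases "I = {}"; simp)+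
  qed (rule eq[OF c I])
 qed
qed

lemma delta_Ide:
 assumes S: "S \<in> FObj"
 shows "darr (faa_Ide C S) = faa_Ide FC (dobj S)"
proof -
 interpret D: cartesian_restriction_category "Faa C" by (rule Faa_crc)
 note dS = delta_obj_Obj[OF S]
 show ?thesis
 proof (rule Faa_Faa_eqI[OF delta_arr_Hom[OF Faa_Ide_Hom[OF S]] D.Faa_Ide_Hom[OF dS]])
  fix U e Z d and I J :: "nat set" and c :: "nat set => ('o, 'm) faa_arr" and w :: "nat set => 'm"
  assume c: "cube FC U e (dobj S) c" and I: "finite I" and w: "cube C Z d U w" and J: "finite J"
  show "ev C (ev FC (darr (faa_Ide C S)) c I) w J = ev C (ev FC (faa_Ide FC (dobj S)) c I) w J"
   using ev_delta_arr[OF Faa_Ide_Hom[OF S] c w I J] ev_faa_Ide[OF S cube_join_cube[OF c w S], of "I |+| J"]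
    D.ev_faa_Ide[OF dS c I] I J by simp
 qed
qed

text \<open>Joining the image of \<open>c\<close> under \<delta>(F) with \<open>w\<close> gives the
  image of the joint cube under \<open>F\<close>. Both sides are then \<open>G\<close> after
  \<open>F\<close> at the joint cube.\<close>

lemma delta_Comp:
 assumes F: "F \<in> Hom FC S T" and G: "G \<in> Hom FC T R"
 shows "darr (FComp F G) = faa_Comp FC (darr F) (darr G)"
proof -
 interpret D: cartesian_restriction_category "Faa C" by (rule Faa_crc)
 note FG = Faa_Comp_Hom[OF F G] and dF = delta_arr_Hom[OF F] and dG = delta_arr_Hom[OF G]
 show ?thesis
 proof (rule Faa_Faa_eqI[OF delta_arr_Hom[OF FG] D.Faa_Comp_Hom[OF dF dG]])
  fix U e Z d and I J :: "nat set" and c :: "nat set => ('o, 'm) faa_arr" and w :: "nat set => 'm"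
  assume c: "cube FC U e (dobj S) c" and I: "finite I" and w: "cube C Z d U w" and J: "finite J"
  note c' = D.Faa_ev_cube[OF dF c]
  note j = cube_join_cube[OF c w Faa_Objs(1)[OF F]]
  let ?K = "I |+| J :: (nat + nat) set"
  have "ev C (ev FC (faa_Comp FC (darr F) (darr G)) c I) w J =
    ev C G (cube_join C (ev FC (darr F) c) w) ?K"
   using D.Faa_ev_Comp[OF dF dG c I] ev_delta_arr[OF G c' w I J] by simp
  also have "... = ev C G (ev C F (cube_join C c w)) ?K"
  proof (rule Faa_ev_cong[OF G Faa_ev_cube[OF F j]])
   have e: "cube_join C (ev FC (darr F) c) w T = ev C F (cube_join C c w) T" if "finite T" for T
   proof -
    have "finite (Inl -` T)" "finite (Inr -` T)" using that by (auto intro: finite_vimageI)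
    from ev_delta_arr[OF F c w this] show ?thesis unfolding sum_set_eq[symmetric] cube_join_def[of C "ev FC (darr F) c"] .
   qed
   show "cube_join C (ev FC (darr F) c) w {} = ev C F (cube_join C c w) {}" by (rule e) simp
   show "cube_join C (ev FC (darr F) c) w T = ev C F (cube_join C c w) T" if "finite T" for T by (rule e[OF that])
  qed
  also have "... = ev C (FComp F G) (cube_join C c w) ?K"
   by (rule Faa_ev_Comp[OF F G j, symmetric]) (use I J in simp)
  also have "... = ev C (ev FC (darr (FComp F G)) c I) w J"
   by (rule ev_delta_arr[OF FG c w I J, symmetric])
  finally show "ev C (ev FC (darr (FComp F G)) c I) w J =
    ev C (ev FC (faa_Comp FC (darr F) (darr G)) c I) w J" by simp
 qed
qed

text \<open>At either level the action restricts every entry, and the two restricting idempotents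
  agree once evaluated at \<open>w\<close>.\<close>

lemma delta_Rst:
 assumes F: "F \<in> Hom FC S T"
 shows "darr (faa_Rst C F) = faa_Rst FC (darr F)"
proof -
 interpret D: cartesian_restriction_category "Faa C" by (rule Faa_crc)
 note R = Faa_Rst_Hom[OF F] and dF = delta_arr_Hom[OF F] and S = Faa_Objs(1)[OF F]
 show ?thesis
 proof (rule Faa_Faa_eqI[OF delta_arr_Hom[OF R] D.Faa_Rst_Hom[OF dF]])
  fix U e Z d and I J :: "nat set" and c :: "nat set => ('o, 'm) faa_arr" and w :: "nat set => 'm"
  assume c: "cube FC U e (dobj S) c" and I: "finite I" and w: "cube C Z d U w" and J: "finite J"
  let ?K = "I |+| J :: (nat + nat) set"
  let ?r = "faa_Rst C (FComp (c {}) F)"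
  note j = cube_join_cube[OF c w S]
  have x: "c {} \<in> Hom FC U S" using D.ptH[OF cubeD(1)[OF c]] delta_obj_simps[OF S] by simp
  note xF = Faa_Comp_Hom[OF x F]
  have r: "?r \<in> pt FC U ?r U" using D.pt_idem(5)[OF D.ptI[OF xF refl]] by simp
  have cI: "c I \<in> Hom FC U (if I = {} then S else (fst S, mcar (fst S)))"
   using x D.ptH[OF cubeD(2)[OF c, of I]] delta_obj_simps[OF S] by simp
  note z0 = ptH[OF cubeD(1)[OF w]]
  have "ev C (ev FC (faa_Rst FC (darr F)) c I) w J = ev C (FComp ?r (c I)) w J"
   using D.ev_faa_Rst[OF dF c I] by (simp add: delta_arr_simps)
  also have "... = edom w ?r \<cdot> cube_join C c w ?K"
   using ev_restrict[OF r cI w J] by simp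
  also have "edom w ?r = Rst C (cube_join C c w {} \<cdot> faa_seq F 0)"
   using Rst_Comp[OF z0 Comp_Hom[OF Faa_0[OF x] Faa_0[OF F]]] Comp_assoc[OF z0 Faa_0[OF x] Faa_0[OF F]]
   by (simp add: Faa_Rst_0 Faa_Comp_0 ev_at_empty)
  also have "... \<cdot> cube_join C c w ?K = ev C (ev FC (darr (faa_Rst C F)) c I) w J"
   using ev_delta_arr[OF R c w I J] ev_faa_Rst[OF F j, of ?K] I J by simp
  finally show "ev C (ev FC (darr (faa_Rst C F)) c I) w J =
    ev C (ev FC (faa_Rst FC (darr F)) c I) w J" by simp
 qed
qed

lemma ev_semilin_diag:
 assumes E: "tcm C E" and A: "tcm C A" and g: "g \<in> pt C (mcar E) (Ide C (mcar E)) (mcar A)" "mhom E A g"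
  and c: "cube C Z e (E, mcar E) c" and J: "finite J"
 shows "ev C (semilin (E, mcar E) (A, mcar A) g g) c J = c J \<cdot> g"
proof (cases "J = {}")
 case True
 then show ?thesis by (simp add: ev_at_empty semilin_0)
next
 case False
 show ?thesis by (rule ev_semilin_total[OF E A ptH[OF g(1)] g(2,1) c J False])
qed

lemma cube_diag: "cube C Z e (E, mcar E) c ==> c J \<in> mpt C Z e E"
 using cubeD[of C Z e "(E, mcar E)" c] by (cases "J = {}") auto

text \<open>All structure maps have the terminal object of \<open>Faa(C)\<close> as target and are
  total, which leaves only one choice.\<close>

lemma delta_cmon_unit: "dmon (unit_cmon C) = unit_cmon FC"
proof -
 interpret D: cartesian_restriction_category "Faa C" by (rule Faa_crc)
 have U: "mcar (unit_cmon C) = Unit C" by (simp add: unit_cmon_def)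
 note s = delta_cmon_simps[OF unit_cmon] and H = delta_cmon_Homs[OF unit_cmon]
 have u: "(unit_cmon C, Unit C) = faa_Unit C" by (simp add: faa_Unit_def)
 interpret DU: crc_monoid "Faa C" "dmon (unit_cmon C)" by unfold_locales (rule delta_cmon[OF unit_cmon])
 have mc: "mcar (dmon (unit_cmon C)) = faa_Unit C" using s(1) U u by simp
 have UO: "faa_Unit C \<in> Obj FC" using D.Unit_Obj by simp
 have "mplus (dmon (unit_cmon C)) = Bang FC (Prod FC (faa_Unit C) (faa_Unit C))"
  using D.pt_Unit_eq[of "mplus (dmon (unit_cmon C))" _ _ "Bang FC (Prod FC (faa_Unit C) (faa_Unit C))"]
   DU.plus_pt D.Bang_pt[OF D.Prod_Obj[OF UO UO]] unfolding mc by simp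
 moreover have "mzero (dmon (unit_cmon C)) = Bang FC (faa_Unit C)"
  using D.pt_Unit_eq[of "mzero (dmon (unit_cmon C))" _ _ "Bang FC (faa_Unit C)"]
   DU.mzero_pt D.Bang_pt[OF UO] unfolding mc by simp
 ultimately show ?thesis using mc by (intro cmon.expand) (simp add: unit_cmon_def)
qed

text \<open>Compared by evaluation. On the left the action is composition with the addition of the
  product monoid; on the right that addition is assembled from its coordinates through four
  composites of projections.\<close>

lemma delta_cmon_prod:
 assumes A: "tcm C A" and B: "tcm C B"
 shows "dmon (prod_cmon C A B) = prod_cmon FC (dmon A) (dmon B)"
proof -
 interpret D: cartesian_restriction_category "Faa C" by (rule Faa_crc)
 interpret A: crc_monoid C A by unfold_locales (rule A)
 interpret B: crc_monoid C B by unfold_locales (rule B)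
 note P = prod_cmon[OF A B]
 interpret P: crc_monoid C "prod_cmon C A B" by unfold_locales (rule P)
 let ?AA = "(A, mcar A)" and ?BB = "(B, mcar B)" and ?PP = "(prod_cmon C A B, Prod C (mcar A) (mcar B))"
 note mcs = delta_cmon_simps(1)[OF A] delta_cmon_simps(1)[OF B]
 have PP: "faa_Prod C ?AA ?BB = ?PP" by (simp add: faa_Prod_def)
 have AO: "?AA \<in> FObj" and BO: "?BB \<in> FObj" and PO: "?PP \<in> FObj"
  using AA_Obj[OF A] AA_Obj[OF B] AA_Obj[OF P] by simp_all
 note dP = D.prod_cmon[OF delta_cmon[OF A] delta_cmon[OF B]]
 interpret dP: crc_monoid "Faa C" "prod_cmon FC (dmon A) (dmon B)" by unfold_locales (rule dP)
 have mc: "mcar (prod_cmon FC (dmon A) (dmon B)) = ?PP" by (simp add: mcs PP)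
 let ?p = "faa_Pi0 C ?PP ?PP" and ?q = "faa_Pi1 C ?PP ?PP" and ?l = "faa_Pi0 C ?AA ?BB" and ?r = "faa_Pi1 C ?AA ?BB"
 let ?PC = "Prod C (mcar A) (mcar B)"
 have Pi: "faa_Pi0 C S T \<in> pt FC (faa_Prod C S T) (faa_Ide C (faa_Prod C S T)) S"
  "faa_Pi1 C S T \<in> pt FC (faa_Prod C S T) (faa_Ide C (faa_Prod C S T)) T"
  if "S \<in> FObj" "T \<in> FObj" for S T
  using D.Pi0_pt[of S T] D.Pi1_pt[of S T] that by simp_all
 note pqlr = Pi[OF PO PO] Pi[OF AO BO, unfolded PP]
 have "mplus (dmon (prod_cmon C A B)) = mplus (prod_cmon FC (dmon A) (dmon B))"
 proof (rule faa_eqI)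
  let ?S = "faa_Prod C ?PP ?PP"
  show "mplus (dmon (prod_cmon C A B)) \<in> Hom FC ?S ?PP" using delta_cmon_Homs(1)[OF P] by simp
  show "mplus (prod_cmon FC (dmon A) (dmon B)) \<in> Hom FC ?S ?PP"
   using dP.plus_Hom unfolding mc by simp
  fix Z e and w :: "nat set => 'm" and J :: "nat set" assume w: "cube C Z e ?S w" and J: "finite J"
  let ?z = "w J" and ?P = "prod_cmon C A B"
  let ?S' = "(prod_cmon C ?P ?P, mcar (prod_cmon C ?P ?P))"
  have w': "cube C Z e ?S' w" using w by (simp add: faa_Prod_def)
  have z: "?z \<in> pt C Z e (Prod C ?PC ?PC)" using cube_diag[OF w', of J] by simp
  note zH = ptH[OF z]
  note PCO = Prod_Obj[OF A.car_Obj B.car_Obj]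
  note cl = Pi0_Hom[OF PCO PCO] Pi1_Hom[OF PCO PCO] Pi0_Hom[OF A.car_Obj B.car_Obj] Pi1_Hom[OF A.car_Obj B.car_Obj]
  note Dc = D.pt_Comp[unfolded Faa_simps]
  note pts = Dc[OF pqlr(1,3)] Dc[OF pqlr(2,3)] Dc[OF pqlr(1,4)] Dc[OF pqlr(2,4)]
  have evpi: "ev C (FComp ?p ?l) w J = ?z \<cdot> (Pi0 C ?PC ?PC \<cdot> Pi0 C (mcar A) (mcar B))"
    "ev C (FComp ?q ?l) w J = ?z \<cdot> (Pi1 C ?PC ?PC \<cdot> Pi0 C (mcar A) (mcar B))"
    "ev C (FComp ?p ?r) w J = ?z \<cdot> (Pi0 C ?PC ?PC \<cdot> Pi1 C (mcar A) (mcar B))"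
    "ev C (FComp ?q ?r) w J = ?z \<cdot> (Pi1 C ?PC ?PC \<cdot> Pi1 C (mcar A) (mcar B))"
  proof -
   note pH = faa_Pi_Hom(1)[OF PO PO] and qH = faa_Pi_Hom(2)[OF PO PO]
    and lH = faa_Pi_Hom(1)[OF AO BO, unfolded PP] and rH = faa_Pi_Hom(2)[OF AO BO, unfolded PP]
   have e1: "ev C ?p w J = ?z \<cdot> Pi0 C ?PC ?PC" "ev C ?q w J = ?z \<cdot> Pi1 C ?PC ?PC"
    using ev_faa_Pi[OF PO PO w J] by (auto split: if_splits)
   have e2: "ev C ?l c J = c J \<cdot> Pi0 C (mcar A) (mcar B)" "ev C ?r c J = c J \<cdot> Pi1 C (mcar A) (mcar B)"
    if "cube C Z e' ?PP c" for c e'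
    using ev_faa_Pi[OF AO BO that[folded PP] J] by (auto split: if_splits)
   show "ev C (FComp ?p ?l) w J = ?z \<cdot> (Pi0 C ?PC ?PC \<cdot> Pi0 C (mcar A) (mcar B))"
    "ev C (FComp ?q ?l) w J = ?z \<cdot> (Pi1 C ?PC ?PC \<cdot> Pi0 C (mcar A) (mcar B))"
    "ev C (FComp ?p ?r) w J = ?z \<cdot> (Pi0 C ?PC ?PC \<cdot> Pi1 C (mcar A) (mcar B))"
    "ev C (FComp ?q ?r) w J = ?z \<cdot> (Pi1 C ?PC ?PC \<cdot> Pi1 C (mcar A) (mcar B))"
    using Faa_ev_Comp[OF pH lH w J] Faa_ev_Comp[OF qH lH w J] Faa_ev_Comp[OF pH rH w J] Faa_ev_Comp[OF qH rH w J]
     e1 e2[OF Faa_ev_cube[OF pH w]] e2[OF Faa_ev_cube[OF qH w]]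
     Comp_assoc[OF zH cl(1,3)] Comp_assoc[OF zH cl(2,3)] Comp_assoc[OF zH cl(1,4)] Comp_assoc[OF zH cl(2,4)] by simp_all
  qed
  have "ev C (mplus (dmon ?P)) w J = ?z \<cdot> mplus ?P"
   using ev_semilin_diag[OF prod_cmon[OF P P] P _ mhom_mplus[OF P] w' J] P.plus_pt delta_cmon_simps(2)[OF P] by simp
  also have "... = Pairing C (madd C A (?z \<cdot> (Pi0 C ?PC ?PC \<cdot> Pi0 C (mcar A) (mcar B))) (?z \<cdot> (Pi1 C ?PC ?PC \<cdot> Pi0 C (mcar A) (mcar B))))
    (madd C B (?z \<cdot> (Pi0 C ?PC ?PC \<cdot> Pi1 C (mcar A) (mcar B))) (?z \<cdot> (Pi1 C ?PC ?PC \<cdot> Pi1 C (mcar A) (mcar B))))"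
  proof -
   note H = Comp_Hom[OF cl(1,3)] Comp_Hom[OF cl(2,3)] Comp_Hom[OF cl(1,4)] Comp_Hom[OF cl(2,4)]
   show ?thesis
    using Comp_Pairing[OF zH A.add_Hom[OF H(1,2)] B.add_Hom[OF H(3,4)]] A.Comp_add[OF H(1,2) zH] B.Comp_add[OF H(3,4) zH]
    by (simp add: prod_cmon_def[of C A B] Let_def)
  qed
  also have "... = ev C (mplus (prod_cmon FC (dmon A) (dmon B))) w J"
  proof -
   interpret dA: crc_monoid "Faa C" "dmon A" by unfold_locales (rule delta_cmon[OF A])
   interpret dB: crc_monoid "Faa C" "dmon B" by unfold_locales (rule delta_cmon[OF B])
   have a: "madd FC (dmon A) (FComp ?p ?l) (FComp ?q ?l) \<in> pt FC ?S (faa_Ide C ?S) ?AA"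
    using dA.add_pt[unfolded mcs, OF pts(1,2)] .
   have b: "madd FC (dmon B) (FComp ?p ?r) (FComp ?q ?r) \<in> pt FC ?S (faa_Ide C ?S) ?BB"
    using dB.add_pt[unfolded mcs, OF pts(3,4)] .
   have "mplus (prod_cmon FC (dmon A) (dmon B)) =
     faa_Pairing C (madd FC (dmon A) (FComp ?p ?l) (FComp ?q ?l)) (madd FC (dmon B) (FComp ?p ?r) (FComp ?q ?r))"
    by (simp add: prod_cmon_def[of "Faa C"] Let_def mcs PP)
   then show ?thesis
    using ev_Pairing[OF a b w J] ev_delta_madd[OF A pts(1,2) w J] ev_delta_madd[OF B pts(3,4) w J] evpi by simp
  qed
  finally show "ev C (mplus (dmon ?P)) w J = ev C (mplus (prod_cmon FC (dmon A) (dmon B))) w J" .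
 qed
 moreover have "mzero (dmon (prod_cmon C A B)) = mzero (prod_cmon FC (dmon A) (dmon B))"
 proof (rule faa_eqI)
  show "mzero (dmon (prod_cmon C A B)) \<in> Hom FC (faa_Unit C) ?PP" using delta_cmon_Homs(2)[OF P] by simp
  show "mzero (prod_cmon FC (dmon A) (dmon B)) \<in> Hom FC (faa_Unit C) ?PP"
   using dP.mzero_Hom unfolding mc by simp
  fix Z e and w :: "nat set => 'm" and J :: "nat set" assume w: "cube C Z e (faa_Unit C) w" and J: "finite J"
  have w': "cube C Z e (unit_cmon C, mcar (unit_cmon C)) w" using w by (simp add: faa_Unit_def unit_cmon_def)
  have z: "w J \<in> pt C Z e (Unit C)" using cube_diag[OF w', of J] by (simp add: unit_cmon_def)
  have uc: "mcar (unit_cmon C) = Unit C" by (simp add: unit_cmon_def)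
  have ez: "ev C (mzero (dmon E)) w J = w J \<cdot> mzero E" if E: "tcm C E" for E
   using ev_semilin_diag[OF unit_cmon E _ mhom_mzero[OF E] w' J] total_comm_monoidD(3)[OF E] delta_cmon_simps(3)[OF E] uc by simp
  interpret dA: crc_monoid "Faa C" "dmon A" by unfold_locales (rule delta_cmon[OF A])
  interpret dB: crc_monoid "Faa C" "dmon B" by unfold_locales (rule delta_cmon[OF B])
  have "ev C (mzero (prod_cmon FC (dmon A) (dmon B))) w J = Pairing C (w J \<cdot> mzero A) (w J \<cdot> mzero B)"
   using ev_Pairing[OF dA.mzero_pt[unfolded mcs, simplified] dB.mzero_pt[unfolded mcs, simplified] w J] ez[OF A] ez[OF B]
   by (simp add: prod_cmon_def[of "Faa C"] Let_def)
  also have "... = ev C (mzero (dmon (prod_cmon C A B))) w J"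
   using ez[OF P] Comp_Pairing[OF ptH[OF z] A.mzero_Hom B.mzero_Hom] by (simp add: prod_cmon_def[of C] Let_def)
  finally show "ev C (mzero (dmon (prod_cmon C A B))) w J = ev C (mzero (prod_cmon FC (dmon A) (dmon B))) w J" by simp
 qed
 moreover have "mcar (dmon (prod_cmon C A B)) = mcar (prod_cmon FC (dmon A) (dmon B))"
  using delta_cmon_simps(1)[OF P] mc by simp
 ultimately show ?thesis by (intro cmon.expand) simp
qed

lemma delta_obj_Unit: "dobj (faa_Unit C) = faa_Unit FC"
 by (simp add: delta_obj_def faa_Unit_def[of C] faa_Unit_def[of "Faa C"] delta_cmon_unit)

lemma delta_obj_Prod: "S \<in> FObj ==> T \<in> FObj ==> dobj (faa_Prod C S T) = faa_Prod FC (dobj S) (dobj T)"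
 by (auto simp: delta_obj_def faa_Prod_def faa_Obj_def delta_cmon_prod)

text \<open>Projections act entrywise at both levels. What must agree is the choice between the
  projection for base points and the one for carriers, and on both sides it depends on whether
  \<open>I\<close> and \<open>J\<close> are both empty.\<close>

lemma delta_Pi:
 assumes S: "S \<in> FObj" and T: "T \<in> FObj"
 shows "darr (faa_Pi0 C S T) = faa_Pi0 FC (dobj S) (dobj T)"
  "darr (faa_Pi1 C S T) = faa_Pi1 FC (dobj S) (dobj T)"
proof -
 interpret D: cartesian_restriction_category "Faa C" by (rule Faa_crc)
 note dS = delta_obj_Obj[OF S] and dT = delta_obj_Obj[OF T] and p = faa_Pi_Hom[OF S T]
 note dp = D.faa_Pi_Hom[OF dS dT]
 have ST: "faa_Prod C S T \<in> FObj" using D.Prod_Obj[of S T] S T by simp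
 note so = delta_obj_simps[OF S] and to = delta_obj_simps[OF T]
 have key: "ev C (ev FC (darr (faa_Pi0 C S T)) c I) w J = ev C (ev FC (faa_Pi0 FC (dobj S) (dobj T)) c I) w J"
  "ev C (ev FC (darr (faa_Pi1 C S T)) c I) w J = ev C (ev FC (faa_Pi1 FC (dobj S) (dobj T)) c I) w J"
  if c: "cube FC U e (dobj (faa_Prod C S T)) c" and I: "finite I" and w: "cube C Z d U w" and J: "finite J"
  for U e Z d and I J :: "nat set" and c :: "nat set => ('o, 'm) faa_arr" and w :: "nat set => 'm"
 proof -
  let ?K = "I |+| J :: (nat + nat) set"
  let ?S = "if I = {} then S else (fst S, mcar (fst S))" and ?T = "if I = {} then T else (fst T, mcar (fst T))"
  note j = cube_join_cube[OF c w ST]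
  have K: "finite ?K" using I J by simp
  have c': "cube FC U e (faa_Prod FC (dobj S) (dobj T)) c" using c delta_obj_Prod[OF S T] by simp
  have O: "?S \<in> FObj" "?T \<in> FObj" using S T AA_Obj' by auto
  have cI: "c I \<in> pt FC U e (faa_Prod C ?S ?T)"
   using cubeD(1)[OF c'] cubeD(2)[OF c', of I] so to by (simp add: faa_Prod_sel)
  note cIc = Faa_pt_0(2)[OF cI w]
  have ms: "mcar (fst ?S) = mcar (fst S)" "mcar (fst ?T) = mcar (fst T)" by simp_all
  have e0: "ev FC (faa_Pi0 FC (dobj S) (dobj T)) c I = FComp (c I) (faa_Pi0 C ?S ?T)"
   using D.ev_faa_Pi(1)[OF dS dT c' I] so to by simp
  have "ev C (FComp (c I) (faa_Pi0 C ?S ?T)) w J = ev C (c I) w J \<cdot> (if J = {} then Pi0 C (snd ?S) (snd ?T) else Pi0 C (mcar (fst S)) (mcar (fst T)))"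
   unfolding Faa_ev_Comp[OF D.ptH[OF cI] faa_Pi_Hom(1)[OF O] w J] ev_faa_Pi(1)[OF O cIc J] ms ..
  also have "(if J = {} then Pi0 C (snd ?S) (snd ?T) else Pi0 C (mcar (fst S)) (mcar (fst T))) =
    (if ?K = {} then Pi0 C (snd S) (snd T) else Pi0 C (mcar (fst S)) (mcar (fst T)))"
   by (cases "I = {}"; cases "J = {}") simp_all
  finally show "ev C (ev FC (darr (faa_Pi0 C S T)) c I) w J = ev C (ev FC (faa_Pi0 FC (dobj S) (dobj T)) c I) w J"
   unfolding ev_delta_arr[OF p(1) c w I J] ev_faa_Pi(1)[OF S T j K] cube_join_Un e0 by (rule sym)
  have e1: "ev FC (faa_Pi1 FC (dobj S) (dobj T)) c I = FComp (c I) (faa_Pi1 C ?S ?T)"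
   using D.ev_faa_Pi(2)[OF dS dT c' I] so to by simp
  have "ev C (FComp (c I) (faa_Pi1 C ?S ?T)) w J = ev C (c I) w J \<cdot> (if J = {} then Pi1 C (snd ?S) (snd ?T) else Pi1 C (mcar (fst S)) (mcar (fst T)))"
   unfolding Faa_ev_Comp[OF D.ptH[OF cI] faa_Pi_Hom(2)[OF O] w J] ev_faa_Pi(2)[OF O cIc J] ms ..
  also have "(if J = {} then Pi1 C (snd ?S) (snd ?T) else Pi1 C (mcar (fst S)) (mcar (fst T))) =
    (if ?K = {} then Pi1 C (snd S) (snd T) else Pi1 C (mcar (fst S)) (mcar (fst T)))"
   by (cases "I = {}"; cases "J = {}") simp_all
  finally show "ev C (ev FC (darr (faa_Pi1 C S T)) c I) w J = ev C (ev FC (faa_Pi1 FC (dobj S) (dobj T)) c I) w J"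
   unfolding ev_delta_arr[OF p(2) c w I J] ev_faa_Pi(2)[OF S T j K] cube_join_Un e1 by (rule sym)
 qed
 show "darr (faa_Pi0 C S T) = faa_Pi0 FC (dobj S) (dobj T)"
  by (rule Faa_Faa_eqI[OF delta_arr_Hom[OF p(1)] dp(1)[folded delta_obj_Prod[OF S T]]]) (rule key(1))
 show "darr (faa_Pi1 C S T) = faa_Pi1 FC (dobj S) (dobj T)"
  by (rule Faa_Faa_eqI[OF delta_arr_Hom[OF p(2)] dp(2)[folded delta_obj_Prod[OF S T]]]) (rule key(2))
qed

lemma comult_functor: "cr_functor FC (Faa FC) (comult C)"
proof -
 have a: "F \<in> faa_Arr C ==> F \<in> Hom FC (faa_src F) (faa_tgt F)" for F by (simp add: Hom_Faa)
 have d: "darr F \<in> faa_Arr FC" "faa_src (darr F) = dobj (faa_src F)" "faa_tgt (darr F) = dobj (faa_tgt F)"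
  if "F \<in> faa_Arr C" for F using delta_arr_Hom[OF a[OF that]] by (auto simp: Hom_Faa)
 have o: "faa_src F \<in> FObj" "faa_tgt F \<in> FObj" if "F \<in> faa_Arr C" for F
  using Faa_Objs[OF a[OF that]] by auto
 interpret D: cartesian_restriction_category "Faa C" by (rule Faa_crc)
 have mem: "faa_Ide C S \<in> faa_Arr C" "faa_Unit C \<in> FObj" "faa_Prod C S T \<in> FObj" "faa_Pi0 C S T \<in> faa_Arr C" "faa_Pi1 C S T \<in> faa_Arr C"
  if "S \<in> FObj" "T \<in> FObj" for S T
  using Faa_Ide_Hom[OF that(1)] D.Unit_Obj D.Prod_Obj[of S T] faa_Pi_Hom(1,2)[OF that] that by (auto simp: Hom_Faa)
 have "FComp F G \<in> faa_Arr C" if "F \<in> faa_Arr C" "G \<in> faa_Arr C" "faa_tgt F = faa_src G" for F G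
  using Faa_Comp_Hom[OF a[OF that(1)], of G] a[OF that(2)] that(3) by (simp add: Hom_Faa)
 moreover have "darr (FComp F G) = faa_Comp FC (darr F) (darr G)"
  if "F \<in> faa_Arr C" "G \<in> faa_Arr C" "faa_tgt F = faa_src G" for F G
  using delta_Comp[OF a[OF that(1)], of G] a[OF that(2)] that(3) by simp
 moreover have "faa_Rst C F \<in> faa_Arr C" "darr (faa_Rst C F) = faa_Rst FC (darr F)" if "F \<in> faa_Arr C" for F
  using Faa_Rst_Hom[OF a[OF that]] delta_Rst[OF a[OF that]] by (simp_all add: Hom_Faa)
 moreover have "faa_Unit C \<in> FObj" using D.Unit_Obj by simp
 ultimately show ?thesis
  unfolding cr_functor_def comult_def
  by (auto simp: d o mem delta_obj_Obj delta_Ide delta_obj_Unit delta_obj_Prod delta_Pi)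
qed

end

subsection \<open>Naturality of the comultiplication\<close>

context cr_fun
begin

lemma F_e_zero:
 assumes "tcm C A" "e \<in> Hom C Z Z"
 shows "Fa (e \<cdot>\<^bsub>C\<^esub> zero_map C A Z) = Fa e \<cdot>\<^bsub>D\<^esub> zero_map D (FM A) (Fo Z)"
proof -
 interpret A: crc_monoid C A by unfold_locales (rule assms(1))
 have Z: "Z \<in> Obj C" using C.Hom_Obj(1)[OF assms(2)] .
 show ?thesis using F_Comp[OF assms(2) C.ptH[OF A.zero_pt[OF Z]]] F_zero_map[OF assms(1) Z] by simp
qed

lemma F_pcube:
 assumes "tcm C A" "e \<in> Hom C Z Z"
 shows "Fa (pcube C A Z e S c x J) = pcube D (FM A) (Fo Z) (Fa e) S (%i. Fa (c i)) (Fa x) J"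
 by (auto simp: pcube_def F_e_zero[OF assms])

lemma F_lin:
 assumes "tcm C A" "e \<in> Hom C Z Z"
 shows "Fa (lin C A Z e K s c T) = lin D (FM A) (Fo Z) (Fa e) K (%k J. Fa (s k J)) (%J. Fa (c J)) T"
 by (auto simp: lin_def F_e_zero[OF assms])

lemma onObj_Faa_fun: "S \<in> faa_Obj C ==> onObj (Faa_fun C F) S = FO S"
 and onArr_Faa_fun: "G \<in> faa_Arr C ==> onArr (Faa_fun C F) G = FA G"
 by (simp_all add: Faa_fun_def)

lemma FF: "cr_fun (Faa C) (Faa D) (Faa_fun C F)"
 using C.Faa_crc D.Faa_crc Faa_functor by (simp add: cr_fun_def cr_fun_axioms_def)

lemma mon_image_delta_cmon:
 assumes A: "tcm C A"
 shows "mon_image (Faa_fun C F) (delta_cmon C A) = delta_cmon D (FM A)"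
proof -
 interpret A: crc_monoid C A by unfold_locales (rule A)
 note AO = A.car_Obj and PO = C.Prod_Obj[OF A.car_Obj A.car_Obj]
 have mem: "mplus (delta_cmon C A) \<in> faa_Arr C" "mzero (delta_cmon C A) \<in> faa_Arr C" "(A, mcar A) \<in> faa_Obj C"
  using C.delta_cmon_Homs[OF A] C.AA_Obj[OF A] by (auto simp: Hom_Faa)
 have u: "FM (unit_cmon C) = unit_cmon D"
  using F_Bang[OF C.Unit_Obj] F_Bang[OF C.Prod_Obj[OF C.Unit_Obj C.Unit_Obj]] F_Prod[OF C.Unit_Obj C.Unit_Obj] F_Unit
  by (simp add: mon_image_def unit_cmon_def)
 have c1: "Fa (Pi0 C (Prod C (mcar A) (mcar A)) (Prod C (mcar A) (mcar A)) \<cdot>\<^bsub>C\<^esub> mplus A) =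
   Pi0 D (Prod D (Fo (mcar A)) (Fo (mcar A))) (Prod D (Fo (mcar A)) (Fo (mcar A))) \<cdot>\<^bsub>D\<^esub> Fa (mplus A)"
  using F_Comp[OF C.Pi0_Hom[OF PO PO] A.plus_Hom] F_Pi0[OF PO PO] F_Prod[OF AO AO] by simp
 have c2: "Fa (Pi0 C (Unit C) (Unit C) \<cdot>\<^bsub>C\<^esub> mzero A) = Pi0 D (Unit D) (Unit D) \<cdot>\<^bsub>D\<^esub> Fa (mzero A)"
  using F_Comp[OF C.Pi0_Hom[OF C.Unit_Obj C.Unit_Obj] A.mzero_Hom] F_Pi0[OF C.Unit_Obj C.Unit_Obj] F_Unit by simp
 have "FA (mplus (delta_cmon C A)) = mplus (delta_cmon D (FM A))"
  using map_faa_linear[OF C.prod_cmon[OF A A] PO A] c1 mon_image_prod[OF A A] F_Prod[OF AO AO]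
  by (simp add: delta_cmon_def Let_def faa_Prod_def)
 moreover have "FA (mzero (delta_cmon C A)) = mzero (delta_cmon D (FM A))"
  using map_faa_linear[OF C.unit_cmon C.Unit_Obj A] c2 u F_Unit
  by (simp add: delta_cmon_def Let_def faa_Unit_def)
 ultimately show ?thesis
  using mem C.delta_cmon_simps(1)[OF A] D.delta_cmon_simps(1)[OF F_cmon[OF A]] onObj_Faa_fun[OF mem(3)]
  by (intro cmon.expand) (simp add: onArr_Faa_fun)
qed

lemma map_delta_obj:
 assumes "S \<in> faa_Obj C"
 shows "map_faa_obj (Faa_fun C F) (delta_obj C S) = delta_obj D (FO S)"
 using assms mon_image_delta_cmon onObj_Faa_fun[OF assms] by (auto simp: delta_obj_def faa_Obj_def)

text \<open>By \<open>dseq_generic\<close> every component is an evaluation at a generic cube, and a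
  functor preserves evaluations and the generic cube. The sum over pairs \<open>(S, \<phi>)\<close>
  stays out of sight.\<close>

lemma map_delta_cmp:
 assumes G: "G \<in> Hom (Faa C) (A, X) (B, Y)" and n: "n \<ge> 1"
 shows "FA (delta_cmp C G n) = delta_cmp D (FA G) n"
proof (rule faa_arr_eqI)
 interpret FF: cr_fun "Faa C" "Faa D" "Faa_fun C F" by (rule FF)
 interpret G: faa_arrow C G A X B Y by (rule C.faa_arrowI[OF G])
 interpret H: faa_arrow D "FA G" "FM A" "Fo X" "FM B" "Fo Y"
  by (rule D.faa_arrowI[OF map_faa_Hom[OF G]])
 interpret GN: faa_cmp C G A X B Y n by unfold_locales (rule n)
 interpret HN: faa_cmp D "FA G" "FM A" "Fo X" "FM B" "Fo Y" n by unfold_locales (rule n)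
 have O: "(A, mcar A) \<in> faa_Obj C" "(A, X) \<in> faa_Obj C" "(B, mcar B) \<in> faa_Obj C"
  using C.AA_Obj[OF G.objs(1)] C.AA_Obj[OF G.objs(3)] G.objs by (auto simp: faa_Obj_def)
 have PO: "GN.VW \<in> faa_Obj C" using FF.C.powprod_Obj[of "(A, mcar A)" "(A, X)" n] O by simp
 show "faa_src (FA (delta_cmp C G n)) = faa_src (delta_cmp D (FA G) n)"
  using FF.F_powprod[of "(A, mcar A)" "(A, X)" n] O onObj_Faa_fun[OF PO] onObj_Faa_fun[OF O(1)] onObj_Faa_fun[OF O(2)] by simp
 show "faa_tgt (FA (delta_cmp C G n)) = faa_tgt (delta_cmp D (FA G) n)" by simp
 fix r
 let ?Z = "powprod C GN.V r GN.W" and ?P = "proj C GN.V r GN.W"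
 let ?Z' = "powprod D HN.V r HN.W" and ?P' = "proj D HN.V r HN.W"
 note AO = G.A.car_Obj
 have Z: "?Z \<in> Obj C" by (rule C.powprod_Obj[OF GN.V GN.W])
 have FV: "Fo GN.V = HN.V" "Fo GN.W = HN.W" using F_powprod[OF AO AO] F_powprod[OF AO G.objs(2)] by simp_all
 have FZ: "Fo ?Z = ?Z'" using F_powprod[OF GN.V GN.W] FV by simp
 have P: "j < r ==> ?P j \<in> pt C ?Z (Ide C ?Z) GN.V" "?P r \<in> pt C ?Z (Ide C ?Z) GN.W" for j
  using C.proj_pt[OF GN.V GN.W] by auto
 have c: "cube C ?Z (Ide C ?Z) (A, X) (GN.vcube ?Z (Ide C ?Z) {..<r} ?P (?P r))"
  by (rule GN.vcube_parts(6)) (use P in auto)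
 have FP: "Fa (?P j) = ?P' j" if "j \<le> r" for j using F_proj[OF GN.V GN.W that] FV by simp
 have Fp: "Fa (GN.p i) = HN.p i" "Fa (GN.q i) = HN.q i" if "i \<le> n" for i
  using F_proj[OF AO AO that] F_proj[OF AO G.objs(2) that] by simp_all
 have v: "Fa (?P j \<cdot>\<^bsub>C\<^esub> GN.p i) = ?P' j \<cdot>\<^bsub>D\<^esub> HN.p i" if "j < r" "i \<le> n" for i j
  using F_Comp[OF C.ptH[OF P(1)[OF that(1)]] C.ptH[OF GN.p_pt[OF that(2)]]] FP Fp that by simp
 have y: "Fa (?P r \<cdot>\<^bsub>C\<^esub> GN.q i) = ?P' r \<cdot>\<^bsub>D\<^esub> HN.q i" if "i \<le> n" for i
  using F_Comp[OF C.ptH[OF P(2)] C.ptH[OF GN.q_pt(1)[of i]]] F_Comp[OF C.ptH[OF P(2)] C.ptH[OF GN.q_pt(2)]] FP Fp that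
  by (cases "i = n") auto
 have L: "Fa (GN.vcube ?Z (Ide C ?Z) {..<r} ?P (?P r) T) = HN.vcube ?Z' (Ide D ?Z') {..<r} ?P' (?P' r) T" for T
  unfolding GN.vcube_def HN.vcube_def F_lin[OF G.objs(1) C.Ide_Hom[OF Z]] F_pcube[OF G.objs(1) C.Ide_Hom[OF Z]] F_Ide[OF Z] FZ
  by (rule lin_cong) (auto simp: v y intro!: pcube_cong)
 have "faa_seq (FA (delta_cmp C G n)) r = Fa (ev C G (GN.vcube ?Z (Ide C ?Z) {..<r} ?P (?P r)) ({..<n} |+| {..<r}))"
  unfolding map_faa_arr_simps GN.dseq_generic ..
 also have "... = ev D (FA G) (%T. Fa (GN.vcube ?Z (Ide C ?Z) {..<r} ?P (?P r) T)) ({..<n} |+| {..<r})"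
  by (rule F_ev[OF G c])
 also have "... = faa_seq (delta_cmp D (FA G) n) r"
  unfolding L HN.dseq_generic ..
 finally show "faa_seq (FA (delta_cmp C G n)) r = faa_seq (delta_cmp D (FA G) n) r" .
qed

lemma map_delta_arr:
 assumes G: "G \<in> faa_Arr C"
 shows "map_faa_arr (Faa_fun C F) (delta_arr C G) = delta_arr D (FA G)"
proof (rule faa_arr_eqI)
 have H: "G \<in> Hom (Faa C) (faa_src G) (faa_tgt G)" using G by (simp add: Hom_Faa)
 note O = C.Faa_Objs[OF H]
 show "faa_src (map_faa_arr (Faa_fun C F) (delta_arr C G)) = faa_src (delta_arr D (FA G))"
  "faa_tgt (map_faa_arr (Faa_fun C F) (delta_arr C G)) = faa_tgt (delta_arr D (FA G))"
  using map_delta_obj[OF O(1)] map_delta_obj[OF O(2)] by (simp_all add: delta_arr_simps)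
 obtain A X B Y where st: "faa_src G = (A, X)" "faa_tgt G = (B, Y)" by (cases "faa_src G"; cases "faa_tgt G") auto
 have H': "G \<in> Hom (Faa C) (A, X) (B, Y)" using H st by simp
 fix n
 show "faa_seq (map_faa_arr (Faa_fun C F) (delta_arr C G)) n = faa_seq (delta_arr D (FA G)) n"
 proof (cases "n = 0")
  case True
  then show ?thesis using G by (simp add: delta_arr_simps onArr_Faa_fun)
 next
  case False
  then have n: "n \<ge> 1" by simp
  interpret d: faa_delta C G A X B Y by (rule C.Faa_delta[OF H'])
  have "delta_cmp C G n \<in> faa_Arr C" using d.cmp_Hom[OF n] by (simp add: Hom_Faa)
  then show ?thesis using map_delta_cmp[OF H' n] n by (simp add: delta_arr_simps onArr_Faa_fun)
 qed
qed

end

subsection \<open>Coassociativity\<close>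

definition sum_assoc :: "('a + 'b) + 'c => 'a + ('b + 'c)" where
 "sum_assoc = case_sum (case_sum Inl (Inr \<circ> Inl)) (Inr \<circ> Inr)"

lemma sum_assoc_image: "sum_assoc ` ((Inl ` N \<union> Inr ` I) |+| J) = N |+| (Inl ` I \<union> Inr ` J)"
 by (simp add: sum_assoc_def image_Un image_image Un_assoc)

lemma inj_sum_assoc: "inj_on sum_assoc T"
 by (rule inj_on_subset[OF _ subset_UNIV]) (auto simp: sum_assoc_def intro!: injI split: sum.splits)

context cartesian_restriction_category
begin

text \<open>With equal base and linear part, an arrow acts on every entry, base point included, by
  the same map \<open>g\<close>. Under \<delta> this becomes composition with \<open>L\<close> on
  every entry, an arrow of the same form over \<open>Faa(C)\<close>. The structure maps of
  \<delta>(A) are of this kind.\<close>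

lemma delta_semilin_diag:
 assumes E: "tcm C E" and A: "tcm C A" and g: "g \<in> pt C (mcar E) (Ide C (mcar E)) (mcar A)" "mhom E A g"
  and L: "L = semilin (E, mcar E) (A, mcar A) g g"
  and dg: "cartesian_restriction_category.mhom FC (dmon E) (dmon A) L"
 shows "darr L = cartesian_restriction_category.semilin FC (dmon E, mcar (dmon E)) (dmon A, mcar (dmon A)) L L"
proof -
 interpret D: cartesian_restriction_category "Faa C" by (rule Faa_crc)
 note mc = delta_cmon_simps(1)[OF E] delta_cmon_simps(1)[OF A]
 note dE = delta_cmon[OF E] and dA = delta_cmon[OF A]
 have LH: "L \<in> Hom FC (E, mcar E) (A, mcar A)" unfolding L by (rule semilin_Hom[OF E A ptH[OF g(1)] g(2)])
 have Lp: "L \<in> pt FC (mcar (dmon E)) (Ide FC (mcar (dmon E))) (mcar (dmon A))"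
  using dg by (simp add: D.mhom_def)
 have EO: "(E, mcar E) \<in> FObj" by (rule AA_Obj[OF E])
 have src: "dobj (E, mcar E) = (dmon E, mcar (dmon E))"
  and tgt: "dobj (A, mcar A) = (dmon A, mcar (dmon A))" by (simp_all add: delta_obj_def mc)
 show ?thesis
 proof (rule Faa_Faa_eqI[OF delta_arr_Hom[OF LH]])
  show "D.semilin (dmon E, mcar (dmon E)) (dmon A, mcar (dmon A)) L L \<in>
    Hom (Faa FC) (dobj (E, mcar E)) (dobj (A, mcar A))"
   unfolding src tgt by (rule D.semilin_Hom[OF dE dA D.ptH[OF Lp] dg])
  fix U e Z d and I J :: "nat set" and c :: "nat set => ('o, 'm) faa_arr" and w :: "nat set => 'm"
  assume c: "cube FC U e (dobj (E, mcar E)) c" and I: "finite I" and w: "cube C Z d U w" and J: "finite J"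
  note j = cube_join_cube[OF c w EO]
  have c': "cube FC U e (dmon E, mcar (dmon E)) c" using c src by simp
  have cI: "c I \<in> pt FC U e (E, mcar E)" using D.cube_diag[OF c', of I] mc by simp
  have "ev C (ev FC (darr L) c I) w J = ev C L (cube_join C c w) (I |+| J)"
   by (rule ev_delta_arr[OF LH c w I J])
  also have "... = ev C (c I) w J \<cdot> g"
   unfolding L using ev_semilin_diag[OF E A g j, of "I |+| J"] I J by simp
  also have "... = ev C L (ev C (c I) w) J"
   unfolding L by (rule ev_semilin_diag[OF E A g Faa_pt_0(2)[OF cI w] J, symmetric])
  also have "... = ev C (FComp (c I) L) w J" by (rule Faa_ev_Comp[OF D.ptH[OF cI] LH w J, symmetric])
  also have "FComp (c I) L = ev FC (D.semilin (dmon E, mcar (dmon E)) (dmon A, mcar (dmon A)) L L) c I"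
   using D.ev_semilin_diag[OF dE dA Lp dg c' I] by simp
  finally show "ev C (ev FC (darr L) c I) w J =
    ev C (ev FC (D.semilin (dmon E, mcar (dmon E)) (dmon A, mcar (dmon A)) L L) c I) w J" .
 qed
qed

lemma onObj_comult: "S \<in> FObj ==> onObj (comult C) S = dobj S"
 and onArr_comult: "F \<in> faa_Arr C ==> onArr (comult C) F = darr F"
 by (simp_all add: comult_def)

text \<open>The monoid part of coassociativity on objects: \<delta> takes the structure maps of
  \<delta>(A) to those of the iterated monoid, their sources matching because \<delta> respects
  product and unit monoids.\<close>

lemma mon_image_comult:
 assumes A: "tcm C A"
 shows "mon_image (comult C) (dmon A) = delta_cmon FC (dmon A)"
proof -
 interpret D: cartesian_restriction_category "Faa C" by (rule Faa_crc)
 interpret A: crc_monoid C A by unfold_locales (rule A)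
 note dA = delta_cmon[OF A] and H = delta_cmon_Homs[OF A] and s = delta_cmon_simps[OF A]
 have mem: "mplus (dmon A) \<in> faa_Arr C" "mzero (dmon A) \<in> faa_Arr C" using H by (auto simp: Hom_Faa)
 note P = prod_cmon[OF A A]
 have "darr (mplus (dmon A)) = mplus (delta_cmon FC (dmon A))"
 proof -
  have "darr (mplus (dmon A)) = D.semilin (dmon (prod_cmon C A A), mcar (dmon (prod_cmon C A A)))
    (dmon A, mcar (dmon A)) (mplus (dmon A)) (mplus (dmon A))"
  proof (rule delta_semilin_diag[OF P A _ mhom_mplus[OF A]])
   show "mplus A \<in> pt C (mcar (prod_cmon C A A)) (Ide C (mcar (prod_cmon C A A))) (mcar A)" using A.plus_pt by simp
   show "mplus (dmon A) = semilin (prod_cmon C A A, mcar (prod_cmon C A A)) (A, mcar A) (mplus A) (mplus A)" using s by simp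
   show "D.mhom (dmon (prod_cmon C A A)) (dmon A) (mplus (dmon A))"
    unfolding delta_cmon_prod[OF A A] by (rule D.mhom_mplus[OF dA])
  qed
  then show ?thesis unfolding D.delta_cmon_simps(2)[OF dA] delta_cmon_prod[OF A A] by simp
 qed
 moreover have "darr (mzero (dmon A)) = mzero (delta_cmon FC (dmon A))"
 proof -
  have u: "mcar (unit_cmon C) = Unit C" "mcar (unit_cmon FC) = Unit FC" by (simp_all add: unit_cmon_def)
  have "darr (mzero (dmon A)) = D.semilin (dmon (unit_cmon C), mcar (dmon (unit_cmon C)))
    (dmon A, mcar (dmon A)) (mzero (dmon A)) (mzero (dmon A))"
  proof (rule delta_semilin_diag[OF unit_cmon A _ mhom_mzero[OF A]])
   show "mzero A \<in> pt C (mcar (unit_cmon C)) (Ide C (mcar (unit_cmon C))) (mcar A)" using A.mzero_pt u by simp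
   show "mzero (dmon A) = semilin (unit_cmon C, mcar (unit_cmon C)) (A, mcar A) (mzero A) (mzero A)" using s u by simp
   show "D.mhom (dmon (unit_cmon C)) (dmon A) (mzero (dmon A))"
    unfolding delta_cmon_unit by (rule D.mhom_mzero[OF dA])
  qed
  then show ?thesis unfolding D.delta_cmon_simps(3)[OF dA] delta_cmon_unit u(2) .
 qed
 moreover have "onObj (comult C) (A, mcar A) = (dmon A, (A, mcar A))"
  using onObj_comult[OF AA_Obj[OF A]] by (simp add: delta_obj_def)
 ultimately show ?thesis
  using mem D.delta_cmon_simps(1)[OF dA] s(1) by (intro cmon.expand) (simp add: onArr_comult)
qed

lemma delta_delta_obj:
 assumes "S \<in> FObj"
 shows "map_faa_obj (comult C) (dobj S) = delta_obj FC (dobj S)"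
 using assms onObj_comult[OF assms] mon_image_comult by (auto simp: delta_obj_def faa_Obj_def)

text \<open>Evaluated at \<open>c\<close> and \<open>w\<close>, the left side becomes an evaluation
  of \<open>F\<close> with directions grouped as \<open>(n + I) + J\<close>, the right side one with
  the grouping \<open>n + (I + J)\<close>. The bijection \<open>sum_assoc\<close> carries one cube
  to the other.\<close>

lemma delta_delta_cmp:
 assumes F: "F \<in> Hom FC (A, X) (B, Y)" and n: "n \<ge> 1"
 shows "delta_cmp FC (darr F) n = darr (delta_cmp C F n)"
proof -
 interpret d: faa_delta C F A X B Y by (rule Faa_delta[OF F])
 interpret N: faa_cmp C F A X B Y n by (rule d.cmp[OF n])
 interpret dF: faa_arrow "Faa C" "darr F" "dmon A" "(A, X)" "dmon B" "(B, Y)"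
  by (rule d.D.faa_arrowI[OF d.delta_Hom])
 interpret M: faa_cmp "Faa C" "darr F" "dmon A" "(A, X)" "dmon B" "(B, Y)" n by unfold_locales (rule n)
 interpret K: cr_fun "Faa C" "Faa FC" "comult C"
  using d.D.Faa_crc comult_functor d.D.cartesian_restriction_category_axioms by (simp add: cr_fun_def cr_fun_axioms_def)
 note mc = d.delta_mcar
 have O: "(A, mcar A) \<in> FObj" "(A, X) \<in> FObj" "(B, mcar B) \<in> FObj" using d.AX_Obj by simp_all
 have VWO: "N.VW \<in> FObj" using d.D.powprod_Obj[of "(A, mcar A)" "(A, X)" n] O by simp
 have src: "dobj N.VW = M.VW"
  using K.F_powprod[of "(A, mcar A)" "(A, X)" n] O onObj_comult[OF VWO] onObj_comult[OF O(1)] onObj_comult[OF O(2)]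
  by (simp add: delta_obj_def mc)
 have tgt: "dobj (B, mcar B) = (dmon B, mcar (dmon B))" by (simp add: delta_obj_def mc)
 note cH = d.cmp_Hom[OF n]
 show ?thesis
 proof (rule Faa_Faa_eqI[OF M.cmp_Hom delta_arr_Hom[OF cH, unfolded src tgt]])
  fix U e Z d and I J :: "nat set" and c :: "nat set => ('o, 'm) faa_arr" and w :: "nat set => 'm"
  assume c: "cube FC U e M.VW c" and I: "finite I" and w: "cube C Z d U w" and J: "finite J"
  have cs: "cube FC U e (dobj N.VW) c" using c src by simp
  let ?e = "edom w e"
  note j = cube_join_cube[OF cs w VWO]
  let ?L = "lin FC (dmon A) U e {..<n} (%i I. Comp FC (c I) (if I = {} then M.q i else M.p i))
    (%I. Comp FC (c I) (if I = {} then M.q n else M.p n))"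
  let ?R = "lin C A Z ?e {..<n} (%i T. cube_join C c w T \<cdot> (if T = {} then N.q i else N.p i)) (%T. cube_join C c w T \<cdot> (if T = {} then N.q n else N.p n))"
  let ?K = "(Inl ` {..<n} \<union> Inr ` I) |+| J :: ((nat + nat) + nat) set"
  have cW: "c {} \<in> pt FC U e (powprod FC (A, mcar A) n (A, X))"
   and cV: "K \<noteq> {} ==> c K \<in> pt FC U e (powprod FC (A, mcar A) n (A, mcar A))" for K
   using cubeD[OF c] by (simp_all add: mc)
  \<comment> \<open>Which projection is used depends on emptiness of the direction set; at the joint
    cube the one for base points occurs only when both sets are empty.\<close>
  have pr: "ev C (FComp (c K) (if K = {} then M.q i else M.p i)) w H = ev C (c K) w H \<cdot> proj C (mcar A) n (if K = {} \<and> H = {} then X else mcar A) i"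
   "Comp FC (c K) (if K = {} then M.q i else M.p i) \<in> pt FC U e (if i = n \<and> K = {} then (A, X) else (A, mcar A))"
   if i: "i \<le> n" and K: "finite H" for i K and H :: "nat set"
  proof -
   let ?X = "if K = {} then X else mcar A"
   have Xo: "?X \<in> Obj C" "(A, ?X) \<in> FObj" using O by (auto simp: faa_Obj_def)
   have eq: "(if K = {} then M.q i else M.p i) = proj FC (A, mcar A) n (A, ?X) i" by (simp add: mc)
   have cK: "c K \<in> pt FC U e (powprod FC (A, mcar A) n (A, ?X))" using cW cV by simp
   have pp: "proj FC (A, mcar A) n (A, ?X) i \<in> pt FC (powprod FC (A, mcar A) n (A, ?X))
     (Ide FC (powprod FC (A, mcar A) n (A, ?X))) (if i = n then (A, ?X) else (A, mcar A))"
    using d.D.proj_pt(1)[OF d.AX_Obj(1), of "(A, ?X)" i n] d.D.proj_pt(2)[OF d.AX_Obj(1), of "(A, ?X)" n] Xo(2) i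
    by (cases "i = n") auto
   have "ev C (FComp (c K) (proj FC (A, mcar A) n (A, ?X) i)) w H = ev C (proj FC (A, mcar A) n (A, ?X) i) (ev C (c K) w) H"
    by (rule Faa_ev_Comp[OF d.D.ptH[OF cK] d.D.ptH[OF pp] w \<open>finite H\<close>])
   also have "... = ev C (c K) w H \<cdot> proj C (mcar A) n (if H = {} then ?X else mcar A) i"
    by (rule ev_proj_Faa[OF d.objs(1) Xo(1) \<open>finite H\<close> Faa_pt_0(2)[OF cK w] i])
   finally show "ev C (FComp (c K) (if K = {} then M.q i else M.p i)) w H = ev C (c K) w H \<cdot> proj C (mcar A) n (if K = {} \<and> H = {} then X else mcar A) i"
    unfolding eq by (cases "K = {}"; cases "H = {}") simp_all
   show "Comp FC (c K) (if K = {} then M.q i else M.p i) \<in> pt FC U e (if i = n \<and> K = {} then (A, X) else (A, mcar A))"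
    unfolding eq using d.D.pt_Comp[OF cK pp] by (cases "K = {}"; cases "i = n") simp_all
  qed
  have e: "e \<in> pt FC U e U" by (rule d.D.pt_idem(5)[OF cW])
  have L: "cube FC U e (dmon A, A, X) ?L"
  proof (rule dF.lin_cube)
   show "Comp FC (c I) (if I = {} then M.q i else M.p i) \<in> pt FC U e (mcar (dmon A))" if "i \<in> {..<n}" for i I
    using pr(2)[of i "{}" I] that by (simp add: mc)
   show "cube FC U e (dmon A, A, X) (%I. Comp FC (c I) (if I = {} then M.q n else M.p n))"
    unfolding cube_def fst_conv snd_conv
   proof (intro conjI allI impI)
    show "Comp FC (c {}) (if ({} :: nat set) = {} then M.q n else M.p n) \<in> pt FC U e (A, X)"
     using pr(2)[of n "{}" "{}"] by (simp add: mc)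
    fix K :: "nat set" assume "K \<noteq> {}"
    then show "Comp FC (c K) (if K = {} then M.q n else M.p n) \<in> pt FC U e (mcar (dmon A))"
     using pr(2)[of n "{}" K] by (simp add: mc)
   qed
  qed
  have R: "cube C Z ?e (A, X) ?R"
  proof -
   have "cube_join C c w {} \<in> pt C Z ?e N.W" "T \<noteq> {} ==> cube_join C c w T \<in> pt C Z ?e N.V" for T
    using cubeD[OF j] by simp_all
   then show ?thesis
    by (intro d.lin_cube) (use pt_Comp[OF _ N.p_pt] pt_Comp[OF _ N.q_pt(1)] pt_Comp[OF _ N.q_pt(2)] in "auto simp: cube_def")
  qed
  have pq: "proj C (mcar A) n (if b then X else mcar A) i = (if b then N.q i else N.p i)" for b i by simp
  \<comment> \<open>Case distinction on the directions of the first kind in \<open>T\<close>: none,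
    a single one below \<open>n\<close>, or a set on which both cubes vanish.\<close>
  have key: "cube_join C ?L w T = ?R (sum_assoc ` T)" if fin: "finite T" for T :: "((nat + nat) + nat) set"
  proof -
   let ?N = "Inl -` (Inl -` T)" and ?I = "Inr -` (Inl -` T)" and ?J = "Inr -` T"
   let ?T = "Inl ` ?I \<union> Inr ` ?J :: (nat + nat) set"
   have fJ: "finite ?J" using fin by (auto intro: finite_vimageI)
   have "T = Inl ` (Inl ` ?N \<union> Inr ` ?I) \<union> Inr ` ?J"
    using sum_set_eq[of T] sum_set_eq[of "Inl -` T"] by simp
   then have aT: "sum_assoc ` T = Inl ` ?N \<union> Inr ` ?T" using sum_assoc_image by metis
   have v: "Inl -` (sum_assoc ` T) = ?N" "Inr -` (sum_assoc ` T) = ?T" unfolding aT by (rule vimage_Inl_Un)+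
   have T0: "?T = {} \<longleftrightarrow> ?I = {} \<and> ?J = {}" by simp
   have E: "ev C (Comp FC (c ?I) (if ?I = {} then M.q i else M.p i)) w ?J =
     cube_join C c w ?T \<cdot> (if ?T = {} then N.q i else N.p i)" if "i \<le> n" for i
    unfolding cube_join_Un T0 Faa_simps pr(1)[OF that fJ] pq ..
   consider "?N = {}" | k where "k < n" "?N = {k}" | "?N \<noteq> {}" "\<not> (\<exists>k\<in>{..<n}. ?N = {k})" by blast
   then show ?thesis
   proof cases
    case 1
    show ?thesis unfolding cube_join_def[of C ?L] lin_Inr[OF 1] lin_Inr[OF 1[folded v(1)]] v(2) by (rule E) simp
   next
    case 2
    have k: "k \<in> {..<n}" using 2(1) by simp
    show ?thesis unfolding cube_join_def[of C ?L] lin_Inl[OF k 2(2)] lin_Inl[OF k 2(2)[folded v(1)]] v(2) by (rule E) (use 2(1) in simp)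
   next
    case 3
    show ?thesis
     unfolding cube_join_def[of C ?L] lin_zero[OF 3] lin_zero[OF 3[folded v(1)]]
     unfolding Faa_simps
     by (rule ev_delta_zero_e[OF d.objs(1) e w fJ])
   qed
  qed
  have "ev C (ev FC (delta_cmp FC (darr F) n) c I) w J = ev C (ev FC (darr F) ?L ({..<n} |+| I)) w J"
   unfolding M.ev_cmp[OF c I] ..
  also have "... = ev C F (cube_join C ?L w) ?K"
   by (rule d.ev_ev_delta[OF L w _ J]) (use I in simp)
  also have "... = ev C F (%T. ?R (sum_assoc ` T)) ?K"
   by (rule d.ev_cong[OF cube_comp_image[OF R]]) (rule key, simp)+
  also have "... = ev C F ?R ({..<n} |+| (Inl ` I \<union> Inr ` J))"
   unfolding sum_assoc_image[symmetric] by (rule d.ev_reindex[OF R inj_sum_assoc, symmetric])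
  also have "... = ev C (delta_cmp C F n) (cube_join C c w) (I |+| J)"
   by (rule N.ev_cmp[OF j, symmetric]) (use I J in simp)
  also have "... = ev C (ev FC (darr (delta_cmp C F n)) c I) w J"
   by (rule ev_delta_arr[OF cH cs w I J, symmetric])
  finally show "ev C (ev FC (delta_cmp FC (darr F) n) c I) w J = ev C (ev FC (darr (delta_cmp C F n)) c I) w J" .
 qed
qed

lemma delta_delta_arr:
 assumes F: "F \<in> faa_Arr C"
 shows "map_faa_arr (comult C) (darr F) = delta_arr FC (darr F)"
proof (rule faa_arr_eqI)
 have H: "F \<in> Hom FC (faa_src F) (faa_tgt F)" using F by (simp add: Hom_Faa)
 note O = Faa_Objs[OF H]
 show "faa_src (map_faa_arr (comult C) (darr F)) = faa_src (delta_arr FC (darr F))"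
  "faa_tgt (map_faa_arr (comult C) (darr F)) = faa_tgt (delta_arr FC (darr F))"
  using delta_delta_obj[OF O(1)] delta_delta_obj[OF O(2)] by (simp_all add: delta_arr_simps)
 obtain A X B Y where st: "faa_src F = (A, X)" "faa_tgt F = (B, Y)" by (cases "faa_src F"; cases "faa_tgt F") auto
 have H': "F \<in> Hom FC (A, X) (B, Y)" using H st by simp
 fix n
 show "faa_seq (map_faa_arr (comult C) (darr F)) n = faa_seq (delta_arr FC (darr F)) n"
 proof (cases "n = 0")
  case True
  then show ?thesis using F by (simp add: delta_arr_simps onArr_comult)
 next
  case False
  then have n: "n \<ge> 1" by simp
  interpret d: faa_delta C F A X B Y by (rule Faa_delta[OF H'])
  have "delta_cmp C F n \<in> faa_Arr C" using d.cmp_Hom[OF n] by (simp add: Hom_Faa)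
  then show ?thesis using delta_delta_cmp[OF H' n] n by (simp add: delta_arr_simps onArr_comult)
 qed
qed

end

subsection \<open>The comonad structure\<close>

lemma crfun_eqI:
 assumes "!!X. X \<in> U ==> g X = g' X" "!!f. f \<in> V ==> h f = h' f"
 shows "CRFun (restrict g U) (restrict h V) = CRFun (restrict g' U) (restrict h' V)"
 using assms by (auto intro!: restrict_ext)

lemma fun_comp_eq: "fun_comp C F G = CRFun (\<lambda>X\<in>Obj C. onObj G (onObj F X)) (\<lambda>f\<in>Arr C. onArr G (onArr F f))"
 by (simp add: fun_comp_def compose_def)

context cartesian_restriction_category
begin

lemma Faa_Arr_Hom: "f \<in> faa_Arr C ==> f \<in> Hom FC (faa_src f) (faa_tgt f)"
 by (simp add: Hom_Faa)

lemma Faa_Arr_seq: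
 assumes "f \<in> faa_Arr C"
 shows "faa_seq f n \<in> Arr C" "faa_src f \<in> FObj" "faa_tgt f \<in> FObj"
proof -
 show "faa_seq f n \<in> Arr C"
  using HomD(1)[OF Faa_0[OF Faa_Arr_Hom[OF assms]]] HomD(1)[OF Faa_n(1)[OF Faa_Arr_Hom[OF assms], of n]]
  by (cases "n = 0") auto
qed (use Faa_Objs[OF Faa_Arr_Hom[OF assms]] in auto)

lemma cmon_mem:
 assumes "tcm C A"
 shows "mcar A \<in> Obj C" "mplus A \<in> Arr C" "mzero A \<in> Arr C"
 using total_comm_monoidD[OF assms] HomD(1) ptD(1) by blast+

lemma Faa_fun_ide: "Faa_fun C (fun_ide C) = fun_ide FC"
proof -
 have o: "map_faa_obj (fun_ide C) S = S" if "S \<in> FObj" for S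
  using that cmon_mem by (auto simp: map_faa_obj_def fun_ide_def faa_Obj_def intro!: cmon.expand)
 have "map_faa_arr (fun_ide C) f = f" if f: "f \<in> faa_Arr C" for f
  by (rule faa_arr_eqI) (use o Faa_Arr_seq[OF f] in "simp_all add: fun_ide_def")
 then show ?thesis unfolding Faa_fun_def fun_ide_def[of "Faa C"] using o by (intro crfun_eqI) simp_all
qed

lemma counit_simps: "S \<in> FObj ==> onObj (counit C) S = snd S" "f \<in> faa_Arr C ==> onArr (counit C) f = faa_seq f 0"
 by (auto simp: counit_def split: prod.splits)

lemma counit_functor: "cr_functor FC C (counit C)"
proof -
 interpret D: cartesian_restriction_category "Faa C" by (rule Faa_crc)
 have mem: "faa_Ide C S \<in> faa_Arr C" "faa_Unit C \<in> FObj" "faa_Prod C S T \<in> FObj" "faa_Pi0 C S T \<in> faa_Arr C" "faa_Pi1 C S T \<in> faa_Arr C"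
  if "S \<in> FObj" "T \<in> FObj" for S T
  using Faa_Ide_Hom[OF that(1)] D.Unit_Obj D.Prod_Obj[of S T] faa_Pi_Hom(1,2)[OF that] that by (auto simp: Hom_Faa)
 have c: "FComp F G \<in> faa_Arr C" if "F \<in> faa_Arr C" "G \<in> faa_Arr C" "faa_tgt F = faa_src G" for F G
  using Faa_Comp_Hom[OF Faa_Arr_Hom[OF that(1)], of G] Faa_Arr_Hom[OF that(2)] that(3) by (simp add: Hom_Faa)
 have r: "faa_Rst C F \<in> faa_Arr C" if "F \<in> faa_Arr C" for F
  using Faa_Rst_Hom[OF Faa_Arr_Hom[OF that]] by (simp add: Hom_Faa)
 have h: "Dom C (faa_seq f 0) = snd (faa_src f)" "Cod C (faa_seq f 0) = snd (faa_tgt f)" if "f \<in> faa_Arr C" for f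
  using HomD(2,3)[OF Faa_0[OF Faa_Arr_Hom[OF that]]] by auto
 have i: "faa_seq (faa_Ide C S) 0 = Ide C (snd S)" for S
  by (cases S) (simp add: faa_Ide_def faa_linear_def)
 have so: "snd S \<in> Obj C" if "S \<in> FObj" for S using that by (auto simp: faa_Obj_def)
 have "onObj (counit C) \<in> FObj \<rightarrow>\<^sub>E Obj C" "onArr (counit C) \<in> faa_Arr C \<rightarrow>\<^sub>E Arr C"
  using so Faa_Arr_seq(1) by (auto simp: counit_def split: prod.splits)
 moreover have "faa_Unit C \<in> FObj" "snd (faa_Unit C) = Unit C" using D.Unit_Obj by (simp_all add: faa_Unit_def)
 ultimately show ?thesis
  unfolding cr_functor_def Faa_simps
  by (simp add: counit_simps mem c r h i Faa_Arr_seq Faa_Comp_0 Faa_Rst_0 faa_Prod_sel faa_Pi_Hom(3,4))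
qed

lemma comult_mem: "S \<in> FObj ==> dobj S \<in> faa_Obj FC" "f \<in> faa_Arr C ==> darr f \<in> faa_Arr FC"
 using delta_obj_Obj delta_arr_Hom[OF Faa_Arr_Hom] by (auto simp: Hom_Faa)

text \<open>The base map of \<delta>(F) is \<open>F\<close> by construction.\<close>

lemma counit_left: "fun_comp FC (comult C) (counit FC) = fun_ide FC"
proof -
 interpret D: cartesian_restriction_category "Faa C" by (rule Faa_crc)
 show ?thesis unfolding fun_comp_eq fun_ide_def
  by (rule crfun_eqI) (simp_all add: onObj_comult onArr_comult D.counit_simps comult_mem delta_obj_simps delta_arr_simps)
qed

text \<open>Applying the counit inside keeps the base map of every component, which for component
  \<open>n\<close> of \<delta>(f) is the original one. On objects, the base maps of the structure of
  \<delta>(A) are the structure maps of \<open>A\<close>.\<close>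

lemma counit_right: "fun_comp FC (comult C) (Faa_fun FC (counit C)) = fun_ide FC"
proof -
 have o: "map_faa_obj (counit C) (dobj S) = S" if S: "S \<in> FObj" for S
 proof -
  obtain A X where AX: "S = (A, X)" "tcm C A" using S by (auto simp: faa_Obj_def)
  have "mplus (dmon A) \<in> faa_Arr C" "mzero (dmon A) \<in> faa_Arr C" "(A, mcar A) \<in> FObj"
   using delta_cmon_Homs[OF AX(2)] AA_Obj[OF AX(2)] by (auto simp: Hom_Faa)
  then have "mon_image (counit C) (dmon A) = A"
   using delta_cmon_simps[OF AX(2)] by (intro cmon.expand) (simp add: counit_simps semilin_0)
  then show ?thesis using S AX(1) by (simp add: delta_obj_def counit_simps)
 qed
 have a: "map_faa_arr (counit C) (darr f) = f" if f: "f \<in> faa_Arr C" for f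
 proof (rule faa_arr_eqI)
  show "faa_src (map_faa_arr (counit C) (darr f)) = faa_src f" "faa_tgt (map_faa_arr (counit C) (darr f)) = faa_tgt f"
   using o Faa_Arr_seq(2,3)[OF f] by (simp_all add: delta_arr_simps)
  fix n
  interpret D: cartesian_restriction_category "Faa C" by (rule Faa_crc)
  have "faa_seq (darr f) n \<in> faa_Arr C" using D.Faa_Arr_seq(1)[OF comult_mem(2)[OF f]] by simp
  then show "faa_seq (map_faa_arr (counit C) (darr f)) n = faa_seq f n"
   by (cases "n = 0") (simp_all add: counit_simps delta_arr_simps delta_cmp_def Let_def)
 qed
 show ?thesis unfolding fun_comp_eq fun_ide_def
  by (rule crfun_eqI) (simp_all add: onObj_comult onArr_comult comult_mem Faa_fun_def o a)
qed

lemma coassoc: "fun_comp FC (comult C) (comult FC) = fun_comp FC (comult C) (Faa_fun FC (comult C))"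
proof -
 interpret D: cartesian_restriction_category "Faa C" by (rule Faa_crc)
 show ?thesis unfolding fun_comp_eq
  by (rule crfun_eqI) (simp_all add: onObj_comult onArr_comult comult_mem Faa_fun_def D.onObj_comult D.onArr_comult delta_delta_obj delta_delta_arr)
qed

end

section \<open>Functoriality and naturality with respect to functors\<close>

context cr_fun
begin

lemma map_faa_mem: "S \<in> faa_Obj C ==> FO S \<in> faa_Obj D" "f \<in> faa_Arr C ==> FA f \<in> faa_Arr D"
proof -
 show "S \<in> faa_Obj C ==> FO S \<in> faa_Obj D" by (rule Faa_Obj_map)
 assume f: "f \<in> faa_Arr C"
 obtain A X B Y where st: "faa_src f = (A, X)" "faa_tgt f = (B, Y)" by (cases "faa_src f"; cases "faa_tgt f") auto
 then have "f \<in> Hom (Faa C) (A, X) (B, Y)" using C.Faa_Arr_Hom[OF f] by simp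
 from map_faa_Hom[OF this] show "FA f \<in> faa_Arr D" by (simp add: Hom_Faa)
qed

lemma Faa_fun_comp: "Faa_fun C (fun_comp C F G) = fun_comp (Faa C) (Faa_fun C F) (Faa_fun D G)"
proof -
 have o: "map_faa_obj (fun_comp C F G) S = map_faa_obj G (FO S)" if "S \<in> faa_Obj C" for S
  using that C.cmon_mem by (auto simp: map_faa_obj_def fun_comp_eq faa_Obj_def)
 have a: "map_faa_arr (fun_comp C F G) f = map_faa_arr G (FA f)" if f: "f \<in> faa_Arr C" for f
  by (rule faa_arr_eqI) (use o C.Faa_Arr_seq[OF f] in "simp_all add: fun_comp_eq")
 show ?thesis unfolding Faa_fun_def[of C "fun_comp C F G"] fun_comp_eq[of "Faa C"]
  by (rule crfun_eqI) (simp_all add: Faa_fun_def map_faa_mem o a)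
qed

lemma counit_natural: "fun_comp (Faa C) (counit C) F = fun_comp (Faa C) (Faa_fun C F) (counit D)"
proof -
 have "snd (FO S) = Fo (snd S)" for S by (cases S) simp
 then show ?thesis unfolding fun_comp_eq
  by (intro crfun_eqI) (simp_all add: Faa_fun_def C.counit_simps D.counit_simps map_faa_mem)
qed

lemma comult_natural:
 "fun_comp (Faa C) (comult C) (Faa_fun (Faa C) (Faa_fun C F)) = fun_comp (Faa C) (Faa_fun C F) (comult D)"
 unfolding fun_comp_eq Faa_fun_def[of "Faa C"]
 by (rule crfun_eqI)
  (simp_all add: C.onObj_comult C.onArr_comult D.onObj_comult D.onArr_comult C.comult_mem map_faa_mem onObj_Faa_fun onArr_Faa_fun
   map_delta_obj map_delta_arr)

end

theorem proposition3p12: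
  fixes X :: "('o1, 'm1) crcat"
    and Y :: "('o2, 'm2) crcat"
    and Z :: "('o3, 'm3) crcat"
  assumes "cartesian_restriction_category X"
    and "cartesian_restriction_category Y"
    and "cartesian_restriction_category Z"
  shows
    \<comment> \<open>Faa is an endofunctor\<close>
    "cartesian_restriction_category (Faa X) \<and>
     (\<forall>F. cr_functor X Y F \<longrightarrow> cr_functor (Faa X) (Faa Y) (Faa_fun X F)) \<and>
     Faa_fun X (fun_ide X) = fun_ide (Faa X) \<and>
     (\<forall>F G. cr_functor X Y F \<and> cr_functor Y Z G \<longrightarrow>
        Faa_fun X (fun_comp X F G) = fun_comp (Faa X) (Faa_fun X F) (Faa_fun Y G)) \<and>
     \<comment> \<open>counit and comultiplication are natural transformations\<close>
     cr_functor (Faa X) X (counit X) \<and>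
     cr_functor (Faa X) (Faa (Faa X)) (comult X) \<and>
     (\<forall>F. cr_functor X Y F \<longrightarrow>
        fun_comp (Faa X) (counit X) F = fun_comp (Faa X) (Faa_fun X F) (counit Y) \<and>
        fun_comp (Faa X) (comult X) (Faa_fun (Faa X) (Faa_fun X F)) =
          fun_comp (Faa X) (Faa_fun X F) (comult Y)) \<and>
     \<comment> \<open>counit laws and coassociativity\<close>
     fun_comp (Faa X) (comult X) (counit (Faa X)) = fun_ide (Faa X) \<and>
     fun_comp (Faa X) (comult X) (Faa_fun (Faa X) (counit X)) = fun_ide (Faa X) \<and>
     fun_comp (Faa X) (comult X) (comult (Faa X)) =
       fun_comp (Faa X) (comult X) (Faa_fun (Faa X) (comult X))"
proof -
 interpret X: cartesian_restriction_category X by fact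
 have XY: "cr_fun X Y F" if "cr_functor X Y F" for F
  using assms that by (simp add: cr_fun_def cr_fun_axioms_def)
 show ?thesis
  using X.Faa_crc X.Faa_fun_ide X.counit_functor X.comult_functor X.counit_left X.counit_right X.coassoc
   cr_fun.Faa_functor[OF XY] cr_fun.Faa_fun_comp[OF XY] cr_fun.counit_natural[OF XY] cr_fun.comult_natural[OF XY]
  by (intro conjI allI impI) (assumption | blast)+
qed

end
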